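(* Let $a\in\mathbb{R}$ and $B>0$. For suitable $b$ with $3/8<b<1/2$ and $\alpha$ with $1/2<\alpha<2/3$ (i.e. there exist such $b$ and $\alpha$), there is a constant $C$ such that for every $v\in Z^b=X^{0,b}\cap L^2_tH^1_{x,y}$, $$\|\partial_x(v^2)\|_{Y^{0,b}}\le C\|v\|_{Z^b}^2.$$
   Context: Notation: $\langle x\rangle:=1+|x|$. For $k\ge1$, $\lambda_k=(k\pi/B)^2$, $e_k(y)=\sqrt{2/B}\,\sin(\sqrt{\lambda_k}\,y)$, and $\omega_k(\xi)=\xi^3+(\lambda_k-a)\xi$. A function (or tempered distribution) $u(x,y,t)$, $x\in\mathbb{R}$, $y\in(0,B)$, $t\in\mathbb{R}$, is expanded as $u=\sum_{k\ge1}u_k(x,t)e_k(y)$ with $u_k=\langle u,e_k\rangle_{L^2(0,B)}$, and $\widehat u_k(\xi,\tau)$ denotes the Fourier transform of $u_k$ in $(x,t)\in\mathbb{R}^2$, with kernel $e^{-i(x\xi+t\tau)}$. $X^{0,b}$ is the closure of Schwartz functions under the norm $$\|u\|_{X^{0,b}}^2=\sum_{k=1}^\infty\Big(\iint_{|\omega_k(\xi)|\ge1}\langle\tau-\omega_k(\xi)\rangle^{2b}|\widehat u_k(\xi,\tau)|^2\,d\xi\,d\tau+\iint_{|\omega_k(\xi)|<1}\langle\tau\rangle^{2\alpha}|\widehat u_k(\xi,\tau)|^2\,d\xi\,d\tau\Big).$$ $Y^{0,b}$ is defined analogously by the norm $$\|f\|_{Y^{0,b}}^2=\sum_{k=1}^\infty\Big(\iint_{|\omega_k(\xi)|\ge1}\frac{|\widehat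 f_k(\xi,\tau)|^2}{\langle\tau-\omega_k(\xi)\rangle^{2b}}\,d\xi\,d\tau+\iint_{|\omega_k(\xi)|<1}\frac{|\widehat f_k(\xi,\tau)|^2}{\langle\tau\rangle^{2(1-\alpha)}}\,d\xi\,d\tau+\int_{|\omega_k(\xi)|\ge1}\Big(\int_{\mathbb{R}}\frac{|\widehat f_k(\xi,\tau)|}{\langle\tau-\omega_k(\xi)\rangle}\,d\tau\Big)^2d\xi\Big).$$ (Both norms depend on the fixed parameter $\alpha$.) $L^2_tH^1_{x,y}=L^2(\mathbb{R}_t;H^1_{x,y})$, where $H^1_{x,y}$ consists of the functions in $H^1(\mathbb{R}\times(0,B))$ vanishing at $y=0$ and $y=B$, with the $H^1$ norm. The norm on $Z^b$ is $\|v\|_{Z^b}=\|v\|_{X^{0,b}}+\|v\|_{L^2_tH^1_{x,y}}$. *)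

theory Defs
  imports "HOL-Analysis.Analysis"
begin

section \<open>Smooth and Schwartz functions\<close>

definition dir_deriv :: "'a::real_normed_vector \<Rightarrow> ('a \<Rightarrow> complex) \<Rightarrow> 'a \<Rightarrow> complex" where
  "dir_deriv d f p = vector_derivative (\<lambda>s. f (p + s *\<^sub>R d)) (at 0)"

definition iter_partial :: "'a::euclidean_space list \<Rightarrow> ('a \<Rightarrow> complex) \<Rightarrow> 'a \<Rightarrow> complex" where
  "iter_partial ds f = foldr dir_deriv ds f"

definition smooth_fun :: "('a::euclidean_space \<Rightarrow> complex) \<Rightarrow> bool" where
  "smooth_fun f \<longleftrightarrow> (\<forall>ds \<in> lists Basis. \<forall>p. iter_partial ds f differentiable (at p))"

definition schwartz :: "('a::euclidean_space \<Rightarrow> complex) \<Rightarrow> bool" where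
  "schwartz f \<longleftrightarrow> smooth_fun f \<and>
     (\<forall>ds \<in> lists Basis. \<forall>N::nat. bounded (range (\<lambda>p. (1 + norm p) ^ N * norm (iter_partial ds f p))))"

definition test_fun :: "'a::euclidean_space set \<Rightarrow> ('a \<Rightarrow> complex) \<Rightarrow> bool" where
  "test_fun S f \<longleftrightarrow> smooth_fun f \<and> (\<exists>K. compact K \<and> K \<subseteq> S \<and> (\<forall>p. p \<notin> K \<longrightarrow> f p = 0))"


section \<open>Square-integrable functions and the Sobolev space \<open>H\<^sup>1\<close>\<close>

text \<open>All norms take values in the extended nonnegative reals, being infinite outside the space.\<close>

definition esqrt :: "ennreal \<Rightarrow> ennreal" where
  "esqrt x = (if x = \<infinity> then \<infinity> else ennreal (sqrt (enn2real x)))"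

definition L2_sq :: "'a::euclidean_space set \<Rightarrow> ('a \<Rightarrow> complex) \<Rightarrow> ennreal" where
  "L2_sq S f = (\<integral>\<^sup>+p\<in>S. ennreal ((norm (f p))\<^sup>2) \<partial>lborel)"

definition L2_space :: "'a::euclidean_space set \<Rightarrow> ('a \<Rightarrow> complex) set" where
  "L2_space S = {f. set_borel_measurable lborel S f \<and> L2_sq S f < \<infinity>}"

definition is_weak_deriv ::
    "'a::euclidean_space set \<Rightarrow> 'a \<Rightarrow> ('a \<Rightarrow> complex) \<Rightarrow> ('a \<Rightarrow> complex) \<Rightarrow> bool" where
  "is_weak_deriv S d f g \<longleftrightarrow>
     (\<forall>\<phi>. test_fun S \<phi> \<longrightarrow> (LINT p:S|lborel. f p * dir_deriv d \<phi> p) = - (LINT p:S|lborel. g p * \<phi> p))"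

definition H1_space :: "'a::euclidean_space set \<Rightarrow> ('a \<Rightarrow> complex) set" where
  "H1_space S = {f \<in> L2_space S. \<forall>d\<in>Basis. \<exists>g\<in>L2_space S. is_weak_deriv S d f g}"

text \<open>Weak derivatives in \<open>L\<^sup>2\<close> are unique almost everywhere, so the choice does not matter.\<close>

definition weak_deriv :: "'a::euclidean_space set \<Rightarrow> 'a \<Rightarrow> ('a \<Rightarrow> complex) \<Rightarrow> 'a \<Rightarrow> complex" where
  "weak_deriv S d f = (SOME g. g \<in> L2_space S \<and> is_weak_deriv S d f g)"

definition H1_sq :: "'a::euclidean_space set \<Rightarrow> ('a \<Rightarrow> complex) \<Rightarrow> ennreal" where
  "H1_sq S f = (if f \<in> H1_space S then L2_sq S f + (\<Sum>d\<in>Basis. L2_sq S (weak_deriv S d f)) else \<infinity>)"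


section \<open>The strip and the space \<open>L\<^sup>2\<^sub>tH\<^sup>1\<^sub>x\<^sub>y\<close>\<close>

text \<open>Points of space are \<open>(x, y)\<close>, points of space-time are \<open>(x, y, t)\<close>.\<close>

definition strip :: "real \<Rightarrow> (real \<times> real) set" where
  "strip B = {(x, y). 0 < y \<and> y < B}"

definition tstrip :: "real \<Rightarrow> (real \<times> real \<times> real) set" where
  "tstrip B = {(x, y, t). 0 < y \<and> y < B}"

text \<open>The trace operator is the continuous extension to \<open>H\<^sup>1\<close> of the restriction
  to the line \<open>y = c\<close>, defined on the dense class of Schwartz functions.\<close>

definition has_trace :: "real \<Rightarrow> real \<Rightarrow> (real \<times> real \<Rightarrow> complex) \<Rightarrow> (real \<Rightarrow> complex) \<Rightarrow> bool" where
  "has_trace B c f g \<longleftrightarrow>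
     (\<exists>\<phi> :: nat \<Rightarrow> real \<times> real \<Rightarrow> complex. (\<forall>n. schwartz (\<phi> n)) \<and>
        (\<lambda>n. H1_sq (strip B) (\<lambda>p. \<phi> n p - f p)) \<longlonglongrightarrow> 0 \<and>
        (\<lambda>n. L2_sq UNIV (\<lambda>x. \<phi> n (x, c) - g x)) \<longlonglongrightarrow> 0)"

definition H1_dir :: "real \<Rightarrow> (real \<times> real \<Rightarrow> complex) set" where
  "H1_dir B = {f \<in> H1_space (strip B). has_trace B 0 f (\<lambda>_. 0) \<and> has_trace B B f (\<lambda>_. 0)}"

definition slice :: "(real \<times> real \<times> real \<Rightarrow> complex) \<Rightarrow> real \<Rightarrow> real \<times> real \<Rightarrow> complex" where
  "slice v t = (\<lambda>(x, y). v (x, y, t))"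

definition L2H1_norm :: "real \<Rightarrow> (real \<times> real \<times> real \<Rightarrow> complex) \<Rightarrow> ennreal" where
  "L2H1_norm B v = esqrt (\<integral>\<^sup>+t. H1_sq (strip B) (slice v t) \<partial>lborel)"

text \<open>Since \<open>H\<^sup>1\<close> is separable, elements of the Bochner space are the jointly measurable \<open>v\<close>
  with almost all slices in \<open>H\<^sup>1\<close> and finite norm.\<close>

definition L2H1_space :: "real \<Rightarrow> (real \<times> real \<times> real \<Rightarrow> complex) set" where
  "L2H1_space B = {v. set_borel_measurable lborel (tstrip B) v \<and>
     (AE t in lborel. slice v t \<in> H1_dir B) \<and> L2H1_norm B v < \<infinity>}"


section \<open>Distributions on the strip and their sine-Fourier coefficients\<close>

text \<open>A distribution on the strip is given by its action on test functions of \<open>(x, y, t)\<close>;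
  the test functions that matter are the products of a Schwartz function of \<open>(x, t)\<close>
  with an eigenfunction in \<open>y\<close>.\<close>

type_synonym strip_distr = "(real \<times> real \<times> real \<Rightarrow> complex) \<Rightarrow> complex"
type_synonym plane_distr = "(real \<times> real \<Rightarrow> complex) \<Rightarrow> complex"

definition distr_of :: "real \<Rightarrow> (real \<times> real \<times> real \<Rightarrow> complex) \<Rightarrow> strip_distr" where
  "distr_of B u = (\<lambda>\<psi>. LINT p:tstrip B|lborel. u p * \<psi> p)"

definition distr_dx :: "strip_distr \<Rightarrow> strip_distr" where
  "distr_dx T = (\<lambda>\<psi>. - T (dir_deriv (1, 0, 0) \<psi>))"

definition lam :: "real \<Rightarrow> nat \<Rightarrow> real" where
  "lam B k = (real k * pi / B)\<^sup>2"

definition eigfun :: "real \<Rightarrow> nat \<Rightarrow> real \<Rightarrow> real" where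
  "eigfun B k y = sqrt (2 / B) * sin (sqrt (lam B k) * y)"

definition omega :: "real \<Rightarrow> real \<Rightarrow> nat \<Rightarrow> real \<Rightarrow> real" where
  "omega a B k \<xi> = \<xi> ^ 3 + (lam B k - a) * \<xi>"

definition bracket :: "real \<Rightarrow> real" where
  "bracket x = 1 + \<bar>x\<bar>"

definition coef :: "real \<Rightarrow> strip_distr \<Rightarrow> nat \<Rightarrow> plane_distr" where
  "coef B T k = (\<lambda>\<phi>. T (\<lambda>(x, y, t). \<phi> (x, t) * complex_of_real (eigfun B k y)))"

definition fourier :: "(real \<times> real \<Rightarrow> complex) \<Rightarrow> real \<times> real \<Rightarrow> complex" where
  "fourier \<phi> = (\<lambda>(\<xi>, \<tau>). LINT (x, t)|lborel. cis (- (x * \<xi> + t * \<tau>)) * \<phi> (x, t))"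

definition fourier_distr :: "plane_distr \<Rightarrow> plane_distr" where
  "fourier_distr T = (\<lambda>\<phi>. T (fourier \<phi>))"

definition represents :: "(real \<times> real \<Rightarrow> complex) \<Rightarrow> plane_distr \<Rightarrow> bool" where
  "represents g T \<longleftrightarrow> g \<in> borel_measurable lborel \<and>
     (\<forall>\<phi>. schwartz \<phi> \<longrightarrow> integrable lborel (\<lambda>p. g p * \<phi> p) \<and> T \<phi> = (LINT p|lborel. g p * \<phi> p))"

text \<open>The representing function is unique almost everywhere, so the choice does not matter.\<close>

definition coef_hat :: "real \<Rightarrow> strip_distr \<Rightarrow> nat \<Rightarrow> real \<times> real \<Rightarrow> complex" where
  "coef_hat B T k = (SOME g. represents g (fourier_distr (coef B T k)))"

definition has_coef_hats :: "real \<Rightarrow> strip_distr \<Rightarrow> bool" where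
  "has_coef_hats B T \<longleftrightarrow> (\<forall>k\<ge>1. \<exists>g. represents g (fourier_distr (coef B T k)))"


section \<open>The spaces \<open>X\<close>, \<open>Y\<close> and \<open>Z\<close>\<close>

definition X_term :: "real \<Rightarrow> real \<Rightarrow> real \<Rightarrow> real \<Rightarrow> nat \<Rightarrow> (real \<times> real \<Rightarrow> complex) \<Rightarrow> ennreal" where
  "X_term a B \<alpha> b k g =
     (\<integral>\<^sup>+(\<xi>, \<tau>)\<in>{(\<xi>, \<tau>). \<bar>omega a B k \<xi>\<bar> \<ge> 1}.
        ennreal (bracket (\<tau> - omega a B k \<xi>) powr (2 * b) * (norm (g (\<xi>, \<tau>)))\<^sup>2) \<partial>lborel) +
     (\<integral>\<^sup>+(\<xi>, \<tau>)\<in>{(\<xi>, \<tau>). \<bar>omega a B k \<xi>\<bar> < 1}.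
        ennreal (bracket \<tau> powr (2 * \<alpha>) * (norm (g (\<xi>, \<tau>)))\<^sup>2) \<partial>lborel)"

definition X_norm :: "real \<Rightarrow> real \<Rightarrow> real \<Rightarrow> real \<Rightarrow> strip_distr \<Rightarrow> ennreal" where
  "X_norm a B \<alpha> b T =
     (if has_coef_hats B T then esqrt (\<Sum>k. X_term a B \<alpha> b (Suc k) (coef_hat B T (Suc k))) else \<infinity>)"

definition Y_term :: "real \<Rightarrow> real \<Rightarrow> real \<Rightarrow> real \<Rightarrow> nat \<Rightarrow> (real \<times> real \<Rightarrow> complex) \<Rightarrow> ennreal" where
  "Y_term a B \<alpha> b k g =
     (\<integral>\<^sup>+(\<xi>, \<tau>)\<in>{(\<xi>, \<tau>). \<bar>omega a B k \<xi>\<bar> \<ge> 1}.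
        ennreal ((norm (g (\<xi>, \<tau>)))\<^sup>2 / bracket (\<tau> - omega a B k \<xi>) powr (2 * b)) \<partial>lborel) +
     (\<integral>\<^sup>+(\<xi>, \<tau>)\<in>{(\<xi>, \<tau>). \<bar>omega a B k \<xi>\<bar> < 1}.
        ennreal ((norm (g (\<xi>, \<tau>)))\<^sup>2 / bracket \<tau> powr (2 * (1 - \<alpha>))) \<partial>lborel) +
     (\<integral>\<^sup>+\<xi>\<in>{\<xi>. \<bar>omega a B k \<xi>\<bar> \<ge> 1}.
        (\<integral>\<^sup>+\<tau>. ennreal (norm (g (\<xi>, \<tau>)) / bracket (\<tau> - omega a B k \<xi>)) \<partial>lborel)\<^sup>2 \<partial>lborel)"

definition Y_norm :: "real \<Rightarrow> real \<Rightarrow> real \<Rightarrow> real \<Rightarrow> strip_distr \<Rightarrow> ennreal" where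
  "Y_norm a B \<alpha> b T =
     (if has_coef_hats B T then esqrt (\<Sum>k. Y_term a B \<alpha> b (Suc k) (coef_hat B T (Suc k))) else \<infinity>)"

text \<open>For nonnegative \<open>b\<close> and \<open>\<alpha>\<close> the weights are at least 1, so the norm dominates the
  \<open>L\<^sup>2\<close> norm (up to a constant) and the closure is realised inside \<open>L\<^sup>2\<close>. Schwartz functions
  not vanishing at \<open>y = 0\<close> or \<open>y = B\<close> can have infinite norm, hence the finiteness condition.\<close>

definition X_set :: "real \<Rightarrow> real \<Rightarrow> real \<Rightarrow> real \<Rightarrow> (real \<times> real \<times> real \<Rightarrow> complex) set" where
  "X_set a B \<alpha> b = {u \<in> L2_space (tstrip B). \<forall>\<epsilon>>0. \<exists>\<phi>. schwartz \<phi> \<and>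
     X_norm a B \<alpha> b (distr_of B \<phi>) < \<infinity> \<and>
     X_norm a B \<alpha> b (distr_of B (\<lambda>p. u p - \<phi> p)) < \<epsilon>}"

definition Z_set :: "real \<Rightarrow> real \<Rightarrow> real \<Rightarrow> real \<Rightarrow> (real \<times> real \<times> real \<Rightarrow> complex) set" where
  "Z_set a B \<alpha> b = X_set a B \<alpha> b \<inter> L2H1_space B"

definition Z_norm :: "real \<Rightarrow> real \<Rightarrow> real \<Rightarrow> real \<Rightarrow> (real \<times> real \<times> real \<Rightarrow> complex) \<Rightarrow> ennreal" where
  "Z_norm a B \<alpha> b v = X_norm a B \<alpha> b (distr_of B v) + L2H1_norm B v"

end

theory Submission
  imports Defs "HOL-Probability.Probability"
begin

text \<open>Take \<open>b = 12/25\<close>, \<open>\<alpha> = 1 - b\<close>, and write points as \<open>((x, t), y)\<close>.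
  The core is a trilinear convolution estimate for a pair of sine modes \<open>j\<close>, \<open>k\<close>: integrating out the
  modulations leaves a power of the phase difference, which for fixed output frequency is quadratic in the
  input frequency, so the kernel is bounded after spending part of the \<open>H\<^sup>1\<close> weight; the remaining gain
  \<open>j powr -13/25\<close> is square summable. By duality and a Schur test in the mode index this bounds
  \<open>\<parallel>v W\<parallel>\<close> in \<open>L\<^sup>2\<close> for every \<open>W\<close> in the space dual to the first part of the \<open>Y\<close> norm.
  The derivative is then moved off by difference quotients: pairing \<open>(v\<^sub>h\<^sup>2 - v\<^sup>2) / h\<close> with \<open>W\<close> gives
  \<open>(v\<^sub>h - v) / h\<close>, bounded by the \<open>H\<^sup>1\<close> norm, against \<open>v\<^sub>h W + v W\<close>. The other parts of the \<open>Y\<close> norm are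
  controlled by the first. The slices enter only through differences in \<open>x\<close> and sine coefficients in \<open>y\<close>,
  the latter by integration by parts using the vanishing traces.\<close>

text \<open>Test functions are expanded in cosines in \<open>y\<close>, although the modes are
  sines. A sine times a cosine is half a combination of two sines, so the dual mode \<open>k\<close>
  and the cosine \<open>l\<close> meet only the modes \<open>k + l\<close> and
  \<open>|k - l|\<close>, and the Schur kernel is built from one summable sequence. Three sines
  would be coupled whenever \<open>j + k + l\<close> is odd, without such locality.

  The value of \<open>b\<close> is squeezed from two sides. Integrating out the modulations needs a
  total exponent above 1 after all other expenses, which pushes \<open>2 * b = 24/25\<close> towards
  1; the third part of the \<open>Y\<close> norm needs \<open>2 - 2 * b > 1\<close>, so
  \<open>b\<close> stays below \<open>1/2\<close>. With \<open>\<alpha> = 1 - b\<close> the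
  \<open>Y\<close> weight in the region \<open>|omega| < 1\<close> has the exponent
  \<open>2 * b\<close> as well, so one modulation weight serves everywhere.

  The square of an \<open>L2\<close> function is only integrable. Difference quotients keep every
  integral a pairing of two \<open>L2\<close> functions, and the limit is taken on the Fourier side
  only.\<close>

text \<open>An integral sign without measure refers to Lebesgue measure.\<close>

abbreviation lborel_nn_integral :: "('a::euclidean_space \<Rightarrow> ennreal) \<Rightarrow> ennreal" (binder "\<integral>\<^sup>+" 10) where
  "lborel_nn_integral f \<equiv> nn_integral lborel f"

abbreviation nsq :: "'a::real_normed_vector \<Rightarrow> ennreal" where
  "nsq z \<equiv> ennreal ((norm z)\<^sup>2)"

section \<open>Invariance of Lebesgue measure, Fubini, and square roots in the extended
  reals\<close>

lemma nn_integral_lborel_shift: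
  fixes f :: "'a::euclidean_space \<Rightarrow> ennreal"
  assumes [measurable]: "f \<in> borel_measurable borel"
  shows "(\<integral>\<^sup>+x. f (x + c)) = (\<integral>\<^sup>+x. f x)"
proof -
  have "(\<integral>\<^sup>+x. f x) = (\<integral>\<^sup>+x. f x \<partial>distr lborel borel ((+) c))"
    by (simp add: lborel_distr_plus)
  also have "\<dots> = (\<integral>\<^sup>+x. f (x + c))"
    by (subst nn_integral_distr) (auto simp: add.commute)
  finally show ?thesis by simp
qed

lemma nn_integral_lborel_shift_diff:
  fixes f :: "'a::euclidean_space \<Rightarrow> ennreal"
  assumes [measurable]: "f \<in> borel_measurable borel"
  shows "(\<integral>\<^sup>+x. f (x - c)) = (\<integral>\<^sup>+x. f x)"
  using nn_integral_lborel_shift[OF assms, of "-c"] by simp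

lemma lborel_distr_neg:
  "distr lborel borel uminus = (lborel :: 'a::euclidean_space measure)"
proof -
  have *: "(lborel :: 'a measure) = density (distr lborel borel (\<lambda>x. 0 + (-1) *\<^sub>R x)) (\<lambda>_. 1)"
    using lborel_affine[of "-1" "0::'a"] by simp
  show ?thesis by (subst (2) *) (simp add: density_1)
qed

lemma nn_integral_lborel_reflect:
  fixes f :: "'a::euclidean_space \<Rightarrow> ennreal"
  assumes [measurable]: "f \<in> borel_measurable borel"
  shows "(\<integral>\<^sup>+x. f (c - x)) = (\<integral>\<^sup>+x. f x)"
proof -
  have "(\<integral>\<^sup>+x. f x) = (\<integral>\<^sup>+x. f (x + c))"
    by (rule nn_integral_lborel_shift[symmetric]) simp
  also have "\<dots> = (\<integral>\<^sup>+x. f (x + c) \<partial>distr lborel borel uminus)"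
    by (simp add: lborel_distr_neg)
  also have "\<dots> = (\<integral>\<^sup>+x. f (c - x))"
    by (subst nn_integral_distr) auto
  finally show ?thesis by simp
qed

lemma lborel_integral_shift:
  fixes f :: "'a::euclidean_space \<Rightarrow> 'b::{banach, second_countable_topology}"
  assumes [measurable]: "f \<in> borel_measurable borel"
  shows "(LBINT x. f (x + c)) = (LBINT x. f x)"
proof -
  have "(LBINT x. f x) = (LINT x|distr lborel borel ((+) c). f x)"
    by (simp add: lborel_distr_plus)
  also have "\<dots> = (LBINT x. f (x + c))"
    by (subst integral_distr) (auto simp: add.commute)
  finally show ?thesis by simp
qed

lemma lborel_integrable_shift:
  fixes f :: "'a::euclidean_space \<Rightarrow> 'b::{banach, second_countable_topology}"
  assumes "integrable lborel f"
  shows "integrable lborel (\<lambda>x. f (x + c))"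
proof -
  have "integrable (distr lborel borel ((+) c)) f" using assms by (simp add: lborel_distr_plus)
  then show ?thesis by (subst (asm) integrable_distr_eq) (use assms in \<open>auto simp: add.commute\<close>)
qed

lemma nn_integral_lborel_pair:
  fixes f :: "'a::euclidean_space \<times> 'b::euclidean_space \<Rightarrow> ennreal"
  assumes "f \<in> borel_measurable borel"
  shows "(\<integral>\<^sup>+p. f p) = (\<integral>\<^sup>+x. \<integral>\<^sup>+y. f (x, y))"
proof -
  have "f \<in> borel_measurable (lborel \<Otimes>\<^sub>M lborel)"
    using assms by (simp add: lborel_prod)
  from lborel.nn_integral_fst[OF this] show ?thesis by (simp add: lborel_prod)
qed

lemma measurable_fst_borel [measurable]:
  "fst \<in> (borel :: ('a::topological_space \<times> 'b::topological_space) measure) \<rightarrow>\<^sub>M borel"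
  by (intro borel_measurable_continuous_onI continuous_intros)

lemma measurable_snd_borel [measurable]:
  "snd \<in> (borel :: ('a::topological_space \<times> 'b::topological_space) measure) \<rightarrow>\<^sub>M borel"
  by (intro borel_measurable_continuous_onI continuous_intros)

lemma borel_measurable_compose2:
  fixes f :: "'a::second_countable_topology \<Rightarrow> 'b::second_countable_topology \<Rightarrow> 'c::topological_space"
  assumes "case_prod f \<in> borel_measurable borel" "g \<in> M \<rightarrow>\<^sub>M borel" "h \<in> M \<rightarrow>\<^sub>M borel"
  shows "(\<lambda>x. f (g x) (h x)) \<in> M \<rightarrow>\<^sub>M borel"
proof -
  have "(\<lambda>x. case_prod f (g x, h x)) \<in> M \<rightarrow>\<^sub>M borel"
    by (rule measurable_compose[OF borel_measurable_Pair[OF assms(2,3)] assms(1)])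
  then show ?thesis by simp
qed

lemma nn_integral_lborel_swap:
  fixes f :: "'a::euclidean_space \<Rightarrow> 'b::euclidean_space \<Rightarrow> ennreal"
  assumes "case_prod f \<in> borel_measurable borel"
  shows "(\<integral>\<^sup>+x. \<integral>\<^sup>+y. f x y) = (\<integral>\<^sup>+y. \<integral>\<^sup>+x. f x y)"
proof -
  have *: "case_prod f \<in> borel_measurable (lborel \<Otimes>\<^sub>M lborel)"
    using assms by (simp add: lborel_prod)
  from lborel_pair.Fubini'[OF *] show ?thesis by simp
qed

text \<open>A nonintegrable function has integral 0 by default, so the inequality needs no case
  distinction where it is used: pairings are estimated directly by nonnegative integrals.\<close>

lemma integral_norm_bound_ennreal_any:
  fixes f :: "'a \<Rightarrow> 'b::{banach, second_countable_topology}"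
  shows "ennreal (norm (LINT x|M. f x)) \<le> (\<integral>\<^sup>+x. ennreal (norm (f x)) \<partial>M)"
  by (cases "integrable M f") (auto simp: integral_norm_bound_ennreal not_integrable_integral_eq)

lemma esqrt_mult_self: "esqrt x * esqrt x = x"
  by (cases x) (auto simp: esqrt_def ennreal_mult_top simp flip: ennreal_mult)

lemma esqrt_power2: "(esqrt x)^2 = x"
  by (simp add: power2_eq_square esqrt_mult_self)

lemma esqrt_mono: "x \<le> y \<Longrightarrow> esqrt x \<le> esqrt y"
proof (cases "y = \<infinity>")
  case False
  assume "x \<le> y"
  with False have "x \<noteq> \<infinity>" by (auto simp: top_unique)
  with False \<open>x \<le> y\<close> show ?thesis
    by (auto simp: esqrt_def intro!: ennreal_leI enn2real_mono simp: less_top)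
qed (simp add: esqrt_def)

lemma measurable_esqrt [measurable]: "esqrt \<in> borel_measurable borel"
  unfolding esqrt_def[abs_def] by measurable

lemma power2_mono_ennreal_iff: "(x::ennreal)^2 \<le> y^2 \<longleftrightarrow> x \<le> y"
proof
  assume *: "x^2 \<le> y^2"
  have r: "esqrt (z^2) = z" for z
    by (cases z) (auto simp: esqrt_def ennreal_power)
  from esqrt_mono[OF *] show "x \<le> y" by (simp add: r)
qed (rule power_mono, auto)

text \<open>Cauchy-Schwarz for an integrand that is controlled through its square. In the trilinear
  estimates kernels appear in bounds for the square of the integrand, and the square roots of
  \<open>f\<close> and \<open>g\<close> occur only inside this proof.\<close>

lemma nn_integral_geometric_mean:
  assumes [measurable]: "f \<in> borel_measurable M" "g \<in> borel_measurable M"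
    and le: "\<And>x. x \<in> space M \<Longrightarrow> (S x)^2 \<le> f x * g x"
  shows "(\<integral>\<^sup>+x. S x \<partial>M)^2 \<le> (\<integral>\<^sup>+x. f x \<partial>M) * (\<integral>\<^sup>+x. g x \<partial>M)"
proof -
  have "S x \<le> esqrt (f x) * esqrt (g x)" if "x \<in> space M" for x
  proof -
    have "(S x)^2 \<le> (esqrt (f x) * esqrt (g x))^2"
      using le[OF that] by (simp add: power_mult_distrib esqrt_power2)
    then show ?thesis by (simp only: power2_mono_ennreal_iff)
  qed
  then have "(\<integral>\<^sup>+x. S x \<partial>M)^2 \<le> (\<integral>\<^sup>+x. esqrt (f x) * esqrt (g x) \<partial>M)^2"
    by (intro power_mono nn_integral_mono) auto
  also have "\<dots> \<le> (\<integral>\<^sup>+x. (esqrt (f x))^2 \<partial>M) * (\<integral>\<^sup>+x. (esqrt (g x))^2 \<partial>M)"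
    by (rule Cauchy_Schwarz_nn_integral) measurable
  finally show ?thesis by (simp add: esqrt_power2)
qed

section \<open>The trilinear convolution estimate\<close>

text \<open>Cauchy-Schwarz twice. In the inner integral the squares of \<open>G\<close> and
  \<open>W\<close> are separated from \<open>u\<close> and the kernel, and only the supremum over
  \<open>z\<close> of the mass of \<open>K\<close> enters. The outer integral then sees
  \<open>F\<close>, a convolution of squares, whose mass factors.\<close>

lemma trilinear_sup_kernel:
  fixes G W u :: "'a::euclidean_space \<Rightarrow> ennreal" and K :: "'a \<Rightarrow> 'a \<Rightarrow> ennreal"
  assumes [measurable]: "G \<in> borel_measurable borel" "W \<in> borel_measurable borel"
      "u \<in> borel_measurable borel" "case_prod K \<in> borel_measurable borel"
    and K: "\<And>z. (\<integral>\<^sup>+z1. K z z1) \<le> M"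
    and S: "\<And>z z1. (S z z1)^2 \<le> (G z1)^2 * (W (z1 - z))^2 * (u z)^2 * K z z1"
  shows "(\<integral>\<^sup>+z. \<integral>\<^sup>+z1. S z z1)^2 \<le>
     M * (\<integral>\<^sup>+z. (G z)^2) * (\<integral>\<^sup>+z. (W z)^2) * (\<integral>\<^sup>+z. (u z)^2)"
proof -
  define F where "F z = (\<integral>\<^sup>+z1. (G z1)^2 * (W (z1 - z))^2)" for z
  have [measurable]: "F \<in> borel_measurable borel"
    unfolding F_def[abs_def] by measurable
  note [measurable (raw)] = borel_measurable_compose2[OF assms(4)]
  have inner: "(\<integral>\<^sup>+z1. S z z1)^2 \<le> F z * (M * (u z)^2)" for z
  proof -
    have "(\<integral>\<^sup>+z1. S z z1)^2 \<le>
        (\<integral>\<^sup>+z1. (G z1)^2 * (W (z1 - z))^2) * (\<integral>\<^sup>+z1. (u z)^2 * K z z1)"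
      by (rule nn_integral_geometric_mean) (use S[of z] in \<open>auto simp: mult_ac\<close>)
    also have "(\<integral>\<^sup>+z1. (u z)^2 * K z z1) = (u z)^2 * (\<integral>\<^sup>+z1. K z z1)"
      by (rule nn_integral_cmult) measurable
    also have "\<dots> \<le> M * (u z)^2"
      using K[of z] by (simp add: mult.commute mult_right_mono)
    finally show ?thesis
      by (simp add: F_def mult_left_mono)
  qed
  have "(\<integral>\<^sup>+z. \<integral>\<^sup>+z1. S z z1)^2 \<le> (\<integral>\<^sup>+z. F z) * (\<integral>\<^sup>+z. M * (u z)^2)"
    by (rule nn_integral_geometric_mean) (use inner in auto)
  also have "(\<integral>\<^sup>+z. M * (u z)^2) = M * (\<integral>\<^sup>+z. (u z)^2)"
    by (rule nn_integral_cmult) measurable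
  also have "(\<integral>\<^sup>+z. F z) = (\<integral>\<^sup>+z1. \<integral>\<^sup>+z. (G z1)^2 * (W (z1 - z))^2)"
    unfolding F_def by (rule nn_integral_lborel_swap) measurable
  also have "\<dots> = (\<integral>\<^sup>+z1. (G z1)^2 * (\<integral>\<^sup>+z. (W z)^2))"
  proof (rule nn_integral_cong)
    fix z1
    have "(\<integral>\<^sup>+z. (G z1)^2 * (W (z1 - z))^2) = (G z1)^2 * (\<integral>\<^sup>+z. (W (z1 - z))^2)"
      by (rule nn_integral_cmult) measurable
    also have "(\<integral>\<^sup>+z. (W (z1 - z))^2) = (\<integral>\<^sup>+z. (W z)^2)"
      by (rule nn_integral_lborel_reflect) measurable
    finally show "(\<integral>\<^sup>+z. (G z1)^2 * (W (z1 - z))^2) = (G z1)^2 * (\<integral>\<^sup>+z. (W z)^2)" .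
  qed
  also have "\<dots> = (\<integral>\<^sup>+z. (G z)^2) * (\<integral>\<^sup>+z. (W z)^2)"
    by (rule nn_integral_multc) measurable
  finally show ?thesis by (simp add: mult_ac)
qed

text \<open>Here the mass of the kernel is bounded only along each fibre of fixed \<open>x\<close>
  and \<open>x1\<close>, by a quantity \<open>m x\<close> that is integrable in the output
  frequency. The previous lemma is used on the fibres; Cauchy-Schwarz in \<open>x1\<close> and then
  in \<open>x\<close> collects the \<open>L2\<close> norms, with \<open>m\<close> separated from
  \<open>u\<close> in the last step.\<close>

lemma trilinear_fiber_kernel:
  fixes G W u :: "real \<times> real \<Rightarrow> ennreal" and K :: "real \<times> real \<Rightarrow> real \<times> real \<Rightarrow> ennreal"
    and m :: "real \<Rightarrow> ennreal"
  assumes [measurable]: "G \<in> borel_measurable borel" "W \<in> borel_measurable borel"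
      "u \<in> borel_measurable borel" "case_prod K \<in> borel_measurable borel" "m \<in> borel_measurable borel"
      "case_prod S \<in> borel_measurable borel"
    and K: "\<And>x t x1. (\<integral>\<^sup>+t1. K (x, t) (x1, t1)) \<le> m x"
    and m: "(\<integral>\<^sup>+x. m x) \<le> M"
    and S: "\<And>z z1. (S z z1)^2 \<le> (G z1)^2 * (W (z1 - z))^2 * (u z)^2 * K z z1"
  shows "(\<integral>\<^sup>+z. \<integral>\<^sup>+z1. S z z1)^2 \<le>
     M * (\<integral>\<^sup>+z. (G z)^2) * (\<integral>\<^sup>+z. (W z)^2) * (\<integral>\<^sup>+z. (u z)^2)"
proof -
  define sq where "sq f x = (\<integral>\<^sup>+t. (f (x, t))^2)" for f :: "real \<times> real \<Rightarrow> ennreal" and x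
  have sqm [measurable]: "sq f \<in> borel_measurable borel" if [measurable]: "f \<in> borel_measurable borel" for f
    unfolding sq_def[abs_def] by measurable
  have sqi: "(\<integral>\<^sup>+x. sq f x) = (\<integral>\<^sup>+z. (f z)^2)"
    if [measurable]: "f \<in> borel_measurable borel" for f
    unfolding sq_def by (rule nn_integral_lborel_pair[symmetric]) measurable
  define T where "T x x1 = (\<integral>\<^sup>+t. \<integral>\<^sup>+t1. S (x, t) (x1, t1))" for x x1
  note [measurable (raw)] = borel_measurable_compose2[OF assms(4)] borel_measurable_compose2[OF assms(6)]
  \<comment> \<open>The second frequency \<open>x1\<close> is moved in front of the first time
    variable, so that the two time integrals of a fibre become innermost.\<close>
  have swap: "(\<integral>\<^sup>+z. \<integral>\<^sup>+z1. S z z1) = (\<integral>\<^sup>+x. \<integral>\<^sup>+x1. T x x1)"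
  proof -
    have "(\<integral>\<^sup>+z. \<integral>\<^sup>+z1. S z z1)
        = (\<integral>\<^sup>+z. \<integral>\<^sup>+x1. \<integral>\<^sup>+t1. S z (x1, t1))"
      by (intro nn_integral_cong nn_integral_lborel_pair) measurable
    also have "\<dots> = (\<integral>\<^sup>+x. \<integral>\<^sup>+t. \<integral>\<^sup>+x1. \<integral>\<^sup>+t1. S (x, t) (x1, t1))"
      by (rule nn_integral_lborel_pair) measurable
    also have "\<dots> = (\<integral>\<^sup>+x. \<integral>\<^sup>+x1. T x x1)"
      unfolding T_def
      by (intro nn_integral_cong nn_integral_lborel_swap) measurable
    finally show ?thesis .
  qed
  have T: "(T x x1)^2 \<le> m x * sq G x1 * sq W (x1 - x) * sq u x" for x x1
  proof -
    have "(T x x1)^2 \<le> m x * (\<integral>\<^sup>+t. (G (x1, t))^2) * (\<integral>\<^sup>+t. (W (x1 - x, t))^2) * (\<integral>\<^sup>+t. (u (x, t))^2)"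
      unfolding T_def
    proof (rule trilinear_sup_kernel[where K = "\<lambda>t t1. K (x, t) (x1, t1)"])
      show "(S (x, t) (x1, t1))^2 \<le> (G (x1, t1))^2 * (W (x1 - x, t1 - t))^2 * (u (x, t))^2 * K (x, t) (x1, t1)" for t t1
        using S[of "(x, t)" "(x1, t1)"] by simp
    qed (use K in measurable)
    then show ?thesis by (simp add: sq_def)
  qed
  define U where "U x = (\<integral>\<^sup>+x1. T x x1)" for x
  define N where "N f = (\<integral>\<^sup>+z. (f z)^2)" for f :: "real \<times> real \<Rightarrow> ennreal"
  have U: "(U x)^2 \<le> m x * (N G * N W * sq u x)" for x
  proof -
    have "(U x)^2 \<le> (\<integral>\<^sup>+x1. m x * sq u x * sq G x1) * (\<integral>\<^sup>+x1. sq W (x1 - x))"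
      unfolding U_def by (rule nn_integral_geometric_mean) (use T[of x] in \<open>auto simp: mult_ac\<close>)
    also have "(\<integral>\<^sup>+x1. sq W (x1 - x)) = N W"
      by (subst nn_integral_lborel_shift_diff) (auto simp: sqi N_def)
    also have "(\<integral>\<^sup>+x1. m x * sq u x * sq G x1) = m x * sq u x * N G"
      by (subst nn_integral_cmult) (auto simp: sqi N_def)
    finally show ?thesis by (simp add: mult_ac)
  qed
  have "(\<integral>\<^sup>+x. U x)^2 \<le> (\<integral>\<^sup>+x. m x) * (\<integral>\<^sup>+x. N G * N W * sq u x)"
    by (rule nn_integral_geometric_mean) (use U in auto)
  also have "(\<integral>\<^sup>+x. N G * N W * sq u x) = N G * N W * N u"
    by (subst nn_integral_cmult) (auto simp: sqi N_def)
  also have "(\<integral>\<^sup>+x. m x) * (N G * N W * N u) \<le> M * (N G * N W * N u)"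
    by (intro mult_right_mono m) auto
  finally show ?thesis unfolding swap U_def by (simp add: N_def mult_ac)
qed

section \<open>Integrals of brackets along the modulation variable and over a quadratic
  phase\<close>

lemma bracket_ge_1: "1 \<le> bracket x" and bracket_pos: "0 < bracket x"
  by (auto simp: bracket_def)

lemma measurable_bracket [measurable]: "bracket \<in> borel_measurable borel"
  unfolding bracket_def[abs_def] by measurable

lemma measurable_omega [measurable]: "omega a B k \<in> borel_measurable borel"
  unfolding omega_def[abs_def] by measurable

lemma nn_integral_bracket_powr:
  assumes "\<kappa> > 1"
  shows "(\<integral>\<^sup>+x. ennreal (bracket x powr - \<kappa>)) \<le> ennreal (2 / (\<kappa> - 1))"
proof -
  let ?f = "\<lambda>x::real. ennreal ((1 + x) powr - \<kappa>) * indicator {0..} x"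
  have half: "(\<integral>\<^sup>+x. ?f x) = ennreal (1 / (\<kappa> - 1))"
  proof -
    have "(\<integral>\<^sup>+x. ?f x) = ennreal (0 - (- ((1 + 0) powr (1 - \<kappa>) / (\<kappa> - 1))))"
    proof (rule nn_integral_FTC_atLeast[where F = "\<lambda>x. - ((1 + x) powr (1 - \<kappa>) / (\<kappa> - 1))"])
      show "((\<lambda>x. - ((1 + x) powr (1 - \<kappa>) / (\<kappa> - 1))) has_real_derivative (1 + x) powr - \<kappa>) (at x)"
        if "0 \<le> x" for x
      proof -
        have "((\<lambda>x. - ((1 + x) powr (1 - \<kappa>) / (\<kappa> - 1))) has_real_derivative
             - ((1 - \<kappa>) * (1 + x) powr (1 - \<kappa> - 1) * 1 / (\<kappa> - 1))) (at x)"
          using that assms by (auto intro!: derivative_eq_intros)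
        also have "- ((1 - \<kappa>) * (1 + x) powr (1 - \<kappa> - 1) * 1 / (\<kappa> - 1)) = (1 + x) powr - \<kappa>"
          using assms by (simp add: field_simps)
        finally show ?thesis .
      qed
      have "((\<lambda>x::real. (1 + x) powr (1 - \<kappa>)) \<longlongrightarrow> 0) at_top"
        using assms by (intro tendsto_neg_powr filterlim_tendsto_add_at_top[OF tendsto_const] filterlim_ident) auto
      then show "((\<lambda>x. - ((1 + x) powr (1 - \<kappa>) / (\<kappa> - 1))) \<longlongrightarrow> 0) at_top"
        using tendsto_minus[OF tendsto_divide[OF _ tendsto_const[of "\<kappa> - 1"]]] assms by fastforce
    qed auto
    then show ?thesis by simp
  qed
  have "(\<integral>\<^sup>+x. ennreal (bracket x powr - \<kappa>)) \<le> (\<integral>\<^sup>+x. ?f x + ?f (0 - x))"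
    by (intro nn_integral_mono) (auto simp: bracket_def indicator_def)
  also have "\<dots> = (\<integral>\<^sup>+x. ?f x) + (\<integral>\<^sup>+x. ?f (0 - x))"
    by (rule nn_integral_add) measurable
  also have "(\<integral>\<^sup>+x. ?f (0 - x)) = (\<integral>\<^sup>+x. ?f x)"
    by (rule nn_integral_lborel_reflect) measurable
  finally show ?thesis
    using assms unfolding half by (simp flip: ennreal_plus)
qed

text \<open>The larger of the two brackets is at least half of \<open>bracket H\<close>, so it pays
  for \<open>bracket H powr \<gamma>\<close> at the cost of \<open>2 powr \<gamma> \<le> 2\<close>.
  What is left of its exponent is nonnegative and is transferred to the smaller bracket, which then
  carries \<open>\<kappa>1 + \<kappa>2 - \<gamma> > 1\<close>. The 8 collects this 2, the two
  summands, and the 2 of each one-dimensional integral.\<close>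

lemma nn_integral_bracket_convolution:
  assumes "0 \<le> \<gamma>" "\<gamma> \<le> 1" "\<gamma> \<le> \<kappa>1" "\<gamma> \<le> \<kappa>2" "\<kappa>1 + \<kappa>2 - \<gamma> > 1"
  shows "(\<integral>\<^sup>+s. ennreal (bracket s powr - \<kappa>1 * bracket (s - H) powr - \<kappa>2))
     \<le> ennreal (8 / (\<kappa>1 + \<kappa>2 - \<gamma> - 1) * bracket H powr - \<gamma>)"
proof -
  define \<mu> where "\<mu> = \<kappa>1 + \<kappa>2 - \<gamma>"
  have \<mu>: "\<mu> > 1" using assms by (simp add: \<mu>_def)
  have aux: "(2 * M) powr \<gamma> * (M powr - p * m powr - q) \<le> 2 * m powr - (p + q - \<gamma>)"
    if "1 \<le> m" "m \<le> M" "\<gamma> \<le> p" for m M p q :: real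
  proof -
    have "(2 * M) powr \<gamma> * (M powr - p * m powr - q) = 2 powr \<gamma> * M powr (\<gamma> - p) * m powr - q"
      using that by (simp add: powr_mult powr_diff powr_minus field_simps)
    also have "\<dots> \<le> 2 powr 1 * m powr (\<gamma> - p) * m powr - q"
      using that assms by (intro mult_mono powr_mono powr_mono2') auto
    also have "\<dots> = 2 * m powr - (p + q - \<gamma>)"
      using that by (simp add: powr_add[symmetric] algebra_simps)
    finally show ?thesis .
  qed
  have pt: "bracket s powr - \<kappa>1 * bracket (s - H) powr - \<kappa>2
     \<le> 2 * bracket H powr - \<gamma> * (bracket s powr - \<mu> + bracket (s - H) powr - \<mu>)" for s
  proof -
    define a b where "a = bracket s" and "b = bracket (s - H)"
    have ab: "1 \<le> a" "1 \<le> b" by (auto simp: a_def b_def bracket_ge_1)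
    have H: "bracket H \<le> 2 * max a b" unfolding a_def b_def bracket_def max_def by (simp split: abs_split)
    have "bracket H powr \<gamma> * (a powr - \<kappa>1 * b powr - \<kappa>2) \<le> (2 * max a b) powr \<gamma> * (a powr - \<kappa>1 * b powr - \<kappa>2)"
      using H bracket_pos[of H] assms by (intro mult_right_mono powr_mono2) auto
    also have "\<dots> \<le> 2 * (a powr - \<mu> + b powr - \<mu>)"
    proof (cases "a \<le> b")
      case True
      have "(2 * max a b) powr \<gamma> * (a powr - \<kappa>1 * b powr - \<kappa>2) \<le> 2 * a powr - (\<kappa>2 + \<kappa>1 - \<gamma>)"
        using aux[OF ab(1) True assms(4), of \<kappa>1] True by (simp add: mult_ac max_def)
      also have "\<dots> \<le> 2 * (a powr - \<mu> + b powr - \<mu>)" by (simp add: \<mu>_def add_ac)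
      finally show ?thesis .
    next
      case False
      have "(2 * max a b) powr \<gamma> * (a powr - \<kappa>1 * b powr - \<kappa>2) \<le> 2 * b powr - (\<kappa>1 + \<kappa>2 - \<gamma>)"
        using aux[OF ab(2) _ assms(3), of a \<kappa>2] False by (simp add: mult_ac max_def)
      also have "\<dots> \<le> 2 * (a powr - \<mu> + b powr - \<mu>)" by (simp add: \<mu>_def)
      finally show ?thesis .
    qed
    finally have "bracket H powr - \<gamma> * (bracket H powr \<gamma> * (a powr - \<kappa>1 * b powr - \<kappa>2))
       \<le> bracket H powr - \<gamma> * (2 * (a powr - \<mu> + b powr - \<mu>))"
      by (rule mult_left_mono) simp
    then show ?thesis
      using bracket_pos[of H] by (simp add: a_def b_def powr_minus field_simps)
  qed
  have "(\<integral>\<^sup>+s. ennreal (bracket s powr - \<kappa>1 * bracket (s - H) powr - \<kappa>2))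
     \<le> (\<integral>\<^sup>+s. ennreal (2 * bracket H powr - \<gamma>) *
          (ennreal (bracket s powr - \<mu>) + ennreal (bracket (s - H) powr - \<mu>)))"
    using pt by (intro nn_integral_mono) (simp flip: ennreal_plus ennreal_mult'')
  also have "\<dots> = ennreal (2 * bracket H powr - \<gamma>) *
      ((\<integral>\<^sup>+s. ennreal (bracket s powr - \<mu>)) + (\<integral>\<^sup>+s. ennreal (bracket (s - H) powr - \<mu>)))"
    by (subst nn_integral_cmult) (auto simp: nn_integral_add)
  also have "(\<integral>\<^sup>+s. ennreal (bracket (s - H) powr - \<mu>)) = (\<integral>\<^sup>+s. ennreal (bracket s powr - \<mu>))"
    by (rule nn_integral_lborel_shift_diff) measurable
  also have "ennreal (2 * bracket H powr - \<gamma>) * ((\<integral>\<^sup>+s. ennreal (bracket s powr - \<mu>)) + (\<integral>\<^sup>+s. ennreal (bracket s powr - \<mu>)))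
     \<le> ennreal (2 * bracket H powr - \<gamma>) * (ennreal (2 / (\<mu> - 1)) + ennreal (2 / (\<mu> - 1)))"
    by (intro mult_left_mono add_mono nn_integral_bracket_powr \<mu>) auto
  also have "\<dots> = ennreal (8 / (\<mu> - 1) * bracket H powr - \<gamma>)"
  proof -
    have "ennreal (2 / (\<mu> - 1)) + ennreal (2 / (\<mu> - 1)) = ennreal (4 / (\<mu> - 1))"
      using \<mu> by (subst ennreal_plus[symmetric]) (auto simp: add_divide_distrib[symmetric])
    then show ?thesis using \<mu> by (simp flip: ennreal_mult'')
  qed
  finally show ?thesis by (simp add: \<mu>_def)
qed

text \<open>With two roots \<open>m - r\<close> and \<open>m + r\<close>, a point on one side of the
  vertex is at least as far from the root on the other side as from the one on its own side, so the
  product of the distances dominates the square of the smaller. Otherwise the vertex itself plays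
  both parts. The two points do not depend on \<open>x\<close>, which lets the integral below be
  centred at each of them.\<close>

lemma quadratic_lower_bound:
  fixes A b c :: real
  assumes "A \<noteq> 0"
  obtains e1 e2 where
    "\<And>x. \<bar>A\<bar> * (x - e1)^2 \<le> \<bar>A * x^2 + b * x + c\<bar> \<or> \<bar>A\<bar> * (x - e2)^2 \<le> \<bar>A * x^2 + b * x + c\<bar>"
proof -
  define m d where "m = - b / (2 * A)" and "d = m^2 - c / A"
  have q: "A * x^2 + b * x + c = A * ((x - m)^2 - d)" for x
    using assms by (simp add: m_def d_def power2_eq_square field_simps)
  show ?thesis
  proof (cases "d \<le> 0")
    case True
    show ?thesis
    proof (rule that[of m m])
      fix x
      have "\<bar>A\<bar> * (x - m)^2 \<le> \<bar>A\<bar> * \<bar>(x - m)\<^sup>2 - d\<bar>"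
        using True by (intro mult_left_mono) auto
      then show "\<bar>A\<bar> * (x - m)^2 \<le> \<bar>A * x^2 + b * x + c\<bar> \<or> \<bar>A\<bar> * (x - m)^2 \<le> \<bar>A * x^2 + b * x + c\<bar>"
        by (simp add: q abs_mult)
    qed
  next
    case False
    define r where "r = sqrt d"
    have r: "r \<ge> 0" "r^2 = d" using False by (auto simp: r_def)
    show ?thesis
    proof (rule that[of "m - r" "m + r"])
      fix x
      define z where "z = x - m"
      have fac: "\<bar>z\<^sup>2 - d\<bar> = \<bar>z - r\<bar> * \<bar>z + r\<bar>"
        by (simp add: r(2)[symmetric] abs_mult[symmetric] power2_eq_square algebra_simps)
      have "(z + r)^2 \<le> \<bar>z\<^sup>2 - d\<bar> \<or> (z - r)\<^sup>2 \<le> \<bar>z\<^sup>2 - d\<bar>"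
      proof (cases "z \<ge> 0")
        case True
        have "\<bar>z - r\<bar> * \<bar>z - r\<bar> \<le> \<bar>z - r\<bar> * \<bar>z + r\<bar>"
          using True r by (intro mult_left_mono) auto
        then show ?thesis unfolding fac by (simp add: power2_eq_square)
      next
        case False
        have "\<bar>z + r\<bar> * \<bar>z + r\<bar> \<le> \<bar>z - r\<bar> * \<bar>z + r\<bar>"
          using False r by (intro mult_right_mono) auto
        then show ?thesis unfolding fac by (simp add: power2_eq_square)
      qed
      then have "\<bar>A\<bar> * (z + r)^2 \<le> \<bar>A\<bar> * \<bar>z\<^sup>2 - d\<bar> \<or> \<bar>A\<bar> * (z - r)^2 \<le> \<bar>A\<bar> * \<bar>z\<^sup>2 - d\<bar>"
        by (auto intro: mult_left_mono)
      then show "\<bar>A\<bar> * (x - (m - r))^2 \<le> \<bar>A * x^2 + b * x + c\<bar> \<or> \<bar>A\<bar> * (x - (m + r))^2 \<le> \<bar>A * x^2 + b * x + c\<bar>"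
        unfolding q abs_mult z_def by (simp only: diff_diff_eq2 diff_diff_eq) (simp add: algebra_simps)
    qed
  qed
qed

text \<open>The exponent \<open>2/5\<close> is below \<open>1/2\<close>, so the power
  \<open>4/5\<close> of the distance to a root is integrable even at a double root. The roots may
  lie anywhere: a window centred at the root costs 10, and the part of \<open>{-R..R}\<close> at
  distance more than \<open>R\<close> from the root adds 2, because the integrand there is at most
  its bound at distance \<open>R\<close>. Two roots give 24.\<close>

lemma nn_integral_bracket_quadratic:
  fixes A b c R :: real
  assumes A: "A \<noteq> 0" and R: "R > 0"
  shows "(\<integral>\<^sup>+x. ennreal (bracket (A * x^2 + b * x + c) powr - (2/5)) * indicator {-R..R} x)
     \<le> ennreal (24 * \<bar>A\<bar> powr - (2/5) * R powr (1/5))"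
proof -
  define P where "P = \<bar>A\<bar> powr - (2/5)"
  define f where "f z = ennreal ((1 + \<bar>A\<bar> * z^2) powr - (2/5))" for z
  have [measurable]: "f \<in> borel_measurable borel" unfolding f_def[abs_def] by measurable
  have f_le: "f z \<le> ennreal (P * r powr - (4/5))" if "0 < r" "r \<le> \<bar>z\<bar>" for z r
  proof -
    have "(1 + \<bar>A\<bar> * z^2) powr - (2/5) \<le> (\<bar>A\<bar> * r^2) powr - (2/5)"
    proof (rule powr_mono2')
      have "r^2 \<le> z^2" using that by (metis abs_le_square_iff abs_of_pos)
      then show "\<bar>A\<bar> * r^2 \<le> 1 + \<bar>A\<bar> * z^2"
        using mult_left_mono[of "r^2" "z^2" "\<bar>A\<bar>"] by auto
      show "0 < \<bar>A\<bar> * r^2" using A that by auto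
    qed simp
    also have "\<dots> = P * r powr - (4/5)"
    proof -
      have "r^2 = r powr 2" using that by simp
      then show ?thesis using that by (simp add: P_def powr_mult powr_powr del: powr_numeral)
    qed
    finally show ?thesis unfolding f_def by (rule ennreal_leI)
  qed
  have half: "(\<integral>\<^sup>+z. ennreal (z powr - (4/5)) * indicator {0..R} z) = ennreal (5 * R powr (1/5))"
  proof -
    have "((\<lambda>z. z powr - (4/5)) has_integral (R powr (- (4/5) + 1) / (- (4/5) + 1))) {0..R}"
      by (rule has_integral_powr_from_0) (use R in auto)
    then have "((\<lambda>z. if z \<in> {0..R} then z powr - (4/5) else 0) has_integral (5 * R powr (1/5))) UNIV"
      by (subst has_integral_restrict_UNIV) (simp add: mult.commute)
    also have "(\<lambda>z. if z \<in> {0..R} then z powr - (4/5) else 0) = (\<lambda>z. z powr - (4/5) * indicator {0..R} z)"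
      by (auto simp: indicator_def)
    finally have "(\<integral>\<^sup>+z. ennreal (z powr - (4/5) * indicator {0..R} z)) = ennreal (5 * R powr (1/5))"
      by (intro nn_integral_has_integral_lborel) auto
    also have "(\<lambda>z. ennreal (z powr - (4/5) * indicator {0..R} z)) = (\<lambda>z. ennreal (z powr - (4/5)) * indicator {0..R} z)"
      by (auto simp: indicator_def)
    finally show ?thesis .
  qed
  have near: "(\<integral>\<^sup>+z. f z * indicator {-R..R} z) \<le> ennreal (10 * P * R powr (1/5))"
  proof -
    let ?g = "\<lambda>z. ennreal (z powr - (4/5)) * indicator {0..R} z"
    have "(\<integral>\<^sup>+z. f z * indicator {-R..R} z) \<le> (\<integral>\<^sup>+z. ennreal P * (?g z + ?g (0 - z)))"
    proof (rule nn_integral_mono_AE)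
      \<comment> \<open>At the origin \<open>0 powr - (4/5)\<close> is 0 while \<open>f 0\<close> is
        1, so the comparison holds only off this point.\<close>
      have "AE z in lborel. z \<noteq> (0::real)" by (rule AE_lborel_singleton)
      then show "AE z in lborel. f z * indicator {-R..R} z \<le> ennreal P * (?g z + ?g (0 - z))"
      proof eventually_elim
        case (elim z)
        have "f z \<le> ennreal P * ennreal (\<bar>z\<bar> powr - (4/5))"
          using f_le[of "\<bar>z\<bar>" z] elim by (simp add: ennreal_mult'' P_def)
        then show ?case
          using elim by (auto simp: indicator_def abs_if split: if_splits)
      qed
    qed
    also have "\<dots> = ennreal P * ((\<integral>\<^sup>+z. ?g z) + (\<integral>\<^sup>+z. ?g (0 - z)))"
      by (subst nn_integral_cmult) (auto simp: nn_integral_add)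
    also have "(\<integral>\<^sup>+z. ?g (0 - z)) = (\<integral>\<^sup>+z. ?g z)"
      by (rule nn_integral_lborel_reflect) measurable
    finally show ?thesis
      unfolding half by (simp add: P_def mult_ac flip: ennreal_plus ennreal_mult'')
  qed
  have shifted: "(\<integral>\<^sup>+x. f (x - e) * indicator {-R..R} x) \<le> ennreal (12 * P * R powr (1/5))" for e
  proof -
    have "(\<integral>\<^sup>+x. f (x - e) * indicator {-R..R} x)
       \<le> (\<integral>\<^sup>+x. f (x - e) * indicator {-R..R} (x - e) + ennreal (P * R powr - (4/5)) * indicator {-R..R} x)"
    proof (rule nn_integral_mono)
      fix x
      show "f (x - e) * indicator {-R..R} x \<le> f (x - e) * indicator {-R..R} (x - e) + ennreal (P * R powr - (4/5)) * indicator {-R..R} x"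
      proof (cases "\<bar>x - e\<bar> \<le> R")
        case True then show ?thesis by (auto simp: indicator_def)
      next
        case False
        then have "f (x - e) \<le> ennreal (P * R powr - (4/5))" using R by (intro f_le) auto
        then show ?thesis by (auto simp: indicator_def)
      qed
    qed
    also have "\<dots> = (\<integral>\<^sup>+x. f (x - e) * indicator {-R..R} (x - e)) + (\<integral>\<^sup>+x. ennreal (P * R powr - (4/5)) * indicator {-R..R} x)"
      by (rule nn_integral_add) measurable
    also have "(\<integral>\<^sup>+x. f (x - e) * indicator {-R..R} (x - e)) = (\<integral>\<^sup>+z. f z * indicator {-R..R} z)"
      by (rule nn_integral_lborel_shift_diff) measurable
    also have "(\<integral>\<^sup>+x. ennreal (P * R powr - (4/5)) * indicator {-R..R} x) = ennreal (2 * P * (R * R powr - (4/5)))"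
      using R by (subst nn_integral_cmult_indicator) (auto simp: P_def mult_ac simp flip: ennreal_mult'')
    also have "R * R powr - (4/5) = R powr (1/5)"
      using R powr_add[of R 1 "-(4/5)"] by simp
    also have "(\<integral>\<^sup>+z. f z * indicator {-R..R} z) + ennreal (2 * P * R powr (1/5))
        \<le> ennreal (10 * P * R powr (1/5)) + ennreal (2 * P * R powr (1/5))"
      by (intro add_right_mono near)
    also have "\<dots> = ennreal (12 * P * R powr (1/5))"
      by (simp add: P_def flip: ennreal_plus)
    finally show ?thesis .
  qed
  obtain e1 e2 where e: "\<And>x. \<bar>A\<bar> * (x - e1)^2 \<le> \<bar>A * x^2 + b * x + c\<bar> \<or> \<bar>A\<bar> * (x - e2)^2 \<le> \<bar>A * x^2 + b * x + c\<bar>"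
    using quadratic_lower_bound[OF A, of b c] by blast
  have pt: "ennreal (bracket (A * x^2 + b * x + c) powr - (2/5)) \<le> f (x - e1) + f (x - e2)" for x
  proof -
    have "ennreal (bracket (A * x^2 + b * x + c) powr - (2/5)) \<le> f (x - e)"
      if "\<bar>A\<bar> * (x - e)^2 \<le> \<bar>A * x^2 + b * x + c\<bar>" for e
      unfolding f_def using that
      by (intro ennreal_leI powr_mono2') (auto simp: bracket_def add_pos_nonneg)
    with e[of x] show ?thesis
      by (metis add.commute add_increasing zero_le)
  qed
  have "(\<integral>\<^sup>+x. ennreal (bracket (A * x^2 + b * x + c) powr - (2/5)) * indicator {-R..R} x)
     \<le> (\<integral>\<^sup>+x. f (x - e1) * indicator {-R..R} x + f (x - e2) * indicator {-R..R} x)"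
    using pt by (intro nn_integral_mono) (auto simp: indicator_def)
  also have "\<dots> = (\<integral>\<^sup>+x. f (x - e1) * indicator {-R..R} x) + (\<integral>\<^sup>+x. f (x - e2) * indicator {-R..R} x)"
    by (rule nn_integral_add) measurable
  also have "\<dots> \<le> ennreal (12 * P * R powr (1/5)) + ennreal (12 * P * R powr (1/5))"
    by (intro add_mono shifted)
  also have "\<dots> = ennreal (24 * P * R powr (1/5))"
    by (simp add: P_def flip: ennreal_plus)
  finally show ?thesis by (simp add: P_def)
qed

text \<open>The weights of the \<open>Z\<close> norm for the mode \<open>j\<close> on the Fourier
  side, added up: \<open>24/25 = 2 * b\<close> on the modulation from \<open>X\<close>, and one
  square for each space derivative from \<open>H1\<close>.\<close>

definition freq_weight :: "real \<Rightarrow> real \<Rightarrow> nat \<Rightarrow> real \<times> real \<Rightarrow> real" where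
  "freq_weight a B j = (\<lambda>(\<xi>, \<tau>). bracket (\<tau> - omega a B j \<xi>) powr (24/25) + \<xi>^2 + (real j)^2)"

definition mod_weight :: "real \<Rightarrow> real \<Rightarrow> nat \<Rightarrow> real \<times> real \<Rightarrow> real" where
  "mod_weight a B k = (\<lambda>(\<xi>, \<tau>). bracket (\<tau> - omega a B k \<xi>) powr (24/25))"

lemma measurable_weights [measurable]:
  "freq_weight a B j \<in> borel_measurable borel" "mod_weight a B j \<in> borel_measurable borel"
  unfolding freq_weight_def mod_weight_def case_prod_beta' by measurable

lemma mod_weight_ge_1: "1 \<le> mod_weight a B k z"
  by (auto simp: mod_weight_def bracket_ge_1 ge_one_powr_ge_zero split: prod.split)

lemma freq_weight_ge: "mod_weight a B k z \<le> freq_weight a B k z"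
  "(fst z)^2 \<le> freq_weight a B k z" "(real k)^2 \<le> freq_weight a B k z"
  by (auto simp: mod_weight_def freq_weight_def split: prod.split)

lemma freq_weight_ge_1: "1 \<le> freq_weight a B k z"
  using mod_weight_ge_1 freq_weight_ge(1) by (rule order_trans)

text \<open>If \<open>s\<close> is the modulation of the mode \<open>j\<close> at the input
  frequency, the modulation of the mode \<open>k\<close> at the difference frequency is
  \<open>s\<close> minus the phase. A convolution of brackets in \<open>s\<close> therefore leaves a
  power of the bracket of the phase.\<close>

definition phase :: "real \<Rightarrow> real \<Rightarrow> nat \<Rightarrow> nat \<Rightarrow> real \<times> real \<Rightarrow> real \<Rightarrow> real" where
  "phase a B j k = (\<lambda>(\<xi>, \<tau>) \<xi>1. \<tau> + omega a B k (\<xi>1 - \<xi>) - omega a B j \<xi>1)"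

text \<open>The cubes cancel. What makes the phase useful is the leading coefficient
  \<open>-3 * \<xi>\<close>: it depends on the output frequency alone, while the mode numbers only
  move the parabola, to which the integral bound is blind.\<close>

lemma phase_quadratic:
  "phase a B j k (\<xi>, \<tau>) x = (-3 * \<xi>) * x^2 + (3 * \<xi>^2 + lam B k - lam B j) * x + (\<tau> - \<xi> ^ 3 - (lam B k - a) * \<xi>)"
  by (simp add: phase_def omega_def power2_eq_square power3_eq_cube algebra_simps)

lemma nn_integral_modulations:
  assumes "0 \<le> \<gamma>" "\<gamma> \<le> 1" "\<gamma> \<le> \<kappa>1" "\<gamma> \<le> \<kappa>2" "\<kappa>1 + \<kappa>2 - \<gamma> > 1"
  shows "(\<integral>\<^sup>+\<tau>1. ennreal (bracket (\<tau>1 - omega a B j \<xi>1) powr - \<kappa>1 * bracket (\<tau>1 - \<tau> - omega a B k (\<xi>1 - \<xi>)) powr - \<kappa>2))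
     \<le> ennreal (8 / (\<kappa>1 + \<kappa>2 - \<gamma> - 1) * bracket (phase a B j k (\<xi>, \<tau>) \<xi>1) powr - \<gamma>)"
proof -
  have "(\<integral>\<^sup>+s. ennreal (bracket s powr - \<kappa>1 * bracket (s - phase a B j k (\<xi>, \<tau>) \<xi>1) powr - \<kappa>2))
    = (\<integral>\<^sup>+s. ennreal (bracket (s - omega a B j \<xi>1) powr - \<kappa>1 * bracket (s - omega a B j \<xi>1 - phase a B j k (\<xi>, \<tau>) \<xi>1) powr - \<kappa>2))"
    by (rule nn_integral_lborel_shift_diff[symmetric]) measurable
  then show ?thesis
    using nn_integral_bracket_convolution[OF assms, of "phase a B j k (\<xi>, \<tau>) \<xi>1"]
    by (simp add: phase_def algebra_simps)
qed

text \<open>Near the output frequency the phase is quadratic in the input frequency with leading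
  coefficient comparable to the output frequency.\<close>

lemma near_kernel_bound:
  "(\<integral>\<^sup>+z1. indicator {x. \<bar>x\<bar> \<le> (1 + \<bar>fst z\<bar>)^2} (fst z1) *
      ennreal (bracket (snd z1 - omega a B j (fst z1)) powr - (288/625) *
        bracket (snd z1 - snd z - omega a B k (fst z1 - fst z)) powr - (24/25)))
     \<le> ennreal (5000/13 * 48)"
proof -
  obtain \<xi> \<tau> where z: "z = (\<xi>, \<tau>)" by (cases z)
  define R where "R = (1 + \<bar>\<xi>\<bar>)^2"
  have R: "R > 0" by (simp add: R_def add_pos_nonneg)
  define ph where "ph = phase a B j k (\<xi>, \<tau>)"
  have [measurable]: "ph \<in> borel_measurable borel" unfolding ph_def phase_def by (simp; measurable)
  have I: "indicator {x. \<bar>x\<bar> \<le> (1 + \<bar>\<xi>\<bar>)^2} x = (indicator {-R..R} x :: ennreal)" for x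
    by (auto simp: indicator_def R_def)
  have "(\<integral>\<^sup>+z1. indicator {x. \<bar>x\<bar> \<le> (1 + \<bar>fst z\<bar>)^2} (fst z1) *
      ennreal (bracket (snd z1 - omega a B j (fst z1)) powr - (288/625) *
        bracket (snd z1 - snd z - omega a B k (fst z1 - fst z)) powr - (24/25)))
    = (\<integral>\<^sup>+x. \<integral>\<^sup>+t. indicator {-R..R} x *
      ennreal (bracket (t - omega a B j x) powr - (288/625) *
        bracket (t - \<tau> - omega a B k (x - \<xi>)) powr - (24/25)))"
    by (subst nn_integral_lborel_pair) (simp_all add: z I)
  \<comment> \<open>The factor is \<open>8 / (288/625 + 24/25 - 2/5 - 1)\<close>; the excess
    \<open>13/625\<close> is what the choice of \<open>b\<close> leaves over.\<close>
  also have "\<dots> \<le> (\<integral>\<^sup>+x. indicator {-R..R} x * ennreal (5000/13 * bracket (ph x) powr - (2/5)))"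
  proof (rule nn_integral_mono)
    fix x
    have "(\<integral>\<^sup>+t. indicator {-R..R} x * ennreal (bracket (t - omega a B j x) powr - (288/625) *
        bracket (t - \<tau> - omega a B k (x - \<xi>)) powr - (24/25)))
      = indicator {-R..R} x * (\<integral>\<^sup>+t. ennreal (bracket (t - omega a B j x) powr - (288/625) *
        bracket (t - \<tau> - omega a B k (x - \<xi>)) powr - (24/25)))"
      by (rule nn_integral_cmult) measurable
    also have "\<dots> \<le> indicator {-R..R} x * ennreal (5000/13 * bracket (ph x) powr - (2/5))"
      using nn_integral_modulations[of "2/5" "288/625" "24/25" a B j x \<tau> k \<xi>]
      by (intro mult_left_mono) (auto simp: ph_def)
    finally show "(\<integral>\<^sup>+t. indicator {-R..R} x * ennreal (bracket (t - omega a B j x) powr - (288/625) *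
        bracket (t - \<tau> - omega a B k (x - \<xi>)) powr - (24/25)))
        \<le> indicator {-R..R} x * ennreal (5000/13 * bracket (ph x) powr - (2/5))" .
  qed
  also have "\<dots> = ennreal (5000/13) * (\<integral>\<^sup>+x. ennreal (bracket (ph x) powr - (2/5)) * indicator {-R..R} x)"
    by (subst nn_integral_cmult[symmetric], measurable) (simp add: ennreal_mult'' ac_simps del: times_divide_eq_left times_divide_eq_right)
  also have "\<dots> \<le> ennreal (5000/13) * ennreal 48"
  proof (rule mult_left_mono[OF _ zero_le])
    show "(\<integral>\<^sup>+x. ennreal (bracket (ph x) powr - (2/5)) * indicator {-R..R} x) \<le> ennreal 48"
  \<comment> \<open>For small \<open>\<xi>\<close> the parabola degenerates, but then the window has
    length at most 8 and the integrand is at most 1. Otherwise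
    \<open>\<bar>\<xi>\<bar> powr - (2/5)\<close> from the leading coefficient compensates
    \<open>R powr (1/5)\<close> up to a factor 2; this balance is why the near region extends to the
    square of the output frequency.\<close>
  proof (cases "\<bar>\<xi>\<bar> \<le> 1")
    case True
    have "(\<integral>\<^sup>+x. ennreal (bracket (ph x) powr - (2/5)) * indicator {-R..R} x) \<le> (\<integral>\<^sup>+x. indicator {-R..R} x)"
    proof (rule nn_integral_mono)
      fix x
      have "bracket (ph x) powr - (2/5) \<le> 1 powr - (2/5)"
        by (rule powr_mono2') (auto simp: bracket_ge_1)
      then show "ennreal (bracket (ph x) powr - (2/5)) * indicator {-R..R} x \<le> indicator {-R..R} x"
        by (auto simp: indicator_def)
    qed
    also have "\<dots> = ennreal (2 * R)" using R by simp
    also have "2 * R \<le> 48"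
      using True power_mono[of "1 + \<bar>\<xi>\<bar>" 2 2] by (simp add: R_def)
    finally show ?thesis by (simp add: ennreal_leI)
  next
    case False
    then have "(\<integral>\<^sup>+x. ennreal (bracket (ph x) powr - (2/5)) * indicator {-R..R} x)
      \<le> ennreal (24 * \<bar>- 3 * \<xi>\<bar> powr - (2/5) * R powr (1/5))"
      unfolding ph_def phase_quadratic by (intro nn_integral_bracket_quadratic R) auto
    also have "24 * \<bar>- 3 * \<xi>\<bar> powr - (2/5) * R powr (1/5) \<le> 24 * (\<bar>\<xi>\<bar> powr - (2/5) * (2 * \<bar>\<xi>\<bar> powr (2/5)))"
    proof -
      have "R powr (1/5) = (1 + \<bar>\<xi>\<bar>) powr (2/5)"
        by (simp add: R_def powr_powr flip: powr_numeral)
      also have "\<dots> \<le> (2 * \<bar>\<xi>\<bar>) powr (2/5)"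
        using False by (intro powr_mono2) auto
      also have "\<dots> \<le> 2 * \<bar>\<xi>\<bar> powr (2/5)"
        using powr_mono[of "2/5" 1 "2::real"] by (simp add: powr_mult mult_right_mono)
      finally have 1: "R powr (1/5) \<le> 2 * \<bar>\<xi>\<bar> powr (2/5)" .
      have "\<bar>- 3 * \<xi>\<bar> powr - (2/5) \<le> \<bar>\<xi>\<bar> powr - (2/5)"
        using False by (intro powr_mono2') auto
      then have "\<bar>- 3 * \<xi>\<bar> powr - (2/5) * R powr (1/5) \<le> \<bar>\<xi>\<bar> powr - (2/5) * (2 * \<bar>\<xi>\<bar> powr (2/5))"
        by (intro mult_mono 1) auto
      from mult_left_mono[OF this, of 24] show ?thesis by (simp only: mult.assoc zero_le_numeral simp_thms)
    qed
    also have "\<dots> = 48" using False by (simp add: powr_minus field_simps)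
    finally show ?thesis by (simp add: ennreal_leI)
  qed
  qed
  also have "ennreal (5000/13) * ennreal 48 = ennreal (5000/13 * 48)"
    by (rule ennreal_mult[symmetric]) auto
  finally show ?thesis .
qed

text \<open>No gain from the phase is taken (\<open>\<gamma> = 0\<close>): the exponents
  \<open>108/625\<close> and \<open>24/25\<close> together exceed 1 by \<open>83/625\<close>, whence
  \<open>5000/83\<close>. The remaining factor in \<open>\<xi>\<close> is integrable since
  \<open>6/5 > 1\<close>.\<close>

lemma far_kernel_bound:
  "(\<integral>\<^sup>+t1. ennreal ((1 + \<bar>\<xi>\<bar>) powr - (6/5) * (bracket (t1 - omega a B j \<xi>1) powr - (108/625) *
        bracket (t1 - \<tau> - omega a B k (\<xi>1 - \<xi>)) powr - (24/25))))
     \<le> ennreal (5000/83) * ennreal (bracket \<xi> powr - (6/5))"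
proof -
  have "(\<integral>\<^sup>+t1. ennreal ((1 + \<bar>\<xi>\<bar>) powr - (6/5) * (bracket (t1 - omega a B j \<xi>1) powr - (108/625) *
        bracket (t1 - \<tau> - omega a B k (\<xi>1 - \<xi>)) powr - (24/25))))
    = ennreal (bracket \<xi> powr - (6/5)) * (\<integral>\<^sup>+t1. ennreal (bracket (t1 - omega a B j \<xi>1) powr - (108/625) *
        bracket (t1 - \<tau> - omega a B k (\<xi>1 - \<xi>)) powr - (24/25)))"
    by (subst nn_integral_cmult[symmetric]) (auto simp: bracket_def ennreal_mult)
  also have "\<dots> \<le> ennreal (bracket \<xi> powr - (6/5)) * ennreal (5000/83)"
    using nn_integral_modulations[of 0 "108/625" "24/25" a B j \<xi>1 \<tau> k \<xi>] bracket_pos[of "phase a B j k (\<xi>, \<tau>) \<xi>1"]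
    by (intro mult_left_mono) auto
  finally show ?thesis by (simp add: mult.commute)
qed

text \<open>The weight is spent in the shares \<open>13/25 + 12/25 = 1\<close>. The first, against
  \<open>(real j)^2\<close>, gives \<open>j powr (26/25)\<close>; the second, against the
  modulation, gives the exponent \<open>24/25 * 12/25 = 288/625\<close>.\<close>

lemma near_weight_bound:
  assumes "j \<ge> 1"
  shows "1 \<le> freq_weight a B j z1 * mod_weight a B k z2 * (real j powr - (26/25) *
     (bracket (snd z1 - omega a B j (fst z1)) powr - (288/625) *
      bracket (snd z2 - omega a B k (fst z2)) powr - (24/25)))"
proof -
  define A s c where "A = freq_weight a B j z1" and "s = bracket (snd z1 - omega a B j (fst z1))"
    and "c = bracket (snd z2 - omega a B k (fst z2))"
  have pos: "A \<ge> 1" "s \<ge> 1" "c \<ge> 1" by (auto simp: A_def s_def c_def bracket_ge_1 freq_weight_ge_1)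
  have sA: "s powr (24/25) \<le> A" using freq_weight_ge(1)[of a B j z1] by (simp add: A_def s_def mod_weight_def case_prod_beta)
  have jA: "(real j)^2 \<le> A" by (simp add: A_def freq_weight_ge)
  have "real j powr (26/25) * s powr (288/625) = ((real j)^2) powr (13/25) * (s powr (24/25)) powr (12/25)"
    using assms pos by (simp add: powr_powr flip: powr_numeral)
  also have "\<dots> \<le> A powr (13/25) * A powr (12/25)"
    using sA jA by (intro mult_mono powr_mono2) auto
  also have "\<dots> = A" using pos by (simp flip: powr_add)
  finally have "real j powr (26/25) * s powr (288/625) \<le> A" .
  moreover have "mod_weight a B k z2 = c powr (24/25)" by (simp add: mod_weight_def c_def case_prod_beta)
  ultimately show ?thesis
    unfolding A_def[symmetric] s_def[symmetric] c_def[symmetric]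
    using pos assms by (simp add: powr_minus field_simps)
qed

text \<open>The shares are now \<open>13/25 + 3/10 + 9/50 = 1\<close>. In the far region the square
  of the input frequency exceeds \<open>(1 + \<bar>x\<bar>) powr 4\<close>, and the share
  \<open>3/10\<close> turns this into the integrable decay \<open>6/5\<close> in the output
  frequency; \<open>24/25 * 9/50 = 108/625\<close> remains for the modulation.\<close>

lemma far_weight_bound:
  assumes "j \<ge> 1" and far: "(1 + \<bar>x\<bar>)^2 < \<bar>fst z1\<bar>"
  shows "1 \<le> freq_weight a B j z1 * mod_weight a B k z2 * (real j powr - (26/25) * ((1 + \<bar>x\<bar>) powr - (6/5) *
     (bracket (snd z1 - omega a B j (fst z1)) powr - (108/625) *
      bracket (snd z2 - omega a B k (fst z2)) powr - (24/25))))"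
proof -
  define A s c r where "A = freq_weight a B j z1" and "s = bracket (snd z1 - omega a B j (fst z1))"
    and "c = bracket (snd z2 - omega a B k (fst z2))" and "r = 1 + \<bar>x\<bar>"
  have pos: "A \<ge> 1" "s \<ge> 1" "c \<ge> 1" "r \<ge> 1" by (auto simp: A_def s_def c_def r_def bracket_ge_1 freq_weight_ge_1)
  have sA: "s powr (24/25) \<le> A" using freq_weight_ge(1)[of a B j z1] by (simp add: A_def s_def mod_weight_def case_prod_beta)
  have jA: "(real j)^2 \<le> A" by (simp add: A_def freq_weight_ge)
  have rA: "r powr 4 \<le> A"
  proof -
    have "r powr 4 = (r^2)^2" using pos by simp
    also have "\<dots> \<le> \<bar>fst z1\<bar>\<^sup>2" using far by (intro power_mono) (auto simp: r_def)
    also have "\<dots> \<le> A" using freq_weight_ge(2)[of z1 a B j] by (simp add: A_def)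
    finally show ?thesis .
  qed
  have "real j powr (26/25) * (r powr (6/5) * s powr (108/625)) =
      ((real j)^2) powr (13/25) * ((r powr 4) powr (3/10) * (s powr (24/25)) powr (9/50))"
    using assms pos by (simp add: powr_powr flip: powr_numeral)
  also have "\<dots> \<le> A powr (13/25) * (A powr (3/10) * A powr (9/50))"
    using sA jA rA by (intro mult_mono powr_mono2) auto
  also have "\<dots> = A" using pos by (simp flip: powr_add)
  finally have "real j powr (26/25) * (r powr (6/5) * s powr (108/625)) \<le> A" .
  moreover have "mod_weight a B k z2 = c powr (24/25)" by (simp add: mod_weight_def c_def case_prod_beta)
  ultimately show ?thesis
    unfolding A_def[symmetric] s_def[symmetric] c_def[symmetric] r_def[symmetric]
    using pos assms by (simp add: powr_minus field_simps)
qed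

text \<open>The kernel is characterised by \<open>1 \<le> x * y * K\<close> and not as a reciprocal
  of the weights, so nothing is divided in the extended reals and any sufficiently large kernel may
  be used.\<close>

lemma le_weighted_square:
  fixes g w u x y K :: ennreal
  assumes "1 \<le> x * y * K"
  shows "(g * w * u)^2 \<le> (esqrt x * g)^2 * (esqrt y * w)^2 * u^2 * K"
proof -
  have "(g * w * u)^2 * 1 \<le> (g * w * u)^2 * (x * y * K)"
    by (intro mult_left_mono assms) simp
  then show ?thesis by (simp add: power_mult_distrib esqrt_power2 mult_ac)
qed

text \<open>Twice the near constant plus twice the far constant, because the form is split into two
  parts before squaring. The last 10 bounds the integral of
  \<open>bracket x powr - (6/5)\<close>.\<close>

definition trilinear_const :: real where
  "trilinear_const = 2 * (5000/13 * 48) + 2 * (5000/83 * 10)"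

text \<open>\<open>g\<close> stands for the transform of a sine mode, \<open>w\<close> for a dual
  mode and \<open>u\<close> for the Fourier side of a cosine coefficient of the test function;
  \<open>z\<close> is the output frequency and \<open>z1\<close> the input frequency. The double
  integral is cut along \<open>\<bar>fst z1\<bar> = (1 + \<bar>fst z\<bar>)^2\<close>: below, the
  kernel has bounded mass in both variables; above, it has bounded mass only along fibres, with
  decay in the output frequency.\<close>

proposition trilinear_estimate:
  fixes g w u :: "real \<times> real \<Rightarrow> ennreal"
  assumes [measurable]: "g \<in> borel_measurable borel" "w \<in> borel_measurable borel" "u \<in> borel_measurable borel"
    and j: "j \<ge> 1"
  shows "(\<integral>\<^sup>+z. \<integral>\<^sup>+z1. g z1 * w (z1 - z) * u z)^2 \<le>
     ennreal (trilinear_const * real j powr - (26/25)) * (\<integral>\<^sup>+z. ennreal (freq_weight a B j z) * (g z)^2)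
       * (\<integral>\<^sup>+z. ennreal (mod_weight a B k z) * (w z)^2) * (\<integral>\<^sup>+z. (u z)^2)"
proof -
  define J where "J = real j powr - (26/25)"
  have J: "J \<ge> 0" by (simp add: J_def)
  define G W where "G z = esqrt (ennreal (freq_weight a B j z)) * g z"
    and "W z = esqrt (ennreal (mod_weight a B k z)) * w z" for z
  have [measurable]: "G \<in> borel_measurable borel" "W \<in> borel_measurable borel"
    unfolding G_def[abs_def] W_def[abs_def] by measurable
  define K1 where "K1 z z1 = ennreal J * (indicator {x. \<bar>x\<bar> \<le> (1 + \<bar>fst z\<bar>)^2} (fst z1) *
      ennreal (bracket (snd z1 - omega a B j (fst z1)) powr - (288/625) *
        bracket (snd z1 - snd z - omega a B k (fst z1 - fst z)) powr - (24/25)))" for z z1 :: "real \<times> real"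
  define K2 where "K2 z z1 = ennreal J * ennreal ((1 + \<bar>fst z\<bar>) powr - (6/5) * (bracket (snd z1 - omega a B j (fst z1)) powr - (108/625) *
        bracket (snd z1 - snd z - omega a B k (fst z1 - fst z)) powr - (24/25)))" for z z1 :: "real \<times> real"
  define near where "near z z1 \<longleftrightarrow> \<bar>fst z1\<bar> \<le> (1 + \<bar>fst z\<bar>)^2" for z z1 :: "real \<times> real"
  have near_m [measurable]: "Measurable.pred borel (case_prod near)" unfolding near_def case_prod_beta' by measurable
  \<comment> \<open>The set under the indicator moves with \<open>z\<close>, so joint measurability
    is reduced to that of the predicate \<open>near\<close>.\<close>
  have indm: "(\<lambda>(z, z1). indicator {x. \<bar>x\<bar> \<le> (1 + \<bar>fst z\<bar>)^2} (fst z1) :: ennreal) \<in> borel_measurable (borel :: ((real \<times> real) \<times> (real \<times> real)) measure)"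
  proof -
    have "(\<lambda>(z, z1). indicator {x. \<bar>x\<bar> \<le> (1 + \<bar>fst z\<bar>)^2} (fst z1) :: ennreal) = (\<lambda>q. if case_prod near q then 1 else 0)"
      by (auto simp: near_def indicator_def fun_eq_iff)
    then show ?thesis by simp
  qed
  note [measurable (raw)] = borel_measurable_compose2[OF indm]
  define T1 T2 where "T1 = (\<integral>\<^sup>+z. \<integral>\<^sup>+z1. (if near z z1 then g z1 * w (z1 - z) * u z else 0))"
    and "T2 = (\<integral>\<^sup>+z. \<integral>\<^sup>+z1. (if near z z1 then 0 else g z1 * w (z1 - z) * u z))"
  have pm: "(\<lambda>x. if near (f x) (h x) then c x else d x) \<in> borel_measurable M"
    if [measurable]: "f \<in> M \<rightarrow>\<^sub>M borel" "h \<in> M \<rightarrow>\<^sub>M borel" "c \<in> borel_measurable M" "d \<in> borel_measurable M"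
    for f h :: "_ \<Rightarrow> real \<times> real" and c d :: "_ \<Rightarrow> ennreal" and M
    unfolding near_def by measurable
  note [measurable (raw)] = pm
  let ?N = "\<lambda>f::real \<times> real \<Rightarrow> ennreal. \<integral>\<^sup>+z. (f z)^2"
  have "(\<integral>\<^sup>+z. \<integral>\<^sup>+z1. g z1 * w (z1 - z) * u z) = (\<integral>\<^sup>+z. (\<integral>\<^sup>+z1. (if near z z1 then g z1 * w (z1 - z) * u z else 0))
     + (\<integral>\<^sup>+z1. (if near z z1 then 0 else g z1 * w (z1 - z) * u z)))"
    by (intro nn_integral_cong, subst nn_integral_add[symmetric]) (auto intro!: nn_integral_cong)
  also have "\<dots> = T1 + T2"
    unfolding T1_def T2_def by (rule nn_integral_add) measurable
  finally have split: "(\<integral>\<^sup>+z. \<integral>\<^sup>+z1. g z1 * w (z1 - z) * u z) = T1 + T2" .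
  have T1: "T1^2 \<le> (ennreal J * ennreal (5000/13 * 48)) * ?N G * ?N W * ?N u"
    unfolding T1_def
  proof (rule trilinear_sup_kernel[where K = K1])
    show "case_prod K1 \<in> borel_measurable borel" unfolding K1_def case_prod_beta' by measurable
    show "(\<integral>\<^sup>+z1. K1 z z1) \<le> ennreal J * ennreal (5000/13 * 48)" for z
      unfolding K1_def by (subst nn_integral_cmult, measurable) (rule mult_left_mono[OF near_kernel_bound], simp)
    show "(if near z z1 then g z1 * w (z1 - z) * u z else 0)^2 \<le> (G z1)^2 * (W (z1 - z))^2 * (u z)^2 * K1 z z1" for z z1
    proof (cases "near z z1")
      case True
      have "1 \<le> ennreal (freq_weight a B j z1) * ennreal (mod_weight a B k (z1 - z)) * K1 z z1"
        using near_weight_bound[OF j, of a B z1 k "z1 - z"] True J freq_weight_ge_1[of a B j z1] mod_weight_ge_1[of a B k "z1 - z"]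
        by (simp add: K1_def near_def indicator_def J_def ennreal_1[symmetric] del: ennreal_1 flip: ennreal_mult'')
      from le_weighted_square[OF this] True show ?thesis unfolding G_def W_def by simp
    qed simp
  qed measurable
  have T2: "T2^2 \<le> (ennreal J * ennreal (5000/83 * 10)) * ?N G * ?N W * ?N u"
    unfolding T2_def
  proof (rule trilinear_fiber_kernel[where K = K2 and m = "\<lambda>x. ennreal J * (ennreal (5000/83) * ennreal (bracket x powr - (6/5)))"])
    show "case_prod K2 \<in> borel_measurable borel" unfolding K2_def case_prod_beta' by measurable
    show "(\<lambda>(z, z1). if near z z1 then 0 else g z1 * w (z1 - z) * u z) \<in> borel_measurable borel"
      unfolding case_prod_beta' by measurable
    show "(\<integral>\<^sup>+t1. K2 (x, t) (x1, t1)) \<le> ennreal J * (ennreal (5000/83) * ennreal (bracket x powr - (6/5)))" for x t x1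
      unfolding K2_def fst_conv snd_conv
      by (subst nn_integral_cmult, measurable) (rule mult_left_mono[OF far_kernel_bound], simp)
    have "(\<integral>\<^sup>+x. ennreal J * (ennreal (5000/83) * ennreal (bracket x powr - (6/5))))
       = ennreal J * (ennreal (5000/83) * (\<integral>\<^sup>+x. ennreal (bracket x powr - (6/5))))"
      by (simp add: nn_integral_cmult)
    also have "\<dots> \<le> ennreal J * (ennreal (5000/83) * ennreal 10)"
      using nn_integral_bracket_powr[of "6/5"] by (intro mult_left_mono) auto
    also have "ennreal (5000/83) * ennreal 10 = ennreal (5000/83 * 10)"
      by (rule ennreal_mult[symmetric]) auto
    finally show "(\<integral>\<^sup>+x. ennreal J * (ennreal (5000/83) * ennreal (bracket x powr - (6/5)))) \<le> ennreal J * ennreal (5000/83 * 10)" .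
    show "(if near z z1 then 0 else g z1 * w (z1 - z) * u z)^2 \<le> (G z1)^2 * (W (z1 - z))^2 * (u z)^2 * K2 z z1" for z z1
    proof (cases "near z z1")
      case False
      have "1 \<le> ennreal (freq_weight a B j z1) * ennreal (mod_weight a B k (z1 - z)) * K2 z z1"
        using far_weight_bound[OF j, of "fst z" z1 a B k "z1 - z"] False J freq_weight_ge_1[of a B j z1] mod_weight_ge_1[of a B k "z1 - z"]
        by (simp add: K2_def near_def J_def ennreal_1[symmetric] del: ennreal_1 flip: ennreal_mult'')
      from le_weighted_square[OF this] False show ?thesis unfolding G_def W_def by simp
    qed simp
  qed measurable
  have "(T1 + T2)^2 \<le> 2 * T1^2 + 2 * T2^2"
  proof -
    have "2 * T1 * T2 \<le> T1^2 + T2^2" by (rule sum_of_squares_ge_ennreal)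
    then have "T1^2 + T2^2 + 2 * T1 * T2 \<le> T1^2 + T2^2 + (T1^2 + T2^2)"
      by (rule add_left_mono)
    then show ?thesis by (simp add: power2_sum mult_2 add_ac)
  qed
  also have "\<dots> \<le> 2 * ((ennreal J * ennreal (5000/13 * 48)) * ?N G * ?N W * ?N u) + 2 * ((ennreal J * ennreal (5000/83 * 10)) * ?N G * ?N W * ?N u)"
    by (intro add_mono mult_left_mono T1 T2) auto
  also have "\<dots> = (2 * ennreal J * ennreal (5000/13 * 48) + 2 * ennreal J * ennreal (5000/83 * 10)) * ?N G * ?N W * ?N u"
    by (simp add: distrib_right mult.assoc)
  also have "2 * ennreal J * ennreal (5000/13 * 48) + 2 * ennreal J * ennreal (5000/83 * 10) = ennreal (trilinear_const * J)"
  proof -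
    have e: "2 * ennreal J * ennreal c = ennreal (2 * J * c)" if "0 \<le> c" for c
      using that J by (simp add: ennreal_mult)
    have "ennreal (2 * J * (5000/13 * 48)) + ennreal (2 * J * (5000/83 * 10)) = ennreal (2 * J * (5000/13 * 48) + 2 * J * (5000/83 * 10))"
      using J by (intro ennreal_plus[symmetric]) auto
    then show ?thesis by (subst (1 2) e) (auto simp: trilinear_const_def algebra_simps)
  qed
  finally show ?thesis
    unfolding split by (simp add: G_def W_def power_mult_distrib esqrt_power2 J_def)
qed

section \<open>Bump functions and uniqueness of representing functions\<close>

text \<open>The powers of \<open>1 / s\<close> are carried along because the derivative of
  \<open>expinv m\<close> is a combination of \<open>expinv (m + 2)\<close> and
  \<open>expinv (m + 1)\<close>: the family is closed under differentiation up to linear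
  combinations, which replaces any analysis of higher derivatives at 0.\<close>

definition expinv :: "nat \<Rightarrow> real \<Rightarrow> real" where
  "expinv m s = (if s > 0 then (1 / s) ^ m * exp (- (1 / s)) else 0)"

lemma expinv_deriv: "(expinv m has_real_derivative (expinv (m + 2) s - real m * expinv (m + 1) s)) (at s)"
proof -
  consider "s > 0" | "s < 0" | "s = 0" by linarith
  then show ?thesis
  proof cases
    case 1
    have "((\<lambda>s. (1 / s) ^ m * exp (- (1 / s))) has_real_derivative (expinv (m + 2) s - real m * expinv (m + 1) s)) (at s)"
    proof -
      define t where "t = 1 / s"
      have t: "((\<lambda>s. 1 / s) has_real_derivative - (t ^ 2)) (at s)"
        using 1 by (auto intro!: derivative_eq_intros simp: t_def power2_eq_square field_simps)
      have "((\<lambda>s. (1 / s) ^ m) has_real_derivative real m * (- (t ^ 2)) * t ^ (m - 1)) (at s)"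
        using DERIV_power[OF t, of m] by (simp add: t_def mult_ac)
      moreover have "((\<lambda>s. exp (- (1 / s))) has_real_derivative exp (- t) * t ^ 2) (at s)"
        using DERIV_chain[OF DERIV_exp[of "- (1 / s)"] DERIV_minus[OF t]] by (simp add: o_def t_def)
      ultimately have "((\<lambda>s. (1 / s) ^ m * exp (- (1 / s))) has_real_derivative
          real m * (- (t ^ 2)) * t ^ (m - 1) * exp (- t) + exp (- t) * t ^ 2 * t ^ m) (at s)"
        using DERIV_mult by (fastforce simp: t_def)
      also have "real m * (- (t ^ 2)) * t ^ (m - 1) * exp (- t) + exp (- t) * t ^ 2 * t ^ m = expinv (m + 2) s - real m * expinv (m + 1) s"
        using 1 by (cases m) (auto simp: expinv_def t_def[symmetric] power2_eq_square algebra_simps)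
      finally show ?thesis .
    qed
    then show ?thesis
      by (rule has_field_derivative_transform_within_open[where S = "{0<..}"]) (use 1 in \<open>auto simp: expinv_def\<close>)
  next
    case 2
    have "((\<lambda>_. 0) has_real_derivative 0) (at s)" by simp
    then have "(expinv m has_real_derivative 0) (at s)"
      by (rule has_field_derivative_transform_within_open[where S = "{..<0}"]) (use 2 in \<open>auto simp: expinv_def\<close>)
    with 2 show ?thesis by (simp add: expinv_def)
  next
    case 3
    have "((\<lambda>h. (expinv m h - expinv m 0) / (h - 0)) \<longlongrightarrow> 0) (at 0)"
    proof (rule filterlim_split_at)
      have "eventually (\<lambda>h. (expinv m h - expinv m 0) / (h - 0) = 0) (at_left (0::real))"
        by (auto simp: eventually_at_filter expinv_def intro!: always_eventually)
      then show "((\<lambda>h. (expinv m h - expinv m 0) / (h - 0)) \<longlongrightarrow> 0) (at_left 0)"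
        by (rule tendsto_eventually)
      \<comment> \<open>Substituting the reciprocal turns the right difference quotient into a power
        over an exponential at infinity.\<close>
      have "((\<lambda>h::real. (inverse h) ^ (m + 1) / exp (inverse h)) \<longlongrightarrow> 0) (at_right 0)"
        by (rule filterlim_compose[OF tendsto_power_div_exp_0 filterlim_inverse_at_top_right])
      moreover have "eventually (\<lambda>h. (inverse h) ^ (m + 1) / exp (inverse h) = (expinv m h - expinv m 0) / (h - 0)) (at_right (0::real))"
        by (auto simp: eventually_at_filter expinv_def exp_minus field_simps intro!: always_eventually)
      ultimately show "((\<lambda>h. (expinv m h - expinv m 0) / (h - 0)) \<longlongrightarrow> 0) (at_right 0)"
        by (rule Lim_transform_eventually)
    qed
    then have "(expinv m has_real_derivative 0) (at 0)" by (simp add: has_field_derivative_iff)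
    with 3 show ?thesis by (simp add: expinv_def)
  qed
qed

text \<open>Smoothness is encoded by generation: the class contains constants and
  \<open>expinv\<close> after affine substitutions, it is an algebra, and it contains the derivative
  of each member. Infinite differentiability thus becomes a closure property.\<close>

inductive smooth_real :: "(real \<Rightarrow> real) \<Rightarrow> bool" where
  base: "smooth_real (\<lambda>x. expinv m (c * x + d))"
| const: "smooth_real (\<lambda>x. c)"
| add: "smooth_real f \<Longrightarrow> smooth_real g \<Longrightarrow> smooth_real (\<lambda>x. f x + g x)"
| mult: "smooth_real f \<Longrightarrow> smooth_real g \<Longrightarrow> smooth_real (\<lambda>x. f x * g x)"

lemma smooth_real_deriv:
  "smooth_real f \<Longrightarrow> \<exists>f'. smooth_real f' \<and> (\<forall>x. (f has_real_derivative f' x) (at x))"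
proof (induction rule: smooth_real.induct)
  case (base m c d)
  let ?f' = "\<lambda>x. (expinv (m + 2) (c * x + d) + (- real m) * expinv (m + 1) (c * x + d)) * c"
  have "((\<lambda>x. expinv m (c * x + d)) has_real_derivative ?f' x) (at x)" for x
  proof -
    have "((\<lambda>x. c * x + d) has_real_derivative c) (at x)" by (auto intro!: derivative_eq_intros)
    from DERIV_chain[OF expinv_deriv this, of m] show ?thesis by (simp add: o_def)
  qed
  moreover have "smooth_real ?f'" by (intro smooth_real.intros)
  ultimately show ?case by blast
next
  case (const c)
  show ?case by (intro exI[of _ "\<lambda>_. 0"]) (auto intro: smooth_real.intros)
next
  case (add f g)
  then obtain f' g' where "smooth_real f'" "smooth_real g'" "\<And>x. (f has_real_derivative f' x) (at x)" "\<And>x. (g has_real_derivative g' x) (at x)"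
    by blast
  then show ?case by (intro exI[of _ "\<lambda>x. f' x + g' x"]) (auto intro!: smooth_real.intros derivative_intros)
next
  case (mult f g)
  then obtain f' g' where d: "smooth_real f'" "smooth_real g'" "\<And>x. (f has_real_derivative f' x) (at x)" "\<And>x. (g has_real_derivative g' x) (at x)"
    by blast
  have "((\<lambda>x. f x * g x) has_real_derivative (f' x * g x + f x * g' x)) (at x)" for x
    using DERIV_mult[OF d(3,4)[of x]] by (simp add: mult.commute add.commute)
  then show ?case using mult.hyps d by (intro exI[of _ "\<lambda>x. f' x * g x + f x * g' x"]) (auto intro!: smooth_real.intros)
qed

lemma has_derivative_imp_dir_deriv:
  assumes "(f has_derivative f') (at p)"
  shows "dir_deriv d f p = f' d"
proof -
  have "((\<lambda>s. f (p + s *\<^sub>R d)) has_derivative (\<lambda>s. f' (s *\<^sub>R d))) (at 0)"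
  proof -
    have "((\<lambda>s. p + s *\<^sub>R d) has_derivative (\<lambda>s. s *\<^sub>R d)) (at 0)"
      by (auto intro!: derivative_eq_intros)
    from has_derivative_compose[OF this] assms show ?thesis by simp
  qed
  moreover have "f' (s *\<^sub>R d) = s *\<^sub>R f' d" for s
    using assms by (intro linear_scale has_derivative_linear)
  ultimately have "((\<lambda>s. f (p + s *\<^sub>R d)) has_vector_derivative f' d) (at 0)"
    by (simp add: has_vector_derivative_def)
  then show ?thesis unfolding dir_deriv_def by (rule vector_derivative_at)
qed

lemma dir_deriv_eq_0_outside:
  fixes f :: "'a::real_normed_vector \<Rightarrow> complex"
  assumes "closed K" "\<And>q. q \<notin> K \<Longrightarrow> f q = 0" "p \<notin> K"
  shows "dir_deriv d f p = 0"
proof -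
  have "((\<lambda>_. 0::complex) has_derivative (\<lambda>_. 0)) (at p)" by simp
  then have "(f has_derivative (\<lambda>_. 0)) (at p)"
    by (rule has_derivative_transform_within_open[OF _ open_Compl[OF assms(1)]]) (use assms in auto)
  then show ?thesis by (simp add: has_derivative_imp_dir_deriv)
qed

text \<open>Tensor products are enough to approximate indicators of boxes, and a coordinate
  derivative of one only differentiates a single factor, so the class is stable under iterated
  partial derivatives.\<close>

definition smooth_prod :: "(real \<times> real \<Rightarrow> complex) set" where
  "smooth_prod = {\<lambda>p. of_real (f (fst p) * g (snd p)) | f g. smooth_real f \<and> smooth_real g}"

lemma smooth_prod_deriv:
  assumes "smooth_real f" "smooth_real g"
  obtains f' g' where "smooth_real f'" "smooth_real g'"
    "\<And>x. (f has_real_derivative f' x) (at x)" "\<And>x. (g has_real_derivative g' x) (at x)"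
    "\<And>p. ((\<lambda>p. complex_of_real (f (fst p) * g (snd p))) has_derivative
        (\<lambda>v. of_real (f' (fst p) * g (snd p) * fst v + f (fst p) * g' (snd p) * snd v))) (at p)"
proof -
  obtain f' g' where d: "smooth_real f'" "smooth_real g'" "\<And>x. (f has_real_derivative f' x) (at x)" "\<And>x. (g has_real_derivative g' x) (at x)"
    using assms smooth_real_deriv by metis
  have "((\<lambda>p. complex_of_real (f (fst p) * g (snd p))) has_derivative
        (\<lambda>v. of_real (f' (fst p) * g (snd p) * fst v + f (fst p) * g' (snd p) * snd v))) (at p)" for p
  proof -
    have 1: "((\<lambda>p. f (fst p)) has_derivative (\<lambda>v. f' (fst p) * fst v)) (at p)"
      using DERIV_compose_FDERIV[OF d(3) has_derivative_fst[OF has_derivative_ident]] by (simp add: mult.commute)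
    have 2: "((\<lambda>p. g (snd p)) has_derivative (\<lambda>v. g' (snd p) * snd v)) (at p)"
      using DERIV_compose_FDERIV[OF d(4) has_derivative_snd[OF has_derivative_ident]] by (simp add: mult.commute)
    have "((\<lambda>p. f (fst p) * g (snd p)) has_derivative (\<lambda>v. f' (fst p) * g (snd p) * fst v + f (fst p) * g' (snd p) * snd v)) (at p)"
      using has_derivative_mult[OF 1 2] by (simp add: algebra_simps)
    then show ?thesis by (rule has_derivative_of_real)
  qed
  with d that show ?thesis by blast
qed

lemma smooth_prod_closed:
  assumes "h \<in> smooth_prod"
  shows "h differentiable (at p)" "d \<in> Basis \<Longrightarrow> dir_deriv d h \<in> smooth_prod"
proof -
  obtain f g where h: "h = (\<lambda>p. of_real (f (fst p) * g (snd p)))" "smooth_real f" "smooth_real g"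
    using assms by (auto simp: smooth_prod_def)
  obtain f' g' where d': "smooth_real f'" "smooth_real g'"
    "\<And>x. (f has_real_derivative f' x) (at x)" "\<And>x. (g has_real_derivative g' x) (at x)"
    "\<And>p. ((\<lambda>p. complex_of_real (f (fst p) * g (snd p))) has_derivative
        (\<lambda>v. of_real (f' (fst p) * g (snd p) * fst v + f (fst p) * g' (snd p) * snd v))) (at p)"
    by (rule smooth_prod_deriv[OF h(2,3)]) (rule that)
  note d = d'(1,2) d'(5)[folded h(1)]
  show "h differentiable (at p)" using d(3) unfolding differentiable_def by blast
  assume "d \<in> Basis"
  then consider "d = (1, 0)" | "d = (0, 1)" by (auto simp: Basis_prod_def)
  then show "dir_deriv d h \<in> smooth_prod"
  proof cases
    case 1
    have "dir_deriv d h = (\<lambda>p. of_real (f' (fst p) * g (snd p)))"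
      by (rule ext) (simp add: has_derivative_imp_dir_deriv[OF d(3)] 1)
    then show ?thesis using d h by (auto simp: smooth_prod_def)
  next
    case 2
    have "dir_deriv d h = (\<lambda>p. of_real (f (fst p) * g' (snd p)))"
      by (rule ext) (simp add: has_derivative_imp_dir_deriv[OF d(3)] 2)
    then show ?thesis using d h by (auto simp: smooth_prod_def)
  qed
qed

lemma smooth_prod_smooth_fun:
  assumes "h \<in> smooth_prod" shows "smooth_fun h"
proof -
  have "iter_partial ds h \<in> smooth_prod" if "ds \<in> lists Basis" for ds
    using that by (induction ds) (auto simp: iter_partial_def assms intro: smooth_prod_closed)
  then show ?thesis unfolding smooth_fun_def by (blast intro: smooth_prod_closed)
qed

text \<open>All iterated derivatives vanish off the compact support, and on it continuity bounds
  them together with any polynomial weight.\<close>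

lemma test_fun_schwartz:
  assumes "test_fun S f" shows "schwartz f"
proof -
  obtain K where K: "compact K" "\<And>p. p \<notin> K \<Longrightarrow> f p = 0" and sm: "smooth_fun f"
    using assms by (auto simp: test_fun_def)
  have z: "iter_partial ds f p = 0" if "p \<notin> K" for ds p
    using that
  proof (induction ds arbitrary: p)
    case (Cons d ds)
    then show ?case
      unfolding iter_partial_def by (simp add: dir_deriv_eq_0_outside[OF compact_imp_closed[OF K(1)]])
  qed (simp add: iter_partial_def K)
  have "bounded (range (\<lambda>p. (1 + norm p) ^ N * norm (iter_partial ds f p)))" if "ds \<in> lists Basis" for ds N
  proof -
    have "continuous_on UNIV (iter_partial ds f)"
      using sm that by (intro differentiable_imp_continuous_on)
         (auto simp: smooth_fun_def differentiable_on_def)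
    then have "continuous_on K (\<lambda>p. (1 + norm p) ^ N * norm (iter_partial ds f p))"
      by (intro continuous_intros) (auto intro: continuous_on_subset)
    then have "bounded ((\<lambda>p. (1 + norm p) ^ N * norm (iter_partial ds f p)) ` K)"
      by (intro compact_imp_bounded compact_continuous_image K)
    then have "bounded (insert 0 ((\<lambda>p. (1 + norm p) ^ N * norm (iter_partial ds f p)) ` K))" by simp
    then show ?thesis
    proof (rule bounded_subset, intro image_subsetI)
      fix p
      show "(1 + norm p) ^ N * norm (iter_partial ds f p) \<in> insert 0 ((\<lambda>p. (1 + norm p) ^ N * norm (iter_partial ds f p)) ` K)"
        by (cases "p \<in> K") (auto simp: z)
    qed
  qed
  with sm show ?thesis by (simp add: schwartz_def)
qed

text \<open>The parameter \<open>n\<close> stretches the distance to the end points inside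
  \<open>expinv 0\<close>: for every \<open>n\<close> the function vanishes outside the interval
  from \<open>a\<close> to \<open>b\<close>, while both factors tend to 1 inside. So the indicator
  of the open interval is a bounded pointwise limit of smooth functions with a common
  support.\<close>

definition bump1 :: "real \<Rightarrow> real \<Rightarrow> nat \<Rightarrow> real \<Rightarrow> real" where
  "bump1 a b n x = expinv 0 (real (Suc n) * x + (- real (Suc n) * a)) * expinv 0 ((- real (Suc n)) * x + real (Suc n) * b)"

definition bump :: "real \<times> real \<Rightarrow> real \<times> real \<Rightarrow> nat \<Rightarrow> real \<times> real \<Rightarrow> complex" where
  "bump a b n p = of_real (bump1 (fst a) (fst b) n (fst p) * bump1 (snd a) (snd b) n (snd p))"

lemma smooth_bump1: "smooth_real (bump1 a b n)"
  unfolding bump1_def[abs_def] by (intro smooth_real.intros)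

lemma bump_smooth_prod: "bump a b n \<in> smooth_prod"
  unfolding bump_def[abs_def] smooth_prod_def using smooth_bump1 by blast

lemma expinv_0_bounds: "0 \<le> expinv 0 s" "expinv 0 s \<le> 1" "s \<le> 0 \<Longrightarrow> expinv 0 s = 0"
  by (auto simp: expinv_def)

lemma bump1_bounds: "0 \<le> bump1 a b n x" "bump1 a b n x \<le> indicator {a<..<b} x"
proof -
  show "0 \<le> bump1 a b n x" by (simp add: bump1_def expinv_0_bounds)
  show "bump1 a b n x \<le> indicator {a<..<b} x"
  proof (cases "x \<in> {a<..<b}")
    case True
    then show ?thesis unfolding bump1_def by (simp add: mult_le_one expinv_0_bounds)
  next
    case False
    then have "real (Suc n) * (x - a) \<le> 0 \<or> real (Suc n) * (b - x) \<le> 0"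
      by (auto simp: not_less mult_le_0_iff)
    then have "real (Suc n) * x + (- real (Suc n) * a) \<le> 0 \<or> (- real (Suc n)) * x + real (Suc n) * b \<le> 0"
      by (simp add: algebra_simps)
    then show ?thesis using False unfolding bump1_def by (auto simp: expinv_0_bounds)
  qed
qed

lemma bump1_tendsto: "(\<lambda>n. bump1 a b n x) \<longlonglongrightarrow> indicator {a<..<b} x"
proof (cases "x \<in> {a<..<b}")
  case True
  have e: "(\<lambda>n. expinv 0 (real (Suc n) * c)) \<longlonglongrightarrow> 1" if "c > 0" for c
  proof -
    have "(\<lambda>n. exp (- ((1 / c) * (1 / real (Suc n))))) \<longlonglongrightarrow> exp (- ((1 / c) * 0))"
      by (intro tendsto_intros lim_1_over_n[THEN LIMSEQ_Suc])
    then show ?thesis using that by (simp add: expinv_def mult.commute)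
  qed
  have "(\<lambda>n. expinv 0 (real (Suc n) * (x - a)) * expinv 0 (real (Suc n) * (b - x))) \<longlonglongrightarrow> 1 * 1"
    by (intro tendsto_mult e) (use True in auto)
  then show ?thesis using True by (simp add: bump1_def algebra_simps)
next
  case False
  then have "bump1 a b n x = 0" for n using bump1_bounds[of a b n x] by simp
  with False show ?thesis by simp
qed

lemma box_prod_real: "p \<in> box a b \<longleftrightarrow> fst p \<in> {fst a<..<fst b} \<and> snd p \<in> {snd a<..<snd b}" for p :: "real \<times> real"
  by (cases p; cases a; cases b) (auto simp: box_def Basis_prod_def)

lemma indicator_box_prod: "indicator (box a b) p = (indicator {fst a<..<fst b} (fst p) * indicator {snd a<..<snd b} (snd p) :: real)" for p :: "real \<times> real"
  by (auto simp: indicator_def box_prod_real)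

lemma norm_bump_le: "norm (bump a b n p) \<le> indicator (box a b) p"
  unfolding bump_def norm_of_real indicator_box_prod abs_mult
  using bump1_bounds by (intro mult_mono) auto

lemma norm_bump_le_1: "norm (bump a b n p) \<le> 1"
  using norm_bump_le[of a b n p] by (rule order_trans) (simp add: indicator_def)

lemma bump_tendsto: "(\<lambda>n. bump a b n p) \<longlonglongrightarrow> of_real (indicator (box a b) p)"
  unfolding bump_def indicator_box_prod by (intro tendsto_of_real tendsto_mult bump1_tendsto)

lemma bump_test_fun:
  assumes "cbox a b \<subseteq> S" shows "test_fun S (bump a b n)"
proof -
  have "bump a b n p = 0" if "p \<notin> cbox a b" for p
  proof -
    have "p \<notin> box a b" using that box_subset_cbox by blast
    then show ?thesis using norm_bump_le[of a b n p] by simp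
  qed
  then show ?thesis
    unfolding test_fun_def using assms smooth_prod_smooth_fun[OF bump_smooth_prod]
    by (intro conjI exI[of _ "cbox a b"]) auto
qed

lemma bump_schwartz: "schwartz (bump a b n)"
  by (rule test_fun_schwartz[OF bump_test_fun[of a b UNIV]]) simp

lemma continuous_smooth_prod: "h \<in> smooth_prod \<Longrightarrow> continuous_on UNIV h"
  by (intro differentiable_imp_continuous_on) (auto simp: differentiable_on_def smooth_prod_closed)

lemma measurable_bump [measurable]: "bump a b n \<in> borel_measurable borel"
  by (intro borel_measurable_continuous_onI continuous_smooth_prod bump_smooth_prod)

lemma Int_box: "box a b \<inter> box c d = box (max (fst a) (fst c), max (snd a) (snd c)) (min (fst b) (fst d), min (snd b) (snd d))"
  for a b c d :: "real \<times> real"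
  by (auto simp: box_prod_real)

lemma cbox_prod_real: "p \<in> cbox a b \<longleftrightarrow> fst p \<in> {fst a..fst b} \<and> snd p \<in> {snd a..snd b}" for p :: "real \<times> real"
  by (cases p; cases a; cases b) (auto simp: cbox_def Basis_prod_def)

text \<open>Boxes are stable under intersection and generate the Borel sets, so Dynkin's theorem
  reduces a property of Borel sets to boxes, complements and disjoint unions.\<close>

lemma box_induct [consumes 1, case_names box empty compl union]:
  fixes A :: "(real \<times> real) set"
  assumes "A \<in> sets borel"
    and "\<And>a b. P (box a b)" "P {}" "\<And>A. A \<in> sets borel \<Longrightarrow> P A \<Longrightarrow> P (- A)"
    and "\<And>A::nat \<Rightarrow> _. disjoint_family A \<Longrightarrow> range A \<subseteq> sets borel \<Longrightarrow> (\<And>i. P (A i)) \<Longrightarrow> P (\<Union>i. A i)"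
  shows "P A"
proof -
  let ?G = "range (\<lambda>(a, b). box a b) :: (real \<times> real) set set"
  have s: "sets (borel :: (real \<times> real) measure) = sigma_sets UNIV ?G" by (subst borel_eq_box) simp
  have "A \<in> sigma_sets UNIV ?G" using assms(1) by (simp add: s)
  have "Int_stable ?G"
    by (auto simp: Int_stable_def Int_box)
  moreover have "?G \<subseteq> Pow UNIV" by simp
  moreover note \<open>A \<in> sigma_sets UNIV ?G\<close>
  ultimately show ?thesis
  proof (induction rule: sigma_sets_induct_disjoint)
    case (compl A)
    then show ?case using assms(4)[of A] by (simp add: s Compl_eq_Diff_UNIV)
  next
    case (union A)
    then show ?case using assms(5)[of A] by (simp add: s)
  qed (use assms in auto)
qed

text \<open>Bumps converge boundedly to the indicator of a box, so \<open>g\<close> cut off to the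
  given box has integral 0 over every box, hence over every Borel set. Staying inside one box keeps
  \<open>g\<close> integrable and, when the closed box lies in an open set, uses only test functions
  supported there.\<close>

lemma bump_orthogonal_imp_zero:
  fixes g :: "real \<times> real \<Rightarrow> complex"
  assumes int: "integrable lborel (\<lambda>p. indicator (box a b) p *\<^sub>R g p)"
    and orth: "\<And>c d n. cbox c d \<subseteq> cbox a b \<Longrightarrow> (LBINT p. g p * bump c d n p) = 0"
  shows "AE p in lborel. p \<in> box a b \<longrightarrow> g p = 0"
proof -
  define G where "G p = indicator (box a b) p *\<^sub>R g p" for p
  have G: "integrable lborel G" using int by (simp add: G_def[abs_def])
  then have [measurable]: "G \<in> borel_measurable borel" by auto
  have boxz: "(LBINT p. indicator (box c d) p *\<^sub>R G p) = 0" for c d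
  proof -
    define c' d' where "c' = (max (fst c) (fst a), max (snd c) (snd a))" and "d' = (min (fst d) (fst b), min (snd d) (snd b))"
    have I: "box c d \<inter> box a b = box c' d'" by (simp add: Int_box c'_def d'_def)
    have "(\<lambda>n. LBINT p. G p * bump c' d' n p) \<longlonglongrightarrow> (LBINT p. G p * of_real (indicator (box c' d') p))"
    proof (rule integral_dominated_convergence[where w = "\<lambda>p. norm (G p)"])
      show "AE p in lborel. (\<lambda>n. G p * bump c' d' n p) \<longlonglongrightarrow> G p * of_real (indicator (box c' d') p)"
        by (intro always_eventually allI tendsto_mult tendsto_const bump_tendsto)
      show "AE p in lborel. norm (G p * bump c' d' n p) \<le> norm (G p)" for n
        by (simp add: norm_mult mult_left_le norm_bump_le_1)
    qed (use G in auto)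
    moreover have "(LBINT p. G p * bump c' d' n p) = 0" for n
    proof (cases "box c' d' = {}")
      case True
      then have "bump c' d' n p = 0" for p using norm_bump_le[of c' d' n p] by simp
      then show ?thesis by simp
    next
      case False
      then have "cbox c' d' \<subseteq> cbox a b"
        unfolding c'_def d'_def by (auto simp: cbox_prod_real)
      from orth[OF this, of n] have "(LBINT p. g p * bump c' d' n p) = 0" .
      moreover have "G p * bump c' d' n p = g p * bump c' d' n p" for p
      proof (cases "p \<in> box a b")
        case False
        then have "p \<notin> box c' d'" unfolding I[symmetric] by blast
        then show ?thesis using norm_bump_le[of c' d' n p] by simp
      qed (simp add: G_def)
      then have "(\<lambda>p. G p * bump c' d' n p) = (\<lambda>p. g p * bump c' d' n p)" by (rule ext)
      ultimately show ?thesis by (simp only:)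
    qed
    ultimately have "(LBINT p. G p * of_real (indicator (box c' d') p)) = 0"
      by (simp add: LIMSEQ_const_iff)
    moreover have "G p * of_real (indicator (box c' d') p) = indicator (box c d) p *\<^sub>R G p" for p
      unfolding I[symmetric] by (auto simp: G_def indicator_def)
    ultimately show ?thesis by simp
  qed
  have sub: "(LBINT p. indicator A p *\<^sub>R G p) = 0" if "A \<in> sets borel" for A
    using that
  proof (induction rule: box_induct)
    case (box c d)
    show ?case by (rule boxz)
  next
    case empty
    then show ?case by simp
  next
    case (compl A)
    have "(LBINT p. G p) = (LBINT p. indicator (box a b) p *\<^sub>R G p)"
      by (intro Bochner_Integration.integral_cong) (auto simp: G_def indicator_def)
    then have UN: "(LBINT p. G p) = 0" by (simp only: boxz)
    have "(LBINT p. indicator (- A) p *\<^sub>R G p) = (LBINT p. G p - indicator A p *\<^sub>R G p)"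
      by (intro Bochner_Integration.integral_cong) (auto simp: indicator_def)
    also have "\<dots> = 0"
      using UN compl G by (subst Bochner_Integration.integral_diff) (auto intro!: integrable_mult_indicator)
    finally show ?case .
  next
    case (union A)
    have "(\<lambda>n. LBINT p. (\<Sum>i<n. indicator (A i) p) *\<^sub>R G p) \<longlonglongrightarrow> (LBINT p. indicator (\<Union>i. A i) p *\<^sub>R G p)"
    proof (rule integral_dominated_convergence[where w = "\<lambda>p. norm (G p)"])
      have [measurable]: "A i \<in> sets borel" for i using union by auto
      show "(\<lambda>p. (\<Sum>i<n. indicator (A i) p) *\<^sub>R G p) \<in> borel_measurable lborel" for n by measurable
      show "(\<lambda>p. indicator (\<Union>i. A i) p *\<^sub>R G p) \<in> borel_measurable lborel" by measurable
      have s: "(\<Sum>i<n. indicator (A i) p) = (indicator (\<Union>i<n. A i) p :: real)" for n p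
        using union(1) by (intro indicator_UN_disjoint[symmetric]) (auto simp: disjoint_family_on_def)
      show "AE p in lborel. norm ((\<Sum>i<n. indicator (A i) p) *\<^sub>R G p) \<le> norm (G p)" for n
        unfolding s by (auto simp: indicator_def)
      show "AE p in lborel. (\<lambda>n. (\<Sum>i<n. indicator (A i) p) *\<^sub>R G p) \<longlonglongrightarrow> indicator (\<Union>i. A i) p *\<^sub>R G p"
        unfolding s by (intro always_eventually allI tendsto_scaleR tendsto_const LIMSEQ_indicator_UN)
    qed (use G in auto)
    moreover have "(LBINT p. (\<Sum>i<n. indicator (A i) p) *\<^sub>R G p) = 0" for n
    proof -
      have "integrable lborel (\<lambda>p. indicator (A i) p *\<^sub>R G p)" for i
        using G union by (intro integrable_mult_indicator) auto
      then show ?thesis unfolding scaleR_sum_left by (subst Bochner_Integration.integral_sum) (auto simp: union(3))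
    qed
    ultimately show ?case by (simp add: LIMSEQ_const_iff)
  qed
  have "AE p in lborel. G p = 0"
    by (rule sigma_finite_measure.density_zero[OF lborel.sigma_finite_measure_axioms G]) (use sub in \<open>simp add: set_lebesgue_integral_def\<close>)
  then show ?thesis by eventually_elim (auto simp: G_def)
qed

text \<open>The two functions are only known to be integrable against Schwartz functions. Local
  integrability of the difference is extracted from a bump that is bounded below on a smaller box;
  orthogonality to bumps then settles each box of an exhaustion.\<close>

lemma represents_unique:
  assumes "represents g T" "represents g' T"
  shows "AE p in lborel. g p = g' p"
proof -
  define h where "h p = g p - g' p" for p
  have gm [measurable]: "g \<in> borel_measurable borel" "g' \<in> borel_measurable borel"
    using assms by (auto simp: represents_def)
  have [measurable]: "h \<in> borel_measurable borel" unfolding h_def[abs_def] by measurable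
  have i: "integrable lborel (\<lambda>p. h p * \<phi> p)" "(LBINT p. h p * \<phi> p) = 0" if "schwartz \<phi>" for \<phi>
  proof -
    have "integrable lborel (\<lambda>p. g p * \<phi> p)" "integrable lborel (\<lambda>p. g' p * \<phi> p)"
      "(LBINT p. g p * \<phi> p) = (LBINT p. g' p * \<phi> p)"
      using assms that by (auto simp: represents_def)
    then show "integrable lborel (\<lambda>p. h p * \<phi> p)" "(LBINT p. h p * \<phi> p) = 0"
      by (auto simp: h_def left_diff_distrib)
  qed
  define c :: "nat \<Rightarrow> real \<times> real" where "c n = (real n + 1, real n + 1)" for n
  have "AE p in lborel. p \<in> box (- c n) (c n) \<longrightarrow> h p = 0" for n
  proof (rule bump_orthogonal_imp_zero)
    show "(LBINT p. h p * bump a b m p) = 0" for a b m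
      by (rule i(2)[OF bump_schwartz])
    \<comment> \<open>This box exceeds the one for \<open>n\<close> by 1 on each side. On the
      smaller box each of the four factors of the bump is \<open>expinv 0\<close> at an argument
      above 1, hence at least \<open>exp (- 1)\<close>; their product is at least
      \<open>exp (- 4)\<close>.\<close>
    define b where "b = bump (- c (Suc n)) (c (Suc n)) 0"
    define \<delta> where "\<delta> = exp (- (4::real))"
    have "integrable lborel (\<lambda>p. h p * b p)" unfolding b_def by (rule i(1)[OF bump_schwartz])
    then have "integrable lborel (\<lambda>p. (1 / \<delta>) *\<^sub>R (h p * b p))" by simp
    then show "integrable lborel (\<lambda>p. indicator (box (- c n) (c n)) p *\<^sub>R h p)"
    proof (rule Bochner_Integration.integrable_bound)
      show "AE p in lborel. norm (indicator (box (- c n) (c n)) p *\<^sub>R h p) \<le> norm ((1 / \<delta>) *\<^sub>R (h p * b p))"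
      proof (intro always_eventually allI)
        fix p
        show "norm (indicator (box (- c n) (c n)) p *\<^sub>R h p) \<le> norm ((1 / \<delta>) *\<^sub>R (h p * b p))"
        proof (cases "p \<in> box (- c n) (c n)")
          case True
          have e: "exp (- 1) \<le> expinv 0 s" if "s > 1" for s
            using that by (auto simp: expinv_def)
          have e1: "exp (- 2) \<le> bump1 (- (real (Suc n) + 1)) (real (Suc n) + 1) 0 x" if "\<bar>x\<bar> < real n + 1" for x
          proof -
            have "exp (- 1) * exp (- 1) \<le> expinv 0 (x + (real (Suc n) + 1)) * expinv 0 (- x + (real (Suc n) + 1))"
              using that by (intro mult_mono e) (auto simp: expinv_0_bounds)
            then show ?thesis by (simp add: bump1_def mult_exp_exp add.commute)
          qed
          have "exp (- 2) * exp (- 2) \<le> bump1 (- (real (Suc n) + 1)) (real (Suc n) + 1) 0 (fst p) * bump1 (- (real (Suc n) + 1)) (real (Suc n) + 1) 0 (snd p)"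
            using True by (intro mult_mono e1) (auto simp: bump1_bounds c_def box_prod_real)
          also have "\<dots> = norm (b p)"
            by (simp add: b_def bump_def c_def norm_mult bump1_bounds)
          finally have "\<delta> \<le> norm (b p)" by (simp add: \<delta>_def mult_exp_exp)
          then have "norm (h p) * \<delta> \<le> norm (h p) * norm (b p)" by (intro mult_left_mono) auto
          then show ?thesis using True by (simp add: norm_mult \<delta>_def field_simps)
        qed simp
      qed
    qed measurable
  qed
  then have "AE p in lborel. \<forall>n. p \<in> box (- c n) (c n) \<longrightarrow> h p = 0" unfolding AE_all_countable by blast
  then show ?thesis
  proof eventually_elim
    case (elim p)
    obtain n where "norm p < real n" using reals_Archimedean2 by blast
    then have "\<bar>fst p\<bar> < real n" "\<bar>snd p\<bar> < real n"
      using norm_fst_le[of "fst p" "snd p"] norm_snd_le[of "snd p" "fst p"] by auto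
    then have "p \<in> box (- c n) (c n)" by (auto simp: box_prod_real c_def)
    with elim have "h p = 0" by blast
    then show ?case by (simp add: h_def)
  qed
qed

section \<open>The Fourier transform on \<open>L\<^sup>2\<close> of the plane\<close>

lemma norm_cis_mult [simp]: "norm (cis r * z) = norm z"
  by (simp add: norm_mult)

lemma measurable_cis [measurable]: "cis \<in> borel_measurable borel"
  by (intro borel_measurable_continuous_onI continuous_intros)

lemma measurable_cnj [measurable]: "cnj \<in> borel_measurable borel"
  by (intro borel_measurable_continuous_onI continuous_intros)

lemma integrable_cis_mult:
  fixes f :: "'a \<Rightarrow> complex"
  assumes "integrable M f" "h \<in> borel_measurable M"
  shows "integrable M (\<lambda>p. cis (h p) * f p)"
  by (rule Bochner_Integration.integrable_bound[OF assms(1)]) (use assms in auto)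

lemma fourier_eq: "fourier f \<zeta> = (LBINT p. cis (- (p \<bullet> \<zeta>)) * f p)"
  by (cases \<zeta>) (simp add: fourier_def case_prod_beta' inner_prod_def)

lemma norm_fourier_le: "norm (fourier f \<zeta>) \<le> (LBINT p. norm (f p))"
proof -
  have "norm (fourier f \<zeta>) \<le> (LBINT p. norm (cis (- (p \<bullet> \<zeta>)) * f p))"
    unfolding fourier_eq by (rule integral_norm_bound)
  then show ?thesis by simp
qed

lemma measurable_fourier [measurable]:
  assumes [measurable]: "f \<in> borel_measurable borel"
  shows "fourier f \<in> borel_measurable borel"
  unfolding fourier_eq[abs_def] by measurable

lemma fourier_pairing:
  assumes f: "integrable lborel f" and g: "integrable lborel g"
  shows "(LBINT \<zeta>. fourier f \<zeta> * g \<zeta>) = (LBINT p. f p * fourier g p)"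
proof -
  have [measurable]: "f \<in> borel_measurable borel" "g \<in> borel_measurable borel" using f g by auto
  have int: "integrable (lborel \<Otimes>\<^sub>M lborel) (\<lambda>(\<zeta>, p). cis (- (p \<bullet> \<zeta>)) * (f p * g \<zeta>))"
  proof (rule lborel_pair.Fubini_integrable)
    show "(\<lambda>(\<zeta>, p). cis (- (p \<bullet> \<zeta>)) * (f p * g \<zeta>)) \<in> borel_measurable (lborel \<Otimes>\<^sub>M lborel)"
      by measurable
    show "integrable lborel (\<lambda>\<zeta>. LBINT p. norm (case (\<zeta>, p) of (\<zeta>, p) \<Rightarrow> cis (- (p \<bullet> \<zeta>)) * (f p * g \<zeta>)))"
      using g f by (simp add: norm_mult)
    show "AE \<zeta> in lborel. integrable lborel (\<lambda>p. case (\<zeta>, p) of (\<zeta>, p) \<Rightarrow> cis (- (p \<bullet> \<zeta>)) * (f p * g \<zeta>))"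
      using f by (intro always_eventually allI) (auto intro!: integrable_cis_mult)
  qed
  have "(LBINT \<zeta>. fourier f \<zeta> * g \<zeta>) = (LBINT \<zeta>. LBINT p. cis (- (p \<bullet> \<zeta>)) * (f p * g \<zeta>))"
    unfolding fourier_eq by (subst integral_mult_left_zero[symmetric]) (simp add: mult.assoc)
  also have "\<dots> = (LBINT p. LBINT \<zeta>. cis (- (p \<bullet> \<zeta>)) * (f p * g \<zeta>))"
    using lborel_pair.Fubini_integral[OF int] by simp
  also have "\<dots> = (LBINT p. f p * fourier g p)"
    unfolding fourier_eq
    by (subst integral_mult_right_zero[symmetric]) (simp add: inner_commute mult_ac)
  finally show ?thesis .
qed

section \<open>Gaussian regularisation and Plancherel's inequality\<close>

definition gauss :: "real \<Rightarrow> real \<times> real \<Rightarrow> real" where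
  "gauss \<epsilon> \<zeta> = exp (- (\<epsilon> * (\<zeta> \<bullet> \<zeta>) / 2))"

lemma measurable_gauss [measurable]: "gauss \<epsilon> \<in> borel_measurable borel"
  unfolding gauss_def[abs_def] by measurable

lemma gauss_bounds: "0 < gauss \<epsilon> \<zeta>" "\<epsilon> \<ge> 0 \<Longrightarrow> gauss \<epsilon> \<zeta> \<le> 1"
  by (auto simp: gauss_def)

text \<open>The integral is the characteristic function of the standard normal distribution after
  scaling by \<open>sqrt \<epsilon>\<close>, with the sign of \<open>s\<close> turned to match the
  kernel of \<open>fourier\<close>.\<close>

lemma fourier_gauss_1d:
  assumes "\<epsilon> > 0"
  shows "integrable lborel (\<lambda>x::real. exp (- (\<epsilon> * x^2 / 2)))"
    "(LBINT x. cis (- (x * s)) * of_real (exp (- (\<epsilon> * x^2 / 2)))) =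
       of_real (sqrt (2 * pi / \<epsilon>) * exp (- (s^2 / (2 * \<epsilon>))))"
proof -
  define r where "r = sqrt \<epsilon>"
  have r: "r > 0" "r^2 = \<epsilon>" using assms by (auto simp: r_def)
  have e: "exp (- (\<epsilon> * x^2 / 2)) = sqrt (2 * pi) * std_normal_density (r * x)" for x
    by (simp add: std_normal_density_def power_mult_distrib r)
  have "integrable lborel std_normal_density" by simp
  then have "integrable lborel (\<lambda>x. std_normal_density (0 + r * x))"
    by (rule lborel_integrable_real_affine) (use r in auto)
  then show "integrable lborel (\<lambda>x::real. exp (- (\<epsilon> * x^2 / 2)))" unfolding e by simp
  have "char std_normal_distribution (- s / r) = of_real (exp (- ((- s / r)^2) / 2))"
    by (simp add: char_std_normal_distribution)
  also have "char std_normal_distribution (- s / r) = (LBINT x. std_normal_density x *\<^sub>R iexp ((- s / r) * x))"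
    unfolding char_def by (subst integral_density) (auto simp: normal_density_nonneg)
  also have "\<dots> = (LBINT x. cis (- (x * s / r)) * of_real (std_normal_density x))"
    by (intro Bochner_Integration.integral_cong) (auto simp: scaleR_conv_of_real cis_conv_exp mult_ac)
  also have "\<dots> = \<bar>r\<bar> *\<^sub>R (LBINT x. cis (- ((0 + r * x) * s / r)) * of_real (std_normal_density (0 + r * x)))"
    by (rule lborel_integral_real_affine) (use r in auto)
  also have "\<dots> = r *\<^sub>R (LBINT x. cis (- (x * s)) * of_real (std_normal_density (r * x)))"
    using r by simp
  finally have *: "r *\<^sub>R (LBINT x. cis (- (x * s)) * of_real (std_normal_density (r * x))) = of_real (exp (- (s^2 / (2 * \<epsilon>))))"
    by (simp add: power_divide r mult.commute)
  have "(LBINT x. cis (- (x * s)) * of_real (exp (- (\<epsilon> * x^2 / 2)))) =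
     of_real (sqrt (2 * pi)) * (LBINT x. cis (- (x * s)) * of_real (std_normal_density (r * x)))"
    unfolding e by (subst integral_mult_right_zero[symmetric]) (simp add: mult_ac)
  also have "(LBINT x. cis (- (x * s)) * of_real (std_normal_density (r * x))) = of_real (exp (- (s^2 / (2 * \<epsilon>))) / r)"
    using * r by (simp add: scaleR_conv_of_real field_simps)
  finally show "(LBINT x. cis (- (x * s)) * of_real (exp (- (\<epsilon> * x^2 / 2)))) =
       of_real (sqrt (2 * pi / \<epsilon>) * exp (- (s^2 / (2 * \<epsilon>))))"
    by (simp add: r_def real_sqrt_divide)
qed

lemma lborel_integral_product:
  fixes f g :: "real \<Rightarrow> complex"
  assumes f: "integrable lborel f" and g: "integrable lborel g"
  shows "integrable lborel (\<lambda>p. f (fst p) * g (snd p))"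
    "(LBINT p. f (fst p) * g (snd p)) = (LBINT x. f x) * (LBINT y. g y)"
proof -
  have [measurable]: "f \<in> borel_measurable borel" "g \<in> borel_measurable borel" using f g by auto
  have int: "integrable (lborel \<Otimes>\<^sub>M lborel) (\<lambda>p. f (fst p) * g (snd p))"
  proof (rule lborel_pair.Fubini_integrable)
    show "integrable lborel (\<lambda>x. LBINT y. norm (f (fst (x, y)) * g (snd (x, y))))"
      using f g by (simp add: norm_mult)
    show "AE x in lborel. integrable lborel (\<lambda>y. f (fst (x, y)) * g (snd (x, y)))"
      using g by auto
  qed measurable
  then show "integrable lborel (\<lambda>p. f (fst p) * g (snd p))" by (simp add: lborel_prod)
  have "(LBINT x. LBINT y. f x * g y) = (LINT p|(lborel \<Otimes>\<^sub>M lborel). f (fst p) * g (snd p))"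
    using lborel_pair.integral_fst'[OF int] by simp
  then show "(LBINT p. f (fst p) * g (snd p)) = (LBINT x. f x) * (LBINT y. g y)"
    by (simp add: lborel_prod)
qed

lemma fourier_gauss:
  assumes "\<epsilon> > 0"
  shows "integrable lborel (\<lambda>\<zeta>. complex_of_real (gauss \<epsilon> \<zeta>))"
    "fourier (\<lambda>\<zeta>. of_real (gauss \<epsilon> \<zeta>)) p = of_real (2 * pi / \<epsilon> * gauss (1 / \<epsilon>) p)"
proof -
  let ?g = "\<lambda>x::real. complex_of_real (exp (- (\<epsilon> * x^2 / 2)))"
  have g: "integrable lborel ?g" using fourier_gauss_1d(1)[OF assms] by simp
  have eq: "complex_of_real (gauss \<epsilon> \<zeta>) = ?g (fst \<zeta>) * ?g (snd \<zeta>)" for \<zeta>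
    by (simp add: gauss_def inner_prod_def power2_eq_square algebra_simps add_divide_distrib exp_add[symmetric] flip: of_real_mult)
  show "integrable lborel (\<lambda>\<zeta>. complex_of_real (gauss \<epsilon> \<zeta>))"
    unfolding eq by (rule lborel_integral_product(1)[OF g g])
  have "fourier (\<lambda>\<zeta>. of_real (gauss \<epsilon> \<zeta>)) p = (LBINT \<zeta>. (cis (- (fst \<zeta> * fst p)) * ?g (fst \<zeta>)) * (cis (- (snd \<zeta> * snd p)) * ?g (snd \<zeta>)))"
    unfolding fourier_eq eq by (intro Bochner_Integration.integral_cong refl) (simp add: inner_prod_def cis_mult mult_ac)
  also have "\<dots> = (LBINT x. cis (- (x * fst p)) * ?g x) * (LBINT x. cis (- (x * snd p)) * ?g x)"
    by (rule lborel_integral_product(2)) (intro integrable_cis_mult g, simp)+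
  also have "\<dots> = of_real (2 * pi / \<epsilon> * gauss (1 / \<epsilon>) p)"
  proof -
    have "sqrt (2 * pi / \<epsilon>) * sqrt (2 * pi / \<epsilon>) = 2 * pi / \<epsilon>" using assms by simp
    moreover have "exp (- ((fst p)^2 / (2 * \<epsilon>))) * exp (- ((snd p)^2 / (2 * \<epsilon>))) = gauss (1 / \<epsilon>) p"
      using assms by (simp add: gauss_def inner_prod_def power2_eq_square exp_add[symmetric] divide_simps)
    ultimately have "(sqrt (2 * pi / \<epsilon>) * exp (- ((fst p)^2 / (2 * \<epsilon>)))) * (sqrt (2 * pi / \<epsilon>) * exp (- ((snd p)^2 / (2 * \<epsilon>))))
        = 2 * pi / \<epsilon> * gauss (1 / \<epsilon>) p"
      by (metis mult.assoc mult.left_commute)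
    then show ?thesis unfolding fourier_gauss_1d(2)[OF assms] of_real_mult[symmetric] by simp
  qed
  finally show "fourier (\<lambda>\<zeta>. of_real (gauss \<epsilon> \<zeta>)) p = of_real (2 * pi / \<epsilon> * gauss (1 / \<epsilon>) p)" .
qed

lemma integrable_gauss: "\<epsilon> > 0 \<Longrightarrow> integrable lborel (gauss \<epsilon>)"
  using integrable_Re[OF fourier_gauss(1)[of \<epsilon>]] by simp

lemma integral_gauss: assumes "\<epsilon> > 0" shows "(LBINT \<zeta>. gauss \<epsilon> \<zeta>) = 2 * pi / \<epsilon>"
proof -
  have "fourier (\<lambda>\<zeta>. of_real (gauss \<epsilon> \<zeta>)) 0 = of_real (2 * pi / \<epsilon>)"
    using fourier_gauss(2)[OF assms, of 0] by (simp add: gauss_def)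
  then have "complex_of_real (LBINT \<zeta>. gauss \<epsilon> \<zeta>) = of_real (2 * pi / \<epsilon>)"
    by (simp add: fourier_eq)
  then show ?thesis using of_real_eq_iff by blast
qed

text \<open>Moving the transform across the pairing shows that a Gaussian damping of the inverse
  transform is an average of \<open>f\<close> near \<open>x\<close>, against a Gaussian of mass
  \<open>(2 * pi)^2\<close> and width of order \<open>sqrt \<epsilon>\<close>.\<close>

lemma fourier_gauss_regularised:
  assumes f: "integrable lborel f" and "\<epsilon> > 0"
  shows "(LBINT \<zeta>. fourier f \<zeta> * (cis (x \<bullet> \<zeta>) * of_real (gauss \<epsilon> \<zeta>))) =
     (LBINT p. f p * of_real (2 * pi / \<epsilon> * gauss (1 / \<epsilon>) (p - x)))"
proof -
  have "fourier (\<lambda>\<zeta>. cis (x \<bullet> \<zeta>) * of_real (gauss \<epsilon> \<zeta>)) p = fourier (\<lambda>\<zeta>. of_real (gauss \<epsilon> \<zeta>)) (p - x)" for p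
    unfolding fourier_eq by (intro Bochner_Integration.integral_cong refl)
      (simp add: inner_diff_right inner_commute cis_mult mult.assoc[symmetric])
  then show ?thesis
    using fourier_pairing[OF f integrable_cis_mult[OF fourier_gauss(1)[OF \<open>\<epsilon> > 0\<close>], of "\<lambda>\<zeta>. x \<bullet> \<zeta>"]]
    by (simp add: fourier_gauss(2)[OF \<open>\<epsilon> > 0\<close>])
qed

lemma nn_integral_gauss_conv:
  assumes "\<epsilon> > 0"
  shows "(\<integral>\<^sup>+p. ennreal (2 * pi / \<epsilon> * gauss (1 / \<epsilon>) (p - q))) = ennreal ((2 * pi)^2)"
proof -
  have "(\<integral>\<^sup>+p. ennreal (2 * pi / \<epsilon> * gauss (1 / \<epsilon>) (p - q))) = (\<integral>\<^sup>+p. ennreal (2 * pi / \<epsilon> * gauss (1 / \<epsilon>) p))"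
    by (rule nn_integral_lborel_shift_diff) measurable
  also have "\<dots> = ennreal (LBINT p. 2 * pi / \<epsilon> * gauss (1 / \<epsilon>) p)"
    using assms by (intro nn_integral_eq_integral integrable_mult_right integrable_gauss) (auto simp: gauss_bounds(1) less_imp_le)
  finally show ?thesis using assms by (simp add: integral_gauss power2_eq_square)
qed

text \<open>With Gaussian damping the energy of the transform is a pairing of \<open>f\<close> with
  its own average against a kernel \<open>K\<close> of mass \<open>(2 * pi)^2\<close>. The symmetry
  of \<open>K\<close> and the inequality \<open>x * y \<le> (x^2 + y^2) / 2\<close> bound it by that
  mass times the square norm, and Fatou's lemma removes the damping.\<close>

lemma plancherel_le:
  assumes f: "integrable lborel f"
  shows "(\<integral>\<^sup>+\<zeta>. nsq (fourier f \<zeta>)) \<le> ennreal ((2 * pi)^2) * (\<integral>\<^sup>+p. nsq (f p))"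
    (is "_ \<le> _ * ?N")
proof -
  have [measurable]: "f \<in> borel_measurable borel" using f by auto
  have half: "ennreal (1/2 * (A + B) * k) = ennreal (1/2) * (ennreal A * ennreal k + ennreal B * ennreal k)"
    if "0 \<le> A" "0 \<le> B" "0 \<le> k" for A B k
  proof -
    have "ennreal A * ennreal k + ennreal B * ennreal k = ennreal (A * k + B * k)"
      using that by (simp add: ennreal_mult)
    moreover have "ennreal (1/2) * ennreal (A * k + B * k) = ennreal (1/2 * (A * k + B * k))"
      using that by (intro ennreal_mult[symmetric]) auto
    ultimately show ?thesis by (simp add: algebra_simps add_divide_distrib del: ennreal_half)
  qed
  have reg: "(\<integral>\<^sup>+\<zeta>. ennreal ((norm (fourier f \<zeta>))^2 * gauss \<epsilon> \<zeta>)) \<le> ennreal ((2 * pi)^2) * ?N" if \<epsilon>: "\<epsilon> > 0" for \<epsilon>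
  proof -
    define K where "K p = 2 * pi / \<epsilon> * gauss (1 / \<epsilon>) p" for p
    have K: "K p \<ge> 0" for p using \<epsilon> by (simp add: K_def gauss_bounds(1) less_imp_le)
    have Ksym: "K (p - q) = K (q - p)" for p q by (simp add: K_def gauss_def inner_diff_left inner_diff_right inner_commute algebra_simps)
    have [measurable]: "K \<in> borel_measurable borel" unfolding K_def[abs_def] by measurable
    have Kint: "(\<integral>\<^sup>+p. ennreal (K (p - q))) = ennreal ((2 * pi)^2)" for q
      unfolding K_def by (rule nn_integral_gauss_conv[OF \<epsilon>])
    define h where "h q = (LBINT p. f p * of_real (K (p - q)))" for q
    have [measurable]: "h \<in> borel_measurable borel" unfolding h_def[abs_def] by measurable
    have int1: "integrable lborel (\<lambda>\<zeta>. of_real (gauss \<epsilon> \<zeta>) * cnj (fourier f \<zeta>))"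
    proof (rule Bochner_Integration.integrable_bound)
      show "integrable lborel (\<lambda>\<zeta>. (LBINT p. norm (f p)) * gauss \<epsilon> \<zeta>)"
        using integrable_gauss[OF \<epsilon>] by simp
      have "0 \<le> (LBINT p. norm (f p))" by simp
      then show "AE \<zeta> in lborel. norm (complex_of_real (gauss \<epsilon> \<zeta>) * cnj (fourier f \<zeta>)) \<le> norm ((LBINT p. norm (f p)) * gauss \<epsilon> \<zeta>)"
        by (auto simp: norm_mult abs_mult mult.commute intro!: mult_mono norm_fourier_le)
    qed measurable
    have int2: "integrable lborel (\<lambda>\<zeta>. (norm (fourier f \<zeta>))^2 * gauss \<epsilon> \<zeta>)"
    proof (rule Bochner_Integration.integrable_bound)
      show "integrable lborel (\<lambda>\<zeta>. (LBINT p. norm (f p))^2 * gauss \<epsilon> \<zeta>)"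
        using integrable_gauss[OF \<epsilon>] by simp
      show "AE \<zeta> in lborel. norm ((norm (fourier f \<zeta>))^2 * gauss \<epsilon> \<zeta>) \<le> norm ((LBINT p. norm (f p))^2 * gauss \<epsilon> \<zeta>)"
        by (auto simp: abs_mult gauss_bounds(1) less_imp_le intro!: mult_right_mono power_mono norm_fourier_le)
    qed measurable
    have "complex_of_real (LBINT \<zeta>. (norm (fourier f \<zeta>))^2 * gauss \<epsilon> \<zeta>) = (LBINT \<zeta>. fourier f \<zeta> * (of_real (gauss \<epsilon> \<zeta>) * cnj (fourier f \<zeta>)))"
      unfolding integral_complex_of_real[symmetric]
      by (intro Bochner_Integration.integral_cong refl) (simp add: complex_norm_square[symmetric] mult_ac)
    also have "\<dots> = (LBINT q. f q * fourier (\<lambda>\<zeta>. of_real (gauss \<epsilon> \<zeta>) * cnj (fourier f \<zeta>)) q)"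
      by (rule fourier_pairing[OF f int1])
    also have "\<dots> = (LBINT q. f q * cnj (h q))"
    proof (intro Bochner_Integration.integral_cong refl)
      fix q
      have "fourier (\<lambda>\<zeta>. of_real (gauss \<epsilon> \<zeta>) * cnj (fourier f \<zeta>)) q = cnj (LBINT \<zeta>. fourier f \<zeta> * (cis (q \<bullet> \<zeta>) * of_real (gauss \<epsilon> \<zeta>)))"
        unfolding fourier_eq[of _ q] by (subst Bochner_Integration.integral_cnj[symmetric])
          (intro Bochner_Integration.integral_cong refl, simp add: cis_cnj inner_commute mult_ac)
      also have "\<dots> = cnj (h q)"
        unfolding h_def K_def fourier_gauss_regularised[OF f \<epsilon>] by simp
      finally show "f q * fourier (\<lambda>\<zeta>. of_real (gauss \<epsilon> \<zeta>) * cnj (fourier f \<zeta>)) q = f q * cnj (h q)" by simp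
    qed
    finally have eq: "complex_of_real (LBINT \<zeta>. (norm (fourier f \<zeta>))^2 * gauss \<epsilon> \<zeta>) = (LBINT q. f q * cnj (h q))" .
    have "(\<integral>\<^sup>+\<zeta>. ennreal ((norm (fourier f \<zeta>))^2 * gauss \<epsilon> \<zeta>)) = ennreal (LBINT \<zeta>. (norm (fourier f \<zeta>))^2 * gauss \<epsilon> \<zeta>)"
      by (intro nn_integral_eq_integral int2) (auto simp: gauss_bounds(1) less_imp_le)
    also have "\<dots> \<le> ennreal (norm (complex_of_real (LBINT \<zeta>. (norm (fourier f \<zeta>))^2 * gauss \<epsilon> \<zeta>)))"
      by (intro ennreal_leI) simp
    also have "\<dots> \<le> (\<integral>\<^sup>+q. ennreal (norm (f q * cnj (h q))))"
      unfolding eq by (rule integral_norm_bound_ennreal_any)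
    also have "\<dots> \<le> (\<integral>\<^sup>+q. \<integral>\<^sup>+p. ennreal (norm (f q) * norm (f p) * K (p - q)))"
    proof (rule nn_integral_mono)
      fix q
      have "ennreal (norm (h q)) \<le> (\<integral>\<^sup>+p. ennreal (norm (f p * of_real (K (p - q)))))"
        unfolding h_def by (rule integral_norm_bound_ennreal_any)
      then have "ennreal (norm (f q)) * ennreal (norm (h q)) \<le> ennreal (norm (f q)) * (\<integral>\<^sup>+p. ennreal (norm (f p) * K (p - q)))"
        using K by (intro mult_left_mono) (auto simp: norm_mult)
      also have "\<dots> = (\<integral>\<^sup>+p. ennreal (norm (f q) * norm (f p) * K (p - q)))"
        using K by (subst nn_integral_cmult[symmetric]) (auto simp: ennreal_mult mult.assoc)
      finally show "ennreal (norm (f q * cnj (h q))) \<le> (\<integral>\<^sup>+p. ennreal (norm (f q) * norm (f p) * K (p - q)))"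
        by (simp add: norm_mult ennreal_mult)
    qed
    also have "\<dots> \<le> (\<integral>\<^sup>+q. \<integral>\<^sup>+p. ennreal (1/2) * (nsq (f q) * ennreal (K (p - q)) + nsq (f p) * ennreal (K (p - q))))"
    proof (intro nn_integral_mono)
      fix q p
      have "norm (f q) * norm (f p) \<le> 1/2 * ((norm (f q))^2 + (norm (f p))^2)"
        using sum_squares_bound[of "norm (f q)" "norm (f p)"] by simp
      then have "norm (f q) * norm (f p) * K (p - q) \<le> 1/2 * ((norm (f q))^2 + (norm (f p))^2) * K (p - q)"
        using K by (intro mult_right_mono) auto
      then have "ennreal (norm (f q) * norm (f p) * K (p - q)) \<le> ennreal (1/2 * ((norm (f q))^2 + (norm (f p))^2) * K (p - q))"
        by (rule ennreal_leI)
      also have "\<dots> = ennreal (1/2) * (nsq (f q) * ennreal (K (p - q)) + nsq (f p) * ennreal (K (p - q)))"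
        by (rule half) (use K[of "p - q"] in auto)
      finally show "ennreal (norm (f q) * norm (f p) * K (p - q)) \<le> ennreal (1/2) * (nsq (f q) * ennreal (K (p - q)) + nsq (f p) * ennreal (K (p - q)))" .
    qed
    also have "\<dots> = ennreal (1/2) * ((\<integral>\<^sup>+q. \<integral>\<^sup>+p. nsq (f q) * ennreal (K (p - q))) + (\<integral>\<^sup>+q. \<integral>\<^sup>+p. nsq (f p) * ennreal (K (p - q))))"
      by (simp add: nn_integral_cmult nn_integral_add)
    also have "(\<integral>\<^sup>+q. \<integral>\<^sup>+p. nsq (f p) * ennreal (K (p - q))) = (\<integral>\<^sup>+p. \<integral>\<^sup>+q. nsq (f p) * ennreal (K (q - p)))"
      by (subst nn_integral_lborel_swap) (simp_all add: Ksym)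
    also have "(\<integral>\<^sup>+q. \<integral>\<^sup>+p. nsq (f q) * ennreal (K (p - q))) = ennreal ((2 * pi)^2) * ?N"
      by (simp add: nn_integral_cmult Kint nn_integral_multc mult.commute del: power_mult_distrib)
    also have "ennreal (1/2) * (ennreal ((2 * pi)^2) * ?N + ennreal ((2 * pi)^2) * ?N) = (ennreal (1/2) * ennreal 2) * (ennreal ((2 * pi)^2) * ?N)"
      by (simp only: mult_2[symmetric] mult.assoc ennreal_numeral)
    also have "ennreal (1/2) * ennreal 2 = 1" by (subst ennreal_mult[symmetric]) auto
    finally show ?thesis by simp
  qed
  have "(\<integral>\<^sup>+\<zeta>. nsq (fourier f \<zeta>)) = (\<integral>\<^sup>+\<zeta>. liminf (\<lambda>n. ennreal ((norm (fourier f \<zeta>))^2 * gauss (1 / real (Suc n)) \<zeta>)))"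
  proof (rule nn_integral_cong)
    fix \<zeta> :: "real \<times> real"
    have "(\<lambda>n. 1 / real (Suc n)) \<longlonglongrightarrow> 0" by (rule lim_1_over_n[THEN LIMSEQ_Suc])
    then have "(\<lambda>n. ennreal ((norm (fourier f \<zeta>))^2 * gauss (1 / real (Suc n)) \<zeta>)) \<longlonglongrightarrow> ennreal ((norm (fourier f \<zeta>))^2 * exp (- (0 * (\<zeta> \<bullet> \<zeta>) / 2)))"
      unfolding gauss_def by (intro tendsto_ennrealI tendsto_intros) auto
    then show "nsq (fourier f \<zeta>) = liminf (\<lambda>n. ennreal ((norm (fourier f \<zeta>))^2 * gauss (1 / real (Suc n)) \<zeta>))"
      by (subst lim_imp_Liminf) auto
  qed
  also have "\<dots> \<le> liminf (\<lambda>n. \<integral>\<^sup>+\<zeta>. ennreal ((norm (fourier f \<zeta>))^2 * gauss (1 / real (Suc n)) \<zeta>))"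
    by (rule nn_integral_liminf) measurable
  also have "\<dots> \<le> ennreal ((2 * pi)^2) * ?N"
    by (intro Liminf_le always_eventually allI reg) auto
  finally show ?thesis .
qed

section \<open>Square-integrable functions and the Fourier transform by duality\<close>

definition sq_norm :: "('a::euclidean_space \<Rightarrow> complex) \<Rightarrow> ennreal" where
  "sq_norm f = (\<integral>\<^sup>+x. nsq (f x))"

definition L2_fun :: "('a::euclidean_space \<Rightarrow> complex) \<Rightarrow> bool" where
  "L2_fun f \<longleftrightarrow> f \<in> borel_measurable borel \<and> sq_norm f < \<infinity>"

lemma L2_fun_measurable [measurable_dest]: "L2_fun f \<Longrightarrow> f \<in> borel_measurable borel"
  by (simp add: L2_fun_def)

lemma L2_fun_bound:
  assumes "L2_fun f" "g \<in> borel_measurable borel" "\<And>x. norm (g x) \<le> norm (f x)"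
  shows "L2_fun g" "sq_norm g \<le> sq_norm f"
proof -
  show "sq_norm g \<le> sq_norm f"
    unfolding sq_norm_def using assms(3) by (intro nn_integral_mono ennreal_leI power_mono) auto
  with assms show "L2_fun g" by (auto simp: L2_fun_def)
qed

lemma nn_integral_mult_sq_norm:
  assumes [measurable]: "f \<in> borel_measurable borel" "g \<in> borel_measurable borel"
  shows "(\<integral>\<^sup>+x. ennreal (norm (f x * g x)))^2 \<le> sq_norm f * sq_norm g"
  using Cauchy_Schwarz_nn_integral[of "\<lambda>x. ennreal (norm (f x))" lborel "\<lambda>x. ennreal (norm (g x))"]
  by (simp add: sq_norm_def norm_mult ennreal_mult ennreal_power)

lemma L2_fun_mult_integrable:
  assumes "L2_fun f" "L2_fun g"
  shows "integrable lborel (\<lambda>x. f x * g x)"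
proof (rule integrableI_bounded)
  note [measurable] = L2_fun_measurable[OF assms(1)] L2_fun_measurable[OF assms(2)]
  show "(\<lambda>x. f x * g x) \<in> borel_measurable lborel" by measurable
  have "(\<integral>\<^sup>+x. ennreal (norm (f x * g x)))^2 \<le> sq_norm f * sq_norm g"
    by (rule nn_integral_mult_sq_norm) measurable
  also have "\<dots> < \<infinity>" using assms by (auto simp: L2_fun_def ennreal_mult_less_top)
  finally show "(\<integral>\<^sup>+x. ennreal (norm (f x * g x))) < \<infinity>"
    by (auto simp: power_less_top_ennreal)
qed

lemma integral_mult_sq_norm:
  assumes [measurable]: "f \<in> borel_measurable borel" "g \<in> borel_measurable borel"
  shows "(ennreal (norm (LBINT x. f x * g x)))^2 \<le> sq_norm f * sq_norm g"
proof -
  have "(ennreal (norm (LBINT x. f x * g x)))^2 \<le> (\<integral>\<^sup>+x. ennreal (norm (f x * g x)))^2"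
    by (intro power_mono integral_norm_bound_ennreal_any) auto
  also have "\<dots> \<le> sq_norm f * sq_norm g" by (rule nn_integral_mult_sq_norm) measurable
  finally show ?thesis .
qed

lemma sq_norm_add_le: 
  assumes [measurable]: "f \<in> borel_measurable borel" "g \<in> borel_measurable borel"
  shows "sq_norm (\<lambda>x. f x + g x) \<le> 2 * sq_norm f + 2 * sq_norm g"
proof -
  have "sq_norm (\<lambda>x. f x + g x) \<le> (\<integral>\<^sup>+x. 2 * nsq (f x) + 2 * nsq (g x))"
    unfolding sq_norm_def
  proof (intro nn_integral_mono)
    fix x
    have "(norm (f x + g x))^2 \<le> (norm (f x) + norm (g x))^2" by (intro power_mono norm_triangle_ineq) auto
    also have "\<dots> \<le> 2 * (norm (f x))^2 + 2 * (norm (g x))^2"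
      using sum_squares_bound[of "norm (f x)" "norm (g x)"] by (simp add: power2_sum)
    finally have "nsq (f x + g x) \<le> ennreal (2 * (norm (f x))^2 + 2 * (norm (g x))^2)" by (rule ennreal_leI)
    then show "nsq (f x + g x) \<le> 2 * nsq (f x) + 2 * nsq (g x)"
      by (simp add: ennreal_mult)
  qed
  also have "\<dots> = 2 * sq_norm f + 2 * sq_norm g"
    unfolding sq_norm_def by (simp add: nn_integral_add nn_integral_cmult)
  finally show ?thesis .
qed

lemma L2_fun_add: "L2_fun f \<Longrightarrow> L2_fun g \<Longrightarrow> L2_fun (\<lambda>x. f x + g x)"
  using sq_norm_add_le[of f g] unfolding L2_fun_def
  by (auto simp: ennreal_mult_less_top intro: le_less_trans)

lemma sq_norm_cmult: "sq_norm (\<lambda>x. c * f x) = nsq c * sq_norm f" if [measurable]: "f \<in> borel_measurable borel"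
  unfolding sq_norm_def norm_mult power_mult_distrib by (subst nn_integral_cmult[symmetric]) (auto simp: ennreal_mult)

lemma L2_fun_cmult: "L2_fun f \<Longrightarrow> L2_fun (\<lambda>x. c * f x)"
  unfolding L2_fun_def by (auto simp: sq_norm_cmult ennreal_mult_less_top)

lemma L2_fun_diff: "L2_fun f \<Longrightarrow> L2_fun g \<Longrightarrow> L2_fun (\<lambda>x. f x - g x)"
  using L2_fun_add[of f "\<lambda>x. (-1) * g x"] L2_fun_cmult[of g "-1"] by simp

lemma L2_fun_bounded_mult:
  assumes "L2_fun f" "h \<in> borel_measurable borel" "\<And>x. norm (h x) \<le> C"
  shows "L2_fun (\<lambda>x. h x * f x)"
proof (rule L2_fun_bound)
  note [measurable] = L2_fun_measurable[OF assms(1)] assms(2)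
  show "L2_fun (\<lambda>x. of_real C * f x)" by (rule L2_fun_cmult) fact
  show "(\<lambda>x. h x * f x) \<in> borel_measurable borel" by measurable
  show "norm (h x * f x) \<le> norm (of_real C * f x)" for x
    using assms(3)[of x] by (auto simp: norm_mult intro!: mult_right_mono)
qed

lemma L2_fun_fourier: "integrable lborel u \<Longrightarrow> L2_fun u \<Longrightarrow> L2_fun (fourier u)"
  and sq_norm_fourier: "integrable lborel u \<Longrightarrow> sq_norm (fourier u) \<le> ennreal ((2 * pi)^2) * sq_norm u"
proof -
  show *: "integrable lborel u \<Longrightarrow> sq_norm (fourier u) \<le> ennreal ((2 * pi)^2) * sq_norm u" for u
    using plancherel_le by (simp add: sq_norm_def)
  assume u: "integrable lborel u" "L2_fun u"
  have "ennreal ((2 * pi)^2) * sq_norm u < \<infinity>"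
    using u(2) by (simp add: L2_fun_def ennreal_mult_less_top)
  with *[OF u(1)] have "sq_norm (fourier u) < \<infinity>" by (rule le_less_trans)
  with u show "L2_fun (fourier u)" by (simp add: L2_fun_def)
qed

lemma fourier_diff:
  assumes "integrable lborel u" "integrable lborel w"
  shows "fourier (\<lambda>\<zeta>. u \<zeta> - w \<zeta>) p = fourier u p - fourier w p"
  unfolding fourier_eq right_diff_distrib
  by (intro Bochner_Integration.integral_diff integrable_cis_mult assms) measurable

lemma fourier_add:
  assumes "integrable lborel u" "integrable lborel w"
  shows "fourier (\<lambda>\<zeta>. u \<zeta> + w \<zeta>) p = fourier u p + fourier w p"
  unfolding fourier_eq distrib_left
  by (intro Bochner_Integration.integral_add integrable_cis_mult assms) measurable

lemma fourier_cmult: "fourier (\<lambda>\<zeta>. c * u \<zeta>) p = c * fourier u p"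
  unfolding fourier_eq by (subst integral_mult_right_zero[symmetric]) (simp add: mult_ac)

text \<open>An \<open>L2\<close> function need not have a pointwise transform integral, so
  \<open>g\<close> is recognised as the transform of \<open>f\<close> by testing. The test
  \<open>u\<close> is a parameter because the class of admissible tests is enlarged step by step
  below.\<close>

definition fourier_dual :: "(real \<times> real \<Rightarrow> complex) \<Rightarrow> (real \<times> real \<Rightarrow> complex) \<Rightarrow> (real \<times> real \<Rightarrow> complex) \<Rightarrow> bool" where
  "fourier_dual f g u \<longleftrightarrow> (LBINT \<zeta>. g \<zeta> * u \<zeta>) = (LBINT p. f p * fourier u p)"

text \<open>A common bound in \<open>L1\<close> and \<open>L2\<close> makes \<open>u n\<close>
  converge to \<open>v\<close> in \<open>L2\<close>. The side with \<open>g\<close> passes to the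
  limit by dominated convergence, the side with \<open>f\<close> by Plancherel's inequality applied
  to \<open>u n - v\<close>.\<close>

lemma fourier_dual_limit:
  assumes f: "L2_fun f" and g: "L2_fun g"
    and [measurable]: "\<And>n. u n \<in> borel_measurable borel" "v \<in> borel_measurable borel"
    and U: "integrable lborel U" "L2_fun U" "\<And>n \<zeta>. norm (u n \<zeta>) \<le> norm (U \<zeta>)"
    and lim: "\<And>\<zeta>. (\<lambda>n. u n \<zeta>) \<longlonglongrightarrow> v \<zeta>"
    and dual: "\<And>n. fourier_dual f g (u n)"
  shows "fourier_dual f g v"
proof -
  note [measurable] = L2_fun_measurable[OF f] L2_fun_measurable[OF g] L2_fun_measurable[OF U(2)]
  have vU: "norm (v \<zeta>) \<le> norm (U \<zeta>)" for \<zeta>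
    by (rule LIMSEQ_le_const2[OF tendsto_norm[OF lim]]) (use U(3) in auto)
  have int_u: "integrable lborel (u n)" for n
    by (rule Bochner_Integration.integrable_bound[OF U(1)]) (use U(3) in auto)
  have int_v: "integrable lborel v"
    by (rule Bochner_Integration.integrable_bound[OF U(1)]) (use vU in auto)
  have L2u: "L2_fun (u n)" for n by (rule L2_fun_bound[OF U(2)]) (use U(3) in auto)
  have L2v: "L2_fun v" by (rule L2_fun_bound[OF U(2)]) (use vU in auto)
  have 1: "(\<lambda>n. LBINT \<zeta>. g \<zeta> * u n \<zeta>) \<longlonglongrightarrow> (LBINT \<zeta>. g \<zeta> * v \<zeta>)"
  proof (rule integral_dominated_convergence[where w = "\<lambda>\<zeta>. norm (g \<zeta> * U \<zeta>)"])
    show "integrable lborel (\<lambda>\<zeta>. norm (g \<zeta> * U \<zeta>))"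
      using L2_fun_mult_integrable[OF g U(2)] by (rule integrable_norm)
    show "AE \<zeta> in lborel. (\<lambda>n. g \<zeta> * u n \<zeta>) \<longlonglongrightarrow> g \<zeta> * v \<zeta>" by (intro always_eventually allI tendsto_mult tendsto_const lim)
    show "AE \<zeta> in lborel. norm (g \<zeta> * u n \<zeta>) \<le> norm (g \<zeta> * U \<zeta>)" for n
      using U(3) by (auto simp: norm_mult intro!: mult_left_mono)
  qed measurable
  have sq0: "(\<lambda>n. sq_norm (\<lambda>\<zeta>. u n \<zeta> - v \<zeta>)) \<longlonglongrightarrow> 0"
  proof -
    have "(\<lambda>n. \<integral>\<^sup>+\<zeta>. nsq (u n \<zeta> - v \<zeta>)) \<longlonglongrightarrow> (\<integral>\<^sup>+\<zeta>. 0 \<partial>(lborel :: (real \<times> real) measure))"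
    proof (rule nn_integral_dominated_convergence[where w = "\<lambda>\<zeta>. ennreal (4 * (norm (U \<zeta>))^2)"])
      show "(\<integral>\<^sup>+\<zeta>. ennreal (4 * (norm (U \<zeta>))^2)) < \<infinity>"
        using U(2) by (simp add: ennreal_mult nn_integral_cmult L2_fun_def sq_norm_def ennreal_mult_less_top)
      show "AE \<zeta> in lborel. nsq (u n \<zeta> - v \<zeta>) \<le> ennreal (4 * (norm (U \<zeta>))^2)" for n
      proof (intro always_eventually allI ennreal_leI)
        fix \<zeta>
        have "norm (u n \<zeta> - v \<zeta>) \<le> 2 * norm (U \<zeta>)"
          using norm_triangle_ineq4[of "u n \<zeta>" "v \<zeta>"] U(3)[of n \<zeta>] vU[of \<zeta>] by linarith
        then have "(norm (u n \<zeta> - v \<zeta>))^2 \<le> (2 * norm (U \<zeta>))^2" by (intro power_mono) auto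
        then show "(norm (u n \<zeta> - v \<zeta>))^2 \<le> 4 * (norm (U \<zeta>))^2" by (simp add: power_mult_distrib)
      qed
      show "AE \<zeta> in lborel. (\<lambda>n. nsq (u n \<zeta> - v \<zeta>)) \<longlonglongrightarrow> 0"
      proof (intro always_eventually allI)
        fix \<zeta>
        have "(\<lambda>n. (norm (u n \<zeta> - v \<zeta>))^2) \<longlonglongrightarrow> (norm (v \<zeta> - v \<zeta>))\<^sup>2"
          by (intro tendsto_intros lim)
        then show "(\<lambda>n. nsq (u n \<zeta> - v \<zeta>)) \<longlonglongrightarrow> 0"
          using tendsto_ennrealI by fastforce
      qed
    qed measurable
    then show ?thesis by (simp add: sq_norm_def)
  qed
  have 2: "(\<lambda>n. LBINT p. f p * fourier (u n) p) \<longlonglongrightarrow> (LBINT p. f p * fourier v p)"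
  proof (rule Lim_null[THEN iffD2], rule tendsto_norm_zero_cancel, rule power_tendsto_0_iff[THEN iffD1, of 2])
    define C where "C = enn2real (sq_norm f) * (2 * pi)^2"
    have bd: "(norm ((LBINT p. f p * fourier (u n) p) - (LBINT p. f p * fourier v p)))^2 \<le> C * enn2real (sq_norm (\<lambda>\<zeta>. u n \<zeta> - v \<zeta>))" for n
    proof -
      have "(LBINT p. f p * fourier (u n) p) - (LBINT p. f p * fourier v p) = (LBINT p. f p * fourier (\<lambda>\<zeta>. u n \<zeta> - v \<zeta>) p)"
        unfolding fourier_diff[OF int_u int_v] right_diff_distrib
        by (intro Bochner_Integration.integral_diff[symmetric] L2_fun_mult_integrable f L2_fun_fourier int_u int_v L2u L2v)
      then have "(ennreal (norm ((LBINT p. f p * fourier (u n) p) - (LBINT p. f p * fourier v p))))^2 \<le> sq_norm f * sq_norm (fourier (\<lambda>\<zeta>. u n \<zeta> - v \<zeta>))"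
        by (simp only:) (rule integral_mult_sq_norm, measurable)
      also have "\<dots> \<le> sq_norm f * (ennreal ((2 * pi)^2) * sq_norm (\<lambda>\<zeta>. u n \<zeta> - v \<zeta>))"
        by (intro mult_left_mono sq_norm_fourier Bochner_Integration.integrable_diff int_u int_v) auto
      also have "\<dots> = ennreal (C * enn2real (sq_norm (\<lambda>\<zeta>. u n \<zeta> - v \<zeta>)))"
      proof -
        have "sq_norm f = ennreal (enn2real (sq_norm f))" using f by (simp add: L2_fun_def)
        moreover have "sq_norm (\<lambda>\<zeta>. u n \<zeta> - v \<zeta>) = ennreal (enn2real (sq_norm (\<lambda>\<zeta>. u n \<zeta> - v \<zeta>)))"
          using L2_fun_diff[OF L2u L2v] by (simp add: L2_fun_def)
        ultimately show ?thesis
          unfolding C_def by (metis (no_types, lifting) ennreal_mult enn2real_nonneg mult.assoc mult_nonneg_nonneg zero_le_power2)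
      qed
      finally show ?thesis by (simp add: ennreal_power C_def)
    qed
    have "(\<lambda>n. enn2real (sq_norm (\<lambda>\<zeta>. u n \<zeta> - v \<zeta>))) \<longlonglongrightarrow> 0"
      by (rule tendsto_enn2real) (use sq0 in auto)
    from tendsto_mult[OF tendsto_const[of C] this] have "(\<lambda>n. C * enn2real (sq_norm (\<lambda>\<zeta>. u n \<zeta> - v \<zeta>))) \<longlonglongrightarrow> 0"
      by simp
    then show "(\<lambda>n. (norm ((LBINT p. f p * fourier (u n) p) - (LBINT p. f p * fourier v p)))^2) \<longlonglongrightarrow> 0"
      by (rule tendsto_sandwich[OF _ _ tendsto_const[of 0], rotated 2]) (simp_all add: bd)
  qed simp
  have "(\<lambda>n. LBINT \<zeta>. g \<zeta> * u n \<zeta>) = (\<lambda>n. LBINT p. f p * fourier (u n) p)"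
    using dual by (simp add: fourier_dual_def)
  with 1 2 show ?thesis unfolding fourier_dual_def by (auto intro: LIMSEQ_unique)
qed

lemma fourier_dual_add:
  assumes "L2_fun f" "L2_fun g" "integrable lborel u" "L2_fun u" "integrable lborel w" "L2_fun w"
    "fourier_dual f g u" "fourier_dual f g w"
  shows "fourier_dual f g (\<lambda>\<zeta>. u \<zeta> + w \<zeta>)"
proof -
  have "(LBINT \<zeta>. g \<zeta> * (u \<zeta> + w \<zeta>)) = (LBINT \<zeta>. g \<zeta> * u \<zeta>) + (LBINT \<zeta>. g \<zeta> * w \<zeta>)"
    unfolding distrib_left by (intro Bochner_Integration.integral_add L2_fun_mult_integrable assms)
  moreover have "(LBINT p. f p * fourier (\<lambda>\<zeta>. u \<zeta> + w \<zeta>) p) = (LBINT p. f p * fourier u p) + (LBINT p. f p * fourier w p)"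
    unfolding distrib_left fourier_add[OF assms(3,5)] by (intro Bochner_Integration.integral_add L2_fun_mult_integrable L2_fun_fourier assms)
  ultimately show ?thesis using assms(7,8) by (simp add: fourier_dual_def)
qed

lemma fourier_dual_cmult:
  assumes "fourier_dual f g u" shows "fourier_dual f g (\<lambda>\<zeta>. c * u \<zeta>)"
proof -
  have "(LBINT \<zeta>. g \<zeta> * (c * u \<zeta>)) = c * (LBINT \<zeta>. g \<zeta> * u \<zeta>)"
    by (subst integral_mult_right_zero[symmetric]) (simp add: mult_ac)
  moreover have "(LBINT p. f p * fourier (\<lambda>\<zeta>. c * u \<zeta>) p) = c * (LBINT p. f p * fourier u p)"
    unfolding fourier_cmult by (subst integral_mult_right_zero[symmetric]) (simp add: mult_ac)
  ultimately show ?thesis using assms by (simp add: fourier_dual_def)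
qed

lemma indicator_L1_L2:
  fixes A :: "'a::euclidean_space set"
  assumes "A \<in> sets borel" "emeasure lborel A < \<infinity>"
  shows "integrable lborel (\<lambda>x. complex_of_real (indicator A x))" "L2_fun (\<lambda>x. complex_of_real (indicator A x))"
proof -
  show "integrable lborel (\<lambda>x. complex_of_real (indicator A x))"
    using assms by (intro integrable_of_real integrable_real_indicator) auto
  have "(\<lambda>x. nsq (complex_of_real (indicator A x))) = indicator A"
    by (auto simp: indicator_def)
  then have "sq_norm (\<lambda>x. complex_of_real (indicator A x)) = emeasure lborel A"
    unfolding sq_norm_def using assms by simp
  with assms show "L2_fun (\<lambda>x. complex_of_real (indicator A x))" by (simp add: L2_fun_def)
qed

text \<open>Bumps are tests that a distributional transform always admits. They approximate
  indicators of boxes, Dynkin's theorem leads to Borel sets, and simple functions reach every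
  integrable \<open>L2\<close> test; each limit on the way is dominated in \<open>L1\<close> and
  \<open>L2\<close>.\<close>

proposition fourier_dual_extend:
  assumes f: "L2_fun f" and g: "L2_fun g"
    and bump: "\<And>a b n. fourier_dual f g (bump a b n)"
    and u: "integrable lborel u" "L2_fun u"
  shows "fourier_dual f g u"
proof -
  define c :: "nat \<Rightarrow> real \<times> real" where "c n = (real n, real n)" for n
  have fin: "emeasure lborel (box a b :: (real \<times> real) set) < \<top>" for a b
    using emeasure_lborel_box_finite by simp
  have boxd: "fourier_dual f g (\<lambda>\<zeta>. of_real (indicator (box a b) \<zeta>))" for a b
    by (rule fourier_dual_limit[OF f g _ _ indicator_L1_L2(1,2)[of "box a b"], where u = "bump a b"])
       (auto simp: fin bump intro!: bump_tendsto norm_bump_le)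
  have fin': "emeasure lborel (A \<inter> box a b :: (real \<times> real) set) < \<top>" if "A \<in> sets borel" for A a b
    using that by (intro le_less_trans[OF emeasure_mono fin]) auto
  \<comment> \<open>Every set is intersected with one fixed box, so complements keep finite measure
    and the indicator of that box dominates all limits.\<close>
  have loc: "fourier_dual f g (\<lambda>\<zeta>. of_real (indicator (A \<inter> box a b) \<zeta>))" if "A \<in> sets borel" for A a b
    using that
  proof (induction rule: box_induct)
    case (box c d)
    show ?case unfolding Int_box by (rule boxd)
  next
    case empty
    show ?case by (simp add: fourier_dual_def fourier_eq)
  next
    case (compl A)
    have "fourier_dual f g (\<lambda>\<zeta>. of_real (indicator (box a b) \<zeta>) + (- 1) * of_real (indicator (A \<inter> box a b) \<zeta>))"
    proof (intro fourier_dual_add f g boxd fourier_dual_cmult compl.IH)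
      have Ai: "A \<inter> box a b \<in> sets borel" "emeasure lborel (A \<inter> box a b) < \<infinity>" using compl fin'[of A a b] by auto
      show "integrable lborel (\<lambda>\<zeta>. (- 1) * complex_of_real (indicator (A \<inter> box a b) \<zeta>))"
        by (intro integrable_mult_right indicator_L1_L2(1) Ai)
      show "L2_fun (\<lambda>\<zeta>. (- 1) * complex_of_real (indicator (A \<inter> box a b) \<zeta>))"
        by (intro L2_fun_cmult indicator_L1_L2(2) Ai)
      show "integrable lborel (\<lambda>\<zeta>. complex_of_real (indicator (box a b) \<zeta>))" "L2_fun (\<lambda>\<zeta>. complex_of_real (indicator (box a b) \<zeta>))"
        using fin[of a b] by (auto intro!: indicator_L1_L2)
    qed
    also have "(\<lambda>\<zeta>. complex_of_real (indicator (box a b) \<zeta>) + (- 1) * of_real (indicator (A \<inter> box a b) \<zeta>)) = (\<lambda>\<zeta>. of_real (indicator (- A \<inter> box a b) \<zeta>))"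
      by (auto simp: indicator_def)
    finally show ?case .
  next
    case (union A)
    have s: "complex_of_real (indicator ((\<Union>i<n. A i) \<inter> box a b) \<zeta>) = (\<Sum>i<n. of_real (indicator (A i \<inter> box a b) \<zeta>))" for n \<zeta>
    proof -
      have "indicator ((\<Union>i<n. A i) \<inter> box a b) \<zeta> = (\<Sum>i<n. indicator (A i \<inter> box a b) \<zeta> :: real)"
        using union(1) by (subst indicator_UN_disjoint[symmetric]) (auto simp: disjoint_family_on_def)
      then show ?thesis by simp
    qed
    have [measurable]: "A i \<in> sets borel" for i using union by auto
    show ?case
    proof (rule fourier_dual_limit[OF f g _ _ indicator_L1_L2(1,2)[of "box a b"], where u = "\<lambda>n \<zeta>. of_real (indicator ((\<Union>i<n. A i) \<inter> box a b) \<zeta>)"])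
      show "fourier_dual f g (\<lambda>\<zeta>. of_real (indicator ((\<Union>i<n. A i) \<inter> box a b) \<zeta>))" for n
      proof (induction n)
        case 0
        show ?case by (simp add: fourier_dual_def fourier_eq)
      next
        case (Suc n)
        have "fourier_dual f g (\<lambda>\<zeta>. of_real (indicator ((\<Union>i<n. A i) \<inter> box a b) \<zeta>) + of_real (indicator (A n \<inter> box a b) \<zeta>))"
        proof (intro fourier_dual_add f g Suc.IH union(3))
          have "(\<Union>i<n. A i) \<in> sets borel" by measurable
          from fin'[OF this, of a b] this
          show "integrable lborel (\<lambda>\<zeta>. complex_of_real (indicator ((\<Union>i<n. A i) \<inter> box a b) \<zeta>))" "L2_fun (\<lambda>\<zeta>. complex_of_real (indicator ((\<Union>i<n. A i) \<inter> box a b) \<zeta>))"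
            by (simp_all only: infinity_ennreal_def indicator_L1_L2 sets.Int borel_open[OF open_box])
          show "integrable lborel (\<lambda>\<zeta>. complex_of_real (indicator (A n \<inter> box a b) \<zeta>))" "L2_fun (\<lambda>\<zeta>. complex_of_real (indicator (A n \<inter> box a b) \<zeta>))"
            using fin'[of "A n" a b] by (auto intro!: indicator_L1_L2)
        qed
        then show ?case unfolding s by simp
      qed
      show "(\<lambda>n. complex_of_real (indicator ((\<Union>i<n. A i) \<inter> box a b) \<zeta>)) \<longlonglongrightarrow> of_real (indicator ((\<Union>i. A i) \<inter> box a b) \<zeta>)" for \<zeta>
        unfolding indicator_inter_arith by (intro tendsto_of_real tendsto_mult tendsto_const LIMSEQ_indicator_UN)
      show "(\<lambda>\<zeta>. complex_of_real (indicator ((\<Union>i<n. A i) \<inter> box a b) \<zeta>)) \<in> borel_measurable borel" for n by measurable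
      show "(\<lambda>\<zeta>. complex_of_real (indicator ((\<Union>i. A i) \<inter> box a b) \<zeta>)) \<in> borel_measurable borel" by measurable
      show "norm (complex_of_real (indicator ((\<Union>i<n. A i) \<inter> box a b) \<zeta>)) \<le> norm (complex_of_real (indicator (box a b) \<zeta>))" for n \<zeta>
        by (simp add: indicator_def)
    qed (use fin[of a b] in auto)
  qed
  have fm: "fourier_dual f g (\<lambda>\<zeta>. of_real (indicator A \<zeta>))" if A [measurable]: "A \<in> sets borel" and "emeasure lborel A < \<infinity>" for A
  proof (rule fourier_dual_limit[OF f g _ _ indicator_L1_L2(1,2)[OF that], where u = "\<lambda>n \<zeta>. of_real (indicator (A \<inter> box (- c n) (c n)) \<zeta>)"])
    show "(\<lambda>n. complex_of_real (indicator (A \<inter> box (- c n) (c n)) \<zeta>)) \<longlonglongrightarrow> of_real (indicator A \<zeta>)" for \<zeta>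
    proof -
      obtain N where N: "norm \<zeta> < real N" using reals_Archimedean2 by blast
      have "\<zeta> \<in> box (- c n) (c n)" if "n \<ge> N" for n
        using N norm_fst_le[of "fst \<zeta>" "snd \<zeta>"] norm_snd_le[of "snd \<zeta>" "fst \<zeta>"] that
        by (auto simp: box_prod_real c_def)
      then have "eventually (\<lambda>n. complex_of_real (indicator (A \<inter> box (- c n) (c n)) \<zeta>) = of_real (indicator A \<zeta>)) sequentially"
        by (intro eventually_sequentiallyI[of N]) (auto simp: indicator_def)
      then show ?thesis by (rule tendsto_eventually)
    qed
    show "norm (complex_of_real (indicator (A \<inter> box (- c n) (c n)) \<zeta>)) \<le> norm (complex_of_real (indicator A \<zeta>))" for n \<zeta>
      by (simp add: indicator_def)
  qed (measurable, rule loc[OF A])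
  obtain s where s: "\<And>i. simple_function lborel (s i)" "\<And>i. emeasure lborel {y \<in> space lborel. s i y \<noteq> 0} \<noteq> \<infinity>"
     "\<And>x. x \<in> space lborel \<Longrightarrow> (\<lambda>i. s i x) \<longlonglongrightarrow> u x" "\<And>x i. x \<in> space lborel \<Longrightarrow> norm (s i x) \<le> 2 * norm (u x)"
    by (rule integrable_implies_simple_function_sequence[OF u(1)]) (rule that)
  have "integrable lborel (s i) \<and> L2_fun (s i) \<and> fourier_dual f g (s i)" for i
    using s(1,2)[of i]
  proof (induction rule: integrable_simple_function_induct)
    case (cong f' g')
    then have "f' = g'" by auto
    with cong show ?case by simp
  next
    case (indicator A y)
    have e: "(\<lambda>x. indicator A x *\<^sub>R y) = (\<lambda>x. y * complex_of_real (indicator A x))"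
      by (simp add: scaleR_conv_of_real mult.commute fun_eq_iff)
    show ?case
      unfolding e using indicator
      by (intro conjI integrable_mult_right indicator_L1_L2 L2_fun_cmult fourier_dual_cmult fm) simp_all
  next
    case (add f' g')
    then show ?case by (blast intro: fourier_dual_add f g L2_fun_add Bochner_Integration.integrable_add)
  qed
  then have s': "L2_fun (s i)" "fourier_dual f g (s i)" for i by blast+
  show ?thesis
  proof (rule fourier_dual_limit[OF f g, where u = s and U = "\<lambda>x. 2 * u x"])
    show "integrable lborel (\<lambda>x. 2 * u x)" "L2_fun (\<lambda>x. 2 * u x)"
      using u by (auto intro: L2_fun_cmult)
    show "norm (s n x) \<le> norm (2 * u x)" for n x using s(4)[of x n] by (simp add: norm_mult)
    show "(\<lambda>n. s n x) \<longlonglongrightarrow> u x" for x using s(3)[of x] by simp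
  qed (use s'(1) u(2) s'(2) in \<open>simp_all add: L2_fun_measurable\<close>)
qed

lemma bounded_support_L1_L2:
  fixes u :: "'a::euclidean_space \<Rightarrow> complex"
  assumes [measurable]: "u \<in> borel_measurable borel" and ub: "\<And>x. norm (u x) \<le> C * indicator (ball 0 r) x"
  shows "integrable lborel u" "L2_fun u"
proof -
  have fin: "emeasure lborel (ball (0::'a) r) < \<infinity>" using emeasure_bounded_finite[OF bounded_ball] by simp
  have le: "norm (u x) \<le> norm (of_real C * complex_of_real (indicator (ball 0 r) x))" for x
    using ub[of x] by (auto simp: norm_mult indicator_def intro: order_trans[OF _ abs_ge_self])
  show "integrable lborel u"
    by (rule Bochner_Integration.integrable_bound[OF integrable_mult_right[OF indicator_L1_L2(1)[OF _ fin]]]) (use le in auto)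
  show "L2_fun u"
    by (rule L2_fun_bound(1)[OF L2_fun_cmult[OF indicator_L1_L2(2)[OF _ fin]]]) (use le in auto)
qed

text \<open>The extremal test is the conjugate of \<open>g\<close>, truncated both in the domain and
  in height: the pairing becomes the square norm of the test, which is finite and can be cancelled.
  Fatou's lemma removes the truncation. So bounded tests of bounded support determine the
  norm.\<close>

lemma sq_norm_le_dual:
  fixes g :: "'a::euclidean_space \<Rightarrow> complex"
  assumes g: "L2_fun g"
    and bd: "\<And>u n. u \<in> borel_measurable borel \<Longrightarrow> (\<And>x. norm (u x) \<le> real n * indicator (ball 0 (real n)) x)
      \<Longrightarrow> (ennreal (norm (LBINT x. g x * u x)))^2 \<le> M * sq_norm u"
  shows "sq_norm g \<le> M"
proof -
  note [measurable] = L2_fun_measurable[OF g]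
  define A where "A n = {x \<in> ball 0 (real n). norm (g x) \<le> real n}" for n :: nat
  define u where "u n x = of_real (indicator (A n) x) * cnj (g x)" for n :: nat and x
  have [measurable]: "ball (0::'a) r \<in> sets borel" for r by simp
  have [measurable]: "A n \<in> sets borel" for n unfolding A_def by measurable
  have [measurable]: "u n \<in> borel_measurable borel" for n unfolding u_def[abs_def] by measurable
  have L2u: "L2_fun (u n)" for n
    by (rule L2_fun_bound[OF g]) (auto simp: u_def norm_mult indicator_def)
  have ub: "norm (u n x) \<le> real n * indicator (ball 0 (real n)) x" for n x
    by (auto simp: u_def A_def norm_mult indicator_def)
  have le: "sq_norm (u n) \<le> M" for n
  proof (cases "sq_norm (u n) = 0")
    case False
    have "(LBINT x. g x * u n x) = (LBINT x. complex_of_real ((norm (u n x))^2))"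
      by (intro Bochner_Integration.integral_cong) (auto simp: u_def indicator_def complex_norm_square[symmetric] simp del: of_real_power)
    then have e: "norm (LBINT x. g x * u n x) = (LBINT x. (norm (u n x))^2)"
      by (simp add: Bochner_Integration.integral_nonneg del: of_real_power)
    have i: "integrable lborel (\<lambda>x. (norm (u n x))^2)"
      using L2u[of n] by (intro integrableI_nonneg) (auto simp: L2_fun_def sq_norm_def)
    have "ennreal (LBINT x. (norm (u n x))^2) = sq_norm (u n)"
      unfolding sq_norm_def by (intro nn_integral_eq_integral[symmetric] i) auto
    then have "(sq_norm (u n))^2 \<le> M * sq_norm (u n)"
      using bd[of "u n" n, OF _ ub] e by simp
    then have "sq_norm (u n) * sq_norm (u n) \<le> sq_norm (u n) * M" by (simp add: power2_eq_square mult.commute)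
    moreover have "sq_norm (u n) < \<top>" using L2u[of n] by (simp add: L2_fun_def)
    ultimately show ?thesis using False by (metis ennreal_mult_le_mult_iff less_irrefl)
  qed simp
  have "sq_norm g = (\<integral>\<^sup>+x. liminf (\<lambda>n. nsq (u n x)))"
    unfolding sq_norm_def
  proof (rule nn_integral_cong)
    fix x :: 'a
    obtain N where N: "max (norm x) (norm (g x)) < real N" using reals_Archimedean2 by blast
    have "eventually (\<lambda>n. nsq (u n x) = nsq (g x)) sequentially"
      using N by (intro eventually_sequentiallyI[of N]) (auto simp: u_def A_def indicator_def)
    then have "(\<lambda>n. nsq (u n x)) \<longlonglongrightarrow> nsq (g x)" by (rule tendsto_eventually)
    then show "nsq (g x) = liminf (\<lambda>n. nsq (u n x))"
      by (subst lim_imp_Liminf) auto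
  qed
  also have "\<dots> \<le> liminf (\<lambda>n. sq_norm (u n))"
    unfolding sq_norm_def by (rule nn_integral_liminf) measurable
  also have "\<dots> \<le> M" by (intro Liminf_le always_eventually allI le) auto
  finally show ?thesis .
qed

definition fourier_rep :: "(real \<times> real \<Rightarrow> complex) \<Rightarrow> (real \<times> real \<Rightarrow> complex) \<Rightarrow> bool" where
  "fourier_rep f g \<longleftrightarrow> L2_fun f \<and> L2_fun g \<and> (\<forall>u. integrable lborel u \<longrightarrow> L2_fun u \<longrightarrow> fourier_dual f g u)"

text \<open>Duality carries Plancherel's inequality over from the integrable tests to the
  represented pair.\<close>

lemma fourier_rep_sq_norm:
  assumes "fourier_rep f g"
  shows "sq_norm g \<le> ennreal ((2 * pi)^2) * sq_norm f"
proof (rule sq_norm_le_dual)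
  show "L2_fun g" using assms by (simp add: fourier_rep_def)
  fix u :: "real \<times> real \<Rightarrow> complex" and n :: nat
  assume "u \<in> borel_measurable borel" "\<And>x. norm (u x) \<le> real n * indicator (ball 0 (real n)) x"
  from bounded_support_L1_L2[OF this] have u: "integrable lborel u" "L2_fun u" .
  have fm: "f \<in> borel_measurable borel" using assms by (simp add: fourier_rep_def L2_fun_def)
  have "(ennreal (norm (LBINT x. g x * u x)))^2 = (ennreal (norm (LBINT p. f p * fourier u p)))^2"
    using assms u by (simp add: fourier_rep_def fourier_dual_def)
  also have "\<dots> \<le> sq_norm f * sq_norm (fourier u)"
    by (intro integral_mult_sq_norm fm measurable_fourier L2_fun_measurable u)
  also have "\<dots> \<le> sq_norm f * (ennreal ((2 * pi)^2) * sq_norm u)"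
    by (intro mult_left_mono sq_norm_fourier u) auto
  finally show "(ennreal (norm (LBINT x. g x * u x)))^2 \<le> ennreal ((2 * pi)^2) * sq_norm f * sq_norm u"
    by (simp only: mult_ac)
qed

lemma sq_norm_shift: "f \<in> borel_measurable borel \<Longrightarrow> sq_norm (\<lambda>x. f (x + h)) = sq_norm f"
  unfolding sq_norm_def by (rule nn_integral_lborel_shift) measurable

lemma L2_fun_shift:
  assumes "L2_fun f" shows "L2_fun (\<lambda>x. f (x + h))"
proof -
  have [measurable]: "f \<in> borel_measurable borel" using assms by (simp add: L2_fun_def)
  have "(\<lambda>x. f (x + h)) \<in> borel_measurable borel" by measurable
  with assms show ?thesis by (simp add: L2_fun_def sq_norm_shift)
qed

lemma fourier_cis_mult: "fourier (\<lambda>\<zeta>. cis (h \<bullet> \<zeta>) * u \<zeta>) p = fourier u (p - h)"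
  unfolding fourier_eq
  by (intro Bochner_Integration.integral_cong refl)
     (simp add: inner_diff_right inner_commute cis_mult mult.assoc[symmetric])

text \<open>A translation of \<open>f\<close> is put on the transform of the test, where by
  \<open>fourier_cis_mult\<close> it comes from a modulation of the test itself.\<close>

lemma fourier_rep_translation:
  assumes "fourier_rep f g"
  shows "fourier_rep (\<lambda>p. f (p + h) - f p) (\<lambda>\<zeta>. (cis (h \<bullet> \<zeta>) - 1) * g \<zeta>)"
proof -
  have f: "L2_fun f" and g: "L2_fun g" and dual: "\<And>u. integrable lborel u \<Longrightarrow> L2_fun u \<Longrightarrow> fourier_dual f g u"
    using assms by (auto simp: fourier_rep_def)
  note [measurable] = L2_fun_measurable[OF f] L2_fun_measurable[OF g]
  have b: "norm (cis (h \<bullet> \<zeta>) - 1) \<le> 2" for \<zeta>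
    using norm_triangle_ineq4[of "cis (h \<bullet> \<zeta>)" 1] by simp
  have "fourier_dual (\<lambda>p. f (p + h) - f p) (\<lambda>\<zeta>. (cis (h \<bullet> \<zeta>) - 1) * g \<zeta>) u" if u: "integrable lborel u" "L2_fun u" for u
  proof -
    note [measurable] = L2_fun_measurable[OF u(2)]
    define u' where "u' \<zeta> = cis (h \<bullet> \<zeta>) * u \<zeta> - u \<zeta>" for \<zeta>
    have ic: "integrable lborel (\<lambda>\<zeta>. cis (h \<bullet> \<zeta>) * u \<zeta>)" by (intro integrable_cis_mult u) measurable
    have Lc: "L2_fun (\<lambda>\<zeta>. cis (h \<bullet> \<zeta>) * u \<zeta>)" by (rule L2_fun_bounded_mult[OF u(2), of _ 1]) auto
    have "integrable lborel u'" "L2_fun u'"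
      unfolding u'_def[abs_def] by (intro Bochner_Integration.integrable_diff L2_fun_diff ic u Lc)+
    from dual[OF this] have "(LBINT \<zeta>. g \<zeta> * u' \<zeta>) = (LBINT p. f p * fourier u' p)" by (simp add: fourier_dual_def)
    moreover have "(LBINT \<zeta>. g \<zeta> * u' \<zeta>) = (LBINT \<zeta>. (cis (h \<bullet> \<zeta>) - 1) * g \<zeta> * u \<zeta>)"
      by (intro Bochner_Integration.integral_cong) (auto simp: u'_def algebra_simps)
    moreover have "(LBINT p. f p * fourier u' p) = (LBINT p. (f (p + h) - f p) * fourier u p)"
    proof -
      have F: "L2_fun (fourier u)" by (intro L2_fun_fourier u)
      have i1: "integrable lborel (\<lambda>p. f (p + h) * fourier u p)" by (intro L2_fun_mult_integrable L2_fun_shift f F)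
      have i2: "integrable lborel (\<lambda>p. f p * fourier u p)" by (intro L2_fun_mult_integrable f F)
      have "(\<lambda>p. f p * fourier u (p - h)) = (\<lambda>p. (\<lambda>p. f (p + h) * fourier u p) (p + (- h)))" by simp
      then have i3: "integrable lborel (\<lambda>p. f p * fourier u (p - h))"
        using lborel_integrable_shift[OF i1, of "- h"] by simp
      have "(LBINT p. f p * fourier u' p) = (LBINT p. f p * fourier u (p - h) - f p * fourier u p)"
        unfolding u'_def by (simp add: fourier_diff[OF ic u(1)] fourier_cis_mult right_diff_distrib)
      also have "\<dots> = (LBINT p. f p * fourier u (p - h)) - (LBINT p. f p * fourier u p)"
        by (intro Bochner_Integration.integral_diff i3 i2)
      also have "(LBINT p. f p * fourier u (p - h)) = (LBINT p. f (p + h) * fourier u p)"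
        using lborel_integral_shift[of "\<lambda>p. f p * fourier u (p - h)" h] by simp
      also have "\<dots> - (LBINT p. f p * fourier u p) = (LBINT p. (f (p + h) - f p) * fourier u p)"
        unfolding left_diff_distrib by (intro Bochner_Integration.integral_diff[symmetric] i1 i2)
      finally show ?thesis .
    qed
    ultimately show ?thesis by (simp add: fourier_dual_def)
  qed
  moreover have "L2_fun (\<lambda>\<zeta>. (cis (h \<bullet> \<zeta>) - 1) * g \<zeta>)"
    by (rule L2_fun_bounded_mult[OF g, of _ 2]) (use b in auto)
  ultimately show ?thesis by (auto simp: fourier_rep_def intro!: L2_fun_diff L2_fun_shift f)
qed

section \<open>Dirichlet \<open>H\<^sup>1\<close> functions on the strip\<close>

lemma L2_fun_sum:
  assumes "finite J" "\<And>j. j \<in> J \<Longrightarrow> L2_fun (f j)"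
  shows "L2_fun (\<lambda>x. \<Sum>j\<in>J. f j x)"
  using assms
proof (induction J)
  case empty
  show ?case by (simp add: L2_fun_def sq_norm_def)
qed (auto intro!: L2_fun_add)

lemma bessel_inequality:
  fixes w :: "real \<Rightarrow> complex" and c :: "nat \<Rightarrow> real \<Rightarrow> real"
  assumes w: "L2_fun w" and fin: "finite J"
    and cm: "\<And>j. L2_fun (\<lambda>y. complex_of_real (c j y))"
    and orth: "\<And>i j. i \<in> J \<Longrightarrow> j \<in> J \<Longrightarrow> (LBINT y. c i y * c j y) = (if i = j then 1 else 0)"
  shows "(\<Sum>j\<in>J. nsq (LBINT y. w y * of_real (c j y))) \<le> sq_norm w"
proof -
  define a where "a j = (LBINT y. w y * of_real (c j y))" for j
  define s where "s y = (\<Sum>j\<in>J. a j * of_real (c j y))" for y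
  define A where "A = (\<Sum>j\<in>J. (norm (a j))^2)"
  have iw: "integrable lborel (\<lambda>y. w y * of_real (c j y))" for j by (rule L2_fun_mult_integrable[OF w cm])
  have icc: "integrable lborel (\<lambda>y. complex_of_real (c i y * c j y))" for i j
    using L2_fun_mult_integrable[OF cm cm, of i j] by simp
  have cc: "(LBINT y. complex_of_real (c i y * c j y)) = (if i = j then 1 else 0)" if "i \<in> J" "j \<in> J" for i j
    using orth[OF that] by (simp only: integral_complex_of_real) simp
  have sL: "L2_fun s" unfolding s_def[abs_def]
    by (intro L2_fun_sum fin L2_fun_cmult cm)
  have ws_eq: "w y * cnj (s y) = (\<Sum>j\<in>J. cnj (a j) * (w y * of_real (c j y)))" for y
    by (simp add: s_def sum_distrib_left mult_ac)
  have ws: "(LBINT y. w y * cnj (s y)) = of_real A"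
    unfolding ws_eq using iw
    by (simp add: Bochner_Integration.integral_sum integrable_mult_right a_def[symmetric] A_def complex_norm_square mult.commute del: of_real_power)
  have iws: "integrable lborel (\<lambda>y. w y * cnj (s y))"
    unfolding ws_eq using iw by (intro Bochner_Integration.integrable_sum integrable_mult_right)
  have ss_eq: "s y * cnj (s y) = (\<Sum>i\<in>J. \<Sum>j\<in>J. (a i * cnj (a j)) * of_real (c i y * c j y))" for y
    by (simp add: s_def sum_product mult_ac)
  have iss: "integrable lborel (\<lambda>y. s y * cnj (s y))"
    unfolding ss_eq using icc by (intro Bochner_Integration.integrable_sum integrable_mult_right)
  have "(LBINT y. s y * cnj (s y)) = (\<Sum>i\<in>J. \<Sum>j\<in>J. (a i * cnj (a j)) * (LBINT y. complex_of_real (c i y * c j y)))"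
    unfolding ss_eq by (subst Bochner_Integration.integral_sum, intro Bochner_Integration.integrable_sum integrable_mult_right icc)
       (intro sum.cong refl, subst Bochner_Integration.integral_sum, intro integrable_mult_right icc, simp)
  also have "\<dots> = (\<Sum>i\<in>J. \<Sum>j\<in>J. (a i * cnj (a j)) * (if i = j then 1 else 0))"
    by (intro sum.cong refl) (simp only: cc)
  also have "\<dots> = of_real A"
    using fin by (simp add: A_def complex_norm_square sum.delta if_distrib cong: if_cong del: of_real_power)
  finally have ss: "(LBINT y. s y * cnj (s y)) = of_real A" .
  have iww: "integrable lborel (\<lambda>y. (norm (w y))^2)"
    using w by (intro integrableI_nonneg) (auto simp: L2_fun_def sq_norm_def)
  have pt: "(norm (w y - s y))^2 = (norm (w y))^2 - 2 * Re (w y * cnj (s y)) + Re (s y * cnj (s y))" for y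
    unfolding cmod_power2 by (simp add: power2_eq_square algebra_simps)
  have "0 \<le> (LBINT y. (norm (w y - s y))^2)" by simp
  also have "\<dots> = (LBINT y. (norm (w y))^2) - 2 * (LBINT y. Re (w y * cnj (s y))) + (LBINT y. Re (s y * cnj (s y)))"
    unfolding pt
    by (subst Bochner_Integration.integral_add, intro Bochner_Integration.integrable_diff integrable_mult_right iww integrable_Re iws,
        rule integrable_Re[OF iss], subst Bochner_Integration.integral_diff, rule iww, intro integrable_mult_right integrable_Re iws,
        simp only: integral_mult_right_zero)
  also have "(LBINT y. Re (w y * cnj (s y))) = A" using ws iws by (simp only: integral_Re Re_complex_of_real)
  also have "(LBINT y. Re (s y * cnj (s y))) = A" using ss iss by (simp only: integral_Re Re_complex_of_real)
  finally have "A \<le> (LBINT y. (norm (w y))^2)" by simp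
  then have "ennreal A \<le> ennreal (LBINT y. (norm (w y))^2)" by (rule ennreal_leI)
  also have "\<dots> = sq_norm w" unfolding sq_norm_def by (rule nn_integral_eq_integral[symmetric]) (use iww in auto)
  finally show ?thesis by (simp add: A_def a_def sum_ennreal)
qed

definition cosfun :: "real \<Rightarrow> nat \<Rightarrow> real \<Rightarrow> real" where
  "cosfun B k y = cos (real k * pi * y / B)"

lemma eigfun_eq: "B > 0 \<Longrightarrow> eigfun B k y = sqrt (2 / B) * sin (real k * pi * y / B)"
  by (simp add: eigfun_def lam_def)

lemma measurable_eigfun [measurable]: "eigfun B k \<in> borel_measurable borel"
  unfolding eigfun_def[abs_def] by measurable

lemma measurable_cosfun [measurable]: "cosfun B k \<in> borel_measurable borel"
  unfolding cosfun_def[abs_def] by measurable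

lemma eigfun_bound: "\<bar>eigfun B k y\<bar> \<le> sqrt (2 / B)" if "B > 0"
proof -
  have "\<bar>eigfun B k y\<bar> = sqrt (2 / B) * \<bar>sin (real k * pi * y / B)\<bar>" using that by (simp add: eigfun_eq abs_mult)
  also have "\<dots> \<le> sqrt (2 / B) * 1" using that by (intro mult_left_mono) auto
  finally show ?thesis by simp
qed

lemma cosfun_bound: "\<bar>cosfun B k y\<bar> \<le> 1"
  by (simp add: cosfun_def)

lemma integral_cos_interval:
  fixes m :: int
  assumes "B > 0"
  shows "(LBINT y. indicator {0<..<B} y * cos (of_int m * pi * y / B)) = (if m = 0 then B else 0)"
proof -
  have "(LBINT y. indicator {0<..<B} y * cos (of_int m * pi * y / B)) = (LBINT y. indicator {0..B} y * cos (of_int m * pi * y / B))"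
  proof (rule integral_cong_AE)
    have "AE y in lborel. y \<noteq> (0::real)" "AE y in lborel. y \<noteq> B" by (rule AE_lborel_singleton)+
    then show "AE y in lborel. indicator {0<..<B} y * cos (of_int m * pi * y / B) = indicator {0..B} y * cos (of_int m * pi * y / B)"
      by eventually_elim (auto simp: indicator_def)
  qed measurable
  also have "\<dots> = (if m = 0 then B else 0)"
  proof (cases "m = 0")
    case True
    then show ?thesis using assms by simp
  next
    case False
    define r where "r = of_int m * pi / B"
    have r: "r \<noteq> 0" using False assms by (simp add: r_def)
    have "(LBINT y. indicator {0..B} y *\<^sub>R cos (r * y)) = sin (r * B) / r - sin (r * 0) / r"
      using assms r by (intro integral_FTC_Icc) (auto intro!: derivative_eq_intros continuous_intros simp: has_real_derivative_iff_has_vector_derivative[symmetric])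
    also have "sin (r * B) = 0" using assms by (simp add: r_def sin_zero_iff_int2)
    finally show ?thesis using False by (simp add: r_def mult_ac)
  qed
  finally show ?thesis .
qed

text \<open>The constant cosine \<open>i = 0\<close> has the integral \<open>B\<close>, twice that
  of the others; hence a lower bound \<open>B / 2\<close> for all \<open>i\<close> stands beside the
  exact value for \<open>i \<ge> 1\<close>.\<close>

lemma
  assumes B: "B > 0"
  shows cosfun_orthogonal: "i \<noteq> j \<Longrightarrow> (LBINT y. indicator {0<..<B} y * (cosfun B i y * cosfun B j y)) = 0"
    and cosfun_norm: "B / 2 \<le> (LBINT y. indicator {0<..<B} y * (cosfun B i y * cosfun B i y))"
    and cosfun_norm_pos: "i \<ge> 1 \<Longrightarrow> (LBINT y. indicator {0<..<B} y * (cosfun B i y * cosfun B i y)) = B / 2"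
    and eigfun_orthonormal: "i \<ge> 1 \<Longrightarrow> j \<ge> 1 \<Longrightarrow> (LBINT y. indicator {0<..<B} y * (eigfun B i y * eigfun B j y)) = (if i = j then 1 else 0)"
proof -
  have I: "integrable lborel (\<lambda>y. indicator {0<..<B} y * cos (of_int m * pi * y / B))" for m :: int
  proof (rule Bochner_Integration.integrable_bound)
    show "integrable lborel (indicator {0<..<B} :: real \<Rightarrow> real)" using B by (intro integrable_real_indicator) auto
    show "AE y in lborel. norm (indicator {0<..<B} y * cos (of_int m * pi * y / B)) \<le> norm (indicator {0<..<B} y :: real)"
      by (auto simp: indicator_def)
  qed measurable
  let ?I = "\<lambda>m::int. LBINT y. indicator {0<..<B} y * cos (of_int m * pi * y / B)"
  have cc: "(LBINT y. indicator {0<..<B} y * (cosfun B i y * cosfun B j y)) = (?I (int i - int j) + ?I (int i + int j)) / 2" for i j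
  proof -
    have "(LBINT y. indicator {0<..<B} y * (cosfun B i y * cosfun B j y)) = (LBINT y. (indicator {0<..<B} y * cos (of_int (int i - int j) * pi * y / B) + indicator {0<..<B} y * cos (of_int (int i + int j) * pi * y / B)) / 2)"
      by (intro Bochner_Integration.integral_cong refl)
         (simp add: cosfun_def cos_times_cos algebra_simps diff_divide_distrib add_divide_distrib)
    also have "\<dots> = (?I (int i - int j) + ?I (int i + int j)) / 2" by (simp only: integral_divide_zero Bochner_Integration.integral_add[OF I I])
    finally show ?thesis .
  qed
  have ee: "(LBINT y. indicator {0<..<B} y * (eigfun B i y * eigfun B j y)) = (?I (int i - int j) - ?I (int i + int j)) / B" for i j
  proof -
    define q where "q = sqrt (2 / B)"
    have q: "2 / B = q * q" using B by (simp add: q_def)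
    have e: "eigfun B i y * eigfun B j y = 2 / B * (sin (real i * pi * y / B) * sin (real j * pi * y / B))" for y
      unfolding eigfun_eq[OF B] q_def[symmetric] unfolding q by (simp only: mult_ac)
    have "(LBINT y. indicator {0<..<B} y * (eigfun B i y * eigfun B j y)) = (LBINT y. (indicator {0<..<B} y * cos (of_int (int i - int j) * pi * y / B) - indicator {0<..<B} y * cos (of_int (int i + int j) * pi * y / B)) / B)"
      unfolding e by (intro Bochner_Integration.integral_cong refl)
         (simp add: sin_times_sin algebra_simps diff_divide_distrib add_divide_distrib)
    also have "\<dots> = (?I (int i - int j) - ?I (int i + int j)) / B" by (simp only: integral_divide_zero Bochner_Integration.integral_diff[OF I I])
    finally show ?thesis .
  qed
  note c = integral_cos_interval[OF B]
  show "i \<noteq> j \<Longrightarrow> (LBINT y. indicator {0<..<B} y * (cosfun B i y * cosfun B j y)) = 0" unfolding cc c by auto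
  show "B / 2 \<le> (LBINT y. indicator {0<..<B} y * (cosfun B i y * cosfun B i y))" unfolding cc c using B by auto
  show "i \<ge> 1 \<Longrightarrow> (LBINT y. indicator {0<..<B} y * (cosfun B i y * cosfun B i y)) = B / 2" unfolding cc c by auto
  show "i \<ge> 1 \<Longrightarrow> j \<ge> 1 \<Longrightarrow> (LBINT y. indicator {0<..<B} y * (eigfun B i y * eigfun B j y)) = (if i = j then 1 else 0)" unfolding ee c using B by auto
qed

lemma interval_bounded_L2:
  fixes h :: "real \<Rightarrow> real"
  assumes [measurable]: "h \<in> borel_measurable borel" and "\<And>y. \<bar>h y\<bar> \<le> C"
  shows "L2_fun (\<lambda>y. complex_of_real (indicator {0<..<B} y * h y))"
proof -
  have "L2_fun (\<lambda>y. complex_of_real (h y) * complex_of_real (indicator {0<..<B} y))"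
    using assms emeasure_bounded_finite[of "{0<..<B}"] by (intro L2_fun_bounded_mult[where C = C] indicator_L1_L2) auto
  then show ?thesis by (simp add: mult.commute)
qed

lemma bessel_eigfun:
  assumes B: "B > 0" and w: "L2_fun w" and J: "finite J" "0 \<notin> J"
  shows "(\<Sum>j\<in>J. nsq (LBINT y. w y * of_real (indicator {0<..<B} y * eigfun B j y))) \<le> sq_norm w"
proof (rule bessel_inequality[OF w J(1)])
  show "L2_fun (\<lambda>y. complex_of_real (indicator {0<..<B} y * eigfun B j y))" for j
    by (rule interval_bounded_L2[OF _ eigfun_bound[OF B]]) measurable
  fix i j assume "i \<in> J" "j \<in> J"
  with J have "i \<ge> 1" "j \<ge> 1" by (auto simp: Suc_le_eq intro: gr0I)
  have "(LBINT y. indicator {0<..<B} y * eigfun B i y * (indicator {0<..<B} y * eigfun B j y)) = (LBINT y. indicator {0<..<B} y * (eigfun B i y * eigfun B j y))"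
    by (intro Bochner_Integration.integral_cong) (auto simp: indicator_def)
  then show "(LBINT y. indicator {0<..<B} y * eigfun B i y * (indicator {0<..<B} y * eigfun B j y)) = (if i = j then 1 else 0)"
    using eigfun_orthonormal[OF B \<open>i \<ge> 1\<close> \<open>j \<ge> 1\<close>] by simp
qed

lemma bessel_cosfun:
  assumes B: "B > 0" and w: "L2_fun w" and J: "finite J" "0 \<notin> J"
  shows "(\<Sum>j\<in>J. nsq (LBINT y. w y * of_real (indicator {0<..<B} y * (sqrt (2 / B) * cosfun B j y)))) \<le> sq_norm w"
proof (rule bessel_inequality[OF w J(1)])
  show "L2_fun (\<lambda>y. complex_of_real (indicator {0<..<B} y * (sqrt (2 / B) * cosfun B j y)))" for j
    by (rule interval_bounded_L2[where C = "sqrt (2 / B) * 1"])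
       (use B in \<open>auto simp: abs_mult intro!: mult_left_mono cosfun_bound\<close>)
  fix i j assume "i \<in> J" "j \<in> J"
  with J have "i \<ge> 1" "j \<ge> 1" by (auto simp: Suc_le_eq intro: gr0I)
  define q where "q = sqrt (2 / B)"
  have q: "2 / B = q * q" using B by (simp add: q_def)
  have "indicator {0<..<B} y * (sqrt (2 / B) * cosfun B i y) * (indicator {0<..<B} y * (sqrt (2 / B) * cosfun B j y)) = 2 / B * (indicator {0<..<B} y * (cosfun B i y * cosfun B j y))" for y
    unfolding q_def[symmetric] unfolding q by (auto simp: indicator_def)
  then have "(LBINT y. indicator {0<..<B} y * (sqrt (2 / B) * cosfun B i y) * (indicator {0<..<B} y * (sqrt (2 / B) * cosfun B j y))) = 2 / B * (LBINT y. indicator {0<..<B} y * (cosfun B i y * cosfun B j y))"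
    by simp
  then show "(LBINT y. indicator {0<..<B} y * (sqrt (2 / B) * cosfun B i y) * (indicator {0<..<B} y * (sqrt (2 / B) * cosfun B j y))) = (if i = j then 1 else 0)"
    using cosfun_orthogonal[OF B, of i j] cosfun_norm_pos[OF B \<open>i \<ge> 1\<close>] B by auto
qed

section \<open>Integration by parts in the plane\<close>

definition C1_fun :: "(real \<times> real \<Rightarrow> complex) \<Rightarrow> bool" where
  "C1_fun f \<longleftrightarrow> (\<forall>p. f differentiable (at p)) \<and> (\<forall>d\<in>Basis. continuous_on UNIV (dir_deriv d f))"

lemma C1_fun_continuous: "C1_fun f \<Longrightarrow> continuous_on UNIV f"
  by (intro differentiable_imp_continuous_on) (auto simp: differentiable_on_def C1_fun_def)

lemma C1_fun_measurable:
  assumes "C1_fun f"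
  shows "f \<in> borel_measurable borel" "d \<in> Basis \<Longrightarrow> dir_deriv d f \<in> borel_measurable borel"
  using assms C1_fun_continuous[OF assms] by (auto simp: C1_fun_def intro!: borel_measurable_continuous_onI)

lemma smooth_fun_C1:
  assumes "smooth_fun f" shows "C1_fun f"
proof -
  have "f differentiable (at p)" for p
  proof -
    have "iter_partial [] f differentiable (at p)" using assms unfolding smooth_fun_def by blast
    then show ?thesis by (simp add: iter_partial_def)
  qed
  moreover have "continuous_on UNIV (dir_deriv d f)" if "d \<in> Basis" for d
  proof -
    have "dir_deriv d f differentiable (at p)" for p
    proof -
      have "[d] \<in> lists Basis" using that by simp
      then have "iter_partial [d] f differentiable (at p)" using assms unfolding smooth_fun_def by blast
      then show ?thesis by (simp add: iter_partial_def)
    qed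
    then show ?thesis by (intro differentiable_imp_continuous_on) (auto simp: differentiable_on_def)
  qed
  ultimately show ?thesis by (simp add: C1_fun_def)
qed

lemma dir_deriv_along_line:
  assumes "\<And>p. f differentiable (at p)"
  shows "((\<lambda>s. f (p + s *\<^sub>R d)) has_vector_derivative dir_deriv d f (p + s *\<^sub>R d)) (at s within S)"
proof -
  obtain f' where f': "(f has_derivative f') (at (p + s *\<^sub>R d))"
    using assms[of "p + s *\<^sub>R d"] unfolding differentiable_def by blast
  have "((\<lambda>s. p + s *\<^sub>R d) has_derivative (\<lambda>s. s *\<^sub>R d)) (at s within S)"
    by (auto intro!: derivative_eq_intros)
  from has_derivative_compose[OF this f'] have "((\<lambda>s. f (p + s *\<^sub>R d)) has_derivative (\<lambda>s. f' (s *\<^sub>R d))) (at s within S)" .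
  moreover have "f' (r *\<^sub>R d) = r *\<^sub>R f' d" for r
    using f' by (intro linear_scale has_derivative_linear)
  ultimately show ?thesis
    by (simp add: has_vector_derivative_def has_derivative_imp_dir_deriv[OF f'])
qed

lemma vector_derivative_quotient:
  fixes f :: "real \<Rightarrow> complex"
  assumes "(f has_vector_derivative D) (at x)"
  shows "((\<lambda>s. (f (x + s) - f x) /\<^sub>R s) \<longlongrightarrow> D) (at 0)"
  using assms unfolding has_vector_derivative_complex_iff tendsto_complex_iff
  by (auto simp: DERIV_def divide_inverse mult.commute)

lemma dir_deriv_mult:
  assumes "f differentiable (at p)" "g differentiable (at p)"
  shows "dir_deriv d (\<lambda>p. f p * g p) p = dir_deriv d f p * g p + f p * dir_deriv d g p"
proof -
  obtain f' g' where d: "(f has_derivative f') (at p)" "(g has_derivative g') (at p)"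
    using assms unfolding differentiable_def by blast
  show ?thesis
    using has_derivative_imp_dir_deriv[OF has_derivative_mult[OF d]] has_derivative_imp_dir_deriv[OF d(1)] has_derivative_imp_dir_deriv[OF d(2)]
    by simp
qed

text \<open>Difference quotients have integral 0 by translation invariance. Their steps are at most
  1, so all of them live in one ball, and the mean value inequality dominates them.\<close>

lemma integral_dir_deriv_eq_0:
  fixes H :: "real \<times> real \<Rightarrow> complex"
  assumes H: "C1_fun H" and d: "d \<in> Basis" and K: "compact K" "\<And>p. p \<notin> K \<Longrightarrow> H p = 0"
  shows "(LBINT p. dir_deriv d H p) = 0"
proof -
  note [measurable] = C1_fun_measurable[OF H]
  have diff: "\<And>p. H differentiable (at p)" and cont: "continuous_on UNIV (dir_deriv d H)"
    using H d by (auto simp: C1_fun_def)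
  have "bounded (dir_deriv d H ` K)"
    by (intro compact_imp_bounded compact_continuous_image K continuous_on_subset[OF cont]) auto
  then obtain C where C: "C > 0" "\<And>p. p \<in> K \<Longrightarrow> norm (dir_deriv d H p) \<le> C"
    by (auto simp: bounded_pos)
  have C': "norm (dir_deriv d H p) \<le> C" for p
    using C dir_deriv_eq_0_outside[OF compact_imp_closed[OF K(1)] K(2), where p = p and d = d] by (cases "p \<in> K") auto
  obtain r where r: "\<And>p. p \<in> K \<Longrightarrow> norm p \<le> r" using compact_imp_bounded[OF K(1)] by (auto simp: bounded_iff)
  define s where "s n = 1 / real (Suc n)" for n
  have s: "0 < s n" "s n \<le> 1" for n by (auto simp: s_def)
  have nd: "norm d = 1" using d by simp
  have iH: "integrable lborel H"
  proof -
    have "integrable lborel (\<lambda>p. indicator K p *\<^sub>R H p)"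
      by (intro borel_integrable_compact K continuous_on_subset[OF C1_fun_continuous[OF H]]) auto
    moreover have "(\<lambda>p. indicator K p *\<^sub>R H p) = H" using K(2) by (auto simp: indicator_def)
    ultimately show ?thesis by simp
  qed
  have "(\<lambda>n. LBINT p. (H (p + s n *\<^sub>R d) - H p) /\<^sub>R s n) \<longlonglongrightarrow> (LBINT p. dir_deriv d H p)"
  proof (rule integral_dominated_convergence[where w = "\<lambda>p. C * indicator (cball 0 (r + 1)) p"])
    show "dir_deriv d H \<in> borel_measurable lborel" using C1_fun_measurable(2)[OF H d] by simp
    show "integrable lborel (\<lambda>p. C * indicator (cball (0::real \<times> real) (r + 1)) p)"
      using emeasure_bounded_finite[OF bounded_cball, of "0::real \<times> real" "r + 1"] by (intro integrable_mult_right integrable_real_indicator) auto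
    have s0: "filterlim s (at 0) sequentially"
    proof -
      have "s \<longlonglongrightarrow> 0" unfolding s_def[abs_def] by (rule lim_1_over_n[THEN LIMSEQ_Suc])
      then show ?thesis unfolding filterlim_at using s(1)[THEN less_imp_neq, THEN not_sym] by simp
    qed
    show "AE p in lborel. (\<lambda>n. (H (p + s n *\<^sub>R d) - H p) /\<^sub>R s n) \<longlonglongrightarrow> dir_deriv d H p"
    proof (intro always_eventually allI)
      fix p
      have "((\<lambda>s. H (p + s *\<^sub>R d)) has_vector_derivative dir_deriv d H (p + 0 *\<^sub>R d)) (at 0)"
        by (rule dir_deriv_along_line[OF diff])
      from vector_derivative_quotient[OF this]
      have "((\<lambda>s. (H (p + s *\<^sub>R d) - H p) /\<^sub>R s) \<longlongrightarrow> dir_deriv d H p) (at 0)" by simp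
      from filterlim_compose[OF this s0] show "(\<lambda>n. (H (p + s n *\<^sub>R d) - H p) /\<^sub>R s n) \<longlonglongrightarrow> dir_deriv d H p" .
    qed
    show "AE p in lborel. norm ((H (p + s n *\<^sub>R d) - H p) /\<^sub>R s n) \<le> C * indicator (cball 0 (r + 1)) p" for n
    proof (intro always_eventually allI)
      fix p
      show "norm ((H (p + s n *\<^sub>R d) - H p) /\<^sub>R s n) \<le> C * indicator (cball 0 (r + 1)) p"
      proof (cases "norm p \<le> r + 1")
        case True
        have "norm (H (p + s n *\<^sub>R d) - H (p + 0 *\<^sub>R d)) \<le> C * norm (s n - 0)"
        proof (rule differentiable_bound[where S = UNIV])
          show "((\<lambda>s. H (p + s *\<^sub>R d)) has_derivative (\<lambda>h. h *\<^sub>R dir_deriv d H (p + x *\<^sub>R d))) (at x)" for x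
            using dir_deriv_along_line[OF diff, of p d x UNIV] by (simp add: has_vector_derivative_def)
          show "onorm (\<lambda>h. h *\<^sub>R dir_deriv d H (p + x *\<^sub>R d)) \<le> C" for x
          proof (rule onorm_le)
            fix h :: real
            show "norm (h *\<^sub>R dir_deriv d H (p + x *\<^sub>R d)) \<le> C * norm h"
              using mult_left_mono[OF C', of "\<bar>h\<bar>" "p + x *\<^sub>R d"] by (simp add: mult.commute)
          qed
        qed auto
        moreover have "norm ((H (p + s n *\<^sub>R d) - H p) /\<^sub>R s n) = norm (H (p + s n *\<^sub>R d) - H p) / s n"
          using s(1)[of n] by (simp add: divide_inverse mult.commute del: scaleR_right_diff_distrib)
        ultimately show ?thesis using True s(1)[of n] by (simp add: pos_divide_le_eq)
      next
        case False
        have "norm p \<le> norm (p + s n *\<^sub>R d) + norm (s n *\<^sub>R d)"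
          using norm_triangle_ineq4[of "p + s n *\<^sub>R d" "s n *\<^sub>R d"] by simp
        then have "norm (p + s n *\<^sub>R d) > r" using False s[of n] nd by simp
        then have "H (p + s n *\<^sub>R d) = 0" "H p = 0" using False r K(2) by fastforce+
        then show ?thesis using False by simp
      qed
    qed
  qed measurable
  moreover have "(LBINT p. (H (p + s n *\<^sub>R d) - H p) /\<^sub>R s n) = 0" for n
  proof -
    have "(LBINT p. H (p + s n *\<^sub>R d) - H p) = (LBINT p. H (p + s n *\<^sub>R d)) - (LBINT p. H p)"
      by (intro Bochner_Integration.integral_diff lborel_integrable_shift iH)
    also have "\<dots> = 0" by (subst lborel_integral_shift) auto
    finally show ?thesis by simp
  qed
  ultimately have "(\<lambda>n. 0) \<longlonglongrightarrow> (LBINT p. dir_deriv d H p)" by (simp only:)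
  then show ?thesis by (simp add: LIMSEQ_const_iff)
qed

lemma C1_fun_mult: "C1_fun f \<Longrightarrow> C1_fun g \<Longrightarrow> C1_fun (\<lambda>p. f p * g p)"
  unfolding C1_fun_def
proof (intro conjI allI ballI)
  fix d :: "real \<times> real" assume h: "(\<forall>p. f differentiable at p) \<and> (\<forall>d\<in>Basis. continuous_on UNIV (dir_deriv d f))"
    "(\<forall>p. g differentiable at p) \<and> (\<forall>d\<in>Basis. continuous_on UNIV (dir_deriv d g))" and d: "d \<in> Basis"
  have "dir_deriv d (\<lambda>p. f p * g p) = (\<lambda>p. dir_deriv d f p * g p + f p * dir_deriv d g p)"
    using h by (intro ext dir_deriv_mult) auto
  moreover have "continuous_on UNIV f" "continuous_on UNIV g"
    using h by (auto intro!: C1_fun_continuous simp: C1_fun_def)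
  ultimately show "continuous_on UNIV (dir_deriv d (\<lambda>p. f p * g p))"
    using h d by (auto intro!: continuous_intros)
qed auto

lemma bump_C1: "C1_fun (bump a b n)"
  by (intro smooth_fun_C1 smooth_prod_smooth_fun bump_smooth_prod)

lemma bump_zero_outside: "p \<notin> cbox a b \<Longrightarrow> bump a b n p = 0"
proof -
  assume "p \<notin> cbox a b"
  then have "p \<notin> box a b" using box_subset_cbox by blast
  then show ?thesis using norm_bump_le[of a b n p] by simp
qed

lemma integration_by_parts_bump:
  assumes f: "C1_fun f" and d: "d \<in> Basis"
  shows "(LBINT p. f p * dir_deriv d (bump a b n) p) = - (LBINT p. dir_deriv d f p * bump a b n p)"
    "integrable lborel (\<lambda>p. f p * dir_deriv d (bump a b n) p)" "integrable lborel (\<lambda>p. dir_deriv d f p * bump a b n p)"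
proof -
  have z: "dir_deriv d (bump a b n) p = 0" if "p \<notin> cbox a b" for p
    by (rule dir_deriv_eq_0_outside[OF closed_cbox bump_zero_outside that])
  have int: "integrable lborel h" if "continuous_on UNIV h" "\<And>p. p \<notin> cbox a b \<Longrightarrow> h p = 0" for h :: "real \<times> real \<Rightarrow> complex"
  proof -
    have "integrable lborel (\<lambda>p. indicator (cbox a b) p *\<^sub>R h p)"
      by (intro borel_integrable_compact continuous_on_subset[OF that(1)]) auto
    moreover have "(\<lambda>p. indicator (cbox a b) p *\<^sub>R h p) = h" using that(2) by (auto simp: indicator_def)
    ultimately show ?thesis by simp
  qed
  have c: "continuous_on UNIV f" "continuous_on UNIV (dir_deriv d f)" "continuous_on UNIV (bump a b n)" "continuous_on UNIV (dir_deriv d (bump a b n))"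
    using f d bump_C1[of a b n] by (auto simp: C1_fun_continuous C1_fun_def)
  show 1: "integrable lborel (\<lambda>p. f p * dir_deriv d (bump a b n) p)"
    by (intro int continuous_intros c) (simp add: z)
  show 2: "integrable lborel (\<lambda>p. dir_deriv d f p * bump a b n p)"
    by (intro int continuous_intros c) (simp add: bump_zero_outside)
  have "(LBINT p. dir_deriv d (\<lambda>p. f p * bump a b n p) p) = 0"
    by (rule integral_dir_deriv_eq_0[OF C1_fun_mult[OF f bump_C1] d compact_cbox[of a b]]) (simp add: bump_zero_outside)
  also have "(\<lambda>p. dir_deriv d (\<lambda>p. f p * bump a b n p) p) = (\<lambda>p. dir_deriv d f p * bump a b n p + f p * dir_deriv d (bump a b n) p)"
    using f bump_C1[of a b n] by (intro ext dir_deriv_mult) (auto simp: C1_fun_def)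
  finally have "(LBINT p. dir_deriv d f p * bump a b n p) + (LBINT p. f p * dir_deriv d (bump a b n) p) = 0"
    using 1 2 by simp
  then show "(LBINT p. f p * dir_deriv d (bump a b n) p) = - (LBINT p. dir_deriv d f p * bump a b n p)"
    by (simp add: eq_neg_iff_add_eq_0 add.commute)
qed

section \<open>Weak derivatives and traces on the strip\<close>

definition restr :: "'a set \<Rightarrow> ('a \<Rightarrow> complex) \<Rightarrow> 'a \<Rightarrow> complex" where
  "restr S f p = indicator S p *\<^sub>R f p"

lemma restr_simps: "p \<in> S \<Longrightarrow> restr S f p = f p" "p \<notin> S \<Longrightarrow> restr S f p = 0"
  by (auto simp: restr_def)

lemma L2_sq_eq: "L2_sq S f = sq_norm (restr S f)"
  unfolding L2_sq_def sq_norm_def by (intro nn_integral_cong) (auto simp: restr_def indicator_def)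

lemma L2_space_iff: "f \<in> L2_space S \<longleftrightarrow> L2_fun (restr S f)"
  by (simp add: L2_space_def L2_fun_def L2_sq_eq set_borel_measurable_def restr_def[abs_def])

lemma weak_deriv_props:
  assumes "f \<in> H1_space S" "d \<in> Basis"
  shows "weak_deriv S d f \<in> L2_space S" "is_weak_deriv S d f (weak_deriv S d f)"
proof -
  have "\<exists>g. g \<in> L2_space S \<and> is_weak_deriv S d f g" using assms by (auto simp: H1_space_def)
  from someI_ex[OF this] show "weak_deriv S d f \<in> L2_space S" "is_weak_deriv S d f (weak_deriv S d f)"
    by (auto simp: weak_deriv_def)
qed

lemma strip_sets [measurable]: "strip B \<in> sets borel"
proof -
  have "strip B = {p. 0 < snd p} \<inter> {p. snd p < B}" by (auto simp: strip_def)
  also have "open \<dots>" by (intro open_Int open_Collect_less continuous_intros)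
  then have "\<dots> \<in> sets borel" by (rule borel_open)
  finally show ?thesis .
qed

lemma mem_strip: "p \<in> strip B \<longleftrightarrow> 0 < snd p \<and> snd p < B"
  by (auto simp: strip_def)

lemma indicator_mult_integral:
  assumes "\<And>p. p \<notin> S \<Longrightarrow> \<psi> p = 0"
  shows "(LINT p:S|lborel. f p * \<psi> p) = (LBINT p. restr S f p * \<psi> p)"
  unfolding set_lebesgue_integral_def by (intro Bochner_Integration.integral_cong refl) (auto simp: restr_def indicator_def assms)

lemma continuous_compact_L2:
  fixes h :: "real \<times> real \<Rightarrow> complex"
  assumes "continuous_on UNIV h" "\<And>p. p \<notin> cbox a b \<Longrightarrow> h p = 0"
  shows "L2_fun h"
proof -
  have "bounded (h ` cbox a b)" by (intro compact_imp_bounded compact_continuous_image continuous_on_subset[OF assms(1)]) auto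
  then obtain C where C: "\<And>p. p \<in> cbox a b \<Longrightarrow> norm (h p) \<le> C" by (auto simp: bounded_iff)
  have [measurable]: "h \<in> borel_measurable borel" by (intro borel_measurable_continuous_onI assms)
  have fin: "emeasure lborel (cbox a b) < \<infinity>" using emeasure_lborel_cbox_finite by simp
  have "L2_fun (\<lambda>p. of_real C * of_real (indicator (cbox a b) p))"
    by (intro L2_fun_cmult indicator_L1_L2 fin) simp
  then show ?thesis
    by (rule L2_fun_bound) (use C assms(2) in \<open>auto simp: indicator_def intro: order_trans[OF _ abs_ge_self]\<close>)
qed

text \<open>\<open>weak_deriv\<close> is a choice, so its additivity holds only almost everywhere
  and has to be tested. \<open>\<phi>\<close> enters with its classical derivative, and integration
  by parts against bumps inside the strip compares the three derivatives.\<close>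

lemma weak_deriv_C1_diff:
  assumes \<phi>: "C1_fun \<phi>" and f: "f \<in> H1_space (strip B)" and g: "(\<lambda>p. \<phi> p - f p) \<in> H1_space (strip B)"
    and d: "d \<in> Basis"
  shows "AE p in lborel. p \<in> strip B \<longrightarrow>
     dir_deriv d \<phi> p - weak_deriv (strip B) d f p = weak_deriv (strip B) d (\<lambda>p. \<phi> p - f p) p"
proof -
  define S where "S = strip B"
  define u D where "u = weak_deriv S d f" and "D = weak_deriv S d (\<lambda>p. \<phi> p - f p)"
  have L: "L2_fun (restr S f)" "L2_fun (restr S u)" "L2_fun (restr S D)"
    using f g weak_deriv_props[OF f d] weak_deriv_props[OF g d]
    by (auto simp: S_def u_def D_def L2_space_iff[symmetric] H1_space_def)
  note [measurable] = L2_fun_measurable[OF L(1)] L2_fun_measurable[OF L(2)] L2_fun_measurable[OF L(3)] C1_fun_measurable(2)[OF \<phi> d]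
  define h where "h p = dir_deriv d \<phi> p - restr S u p - restr S D p" for p
  \<comment> \<open>The margin \<open>B / (real n + 3)\<close> is below half the width, so the
    closed boxes are nonempty and lie in the open strip, and they exhaust it.\<close>
  define a b where "a n = (- real (Suc n), B / (real n + 3))" and "b n = (real (Suc n), B - B / (real n + 3))" for n
  have *: "AE p in lborel. p \<in> box (a n) (b n) \<longrightarrow> h p = 0" if B: "B > 0" for n
  proof (rule bump_orthogonal_imp_zero)
    have cb: "cbox (a n) (b n) \<subseteq> S"
    proof -
      have "0 < B / (real n + 3)" using B by simp
      then show ?thesis by (auto simp: S_def mem_strip cbox_prod_real a_def b_def)
    qed
    have fin: "emeasure lborel (box (a n) (b n)) < \<infinity>" using emeasure_lborel_box_finite by simp
    have i: "integrable lborel (\<lambda>p. indicator (box (a n) (b n)) p *\<^sub>R w p)" if "L2_fun w" for w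
      using L2_fun_mult_integrable[OF indicator_L1_L2(2)[of "box (a n) (b n)", OF _ fin] that] by (simp add: scaleR_conv_of_real)
    have "integrable lborel (\<lambda>p. indicator (cbox (a n) (b n)) p *\<^sub>R dir_deriv d \<phi> p)"
      using \<phi> d by (intro borel_integrable_compact) (auto simp: C1_fun_def intro: continuous_on_subset)
    then have "integrable lborel (\<lambda>p. indicator (box (a n) (b n)) p *\<^sub>R dir_deriv d \<phi> p)"
      by (rule Bochner_Integration.integrable_bound) (use box_subset_cbox in \<open>auto simp: indicator_def\<close>)
    then show "integrable lborel (\<lambda>p. indicator (box (a n) (b n)) p *\<^sub>R h p)"
      unfolding h_def scaleR_diff_right by (intro Bochner_Integration.integrable_diff i[OF L(2)] i[OF L(3)])
    fix c c' m assume c: "cbox c c' \<subseteq> cbox (a n) (b n)"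
    define \<psi> where "\<psi> = bump c c' m"
    have \<psi>0: "\<psi> p = 0" if "p \<notin> cbox c c'" for p unfolding \<psi>_def by (rule bump_zero_outside[OF that])
    have \<psi>S: "\<psi> p = 0" if "p \<notin> S" for p using \<psi>0 c cb that by blast
    have d\<psi>0: "dir_deriv d \<psi> p = 0" if "p \<notin> cbox c c'" for p
      by (rule dir_deriv_eq_0_outside[OF closed_cbox \<psi>0 that])
    have d\<psi>S: "dir_deriv d \<psi> p = 0" if "p \<notin> S" for p using d\<psi>0 c cb that by blast
    have cont: "continuous_on UNIV \<psi>" "continuous_on UNIV (dir_deriv d \<psi>)"
      using bump_C1[of c c' m] d by (auto simp: \<psi>_def C1_fun_continuous C1_fun_def)
    have L\<psi>: "L2_fun \<psi>" "L2_fun (dir_deriv d \<psi>)"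
      by (rule continuous_compact_L2[OF cont(1) \<psi>0] continuous_compact_L2[OF cont(2) d\<psi>0]; assumption)+
    have test: "test_fun S \<psi>" unfolding \<psi>_def using c cb by (intro bump_test_fun) auto
    have w1: "(LBINT p. restr S f p * dir_deriv d \<psi> p) = - (LBINT p. restr S u p * \<psi> p)"
    proof -
      have "(LINT p:S|lborel. f p * dir_deriv d \<psi> p) = - (LINT p:S|lborel. u p * \<psi> p)"
        using weak_deriv_props(2)[OF f d] test unfolding is_weak_deriv_def S_def[symmetric] u_def[symmetric] by blast
      moreover have "(LINT p:S|lborel. f p * dir_deriv d \<psi> p) = (LBINT p. restr S f p * dir_deriv d \<psi> p)"
        by (rule indicator_mult_integral) (rule d\<psi>S)
      moreover have "(LINT p:S|lborel. u p * \<psi> p) = (LBINT p. restr S u p * \<psi> p)"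
        by (rule indicator_mult_integral) (rule \<psi>S)
      ultimately show ?thesis by (simp only:)
    qed
    have w2: "(LBINT p. restr S (\<lambda>p. \<phi> p - f p) p * dir_deriv d \<psi> p) = - (LBINT p. restr S D p * \<psi> p)"
    proof -
      have "(LINT p:S|lborel. (\<phi> p - f p) * dir_deriv d \<psi> p) = - (LINT p:S|lborel. D p * \<psi> p)"
        using weak_deriv_props(2)[OF g d] test unfolding is_weak_deriv_def S_def[symmetric] D_def[symmetric] by blast
      moreover have "(LINT p:S|lborel. (\<phi> p - f p) * dir_deriv d \<psi> p) = (LBINT p. restr S (\<lambda>p. \<phi> p - f p) p * dir_deriv d \<psi> p)"
        by (rule indicator_mult_integral) (rule d\<psi>S)
      moreover have "(LINT p:S|lborel. D p * \<psi> p) = (LBINT p. restr S D p * \<psi> p)"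
        by (rule indicator_mult_integral) (rule \<psi>S)
      ultimately show ?thesis by (simp only:)
    qed
    note ibp = integration_by_parts_bump[OF \<phi> d, of c c' m, folded \<psi>_def]
    have "(LBINT p. restr S (\<lambda>p. \<phi> p - f p) p * dir_deriv d \<psi> p) = (LBINT p. \<phi> p * dir_deriv d \<psi> p - restr S f p * dir_deriv d \<psi> p)"
    proof (intro Bochner_Integration.integral_cong refl)
      fix p
      show "restr S (\<lambda>p. \<phi> p - f p) p * dir_deriv d \<psi> p = \<phi> p * dir_deriv d \<psi> p - restr S f p * dir_deriv d \<psi> p"
        by (cases "p \<in> S") (auto simp: restr_simps d\<psi>S left_diff_distrib)
    qed
    also have "\<dots> = (LBINT p. \<phi> p * dir_deriv d \<psi> p) - (LBINT p. restr S f p * dir_deriv d \<psi> p)"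
      by (intro Bochner_Integration.integral_diff ibp L2_fun_mult_integrable L L\<psi>)
    finally have "(LBINT p. dir_deriv d \<phi> p * \<psi> p) - (LBINT p. restr S u p * \<psi> p) - (LBINT p. restr S D p * \<psi> p) = 0"
      unfolding w1 w2 ibp(1) by (simp add: algebra_simps)
    moreover have "(LBINT p. h p * \<psi> p) = (LBINT p. dir_deriv d \<phi> p * \<psi> p) - (LBINT p. restr S u p * \<psi> p) - (LBINT p. restr S D p * \<psi> p)"
      unfolding h_def left_diff_distrib
      by (subst Bochner_Integration.integral_diff, intro Bochner_Integration.integrable_diff ibp L2_fun_mult_integrable L L\<psi>, intro L2_fun_mult_integrable L L\<psi>,
          subst Bochner_Integration.integral_diff, rule ibp, intro L2_fun_mult_integrable L L\<psi>, simp)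
    ultimately show "(LBINT p. h p * bump c c' m p) = 0" by (simp add: \<psi>_def)
  qed
  show ?thesis
  proof (cases "B > 0")
    case True
    have "AE p in lborel. \<forall>n. p \<in> box (a n) (b n) \<longrightarrow> h p = 0" unfolding AE_all_countable using *[OF True] by blast
    then show ?thesis
    proof eventually_elim
      case (elim p)
      show ?case
      proof
        assume p: "p \<in> strip B"
        obtain n :: nat where n: "max \<bar>fst p\<bar> (max (B / snd p) (B / (B - snd p))) < real n" using reals_Archimedean2 by blast
        have "B < real n * snd p" "B < real n * (B - snd p)"
          using n p by (auto simp: mem_strip field_simps)
        moreover have "0 < snd p" "0 < B - snd p" using p by (auto simp: mem_strip)
        moreover have "B / (real n + 3) < q" if "0 < q" "B < real n * q" for q
          using that by (simp add: pos_divide_less_eq algebra_simps)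
        ultimately have "B / (real n + 3) < snd p" "B / (real n + 3) < B - snd p" by blast+
        then have "p \<in> box (a n) (b n)" using n by (auto simp: box_prod_real a_def b_def)
        with elim have "h p = 0" by blast
        then show "dir_deriv d \<phi> p - weak_deriv (strip B) d f p = weak_deriv (strip B) d (\<lambda>p. \<phi> p - f p) p"
          using p by (simp add: h_def restr_simps S_def[symmetric] u_def D_def)
      qed
    qed
  next
    case False
    then have "p \<notin> strip B" for p by (auto simp: mem_strip)
    then show ?thesis by simp
  qed
qed

text \<open>\<open>has_trace\<close> carries a sequence of Schwartz functions that converges in
  \<open>H1\<close> and on the line at once. It is unpacked here into separate convergences, with
  the weak derivatives of the differences replaced by classical derivatives of the approximants.
  Where a difference is not in \<open>H1\<close>, the bounding quantity is infinite.\<close>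

lemma trace_zero_approximation:
  assumes f: "f \<in> H1_space (strip B)" and tr: "has_trace B c f (\<lambda>_. 0)"
  obtains \<phi> where "\<And>n. C1_fun (\<phi> n)" "(\<lambda>n. sq_norm (restr (strip B) (\<lambda>p. \<phi> n p - f p))) \<longlonglongrightarrow> 0"
    "\<And>d. d \<in> Basis \<Longrightarrow> (\<lambda>n. sq_norm (restr (strip B) (\<lambda>p. dir_deriv d (\<phi> n) p - weak_deriv (strip B) d f p))) \<longlonglongrightarrow> 0"
    "(\<lambda>n. sq_norm (\<lambda>x. \<phi> n (x, c))) \<longlonglongrightarrow> 0"
proof -
  define S where "S = strip B"
  obtain \<phi> :: "nat \<Rightarrow> real \<times> real \<Rightarrow> complex" where \<phi>: "\<And>n. schwartz (\<phi> n)"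
    "(\<lambda>n. H1_sq S (\<lambda>p. \<phi> n p - f p)) \<longlonglongrightarrow> 0" "(\<lambda>n. L2_sq UNIV (\<lambda>x. \<phi> n (x, c))) \<longlonglongrightarrow> 0"
    using tr by (auto simp: has_trace_def S_def)
  have C1: "C1_fun (\<phi> n)" for n using \<phi>(1) by (auto simp: schwartz_def intro: smooth_fun_C1)
  have le1: "sq_norm (restr S (\<lambda>p. \<phi> n p - f p)) \<le> H1_sq S (\<lambda>p. \<phi> n p - f p)" for n
    by (auto simp: H1_sq_def L2_sq_eq)
  have le2: "sq_norm (restr S (\<lambda>p. dir_deriv d (\<phi> n) p - weak_deriv S d f p)) \<le> H1_sq S (\<lambda>p. \<phi> n p - f p)" if d: "d \<in> Basis" for n d
  proof (cases "(\<lambda>p. \<phi> n p - f p) \<in> H1_space S")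
    case True
    have "sq_norm (restr S (\<lambda>p. dir_deriv d (\<phi> n) p - weak_deriv S d f p)) = sq_norm (restr S (weak_deriv S d (\<lambda>p. \<phi> n p - f p)))"
      unfolding sq_norm_def
    proof (rule nn_integral_cong_AE)
      show "AE p in lborel. nsq (restr S (\<lambda>p. dir_deriv d (\<phi> n) p - weak_deriv S d f p) p) = nsq (restr S (weak_deriv S d (\<lambda>p. \<phi> n p - f p)) p)"
        using weak_deriv_C1_diff[OF C1 f True[unfolded S_def] d] unfolding S_def[symmetric]
        by eventually_elim (auto simp: restr_def indicator_def)
    qed
    also have "\<dots> \<le> (\<Sum>d\<in>Basis. L2_sq S (weak_deriv S d (\<lambda>p. \<phi> n p - f p)))"
      unfolding L2_sq_eq using d by (intro member_le_sum) auto
    also have "\<dots> \<le> H1_sq S (\<lambda>p. \<phi> n p - f p)" using True by (simp add: H1_sq_def)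
    finally show ?thesis .
  qed (simp add: H1_sq_def)
  show ?thesis
  proof (rule that[OF C1, folded S_def])
    show "(\<lambda>n. sq_norm (restr S (\<lambda>p. \<phi> n p - f p))) \<longlonglongrightarrow> 0"
      by (rule tendsto_sandwich[OF _ _ tendsto_const \<phi>(2)]) (auto simp: le1)
    show "(\<lambda>n. sq_norm (restr S (\<lambda>p. dir_deriv d (\<phi> n) p - weak_deriv S d f p))) \<longlonglongrightarrow> 0" if "d \<in> Basis" for d
      by (rule tendsto_sandwich[OF _ _ tendsto_const \<phi>(2)]) (auto simp: le2 that)
    show "(\<lambda>n. sq_norm (\<lambda>x. \<phi> n (x, c))) \<longlonglongrightarrow> 0"
      using \<phi>(3) by (simp add: L2_sq_eq restr_def[abs_def])
  qed
qed

lemma strip_shift: "(p + (s, 0)) \<in> strip B \<longleftrightarrow> p \<in> strip B"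
  by (cases p) (simp add: mem_strip)

text \<open>The increment is the integral of the derivative over a segment of length
  \<open>h\<close>: Cauchy-Schwarz gives one factor \<open>h\<close>, integration along the segment
  the other. Horizontal shifts preserve the strip.\<close>

lemma C1_difference_bound:
  assumes \<phi>: "C1_fun \<phi>" and h: "h > 0"
  shows "sq_norm (restr (strip B) (\<lambda>p. \<phi> (p + (h, 0)) - \<phi> p)) \<le> ennreal (h^2) * sq_norm (restr (strip B) (dir_deriv (1, 0) \<phi>))"
proof -
  define D where "D = dir_deriv (1, 0) \<phi>"
  have d: "(1, 0) \<in> (Basis :: (real \<times> real) set)" by (auto simp: Basis_prod_def)
  have Dc: "continuous_on UNIV D" and diff: "\<And>p. \<phi> differentiable (at p)" using \<phi> d by (auto simp: C1_fun_def D_def)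
  have [measurable]: "D \<in> borel_measurable borel" by (intro borel_measurable_continuous_onI Dc)
  note [measurable] = C1_fun_measurable(1)[OF \<phi>]
  have pt: "nsq (\<phi> (p + (h, 0)) - \<phi> p) \<le> ennreal h * (\<integral>\<^sup>+s. indicator {0..h} s * nsq (D (p + (s, 0))))" for p
  proof -
    have "(LBINT s. indicator {0..h} s *\<^sub>R D (p + s *\<^sub>R (1, 0))) = \<phi> (p + h *\<^sub>R (1, 0)) - \<phi> (p + 0 *\<^sub>R (1, 0))"
    proof (rule integral_FTC_Icc)
      show "((\<lambda>s. \<phi> (p + s *\<^sub>R (1, 0))) has_vector_derivative D (p + x *\<^sub>R (1, 0))) (at x within {0..h})" for x
        unfolding D_def by (rule dir_deriv_along_line[OF diff])
      show "continuous_on {0..h} (\<lambda>s. D (p + s *\<^sub>R (1, 0)))"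
        by (intro continuous_on_compose2[OF Dc] continuous_intros) auto
    qed (use h in auto)
    then have "\<phi> (p + (h, 0)) - \<phi> p = (LBINT s. indicator {0..h} s *\<^sub>R D (p + (s, 0)))" by (simp add: zero_prod_def[symmetric])
    then have "(ennreal (norm (\<phi> (p + (h, 0)) - \<phi> p)))^2 \<le> (\<integral>\<^sup>+s. ennreal (norm (indicator {0..h} s *\<^sub>R D (p + (s, 0)))))^2"
      by (simp only:) (intro power_mono integral_norm_bound_ennreal_any, simp)
    also have "\<dots> = (\<integral>\<^sup>+s. indicator {0..h} s * (indicator {0..h} s * ennreal (norm (D (p + (s, 0))))))^2"
      by (intro arg_cong[where f = "\<lambda>x. x^2"] nn_integral_cong) (auto simp: indicator_def)
    also have "\<dots> \<le> (\<integral>\<^sup>+s. (indicator {0..h} s)^2) * (\<integral>\<^sup>+s. (indicator {0..h} s * ennreal (norm (D (p + (s, 0)))))^2)"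
      by (rule Cauchy_Schwarz_nn_integral) measurable
    also have "(\<integral>\<^sup>+s. (indicator {0..h} s)^2) = (\<integral>\<^sup>+s. indicator {0..h} s)"
      by (intro nn_integral_cong) (auto simp: indicator_def)
    also have "\<dots> = ennreal h" using h by simp
    also have "(\<integral>\<^sup>+s. (indicator {0..h} s * ennreal (norm (D (p + (s, 0)))))^2) = (\<integral>\<^sup>+s. indicator {0..h} s * nsq (D (p + (s, 0))))"
      by (intro nn_integral_cong) (auto simp: indicator_def ennreal_power)
    finally show ?thesis by (simp add: ennreal_power)
  qed
  have "sq_norm (restr (strip B) (\<lambda>p. \<phi> (p + (h, 0)) - \<phi> p)) \<le> (\<integral>\<^sup>+p. ennreal h * (\<integral>\<^sup>+s. indicator {0..h} s * nsq (restr (strip B) D (p + (s, 0)))))"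
    unfolding sq_norm_def
  proof (rule nn_integral_mono)
    fix p
    show "nsq (restr (strip B) (\<lambda>p. \<phi> (p + (h, 0)) - \<phi> p) p) \<le> ennreal h * (\<integral>\<^sup>+s. indicator {0..h} s * nsq (restr (strip B) D (p + (s, 0))))"
      using pt[of p] by (cases "p \<in> strip B") (simp_all add: restr_simps strip_shift)
  qed
  also have "\<dots> = ennreal h * (\<integral>\<^sup>+p. \<integral>\<^sup>+s. indicator {0..h} s * nsq (restr (strip B) D (p + (s, 0))))"
    unfolding restr_def by (rule nn_integral_cmult) measurable
  also have "(\<integral>\<^sup>+p. \<integral>\<^sup>+s. indicator {0..h} s * nsq (restr (strip B) D (p + (s, 0))))
     = (\<integral>\<^sup>+s. \<integral>\<^sup>+p. indicator {0..h} s * nsq (restr (strip B) D (p + (s, 0))))"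
    unfolding restr_def by (rule nn_integral_lborel_swap) measurable
  also have "\<dots> = (\<integral>\<^sup>+s. indicator {0..h} s * sq_norm (restr (strip B) D))"
  proof (rule nn_integral_cong)
    fix s :: real
    have [measurable]: "restr (strip B) D \<in> borel_measurable borel" unfolding restr_def[abs_def] by measurable
    have "(\<integral>\<^sup>+p. indicator {0..h} s * nsq (restr (strip B) D (p + (s, 0)))) = indicator {0..h} s * (\<integral>\<^sup>+p. nsq (restr (strip B) D (p + (s, 0))))"
      by (rule nn_integral_cmult) measurable
    also have "(\<integral>\<^sup>+p. nsq (restr (strip B) D (p + (s, 0)))) = sq_norm (restr (strip B) D)"
      unfolding sq_norm_def by (rule nn_integral_lborel_shift) measurable
    finally show "(\<integral>\<^sup>+p. indicator {0..h} s * nsq (restr (strip B) D (p + (s, 0)))) = indicator {0..h} s * sq_norm (restr (strip B) D)" .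
  qed
  also have "\<dots> = ennreal h * sq_norm (restr (strip B) D)"
    using h by (simp add: nn_integral_multc)
  also have "ennreal h * (ennreal h * sq_norm (restr (strip B) D)) = ennreal (h^2) * sq_norm (restr (strip B) D)"
    using h by (simp add: power2_eq_square ennreal_mult mult.assoc)
  finally show ?thesis by (simp add: D_def)
qed

lemma tendsto_0_le_ennreal:
  fixes f :: "nat \<Rightarrow> ennreal"
  assumes "f \<longlonglongrightarrow> 0" "c < \<top>"
  shows "(\<lambda>n. c * f n) \<longlonglongrightarrow> 0"
  using ennreal_tendsto_cmult[OF assms(2,1)] by simp

text \<open>The approximants that accompany the trace obey the bound for smooth functions. The 4
  comes from two uses of \<open>sq_norm_add_le\<close>, one to pass from \<open>f\<close> to the
  approximant and one to return from its derivative to the weak derivative; the remaining terms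
  vanish in the limit.\<close>

lemma H1_difference_bound:
  assumes f: "f \<in> H1_space (strip B)" and tr: "has_trace B c f (\<lambda>_. 0)" and h: "h > 0"
  shows "sq_norm (restr (strip B) (\<lambda>p. f (p + (h, 0)) - f p)) \<le> ennreal (4 * h^2) * L2_sq (strip B) (weak_deriv (strip B) (1, 0) f)"
proof -
  define S where "S = strip B"
  define u where "u = weak_deriv S (1, 0) f"
  have d: "(1, 0) \<in> (Basis :: (real \<times> real) set)" by (auto simp: Basis_prod_def)
  obtain \<phi> where \<phi>: "\<And>n. C1_fun (\<phi> n)" "(\<lambda>n. sq_norm (restr S (\<lambda>p. \<phi> n p - f p))) \<longlonglongrightarrow> 0"
    "\<And>d. d \<in> Basis \<Longrightarrow> (\<lambda>n. sq_norm (restr S (\<lambda>p. dir_deriv d (\<phi> n) p - weak_deriv S d f p))) \<longlonglongrightarrow> 0"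
    "(\<lambda>n. sq_norm (\<lambda>x. \<phi> n (x, c))) \<longlonglongrightarrow> 0"
    using trace_zero_approximation[OF f tr] unfolding S_def by blast
  note [measurable] = C1_fun_measurable(1)[OF \<phi>(1)] C1_fun_measurable(2)[OF \<phi>(1) d]
  have Lf: "restr S f \<in> borel_measurable borel" using f by (auto simp: H1_space_def S_def L2_space_iff L2_fun_def)
  have Lu: "restr S u \<in> borel_measurable borel" using weak_deriv_props(1)[OF f d] by (auto simp: u_def S_def L2_space_iff L2_fun_def)
  have Sm [measurable]: "S \<in> sets borel" by (simp add: S_def)
  define w where "w n = restr S (\<lambda>p. \<phi> n p - f p)" for n
  define z where "z n = restr S (\<lambda>p. dir_deriv (1, 0) (\<phi> n) p - u p)" for n
  have rd: "restr S (\<lambda>p. F p - G p) = (\<lambda>p. restr S F p - restr S G p)" for F G by (auto simp: restr_def scaleR_diff_right)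
  have rm: "restr S F \<in> borel_measurable borel" if [measurable]: "F \<in> borel_measurable borel" for F unfolding restr_def[abs_def] by measurable
  have [measurable]: "w n \<in> borel_measurable borel" for n unfolding w_def rd by (intro borel_measurable_diff rm Lf) measurable
  have [measurable]: "z n \<in> borel_measurable borel" for n unfolding z_def rd by (intro borel_measurable_diff rm Lu) measurable
  have AE: "(\<lambda>n. sq_norm (w n)) \<longlonglongrightarrow> 0" "(\<lambda>n. sq_norm (z n)) \<longlonglongrightarrow> 0"
    using \<phi>(2) \<phi>(3)[OF d] by (auto simp: w_def z_def u_def)
  have "sq_norm (restr S (\<lambda>p. f (p + (h, 0)) - f p)) \<le> ennreal (4 * h^2) * sq_norm (restr S u) + (ennreal (4 * h^2) * sq_norm (z n) + 8 * sq_norm (w n))" for n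
  proof -
    have e: "restr S (\<lambda>p. f (p + (h, 0)) - f p) = (\<lambda>p. restr S (\<lambda>p. \<phi> n (p + (h, 0)) - \<phi> n p) p + (w n p + (- 1) * w n (p + (h, 0))))"
    proof
      fix p
      show "restr S (\<lambda>p. f (p + (h, 0)) - f p) p = restr S (\<lambda>p. \<phi> n (p + (h, 0)) - \<phi> n p) p + (w n p + (- 1) * w n (p + (h, 0)))"
        by (cases "p \<in> S") (auto simp: restr_simps strip_shift S_def w_def)
    qed
    have 1: "sq_norm (restr S (\<lambda>p. f (p + (h, 0)) - f p)) \<le> 2 * sq_norm (restr S (\<lambda>p. \<phi> n (p + (h, 0)) - \<phi> n p))
        + 2 * sq_norm (\<lambda>p. w n p + (- 1) * w n (p + (h, 0)))"
      unfolding e by (intro sq_norm_add_le rm) measurable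
    have 2: "sq_norm (\<lambda>p. w n p + (- 1) * w n (p + (h, 0))) \<le> 2 * sq_norm (w n) + 2 * sq_norm (\<lambda>p. (- 1) * w n (p + (h, 0)))"
      by (intro sq_norm_add_le) measurable
    have 3: "sq_norm (\<lambda>p. (- 1) * w n (p + (h, 0))) = sq_norm (w n)"
      by (simp add: sq_norm_def nn_integral_lborel_shift[of "\<lambda>p. nsq (w n p)" "(h, 0)"])
    have 4: "sq_norm (restr S (\<lambda>p. \<phi> n (p + (h, 0)) - \<phi> n p)) \<le> ennreal (h^2) * sq_norm (restr S (dir_deriv (1, 0) (\<phi> n)))"
      unfolding S_def by (rule C1_difference_bound[OF \<phi>(1) h])
    have e2: "restr S (dir_deriv (1, 0) (\<phi> n)) = (\<lambda>p. restr S u p + z n p)"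
      by (auto simp: restr_def indicator_def z_def)
    have 5: "sq_norm (restr S (dir_deriv (1, 0) (\<phi> n))) \<le> 2 * sq_norm (restr S u) + 2 * sq_norm (z n)"
      unfolding e2 by (intro sq_norm_add_le Lu) measurable
    have 6: "sq_norm (restr S (\<lambda>p. \<phi> n (p + (h, 0)) - \<phi> n p)) \<le> ennreal (h^2) * (2 * sq_norm (restr S u) + 2 * sq_norm (z n))"
      by (rule order_trans[OF 4 mult_left_mono[OF 5]]) simp
    have "sq_norm (restr S (\<lambda>p. f (p + (h, 0)) - f p)) \<le> 2 * (ennreal (h^2) * (2 * sq_norm (restr S u) + 2 * sq_norm (z n))) + 2 * (2 * sq_norm (w n) + 2 * sq_norm (w n))"
      by (rule order_trans[OF 1 add_mono[OF mult_left_mono[OF 6] mult_left_mono[OF 2[unfolded 3]]]]) auto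
    also have "\<dots> = (4 * ennreal (h^2)) * sq_norm (restr S u) + ((4 * ennreal (h^2)) * sq_norm (z n) + 8 * sq_norm (w n))"
    proof -
      have "2 * (ennreal (h^2) * (2 * sq_norm (restr S u) + 2 * sq_norm (z n))) = (2 * 2) * ennreal (h^2) * sq_norm (restr S u) + (2 * 2) * ennreal (h^2) * sq_norm (z n)"
        by (simp only: distrib_left mult_ac)
      moreover have "2 * (2 * sq_norm (w n) + 2 * sq_norm (w n)) = (8::ennreal) * sq_norm (w n)"
        by (simp only: distrib_right[symmetric] mult.assoc[symmetric]) simp
      ultimately show ?thesis by (simp add: add.assoc)
    qed
    also have "4 * ennreal (h^2) = ennreal (4 * h^2)" by (simp add: ennreal_mult)
    finally show ?thesis .
  qed
  moreover have "(\<lambda>n. ennreal (4 * h^2) * sq_norm (restr S u) + (ennreal (4 * h^2) * sq_norm (z n) + 8 * sq_norm (w n))) \<longlonglongrightarrow> ennreal (4 * h^2) * sq_norm (restr S u) + (0 + 0)"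
    by (intro tendsto_add tendsto_const tendsto_0_le_ennreal AE) (auto simp: less_top[symmetric])
  ultimately have "sq_norm (restr S (\<lambda>p. f (p + (h, 0)) - f p)) \<le> ennreal (4 * h^2) * sq_norm (restr S u)"
    by (intro LIMSEQ_le_const[of _ "ennreal (4 * h^2) * sq_norm (restr S u)"]) auto
  then show ?thesis by (simp add: S_def u_def L2_sq_eq)
qed

lemma sq_norm_pair:
  fixes F :: "'a::euclidean_space \<times> 'b::euclidean_space \<Rightarrow> complex"
  assumes [measurable]: "F \<in> borel_measurable borel"
  shows "sq_norm F = (\<integral>\<^sup>+x. sq_norm (\<lambda>y. F (x, y)))"
  unfolding sq_norm_def by (rule nn_integral_lborel_pair) measurable

lemma AE_L2_section:
  fixes F :: "'a::euclidean_space \<times> 'b::euclidean_space \<Rightarrow> complex"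
  assumes "L2_fun F"
  shows "AE x in lborel. L2_fun (\<lambda>y. F (x, y))"
proof -
  have [measurable]: "F \<in> borel_measurable borel" using assms by (simp add: L2_fun_def)
  have [measurable]: "(\<lambda>x. sq_norm (\<lambda>y. F (x, y))) \<in> borel_measurable borel" unfolding sq_norm_def by measurable
  have "(\<integral>\<^sup>+x. sq_norm (\<lambda>y. F (x, y))) \<noteq> \<infinity>"
    using assms by (simp add: sq_norm_pair[symmetric] L2_fun_def)
  then have "AE x in lborel. sq_norm (\<lambda>y. F (x, y)) \<noteq> \<infinity>"
    by (intro nn_integral_noteq_infinite) auto
  then show ?thesis by eventually_elim (auto simp: L2_fun_def less_top)
qed

lemma sq_norm_partial_integral:
  fixes F :: "'a::euclidean_space \<times> 'b::euclidean_space \<Rightarrow> complex"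
  assumes [measurable]: "F \<in> borel_measurable borel" "g \<in> borel_measurable borel"
  shows "sq_norm (\<lambda>x. LBINT y. F (x, y) * g y) \<le> sq_norm g * sq_norm F"
proof -
  have [measurable]: "(\<lambda>x. sq_norm (\<lambda>y. F (x, y))) \<in> borel_measurable borel" unfolding sq_norm_def by measurable
  have "sq_norm (\<lambda>x. LBINT y. F (x, y) * g y) \<le> (\<integral>\<^sup>+x. sq_norm g * sq_norm (\<lambda>y. F (x, y)))"
    unfolding sq_norm_def[of "\<lambda>x. LBINT y. F (x, y) * g y"]
  proof (rule nn_integral_mono)
    fix x
    have "(ennreal (norm (LBINT y. F (x, y) * g y)))^2 \<le> sq_norm (\<lambda>y. F (x, y)) * sq_norm g"
      by (rule integral_mult_sq_norm) measurable
    then show "nsq (LBINT y. F (x, y) * g y) \<le> sq_norm g * sq_norm (\<lambda>y. F (x, y))"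
      by (simp add: ennreal_power mult.commute)
  qed
  also have "\<dots> = sq_norm g * sq_norm F"
    by (subst nn_integral_cmult) (auto simp: sq_norm_pair)
  finally show ?thesis .
qed

text \<open>One boundary line at a time: \<open>G\<close> vanishes at the opposite end
  \<open>B - c\<close>, and the trace makes the boundary values at \<open>c\<close> tend to 0. The
  approximating sequences for the lines \<open>y = 0\<close> and \<open>y = B\<close> are unrelated,
  so no single sequence is known to control both boundary terms.\<close>

lemma trace_zero_by_parts:
  assumes B: "B > 0" and f: "f \<in> H1_space (strip B)" and tr: "has_trace B c f (\<lambda>_. 0)" and c: "c = 0 \<or> c = B"
    and G: "\<And>y. (G has_real_derivative G' y) (at y)" "continuous_on UNIV G'" "G (B - c) = 0"
    and M: "\<And>y. y \<in> {0..B} \<Longrightarrow> \<bar>G y\<bar> \<le> M" "\<And>y. y \<in> {0..B} \<Longrightarrow> \<bar>G' y\<bar> \<le> M"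
  shows "AE x in lborel. (LBINT y. restr (strip B) f (x, y) * of_real (G' y)) =
      - (LBINT y. restr (strip B) (weak_deriv (strip B) (0, 1) f) (x, y) * of_real (G y))"
proof -
  define S where "S = strip B"
  define u where "u = weak_deriv S (0, 1) f"
  have d: "(0, 1) \<in> (Basis :: (real \<times> real) set)" by (auto simp: Basis_prod_def)
  obtain \<phi> where \<phi>: "\<And>n. C1_fun (\<phi> n)" "(\<lambda>n. sq_norm (restr S (\<lambda>p. \<phi> n p - f p))) \<longlonglongrightarrow> 0"
    "\<And>d. d \<in> Basis \<Longrightarrow> (\<lambda>n. sq_norm (restr S (\<lambda>p. dir_deriv d (\<phi> n) p - weak_deriv S d f p))) \<longlonglongrightarrow> 0"
    "(\<lambda>n. sq_norm (\<lambda>x. \<phi> n (x, c))) \<longlonglongrightarrow> 0"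
    using trace_zero_approximation[OF f tr] unfolding S_def by blast
  note [measurable] = C1_fun_measurable(1)[OF \<phi>(1)] C1_fun_measurable(2)[OF \<phi>(1) d]
  have M0: "M \<ge> 0" using M(1)[of 0] B by auto
  have Gc: "continuous_on UNIV G" using G(1) by (meson DERIV_continuous_on has_field_derivative_at_within)
  have [measurable]: "G \<in> borel_measurable borel" "G' \<in> borel_measurable borel"
    by (intro borel_measurable_continuous_onI Gc G(2))+
  define I where "I = {0<..<B}"
  have [measurable]: "I \<in> sets borel" by (simp add: I_def)
  define g g' where "g y = complex_of_real (indicator I y * G y)" and "g' y = complex_of_real (indicator I y * G' y)" for y
  have [measurable]: "g \<in> borel_measurable borel" "g' \<in> borel_measurable borel" unfolding g_def[abs_def] g'_def[abs_def] by measurable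
  have bdg: "sq_norm h \<le> ennreal (M^2 * B)" if "\<And>y. norm (h y) \<le> M * indicator I y" for h :: "real \<Rightarrow> complex"
  proof -
    have "sq_norm h \<le> (\<integral>\<^sup>+y. ennreal (M^2) * indicator I y)"
      unfolding sq_norm_def
    proof (rule nn_integral_mono)
      fix y
      have "(norm (h y))^2 \<le> (M * indicator I y)^2" by (intro power_mono that) auto
      then show "nsq (h y) \<le> ennreal (M^2) * indicator I y"
        by (cases "y \<in> I") (auto intro: ennreal_leI)
    qed
    also have "\<dots> = ennreal (M^2 * B)" using B by (simp add: nn_integral_cmult I_def ennreal_mult)
    finally show ?thesis .
  qed
  have Ng: "sq_norm g \<le> ennreal (M^2 * B)" "sq_norm g' \<le> ennreal (M^2 * B)"
    by (rule bdg; use M in \<open>auto simp: g_def g'_def I_def indicator_def\<close>)+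
  have Lg: "L2_fun g" "L2_fun g'" using Ng by (auto simp: L2_fun_def intro: le_less_trans)
  define F U where "F = restr S f" and "U = restr S u"
  have LF: "L2_fun F" "L2_fun U" using f weak_deriv_props(1)[OF f d]
    by (auto simp: F_def U_def S_def u_def H1_space_def L2_space_iff)
  note [measurable] = L2_fun_measurable[OF LF(1)] L2_fun_measurable[OF LF(2)]
  have Sm [measurable]: "S \<in> sets borel" by (simp add: S_def)
  define P Q where "P n = restr S (\<phi> n)" and "Q n = restr S (dir_deriv (0, 1) (\<phi> n))" for n
  have [measurable]: "P n \<in> borel_measurable borel" "Q n \<in> borel_measurable borel" for n unfolding P_def Q_def restr_def[abs_def] by measurable
  define w z where "w n p = P n p - F p" and "z n p = Q n p - U p" for n p
  have [measurable]: "w n \<in> borel_measurable borel" "z n \<in> borel_measurable borel" for n unfolding w_def[abs_def] z_def[abs_def] by measurable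
  have wz0: "(\<lambda>n. sq_norm (w n)) \<longlonglongrightarrow> 0" "(\<lambda>n. sq_norm (z n)) \<longlonglongrightarrow> 0"
  proof -
    have "w n = restr S (\<lambda>p. \<phi> n p - f p)" "z n = restr S (\<lambda>p. dir_deriv (0, 1) (\<phi> n) p - u p)" for n
      by (auto simp: w_def z_def P_def Q_def F_def U_def restr_def scaleR_diff_right)
    then show "(\<lambda>n. sq_norm (w n)) \<longlonglongrightarrow> 0" "(\<lambda>n. sq_norm (z n)) \<longlonglongrightarrow> 0"
      using \<phi>(2) \<phi>(3)[OF d] by (auto simp: u_def)
  qed
  have mem: "indicator S (x, y) = (indicator I y :: real)" for x y by (auto simp: S_def I_def mem_strip indicator_def)
  define b where "b n x = \<phi> n (x, B) * of_real (G B) - \<phi> n (x, 0) * of_real (G 0)" for n x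
  have sections: "L2_fun (\<lambda>y. P n (x, y))" "L2_fun (\<lambda>y. Q n (x, y))"
    and by_parts: "(LBINT y. P n (x, y) * g' y) + (LBINT y. Q n (x, y) * g y) = b n x" for n x
  proof -
    let ?p = "\<lambda>y. \<phi> n (x, y)" and ?q = "\<lambda>y. dir_deriv (0, 1) (\<phi> n) (x, y)"
    have cont: "continuous_on UNIV ?p" "continuous_on UNIV ?q"
    proof -
      have qc: "continuous_on UNIV (dir_deriv (0, 1) (\<phi> n))" using \<phi>(1)[of n] d unfolding C1_fun_def by blast
      show "continuous_on UNIV ?p"
        by (rule continuous_on_compose2[OF C1_fun_continuous[OF \<phi>(1)]]) (intro continuous_intros, simp)
      show "continuous_on UNIV ?q"
        by (rule continuous_on_compose2[OF qc]) (intro continuous_intros, simp)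
    qed
    have L: "L2_fun (\<lambda>y. indicator I y *\<^sub>R h y)" if h: "continuous_on UNIV h" for h :: "real \<Rightarrow> complex"
    proof -
      have "bounded (h ` {0..B})" by (intro compact_imp_bounded compact_continuous_image continuous_on_subset[OF h]) auto
      then obtain C where "\<forall>v \<in> h ` {0..B}. norm v \<le> C" unfolding bounded_iff by blast
      then have C: "\<And>y. y \<in> {0..B} \<Longrightarrow> norm (h y) \<le> C" by blast
      have "L2_fun (\<lambda>y. of_real C * complex_of_real (indicator I y))"
        using B by (intro L2_fun_cmult indicator_L1_L2) (auto simp: I_def)
      moreover have "(\<lambda>y. indicator I y *\<^sub>R h y) \<in> borel_measurable borel"
        using borel_measurable_continuous_onI[OF h] by measurable
      ultimately show ?thesis
        by (rule L2_fun_bound(1)) (use C in \<open>auto simp: indicator_def I_def intro: order_trans[OF _ abs_ge_self]\<close>)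
    qed
    show sP: "L2_fun (\<lambda>y. P n (x, y))" and sQ: "L2_fun (\<lambda>y. Q n (x, y))"
      unfolding P_def Q_def restr_def mem by (intro L cont)+
    have vd: "(?p has_vector_derivative ?q y) (at y within {0..B})" for y
    proof -
      have "\<phi> n differentiable (at p)" for p using \<phi>(1)[of n] unfolding C1_fun_def by blast
      from dir_deriv_along_line[OF this, of "(x, 0)" "(0, 1)" y "{0..B}"] show ?thesis by simp
    qed
    have Gd: "((\<lambda>y. complex_of_real (G y)) has_vector_derivative of_real (G' y)) (at y within {0..B})" for y
      using G(1)[of y] by (intro has_vector_derivative_of_real has_vector_derivative_at_within) (simp add: has_real_derivative_iff_has_vector_derivative)
    have "(LBINT y. indicator {0..B} y *\<^sub>R (?p y * of_real (G' y) + ?q y * of_real (G y))) = ?p B * of_real (G B) - ?p 0 * of_real (G 0)"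
    proof (rule integral_FTC_Icc)
      show "((\<lambda>y. ?p y * of_real (G y)) has_vector_derivative (?p y * of_real (G' y) + ?q y * of_real (G y))) (at y within {0..B})" for y
        by (rule has_vector_derivative_mult[OF vd Gd])
      show "continuous_on {0..B} (\<lambda>y. ?p y * of_real (G' y) + ?q y * of_real (G y))"
        by (intro continuous_intros continuous_on_subset[OF cont(1)] continuous_on_subset[OF cont(2)] continuous_on_subset[OF Gc] continuous_on_subset[OF G(2)]) auto
    qed (use B in auto)
    also have "(LBINT y. indicator {0..B} y *\<^sub>R (?p y * of_real (G' y) + ?q y * of_real (G y))) = (LBINT y. P n (x, y) * g' y + Q n (x, y) * g y)"
    proof (rule integral_cong_AE)
      have "AE y in lborel. y \<noteq> (0::real)" "AE y in lborel. y \<noteq> B" by (rule AE_lborel_singleton)+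
      then show "AE y in lborel. indicator {0..B} y *\<^sub>R (?p y * of_real (G' y) + ?q y * of_real (G y)) = P n (x, y) * g' y + Q n (x, y) * g y"
      proof eventually_elim
        case (elim y)
        have "indicator {0..B} y = (indicator I y :: real)" using elim by (auto simp: I_def indicator_def)
        then show ?case by (cases "y \<in> I") (simp_all add: P_def Q_def restr_def mem g_def g'_def)
      qed
    qed measurable
    also have "\<dots> = (LBINT y. P n (x, y) * g' y) + (LBINT y. Q n (x, y) * g y)"
      by (intro Bochner_Integration.integral_add L2_fun_mult_integrable sP sQ Lg)
    finally show "(LBINT y. P n (x, y) * g' y) + (LBINT y. Q n (x, y) * g y) = b n x" by (simp add: b_def)
  qed
  \<comment> \<open>\<open>R\<close> is the defect in the claimed identity. For the approximants the
    defect is the boundary term \<open>b n\<close>, so \<open>R\<close> is bounded by this term and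
    the two approximation errors, all of which tend to 0 in \<open>L2\<close>.\<close>
  define R where "R x = (LBINT y. F (x, y) * g' y) + (LBINT y. U (x, y) * g y)" for x
  have [measurable]: "R \<in> borel_measurable borel" unfolding R_def[abs_def] by measurable
  have [measurable]: "b n \<in> borel_measurable borel" for n unfolding b_def[abs_def] by measurable
  have Rn: "sq_norm R \<le> 2 * (ennreal (M^2) * sq_norm (\<lambda>x. \<phi> n (x, c))) + 2 * (2 * (ennreal (M^2 * B) * sq_norm (w n)) + 2 * (ennreal (M^2 * B) * sq_norm (z n)))" for n
  proof -
    let ?W = "\<lambda>x. LBINT y. w n (x, y) * g' y" and ?Z = "\<lambda>x. LBINT y. z n (x, y) * g y"
    have "AE x in lborel. L2_fun (\<lambda>y. F (x, y))" "AE x in lborel. L2_fun (\<lambda>y. U (x, y))" by (rule AE_L2_section; rule LF)+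
    then have "AE x in lborel. R x = b n x + (-1) * (?W x + ?Z x)"
    proof eventually_elim
      case (elim x)
      have "?W x = (LBINT y. P n (x, y) * g' y) - (LBINT y. F (x, y) * g' y)"
        unfolding w_def left_diff_distrib by (intro Bochner_Integration.integral_diff L2_fun_mult_integrable sections Lg elim)
      moreover have "?Z x = (LBINT y. Q n (x, y) * g y) - (LBINT y. U (x, y) * g y)"
        unfolding z_def left_diff_distrib by (intro Bochner_Integration.integral_diff L2_fun_mult_integrable sections Lg elim)
      ultimately show ?case by (simp add: R_def by_parts[of n x, symmetric] algebra_simps)
    qed
    then have "sq_norm R = sq_norm (\<lambda>x. b n x + (-1) * (?W x + ?Z x))"
      unfolding sq_norm_def by (intro nn_integral_cong_AE) (auto elim!: eventually_mono)
    also have "\<dots> \<le> 2 * sq_norm (b n) + 2 * sq_norm (\<lambda>x. (-1) * (?W x + ?Z x))"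
      by (rule sq_norm_add_le) measurable
    also have "\<dots> \<le> 2 * (ennreal (M^2) * sq_norm (\<lambda>x. \<phi> n (x, c))) + 2 * (2 * (ennreal (M^2 * B) * sq_norm (w n)) + 2 * (ennreal (M^2 * B) * sq_norm (z n)))"
    proof (intro add_mono mult_left_mono)
      have "norm (b n x) \<le> M * norm (\<phi> n (x, c))" for x
        using c G(3) M(1)[of c] B by (auto simp: b_def norm_mult mult.commute intro!: mult_right_mono)
      then have "sq_norm (b n) \<le> sq_norm (\<lambda>x. of_real M * \<phi> n (x, c))"
        unfolding sq_norm_def using M0 by (intro nn_integral_mono ennreal_leI power_mono) (auto simp: norm_mult)
      also have "\<dots> = ennreal (M^2) * sq_norm (\<lambda>x. \<phi> n (x, c))"
        using M0 by (subst sq_norm_cmult) auto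
      finally show "sq_norm (b n) \<le> ennreal (M^2) * sq_norm (\<lambda>x. \<phi> n (x, c))" .
      have "sq_norm (\<lambda>x. (-1) * (?W x + ?Z x)) = sq_norm (\<lambda>x. ?W x + ?Z x)"
        by (subst sq_norm_cmult) auto
      also have "\<dots> \<le> 2 * sq_norm ?W + 2 * sq_norm ?Z" by (rule sq_norm_add_le) measurable
      also have "\<dots> \<le> 2 * (ennreal (M^2 * B) * sq_norm (w n)) + 2 * (ennreal (M^2 * B) * sq_norm (z n))"
        by (intro add_mono mult_left_mono order_trans[OF sq_norm_partial_integral] mult_right_mono Ng) auto
      finally show "sq_norm (\<lambda>x. (-1) * (?W x + ?Z x)) \<le> 2 * (ennreal (M^2 * B) * sq_norm (w n)) + 2 * (ennreal (M^2 * B) * sq_norm (z n))" .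
    qed auto
    finally show ?thesis .
  qed
  have "(\<lambda>n. 2 * (ennreal (M^2) * sq_norm (\<lambda>x. \<phi> n (x, c))) + 2 * (2 * (ennreal (M^2 * B) * sq_norm (w n)) + 2 * (ennreal (M^2 * B) * sq_norm (z n)))) \<longlonglongrightarrow> 0 + 2 * (0 + 0)"
    by (intro tendsto_add tendsto_0_le_ennreal ennreal_tendsto_cmult \<phi>(4) wz0) (auto simp: less_top[symmetric])
  then have "sq_norm R \<le> 0"
    by (intro LIMSEQ_le_const[of _ "0::ennreal"]) (use Rn in auto)
  then have "AE x in lborel. nsq (R x) = 0"
    by (subst nn_integral_0_iff_AE[symmetric]) (auto simp: sq_norm_def)
  then show ?thesis
  proof eventually_elim
    case (elim x)
    then have "R x = 0" by simp
    moreover have "(\<lambda>y. F (x, y) * g' y) = (\<lambda>y. restr (strip B) f (x, y) * of_real (G' y))" "(\<lambda>y. U (x, y) * g y) = (\<lambda>y. restr (strip B) u (x, y) * of_real (G y))"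
      by (auto simp: F_def U_def S_def g_def g'_def I_def restr_def mem_strip indicator_def)
    ultimately show ?case by (simp add: R_def u_def S_def eq_neg_iff_add_eq_0)
  qed
qed

text \<open>Integration by parts in \<open>y\<close> turns \<open>j * pi / B\<close> times a sine
  coefficient of \<open>f\<close> into a cosine coefficient of the weak derivative, and Bessel's
  inequality for the cosines sums these over \<open>j\<close>, for almost every
  \<open>x\<close>.\<close>

proposition H1_dir_sine_coefficients:
  assumes B: "B > 0" and f: "f \<in> H1_dir B" and J: "finite J" "0 \<notin> J"
  shows "(\<Sum>j\<in>J. ennreal ((real j)^2) * sq_norm (\<lambda>x. LBINT y. restr (strip B) f (x, y) * of_real (eigfun B j y)))
     \<le> ennreal ((B / pi)^2) * L2_sq (strip B) (weak_deriv (strip B) (0, 1) f)"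
proof -
  define S where "S = strip B"
  define F U where "F = restr S f" and "U = restr S (weak_deriv S (0, 1) f)"
  have d: "(0, 1) \<in> (Basis :: (real \<times> real) set)" by (auto simp: Basis_prod_def)
  have fH: "f \<in> H1_space S" and t0: "has_trace B 0 f (\<lambda>_. 0)" and tB: "has_trace B B f (\<lambda>_. 0)"
    using f by (auto simp: H1_dir_def S_def)
  have LF: "L2_fun F" "L2_fun U" using fH weak_deriv_props(1)[OF fH d] by (auto simp: F_def U_def H1_space_def L2_space_iff)
  note [measurable] = L2_fun_measurable[OF LF(1)] L2_fun_measurable[OF LF(2)]
  define e where "e j y = indicator {0<..<B} y * (sqrt (2 / B) * cosfun B j y)" for j y
  have key: "AE x in lborel. of_real (real j * pi / B) * (LBINT y. F (x, y) * of_real (eigfun B j y)) = (LBINT y. U (x, y) * of_real (e j y))" if j: "j \<in> J" for j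
  proof -
    define r where "r = real j * pi / B"
    define q where "q = sqrt (2 / B)"
    have q0: "q \<ge> 0" using B by (simp add: q_def)
    have r0: "r \<ge> 0" using B by (simp add: r_def)
    \<comment> \<open>The cosine is split into \<open>1 - y / B\<close> and \<open>y / B\<close>
      times itself: each piece vanishes at one end and can be used with the trace at the other. In
      the sum the derivatives of the two cutoffs cancel.\<close>
    define G1 G1' where "G1 y = (1 - y / B) * (q * cos (r * y))" and "G1' y = - (1 / B) * (q * cos (r * y)) - (1 - y / B) * (q * (r * sin (r * y)))" for y
    define G2 G2' where "G2 y = (y / B) * (q * cos (r * y))" and "G2' y = (1 / B) * (q * cos (r * y)) - (y / B) * (q * (r * sin (r * y)))" for y
    define M where "M = q + (1 / B) * q + q * r"
    have MM: "q \<le> M" "0 \<le> M" using B q0 r0 by (auto simp: M_def)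
    have cs: "\<bar>q * cos (r * y)\<bar> \<le> q" "\<bar>q * (r * sin (r * y))\<bar> \<le> q * r" for y
      using q0 r0 by (auto simp: abs_mult mult_left_le mult_left_mono)
    have m1: "\<bar>t * v\<bar> \<le> v'" if "0 \<le> t" "t \<le> 1" "\<bar>v\<bar> \<le> v'" for t v v' :: real
    proof -
      have "t * \<bar>v\<bar> \<le> 1 * v'" using that by (intro mult_mono) auto
      then show ?thesis using that by (simp add: abs_mult)
    qed
    have m2: "\<bar>(1 / B) * v\<bar> \<le> (1 / B) * v'" if "\<bar>v\<bar> \<le> v'" for v v' :: real
      using that B by (simp add: abs_mult divide_right_mono)
    have bd: "\<bar>G1 y\<bar> \<le> M" "\<bar>G1' y\<bar> \<le> M" "\<bar>G2 y\<bar> \<le> M" "\<bar>G2' y\<bar> \<le> M" if "y \<in> {0..B}" for y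
    proof -
      have y: "0 \<le> y / B" "y / B \<le> 1" "0 \<le> 1 - y / B" "1 - y / B \<le> 1" using that B by auto
      show "\<bar>G1 y\<bar> \<le> M" "\<bar>G2 y\<bar> \<le> M" unfolding G1_def G2_def using m1[OF y(1,2) cs(1)] m1[OF y(3,4) cs(1)] MM by (auto intro: order_trans)
      define A X1 X2 where "A = (1 / B) * (q * cos (r * y))" and "X1 = (1 - y / B) * (q * (r * sin (r * y)))"
        and "X2 = (y / B) * (q * (r * sin (r * y)))"
      have "\<bar>A\<bar> \<le> (1 / B) * q" "\<bar>X1\<bar> \<le> q * r" "\<bar>X2\<bar> \<le> q * r"
        unfolding A_def X1_def X2_def by (rule m2[OF cs(1)] m1[OF y(3,4) cs(2)] m1[OF y(1,2) cs(2)])+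
      moreover have "G1' y = - A - X1" "G2' y = A - X2"
        by (simp_all add: G1'_def G2'_def A_def X1_def X2_def)
      ultimately show "\<bar>G1' y\<bar> \<le> M" "\<bar>G2' y\<bar> \<le> M"
        using q0 unfolding M_def by linarith+
    qed
    have dcos: "((\<lambda>y. q * cos (r * y)) has_real_derivative - (q * (r * sin (r * y)))) (at y)" for y
      by (auto intro!: derivative_eq_intros)
    have a1: "AE x in lborel. (LBINT y. F (x, y) * of_real (G1' y)) = - (LBINT y. U (x, y) * of_real (G1 y))"
      unfolding F_def U_def S_def
    proof (rule trace_zero_by_parts[OF B fH[unfolded S_def] t0])
      show "(G1 has_real_derivative G1' y) (at y)" for y
      proof -
        have "((\<lambda>y. 1 - y / B) has_real_derivative - (1 / B)) (at y)" using B by (auto intro!: derivative_eq_intros)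
        from DERIV_mult[OF this dcos] show ?thesis unfolding G1_def[abs_def] G1'_def by (simp add: mult.commute)
      qed
      show "continuous_on UNIV G1'" unfolding G1'_def using B by (intro continuous_intros) auto
      show "G1 (B - 0) = 0" using B by (simp add: G1_def)
    qed (use bd in auto)
    have a2: "AE x in lborel. (LBINT y. F (x, y) * of_real (G2' y)) = - (LBINT y. U (x, y) * of_real (G2 y))"
      unfolding F_def U_def S_def
    proof (rule trace_zero_by_parts[OF B fH[unfolded S_def] tB])
      show "(G2 has_real_derivative G2' y) (at y)" for y
      proof -
        have "((\<lambda>y. y / B) has_real_derivative (1 / B)) (at y)" using B by (auto intro!: derivative_eq_intros)
        from DERIV_mult[OF this dcos] show ?thesis unfolding G2_def[abs_def] G2'_def by (simp add: mult.commute)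
      qed
      show "continuous_on UNIV G2'" unfolding G2'_def using B by (intro continuous_intros) auto
      show "G2 (B - B) = 0" by (simp add: G2_def)
    qed (use bd in auto)
    have s1: "AE x in lborel. L2_fun (\<lambda>y. F (x, y))" and s2: "AE x in lborel. L2_fun (\<lambda>y. U (x, y))" by (rule AE_L2_section; rule LF)+
    have [measurable]: "G1 \<in> borel_measurable borel" "G2 \<in> borel_measurable borel" "G1' \<in> borel_measurable borel" "G2' \<in> borel_measurable borel"
      unfolding G1_def[abs_def] G2_def[abs_def] G1'_def[abs_def] G2'_def[abs_def] by measurable
    have int: "integrable lborel (\<lambda>y. H (x, y) * of_real (h y))"
      if "L2_fun (\<lambda>y. H (x, y))" "h \<in> borel_measurable borel" "\<And>y. y \<in> {0..B} \<Longrightarrow> \<bar>h y\<bar> \<le> M" "\<And>y. y \<notin> {0<..<B} \<Longrightarrow> H (x, y) = 0"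
      for H :: "real \<times> real \<Rightarrow> complex" and h :: "real \<Rightarrow> real" and x
    proof -
      note [measurable] = that(2)
      have "integrable lborel (\<lambda>y. H (x, y) * complex_of_real (indicator {0<..<B} y * (indicator {0..B} y * h y)))"
        by (intro L2_fun_mult_integrable that(1) interval_bounded_L2[where C = M]) (use that(3) MM in \<open>auto simp: indicator_def\<close>)
      also have "(\<lambda>y. H (x, y) * complex_of_real (indicator {0<..<B} y * (indicator {0..B} y * h y))) = (\<lambda>y. H (x, y) * of_real (h y))"
      proof
        fix y
        show "H (x, y) * complex_of_real (indicator {0<..<B} y * (indicator {0..B} y * h y)) = H (x, y) * of_real (h y)"
          using that(4)[of y] by (cases "y \<in> {0<..<B}") simp_all
      qed
      finally show ?thesis .
    qed
    have z: "F (x, y) = 0" "U (x, y) = 0" if "y \<notin> {0<..<B}" for x y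
      using that by (auto simp: F_def U_def S_def restr_def mem_strip indicator_def)
    from a1 a2 s1 s2 show ?thesis
    proof eventually_elim
      case (elim x)
      have "(LBINT y. F (x, y) * of_real (G1' y)) + (LBINT y. F (x, y) * of_real (G2' y)) = (LBINT y. F (x, y) * of_real (G1' y) + F (x, y) * of_real (G2' y))"
        by (rule Bochner_Integration.integral_add[symmetric]; rule int) (use elim bd z in auto)
      also have "\<dots> = (LBINT y. (- of_real r) * (F (x, y) * of_real (eigfun B j y)))"
      proof (intro Bochner_Integration.integral_cong refl)
        fix y
        have "G1' y + G2' y = - r * eigfun B j y"
        proof -
          have "G1' y + G2' y = - (q * (r * sin (r * y)))" unfolding G1'_def G2'_def by (simp add: left_diff_distrib)
          also have "\<dots> = - r * eigfun B j y" unfolding eigfun_eq[OF B] q_def[symmetric] by (simp add: r_def)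
          finally show ?thesis .
        qed
        then have "F (x, y) * of_real (G1' y + G2' y) = F (x, y) * of_real (- r * eigfun B j y)" by simp
        then show "F (x, y) * of_real (G1' y) + F (x, y) * of_real (G2' y) = (- of_real r) * (F (x, y) * of_real (eigfun B j y))"
          by (simp add: distrib_left mult_ac)
      qed
      also have "\<dots> = - of_real r * (LBINT y. F (x, y) * of_real (eigfun B j y))" by simp
      finally have L: "(LBINT y. F (x, y) * of_real (G1' y)) + (LBINT y. F (x, y) * of_real (G2' y)) = - of_real r * (LBINT y. F (x, y) * of_real (eigfun B j y))" .
      have "(LBINT y. U (x, y) * of_real (G1 y)) + (LBINT y. U (x, y) * of_real (G2 y)) = (LBINT y. U (x, y) * of_real (G1 y) + U (x, y) * of_real (G2 y))"
        by (rule Bochner_Integration.integral_add[symmetric]; rule int) (use elim bd z in auto)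
      also have "\<dots> = (LBINT y. U (x, y) * of_real (e j y))"
      proof (intro Bochner_Integration.integral_cong refl)
        fix y
        have "G1 y + G2 y = q * cosfun B j y" unfolding G1_def G2_def cosfun_def by (simp add: left_diff_distrib r_def)
        then have "U (x, y) * of_real (G1 y + G2 y) = U (x, y) * of_real (q * cosfun B j y)" by simp
        then show "U (x, y) * of_real (G1 y) + U (x, y) * of_real (G2 y) = U (x, y) * of_real (e j y)"
          using z[of y x] by (cases "y \<in> {0<..<B}") (auto simp: distrib_left e_def q_def)
      qed
      finally have K: "(LBINT y. U (x, y) * of_real (G1 y)) + (LBINT y. U (x, y) * of_real (G2 y)) = (LBINT y. U (x, y) * of_real (e j y))" .
      have "- of_real r * (LBINT y. F (x, y) * of_real (eigfun B j y)) = - (LBINT y. U (x, y) * of_real (e j y))"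
        by (simp only: L[symmetric] elim(1) elim(2) K[symmetric] minus_add_distrib)
      then show ?case unfolding r_def[symmetric] by simp
    qed
  qed
  define a where "a j x = (LBINT y. F (x, y) * of_real (eigfun B j y))" for j x
  have [measurable]: "a j \<in> borel_measurable borel" for j unfolding a_def[abs_def] by measurable
  have [measurable]: "e j \<in> borel_measurable borel" for j unfolding e_def[abs_def] by measurable
  have keys: "AE x in lborel. \<forall>j\<in>J. of_real (real j * pi / B) * a j x = (LBINT y. U (x, y) * of_real (e j y))"
    using key J(1) unfolding a_def by (intro AE_finite_allI) auto
  have s2: "AE x in lborel. L2_fun (\<lambda>y. U (x, y))" by (rule AE_L2_section; rule LF)
  have "(\<Sum>j\<in>J. ennreal ((real j)^2) * sq_norm (a j)) = (\<integral>\<^sup>+x. (\<Sum>j\<in>J. ennreal ((real j)^2) * nsq (a j x)))"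
    unfolding sq_norm_def by (simp add: nn_integral_sum nn_integral_cmult)
  also have "\<dots> \<le> (\<integral>\<^sup>+x. ennreal ((B / pi)^2) * sq_norm (\<lambda>y. U (x, y)))"
  proof (rule nn_integral_mono_AE)
    from keys s2 show "AE x in lborel. (\<Sum>j\<in>J. ennreal ((real j)^2) * nsq (a j x)) \<le> ennreal ((B / pi)^2) * sq_norm (\<lambda>y. U (x, y))"
    proof eventually_elim
      case (elim x)
      have "(\<Sum>j\<in>J. ennreal ((real j)^2) * nsq (a j x)) = (\<Sum>j\<in>J. ennreal ((B / pi)^2) * nsq (LBINT y. U (x, y) * of_real (e j y)))"
      proof (rule sum.cong[OF refl])
        fix j assume "j \<in> J"
        then have "(LBINT y. U (x, y) * of_real (e j y)) = of_real (real j * pi / B) * a j x" using elim by simp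
        then have "(norm (LBINT y. U (x, y) * of_real (e j y)))^2 = (real j * pi / B)^2 * (norm (a j x))^2"
          using B by (simp add: norm_mult power_mult_distrib norm_divide power_divide)
        then have "(B / pi)^2 * (norm (LBINT y. U (x, y) * of_real (e j y)))^2 = (real j)^2 * (norm (a j x))^2"
          using B by (simp add: power_mult_distrib power_divide)
        then show "ennreal ((real j)^2) * nsq (a j x) = ennreal ((B / pi)^2) * nsq (LBINT y. U (x, y) * of_real (e j y))"
          by (simp flip: ennreal_mult)
      qed
      also have "\<dots> = ennreal ((B / pi)^2) * (\<Sum>j\<in>J. nsq (LBINT y. U (x, y) * of_real (e j y)))" by (simp only: sum_distrib_left)
      also have "\<dots> \<le> ennreal ((B / pi)^2) * sq_norm (\<lambda>y. U (x, y))"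
        unfolding e_def by (intro mult_left_mono bessel_cosfun B J elim) auto
      finally show ?case .
    qed
  qed
  also have "\<dots> = ennreal ((B / pi)^2) * sq_norm U"
  proof -
    have "(\<lambda>x. sq_norm (\<lambda>y. U (x, y))) \<in> borel_measurable lborel" unfolding sq_norm_def by measurable
    then show ?thesis by (simp add: nn_integral_cmult sq_norm_pair)
  qed
  finally show ?thesis by (simp add: a_def[abs_def] F_def U_def S_def L2_sq_eq)
qed

section \<open>The product estimate\<close>

lemma continuous_compact_support_L2:
  fixes P :: "'a::euclidean_space \<Rightarrow> complex"
  assumes P: "continuous_on UNIV P" and supp: "\<And>x. norm x \<ge> r \<Longrightarrow> P x = 0"
  shows "L2_fun P"
proof -
  have "bounded (P ` cball 0 r)" by (intro compact_imp_bounded compact_continuous_image continuous_on_subset[OF P]) auto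
  then obtain C where "\<forall>v\<in>P ` cball 0 r. norm v \<le> C" unfolding bounded_iff by blast
  then have "norm (P x) \<le> C * indicator (ball 0 r) x" for x using supp[of x] by (cases "norm x < r") auto
  then show ?thesis by (rule bounded_support_L1_L2(2)[OF borel_measurable_continuous_onI[OF P]])
qed

text \<open>A measurable function is the limit almost everywhere of continuous ones. The
  nearest-point projection to a disc and the cutoff \<open>ch\<close> restore the bounds on values
  and support without disturbing the limit; the radius grows by 1 to leave room for the
  cutoff.\<close>

lemma Cc_approximation:
  fixes u :: "'a::euclidean_space \<Rightarrow> complex"
  assumes um: "u \<in> borel_measurable borel" and ub: "\<And>x. norm (u x) \<le> n * indicator (ball 0 n) x" and n: "n \<ge> 0"
  obtains P where "\<And>i::nat. continuous_on UNIV (P i)" "\<And>i x. norm (P i x) \<le> n * indicator (ball 0 (n + 1)) x"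
    "AE x in lborel. (\<lambda>i. P i x) \<longlonglongrightarrow> u x"
proof -
  have "u \<in> borel_measurable lebesgue"
    using um by (simp add: measurable_completion)
  then have "u measurable_on UNIV" by (rule lebesgue_measurable_imp_measurable_on) simp
  then obtain N g where N: "negligible N" and g: "\<And>i. continuous_on UNIV (g i)" "\<And>x. x \<notin> N \<Longrightarrow> (\<lambda>i. g i x) \<longlonglongrightarrow> u x"
    by (auto simp: measurable_on_def)
  define cl :: "complex \<Rightarrow> complex" where "cl = closest_point (cball 0 n)"
  have cl: "continuous_on UNIV cl" "\<And>z. norm (cl z) \<le> n" "\<And>z. norm z \<le> n \<Longrightarrow> cl z = z"
  proof -
    show "continuous_on UNIV cl" unfolding cl_def using n by (intro continuous_on_closest_point) auto
    show "norm (cl z) \<le> n" for z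
      using closest_point_in_set[of "cball (0::complex) n" z] n by (auto simp: cl_def)
    show "norm z \<le> n \<Longrightarrow> cl z = z" for z unfolding cl_def by (intro closest_point_self) auto
  qed
  define ch where "ch x = max 0 (min 1 (n + 1 - norm x))" for x :: 'a
  have ch: "continuous_on UNIV ch" "\<And>x. 0 \<le> ch x" "\<And>x. ch x \<le> 1" "\<And>x. norm x < n \<Longrightarrow> ch x = 1" "\<And>x. norm x \<ge> n + 1 \<Longrightarrow> ch x = 0"
    unfolding ch_def by (auto intro!: continuous_intros)
  define P where "P i x = of_real (ch x) * cl (g i x)" for i x
  show ?thesis
  proof (rule that[of P])
    show "continuous_on UNIV (P i)" for i
      unfolding P_def[abs_def] by (intro continuous_intros ch(1) continuous_on_compose2[OF cl(1) g(1)]) auto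
    show "norm (P i x) \<le> n * indicator (ball 0 (n + 1)) x" for i x
    proof (cases "norm x < n + 1")
      case True
      have "ch x * norm (cl (g i x)) \<le> 1 * n" using ch cl(2) by (intro mult_mono) auto
      with True show ?thesis using ch(2)[of x] by (simp add: P_def norm_mult)
    qed (simp add: P_def ch(5))
    have "AE x in lborel. x \<notin> N"
    proof -
      have "AE x in lebesgue. x \<notin> N" using N by (simp add: negligible_iff_null_sets AE_not_in)
      then show ?thesis by (simp add: AE_completion_iff)
    qed
    then show "AE x in lborel. (\<lambda>i. P i x) \<longlonglongrightarrow> u x"
    proof eventually_elim
      case (elim x)
      have nu: "norm (u x) \<le> n" by (rule order_trans[OF ub[of x]]) (simp add: indicator_def n)
      have "isCont cl (u x)" using cl(1) by (simp add: continuous_on_eq_continuous_at)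
      from isCont_tendsto_compose[OF this g(2)[OF elim]] have "(\<lambda>i. P i x) \<longlonglongrightarrow> of_real (ch x) * cl (u x)"
        unfolding P_def by (intro tendsto_mult tendsto_const)
      also have "of_real (ch x) * cl (u x) = u x"
        using ub[of x] ch(4)[of x] cl(3)[OF nu] by (cases "norm x < n") auto
      finally show ?case .
    qed
  qed
qed

text \<open>One square-integrable bound serves both sides: \<open>g * b\<close> dominates the
  pairings, and the square of \<open>b\<close> dominates the norms, so both sides converge.\<close>

lemma dual_bound_limit:
  fixes g :: "'a::euclidean_space \<Rightarrow> complex"
  assumes g: "L2_fun g" and Mf: "M < \<top>" and b: "L2_fun b"
    and [measurable]: "\<And>i::nat. P i \<in> borel_measurable borel" "u \<in> borel_measurable borel"
    and le: "\<And>i x. norm (P i x) \<le> norm (b x)" and lim: "AE x in lborel. (\<lambda>i. P i x) \<longlonglongrightarrow> u x"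
    and bd: "\<And>i. (ennreal (norm (LBINT x. g x * P i x)))^2 \<le> M * sq_norm (P i)"
  shows "(ennreal (norm (LBINT x. g x * u x)))^2 \<le> M * sq_norm u"
proof -
  note [measurable] = L2_fun_measurable[OF g] L2_fun_measurable[OF b]
  have 1: "(\<lambda>i. LBINT x. g x * P i x) \<longlonglongrightarrow> (LBINT x. g x * u x)"
  proof (rule integral_dominated_convergence[where w = "\<lambda>x. norm (g x * b x)"])
    show "integrable lborel (\<lambda>x. norm (g x * b x))" by (intro integrable_norm L2_fun_mult_integrable g b)
    show "AE x in lborel. (\<lambda>i. g x * P i x) \<longlonglongrightarrow> g x * u x"
      using lim by eventually_elim (intro tendsto_mult tendsto_const)
    show "AE x in lborel. norm (g x * P i x) \<le> norm (g x * b x)" for i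
      using le by (auto simp: norm_mult intro!: mult_left_mono)
  qed measurable
  have 2: "(\<lambda>i. sq_norm (P i)) \<longlonglongrightarrow> sq_norm u"
    unfolding sq_norm_def
  proof (rule nn_integral_dominated_convergence[where w = "\<lambda>x. nsq (b x)"])
    show "(\<integral>\<^sup>+x. nsq (b x)) < \<infinity>" using b by (simp add: L2_fun_def sq_norm_def)
    show "AE x in lborel. nsq (P i x) \<le> nsq (b x)" for i
      using le by (auto intro!: ennreal_leI power_mono)
    show "AE x in lborel. (\<lambda>i. nsq (P i x)) \<longlonglongrightarrow> nsq (u x)"
      using lim by eventually_elim (intro tendsto_ennrealI tendsto_power tendsto_norm)
  qed measurable
  have L1: "(\<lambda>i. nsq (LBINT x. g x * P i x)) \<longlonglongrightarrow> nsq (LBINT x. g x * u x)"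
    by (intro tendsto_ennrealI tendsto_power tendsto_norm 1)
  have L2: "(\<lambda>i. M * sq_norm (P i)) \<longlonglongrightarrow> M * sq_norm u" by (intro ennreal_tendsto_cmult Mf 2)
  have "nsq (LBINT x. g x * u x) \<le> M * sq_norm u"
    by (rule LIMSEQ_le[OF L1 L2]) (use bd in \<open>auto simp: ennreal_power\<close>)
  then show ?thesis by (simp add: ennreal_power)
qed

text \<open>Continuous tests of compact support are wanted because they can be approximated
  uniformly by cosine sums in \<open>y\<close>.\<close>

lemma sq_norm_le_dual_Cc:
  fixes g :: "'a::euclidean_space \<Rightarrow> complex"
  assumes g: "L2_fun g" and Mf: "M < \<top>"
    and bd: "\<And>P r. continuous_on UNIV P \<Longrightarrow> (\<And>x. norm x \<ge> r \<Longrightarrow> P x = 0) \<Longrightarrow>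
       (ennreal (norm (LBINT x. g x * P x)))^2 \<le> M * sq_norm P"
  shows "sq_norm g \<le> M"
proof (rule sq_norm_le_dual[OF g])
  fix u :: "'a \<Rightarrow> complex" and n :: nat
  assume um [measurable]: "u \<in> borel_measurable borel" and ub: "\<And>x. norm (u x) \<le> real n * indicator (ball 0 (real n)) x"
  obtain P where P: "\<And>i::nat. continuous_on UNIV (P i)" "\<And>i x. norm (P i x) \<le> real n * indicator (ball 0 (real n + 1)) x"
    "AE x in lborel. (\<lambda>i. P i x) \<longlonglongrightarrow> u x"
    by (rule Cc_approximation[OF um ub of_nat_0_le_iff]) (rule that)
  have Pm: "P i \<in> borel_measurable borel" for i by (intro borel_measurable_continuous_onI P)
  have fin: "emeasure lborel (ball (0::'a) (real n + 1)) < \<infinity>" using emeasure_bounded_finite[OF bounded_ball] by simp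
  define b where "b x = of_real (real n) * complex_of_real (indicator (ball (0::'a) (real n + 1)) x)" for x
  have b: "L2_fun b" "\<And>i x. norm (P i x) \<le> norm (b x)"
    unfolding b_def[abs_def] using P(2) by (auto intro!: L2_fun_cmult indicator_L1_L2 fin simp: norm_mult)
  have "(ennreal (norm (LBINT x. g x * P i x)))^2 \<le> M * sq_norm (P i)" for i
  proof -
    have "P i x = 0" if "norm x \<ge> real n + 1" for x
    proof -
      have "indicator (ball 0 (real n + 1)) x = (0::real)" using that by simp
      with P(2)[of i x] show ?thesis by simp
    qed
    from bd[OF P(1) this] show ?thesis .
  qed
  then show "(ennreal (norm (LBINT x. g x * u x)))^2 \<le> M * sq_norm u"
    by (rule dual_bound_limit[OF g Mf b(1) Pm um b(2) P(3)])
qed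

section \<open>Approximate Fourier inversion and cosine expansion of test functions\<close>

lemma integral_scale_R2:
  fixes f :: "real \<times> real \<Rightarrow> complex"
  assumes [measurable]: "f \<in> borel_measurable borel" and "s > 0"
  shows "(LBINT z. f z) = s^2 *\<^sub>R (LBINT z. f (s *\<^sub>R z))"
proof -
  have *: "(lborel :: (real \<times> real) measure) = density (distr lborel borel (\<lambda>x. 0 + s *\<^sub>R x)) (\<lambda>_. ennreal (\<bar>s\<bar> ^ DIM(real \<times> real)))"
    by (rule lborel_affine) (use assms in auto)
  have "(LBINT z. f z) = (LINT z|density (distr lborel borel (\<lambda>x. 0 + s *\<^sub>R x)) (\<lambda>_. ennreal (\<bar>s\<bar> ^ DIM(real \<times> real))). f z)"
    using * by simp
  also have "\<dots> = (LINT z|distr lborel borel (\<lambda>x. 0 + s *\<^sub>R x). (\<bar>s\<bar> ^ DIM(real \<times> real)) *\<^sub>R f z)"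
    by (rule integral_density) auto
  also have "\<dots> = (LBINT z. s^2 *\<^sub>R f (s *\<^sub>R z))"
    by (subst integral_distr) (auto simp: power2_eq_square)
  finally show ?thesis by simp
qed

text \<open>The trilinear estimate speaks of tests given through their transforms, whereas
  \<open>p\<close> lives in physical space. \<open>u n\<close> is the reflected transform of
  \<open>p\<close> with Gaussian damping; its own transform is an average of \<open>p\<close>, hence
  bounded by a bound for \<open>p\<close> and pointwise convergent by continuity. The norm constant
  is \<open>c^2 * (2 * pi)^2\<close> with \<open>c = 1 / (2 * pi)^2\<close>.\<close>

lemma fourier_approximate_inverse:
  fixes p :: "real \<times> real \<Rightarrow> complex"
  assumes p: "continuous_on UNIV p" and supp: "\<And>q. norm q \<ge> r \<Longrightarrow> p q = 0"
  obtains u C where "\<And>n::nat. integrable lborel (u n)" "\<And>n. L2_fun (u n)"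
    "\<And>n. sq_norm (u n) \<le> ennreal (1 / (2 * pi)^2) * sq_norm p" "\<And>n x. norm (fourier (u n) x) \<le> C"
    "\<And>x. (\<lambda>n. fourier (u n) x) \<longlonglongrightarrow> p x"
proof -
  have pm [measurable]: "p \<in> borel_measurable borel" by (intro borel_measurable_continuous_onI p)
  have "bounded (p ` cball 0 r)" by (intro compact_imp_bounded compact_continuous_image continuous_on_subset[OF p]) auto
  then obtain C0 where "\<forall>v\<in>p ` cball 0 r. norm v \<le> C0" unfolding bounded_iff by blast
  then have C0: "norm (p q) \<le> C0" if "norm q \<le> r" for q using that by auto
  define C where "C = max C0 0"
  have C: "norm (p q) \<le> C" for q using C0[of q] supp[of q] by (cases "norm q \<le> r") (auto simp: C_def)
  have "C \<ge> 0" by (simp add: C_def)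
  have "norm (p q) \<le> C * indicator (ball 0 r) q" for q using C[of q] supp[of q] by (cases "norm q < r") auto
  from bounded_support_L1_L2[OF pm this] have pi: "integrable lborel p" and pL: "L2_fun p" by auto
  define c where "c = 1 / (2 * pi)^2"
  define s where "s n = 1 / real (Suc n)" for n
  have s: "s n > 0" for n by (simp add: s_def)
  define u where "u n \<zeta> = of_real (c * gauss ((s n)^2) \<zeta>) * fourier p (- \<zeta>)" for n \<zeta>
  have [measurable]: "u n \<in> borel_measurable borel" for n unfolding u_def[abs_def] by measurable
  have Fneg: "sq_norm (\<lambda>\<zeta>. fourier p (- \<zeta>)) = sq_norm (fourier p)"
    using nn_integral_lborel_reflect[of "\<lambda>\<zeta>. nsq (fourier p \<zeta>)" 0] by (simp add: sq_norm_def)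
  have FL: "L2_fun (fourier p)" by (intro L2_fun_fourier pi pL)
  have LFn: "L2_fun (\<lambda>\<zeta>. fourier p (- \<zeta>))" using FL by (simp add: L2_fun_def Fneg)
  have c0: "c > 0" by (simp add: c_def)
  have g01: "0 \<le> gauss ((s n)^2) \<zeta>" "gauss ((s n)^2) \<zeta> \<le> 1" for n \<zeta> using gauss_bounds[of "(s n)^2" \<zeta>] by auto
  have un: "norm (u n \<zeta>) \<le> norm (of_real c * fourier p (- \<zeta>))" for n \<zeta>
    using g01[of n \<zeta>] c0 by (simp add: u_def norm_mult mult_right_mono mult_left_le)
  show ?thesis
  proof (rule that[of u C])
    show "integrable lborel (u n)" for n
    proof (rule Bochner_Integration.integrable_bound)
      show "integrable lborel (\<lambda>\<zeta>. c * (LBINT p'. norm (p p')) * gauss ((s n)^2) \<zeta>)"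
        by (intro integrable_mult_right integrable_gauss) (simp add: s[THEN less_imp_neq, THEN not_sym])
      have "norm (u n \<zeta>) \<le> c * (LBINT p'. norm (p p')) * gauss ((s n)^2) \<zeta>" for \<zeta>
        using mult_left_mono[OF norm_fourier_le[of p "- \<zeta>"], of "c * gauss ((s n)^2) \<zeta>"] g01[of n \<zeta>] c0
        by (simp add: u_def norm_mult mult_ac)
      then show "AE \<zeta> in lborel. norm (u n \<zeta>) \<le> norm (c * (LBINT p'. norm (p p')) * gauss ((s n)^2) \<zeta>)"
        by (intro always_eventually allI) (simp only: real_norm_def, rule order_trans[OF _ abs_ge_self], simp)
    qed measurable
    show "L2_fun (u n)" for n
      by (rule L2_fun_bound(1)[OF L2_fun_cmult[OF LFn] _ un]) measurable
    show "sq_norm (u n) \<le> ennreal (1 / (2 * pi)^2) * sq_norm p" for n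
    proof -
      have "sq_norm (u n) \<le> sq_norm (\<lambda>\<zeta>. of_real c * fourier p (- \<zeta>))"
        by (rule L2_fun_bound(2)[OF L2_fun_cmult[OF LFn] _ un]) measurable
      also have "\<dots> = ennreal (c^2) * sq_norm (fourier p)"
        using c0 by (subst sq_norm_cmult) (auto simp: Fneg)
      also have "\<dots> \<le> ennreal (c^2) * (ennreal ((2 * pi)^2) * sq_norm p)"
        by (intro mult_left_mono sq_norm_fourier pi) auto
      also have "\<dots> = ennreal (c^2 * (2 * pi)^2) * sq_norm p" by (simp add: ennreal_mult mult.assoc del: power_mult_distrib)
      also have "c^2 * (2 * pi)^2 = 1 / (2 * pi)^2" unfolding c_def by (simp add: power2_eq_square)
      finally show ?thesis .
    qed
    \<comment> \<open>Scaling by \<open>s n\<close> absorbs the width of the Gaussian: the averaging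
      density becomes \<open>gauss 1 y / (2 * pi)\<close>, of mass 1, and \<open>n\<close> remains
      only in the argument of \<open>p\<close>.\<close>
    have rep: "fourier (u n) x = (LBINT y. p (x + s n *\<^sub>R y) * of_real (gauss 1 y / (2 * pi)))" for n x
    proof -
      have "fourier (u n) x = (LBINT \<zeta>. cis (- (\<zeta> \<bullet> x)) * u n \<zeta>)" by (simp add: fourier_eq)
      also have "\<dots> = (LINT \<zeta>|distr lborel borel uminus. cis (- (\<zeta> \<bullet> x)) * u n \<zeta>)" by (simp add: lborel_distr_neg)
      also have "\<dots> = (LBINT \<zeta>. cis (\<zeta> \<bullet> x) * u n (- \<zeta>))" by (subst integral_distr) auto
      also have "\<dots> = (LBINT \<zeta>. of_real c * (fourier p \<zeta> * (cis (x \<bullet> \<zeta>) * of_real (gauss ((s n)^2) \<zeta>))))"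
        by (intro Bochner_Integration.integral_cong refl) (simp add: u_def gauss_def inner_commute mult_ac)
      also have "\<dots> = of_real c * (LBINT \<zeta>. fourier p \<zeta> * (cis (x \<bullet> \<zeta>) * of_real (gauss ((s n)^2) \<zeta>)))"
        by (rule integral_mult_right_zero)
      also have "(LBINT \<zeta>. fourier p \<zeta> * (cis (x \<bullet> \<zeta>) * of_real (gauss ((s n)^2) \<zeta>))) = (LBINT q. p q * of_real (2 * pi / (s n)^2 * gauss (1 / (s n)^2) (q - x)))"
        by (rule fourier_gauss_regularised[OF pi]) (use s[of n] in simp)
      also have "\<dots> = (LBINT z. p (z + x) * of_real (2 * pi / (s n)^2 * gauss (1 / (s n)^2) (z + x - x)))"
        by (rule lborel_integral_shift[symmetric]) measurable
      also have "\<dots> = (s n)^2 *\<^sub>R (LBINT y. p (s n *\<^sub>R y + x) * of_real (2 * pi / (s n)^2 * gauss (1 / (s n)^2) (s n *\<^sub>R y + x - x)))"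
        by (rule integral_scale_R2[OF _ s]) measurable
      also have "of_real c * \<dots> = (LBINT y. of_real (c * (s n)^2) * (p (s n *\<^sub>R y + x) * of_real (2 * pi / (s n)^2 * gauss (1 / (s n)^2) (s n *\<^sub>R y + x - x))))"
        by (subst integral_mult_right_zero) (simp add: scaleR_conv_of_real)
      also have "\<dots> = (LBINT y. p (x + s n *\<^sub>R y) * of_real (gauss 1 y / (2 * pi)))"
      proof (intro Bochner_Integration.integral_cong refl)
        fix y
        have "gauss (1 / (s n)^2) (s n *\<^sub>R y + x - x) = gauss 1 y"
          using s[of n] by (simp add: gauss_def power2_eq_square)
        moreover have e2: "c * (s n)^2 * (2 * pi / (s n)^2 * gauss 1 y) = gauss 1 y / (2 * pi)"
          using s[of n] by (simp add: c_def power2_eq_square)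
        moreover have "complex_of_real (c * (s n)^2) * (p (s n *\<^sub>R y + x) * of_real (2 * pi / (s n)^2 * gauss 1 y)) = p (s n *\<^sub>R y + x) * of_real (c * (s n)^2 * (2 * pi / (s n)^2 * gauss 1 y))"
          by (simp only: of_real_mult mult_ac)
        ultimately show "of_real (c * (s n)^2) * (p (s n *\<^sub>R y + x) * of_real (2 * pi / (s n)^2 * gauss (1 / (s n)^2) (s n *\<^sub>R y + x - x))) = p (x + s n *\<^sub>R y) * of_real (gauss 1 y / (2 * pi))"
          by (simp only: add.commute)
      qed
      finally show ?thesis .
    qed
    have ig: "integrable lborel (\<lambda>y. C * (gauss 1 y / (2 * pi)))" using integrable_gauss[of 1] by simp
    have g1: "(LBINT y. gauss 1 y / (2 * pi)) = 1" using integral_gauss[of 1] by simp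
    have nb: "norm (p (x + s n *\<^sub>R y) * complex_of_real (gauss 1 y / (2 * pi))) \<le> C * (gauss 1 y / (2 * pi))" for x y n
    proof -
      have "\<bar>gauss 1 y / (2 * pi)\<bar> = gauss 1 y / (2 * pi)" using gauss_bounds(1)[of 1 y] by simp
      then show ?thesis unfolding norm_mult norm_of_real using C \<open>C \<ge> 0\<close> gauss_bounds(1)[of 1 y] by (intro mult_mono) auto
    qed
    show "norm (fourier (u n) x) \<le> C" for n x
    proof -
      have "norm (fourier (u n) x) \<le> (LBINT y. C * (gauss 1 y / (2 * pi)))"
        unfolding rep
      proof (rule Bochner_Integration.integral_norm_bound_integral)
        show "integrable lborel (\<lambda>y. p (x + s n *\<^sub>R y) * complex_of_real (gauss 1 y / (2 * pi)))"
          by (rule Bochner_Integration.integrable_bound[OF ig], measurable) (intro always_eventually allI, rule order_trans[OF nb], simp only: real_norm_def abs_ge_self)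
        show "integrable lborel (\<lambda>y. C * (gauss 1 y / (2 * pi)))" by (rule ig)
      qed (rule nb)
      then show ?thesis by (simp only: integral_mult_right_zero g1 mult_1_right)
    qed
    show "(\<lambda>n. fourier (u n) x) \<longlonglongrightarrow> p x" for x
    proof -
      have "(\<lambda>n. LBINT y. p (x + s n *\<^sub>R y) * of_real (gauss 1 y / (2 * pi))) \<longlonglongrightarrow> (LBINT y. p x * complex_of_real (gauss 1 y / (2 * pi)))"
      proof (rule integral_dominated_convergence[where w = "\<lambda>y. C * (gauss 1 y / (2 * pi))"])
        have s0: "s \<longlonglongrightarrow> 0" unfolding s_def[abs_def] by (rule lim_1_over_n[THEN LIMSEQ_Suc])
        show "AE y in lborel. (\<lambda>n. p (x + s n *\<^sub>R y) * of_real (gauss 1 y / (2 * pi))) \<longlonglongrightarrow> p x * of_real (gauss 1 y / (2 * pi))"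
        proof (intro always_eventually allI tendsto_mult tendsto_const)
          fix y
          have "isCont p x" using p unfolding continuous_on_eq_continuous_at[OF open_UNIV] by blast
          moreover have "(\<lambda>n. x + s n *\<^sub>R y) \<longlonglongrightarrow> x + 0 *\<^sub>R y" by (intro tendsto_intros s0)
          ultimately show "(\<lambda>n. p (x + s n *\<^sub>R y)) \<longlonglongrightarrow> p x" by (intro isCont_tendsto_compose[of x p]) auto
        qed
        show "integrable lborel (\<lambda>y. C * (gauss 1 y / (2 * pi)))" by (rule ig)
        show "AE y in lborel. norm (p (x + s n *\<^sub>R y) * complex_of_real (gauss 1 y / (2 * pi))) \<le> C * (gauss 1 y / (2 * pi))" for n
          by (intro always_eventually allI nb)
      qed measurable
      also have "(LBINT y. p x * complex_of_real (gauss 1 y / (2 * pi))) = p x"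
        using g1 by (simp only: integral_mult_right_zero integral_complex_of_real) simp
      finally show ?thesis by (simp only: rep)
    qed
  qed
qed

text \<open>A product of two cosines is a combination of two cosines, so this class is an algebra,
  and Stone-Weierstrass applies with arbitrary continuous coefficients in the first
  component.\<close>

inductive cos_poly :: "real \<Rightarrow> ((real \<times> real) \<times> real \<Rightarrow> real) \<Rightarrow> bool" for B where
  mono: "continuous_on UNIV a \<Longrightarrow> cos_poly B (\<lambda>z. a (fst z) * cosfun B l (snd z))"
| add: "cos_poly B f \<Longrightarrow> cos_poly B g \<Longrightarrow> cos_poly B (\<lambda>z. f z + g z)"

lemma cosfun_mult: "cosfun B i y * cosfun B j y = (cosfun B (i + j) y + cosfun B (if i \<le> j then j - i else i - j) y) / 2"
proof -
  have "cos (real i * pi * y / B) * cos (real j * pi * y / B) = (cos (real i * pi * y / B - real j * pi * y / B) + cos (real i * pi * y / B + real j * pi * y / B)) / 2"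
    by (rule cos_times_cos)
  moreover have "real i * pi * y / B + real j * pi * y / B = real (i + j) * pi * y / B"
    by (simp add: add_divide_distrib distrib_right)
  moreover have "cos (real i * pi * y / B - real j * pi * y / B) = cos (real (if i \<le> j then j - i else i - j) * pi * y / B)"
  proof (cases "i \<le> j")
    case True
    then have "real i * pi * y / B - real j * pi * y / B = - (real (j - i) * pi * y / B)"
      by (simp add: of_nat_diff diff_divide_distrib left_diff_distrib)
    then show ?thesis using True by simp
  next
    case False
    then have "real i * pi * y / B - real j * pi * y / B = real (i - j) * pi * y / B"
      by (simp add: of_nat_diff diff_divide_distrib left_diff_distrib)
    then show ?thesis using False by simp
  qed
  ultimately show ?thesis by (simp add: cosfun_def add.commute)
qed

lemma cos_poly_mult:
  assumes "cos_poly B f" "cos_poly B g" shows "cos_poly B (\<lambda>z. f z * g z)"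
  using assms
proof (induction arbitrary: g rule: cos_poly.induct)
  case (mono a i)
  from mono(2) show ?case
  proof (induction rule: cos_poly.induct)
    case (mono b j)
    have c: "continuous_on UNIV (\<lambda>q. a q * b q / 2)"
      using mono \<open>continuous_on UNIV a\<close> by (intro continuous_intros) auto
    have "cos_poly B (\<lambda>z. (a (fst z) * b (fst z) / 2) * cosfun B (i + j) (snd z) + (a (fst z) * b (fst z) / 2) * cosfun B (if i \<le> j then j - i else i - j) (snd z))"
      by (intro cos_poly.add cos_poly.mono[OF c])
    moreover have "a (fst z) * cosfun B i (snd z) * (b (fst z) * cosfun B j (snd z)) = (a (fst z) * b (fst z) / 2) * cosfun B (i + j) (snd z) + (a (fst z) * b (fst z) / 2) * cosfun B (if i \<le> j then j - i else i - j) (snd z)" for z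
    proof -
      have "a (fst z) * cosfun B i (snd z) * (b (fst z) * cosfun B j (snd z)) = (a (fst z) * b (fst z)) * (cosfun B i (snd z) * cosfun B j (snd z))" by (simp only: mult_ac)
      also have "\<dots> = (a (fst z) * b (fst z)) * ((cosfun B (i + j) (snd z) + cosfun B (if i \<le> j then j - i else i - j) (snd z)) / 2)" by (simp only: cosfun_mult)
      finally show ?thesis by (simp add: distrib_left add_divide_distrib)
    qed
    ultimately show ?case by simp
  next
    case (add f g)
    from cos_poly.add[OF add.IH] show ?case by (simp add: distrib_left)
  qed
next
  case (add f1 f2)
  from cos_poly.add[OF add.IH(1)[OF add.prems] add.IH(2)[OF add.prems]] show ?case by (simp add: distrib_right)
qed

lemma continuous_cosfun: "continuous_on A (cosfun B l)" if "B > 0"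
  unfolding cosfun_def using that by (intro continuous_intros) auto

lemma cos_poly_continuous: "cos_poly B f \<Longrightarrow> B > 0 \<Longrightarrow> continuous_on UNIV f"
proof (induction rule: cos_poly.induct)
  case (mono a l)
  then show ?case
    by (intro continuous_intros continuous_on_compose2[OF mono(1)] continuous_on_compose2[OF continuous_cosfun[of B UNIV l]]) auto
qed (auto intro: continuous_intros)

lemma cos_poly_expand:
  "cos_poly B f \<Longrightarrow> \<exists>N a. (\<forall>l. continuous_on UNIV (a l)) \<and> (\<forall>z. f z = (\<Sum>l\<le>N. a l (fst z) * cosfun B l (snd z)))"
proof (induction rule: cos_poly.induct)
  case (mono a l)
  have "a (fst z) * cosfun B l (snd z) = (\<Sum>i\<le>l. (if i = l then a else (\<lambda>_. 0)) (fst z) * cosfun B i (snd z))" for z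
    by (simp add: if_distrib[of "\<lambda>f. f (fst z)"] if_distrib[of "\<lambda>x. x * _"] cong: if_cong)
  then show ?case using mono by (intro exI[of _ l] exI[of _ "\<lambda>i. if i = l then a else (\<lambda>_. 0)"]) auto
next
  case (add f g)
  then obtain N a M b where a: "\<And>l. continuous_on UNIV (a l)" "\<And>z. f z = (\<Sum>l\<le>N. a l (fst z) * cosfun B l (snd z))"
    and b: "\<And>l. continuous_on UNIV (b l)" "\<And>z. g z = (\<Sum>l\<le>M. b l (fst z) * cosfun B l (snd z))" by blast
  define a' b' where "a' l = (if l \<le> N then a l else (\<lambda>_. 0))" and "b' l = (if l \<le> M then b l else (\<lambda>_. 0))" for l
  have "f z = (\<Sum>l\<le>max N M. a' l (fst z) * cosfun B l (snd z))" for z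
    unfolding a(2) by (rule sum.mono_neutral_cong_left) (auto simp: a'_def)
  moreover have "g z = (\<Sum>l\<le>max N M. b' l (fst z) * cosfun B l (snd z))" for z
    unfolding b(2) by (rule sum.mono_neutral_cong_left) (auto simp: b'_def)
  ultimately have "f z + g z = (\<Sum>l\<le>max N M. (\<lambda>q. a' l q + b' l q) (fst z) * cosfun B l (snd z))" for z
    by (simp add: sum.distrib distrib_right)
  moreover have "continuous_on UNIV (\<lambda>q. a' l q + b' l q)" for l
    using a b by (intro continuous_intros) (auto simp: a'_def b'_def)
  ultimately show ?case by (intro exI[of _ "max N M"] exI[of _ "\<lambda>l q. a' l q + b' l q"]) auto
qed

text \<open>Points with different first components are separated by the inner product with their
  difference, the others by the first cosine, which is injective on \<open>{0..B}\<close>. Sines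
  would not do here, since a test function need not vanish at the two ends.\<close>

lemma cos_poly_dense:
  fixes f :: "(real \<times> real) \<times> real \<Rightarrow> real"
  assumes B: "B > 0" and f: "continuous_on UNIV f" and e: "e > 0"
  obtains N a where "\<And>l. continuous_on UNIV (a l)"
    "\<And>q y. norm q \<le> r \<Longrightarrow> y \<in> {0..B} \<Longrightarrow> \<bar>f (q, y) - (\<Sum>l\<le>N. a l q * cosfun B l y)\<bar> < e"
proof -
  define S where "S = cball (0::real \<times> real) r \<times> {0..B}"
  have "\<exists>g. cos_poly B g \<and> (\<forall>z\<in>S. \<bar>f z - g z\<bar> < e)"
  proof (rule Stone_Weierstrass_HOL[where P = "cos_poly B"])
    show "compact S" unfolding S_def by (intro compact_Times) auto
    show "cos_poly B (\<lambda>z. c)" for c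
      using cos_poly.mono[of "\<lambda>_. c" B 0] by (simp add: cosfun_def)
    show "continuous_on S g" if "cos_poly B g" for g
      using cos_poly_continuous[OF that B] by (rule continuous_on_subset) simp
    show "continuous_on S f" using f by (rule continuous_on_subset) simp
    show "\<exists>g. cos_poly B g \<and> g z \<noteq> g z'" if z: "z \<in> S \<and> z' \<in> S \<and> z \<noteq> z'" for z z'
    proof (cases "fst z = fst z'")
      case False
      define d where "d = fst z - fst z'"
      have "cos_poly B (\<lambda>w. (fst w \<bullet> d) * cosfun B 0 (snd w))"
        by (rule cos_poly.mono) (intro continuous_intros)
      moreover have "fst z \<bullet> d - fst z' \<bullet> d = d \<bullet> d" by (simp add: d_def inner_diff_left)
      then have "fst z \<bullet> d \<noteq> fst z' \<bullet> d" using False by (auto simp: d_def)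
      ultimately show ?thesis by (intro exI[of _ "\<lambda>w. (fst w \<bullet> d) * cosfun B 0 (snd w)"]) (simp add: cosfun_def)
    next
      case True
      then have ne: "snd z \<noteq> snd z'" using z by (auto simp: prod_eq_iff)
      have "cos_poly B (\<lambda>w. 1 * cosfun B 1 (snd w))"
        using cos_poly.mono[of "\<lambda>_. 1" B 1] by simp
      moreover have "cosfun B 1 (snd z) \<noteq> cosfun B 1 (snd z')"
      proof
        assume "cosfun B 1 (snd z) = cosfun B 1 (snd z')"
        then have c: "cos (pi * snd z / B) = cos (pi * snd z' / B)" by (simp add: cosfun_def)
        have r: "0 \<le> pi * y / B" "pi * y / B \<le> pi" if "y \<in> {0..B}" for y
          using that B by (auto simp: divide_le_eq)
        have m: "snd z \<in> {0..B}" "snd z' \<in> {0..B}" using z by (auto simp: S_def)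
        have "pi * snd z / B = pi * snd z' / B"
          by (rule cos_inj_pi[OF r(1)[OF m(1)] r(2)[OF m(1)] r(1)[OF m(2)] r(2)[OF m(2)] c])
        then have "pi * snd z = pi * snd z'" using B by (metis divide_cancel_right less_irrefl)
        then have "snd z = snd z'" by (metis mult_cancel_left pi_neq_zero)
        then show False using ne by contradiction
      qed
      ultimately show ?thesis by (intro exI[of _ "\<lambda>w. 1 * cosfun B 1 (snd w)"]) simp
    qed
    show "cos_poly B (\<lambda>z. g z + g' z)" if "cos_poly B g \<and> cos_poly B g'" for g g' using that by (intro cos_poly.add) auto
    show "cos_poly B (\<lambda>z. g z * g' z)" if "cos_poly B g \<and> cos_poly B g'" for g g' using that by (intro cos_poly_mult) auto
  qed (rule e)
  then obtain g where g: "cos_poly B g" "\<And>z. z \<in> S \<Longrightarrow> \<bar>f z - g z\<bar> < e" by blast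
  obtain N a where a: "\<forall>l. continuous_on UNIV (a l)" "\<forall>z. g z = (\<Sum>l\<le>N. a l (fst z) * cosfun B l (snd z))"
    using cos_poly_expand[OF g(1)] by blast
  show ?thesis
  proof (rule that[of a N])
    show "continuous_on UNIV (a l)" for l using a by blast
    show "\<bar>f (q, y) - (\<Sum>l\<le>N. a l q * cosfun B l y)\<bar> < e" if "norm q \<le> r" "y \<in> {0..B}" for q y
      using g(2)[of "(q, y)"] that a(2)[rule_format, of "(q, y)"] by (simp add: S_def)
  qed
qed

text \<open>Real and imaginary parts are approximated separately on a ball larger by 1. The cutoff
  \<open>ch\<close> is 1 wherever \<open>P\<close> can be nonzero and gives the coefficients compact
  support, so the error is not only uniformly small but also confined to a ball.\<close>

lemma cosine_approximation:
  fixes P :: "(real \<times> real) \<times> real \<Rightarrow> complex"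
  assumes B: "B > 0" and P: "continuous_on UNIV P" and supp: "\<And>z. norm z \<ge> r \<Longrightarrow> P z = 0" and e: "e > 0"
  obtains N p where "\<And>l. continuous_on UNIV (p l)" "\<And>l q. norm q \<ge> r + 1 \<Longrightarrow> p l q = 0"
    "\<And>q y. y \<in> {0..B} \<Longrightarrow> norm (P (q, y) - (\<Sum>l\<le>N. p l q * of_real (cosfun B l y))) \<le> e * indicator (ball 0 (r + 1)) q"
proof -
  have cRe: "continuous_on UNIV (\<lambda>z. Re (P z))" and cIm: "continuous_on UNIV (\<lambda>z. Im (P z))" by (intro continuous_intros P)+
  have e2: "e / 2 > 0" using e by simp
  obtain N a where a: "\<And>l. continuous_on UNIV (a l)"
    "\<And>q y. norm q \<le> r + 1 \<Longrightarrow> y \<in> {0..B} \<Longrightarrow> \<bar>Re (P (q, y)) - (\<Sum>l\<le>N. a l q * cosfun B l y)\<bar> < e / 2"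
    by (rule cos_poly_dense[OF B cRe e2, of "r + 1"]) (rule that)
  obtain M b where b: "\<And>l. continuous_on UNIV (b l)"
    "\<And>q y. norm q \<le> r + 1 \<Longrightarrow> y \<in> {0..B} \<Longrightarrow> \<bar>Im (P (q, y)) - (\<Sum>l\<le>M. b l q * cosfun B l y)\<bar> < e / 2"
    by (rule cos_poly_dense[OF B cIm e2, of "r + 1"]) (rule that)
  define ch where "ch q = max 0 (min 1 (r + 1 - norm q))" for q :: "real \<times> real"
  have ch: "continuous_on UNIV ch" "\<And>q. 0 \<le> ch q" "\<And>q. ch q \<le> 1" "\<And>q. norm q < r \<Longrightarrow> ch q = 1" "\<And>q. norm q \<ge> r + 1 \<Longrightarrow> ch q = 0"
    unfolding ch_def by (auto intro!: continuous_intros)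
  define a' b' where "a' l = (if l \<le> N then a l else (\<lambda>_. 0))" and "b' l = (if l \<le> M then b l else (\<lambda>_. 0))" for l
  define p where "p l q = of_real (ch q) * Complex (a' l q) (b' l q)" for l and q :: "real \<times> real"
  have c': "continuous_on UNIV (a' l)" "continuous_on UNIV (b' l)" for l using a b by (auto simp: a'_def b'_def)
  have sa: "(\<Sum>l\<le>max N M. a' l q * cosfun B l y) = (\<Sum>l\<le>N. a l q * cosfun B l y)" for q y
    by (rule sum.mono_neutral_cong_right) (auto simp: a'_def)
  have sb: "(\<Sum>l\<le>max N M. b' l q * cosfun B l y) = (\<Sum>l\<le>M. b l q * cosfun B l y)" for q y
    by (rule sum.mono_neutral_cong_right) (auto simp: b'_def)
  show ?thesis
  proof (rule that[of p "max N M"])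
    show "continuous_on UNIV (p l)" for l
      unfolding p_def[abs_def] Complex_eq by (intro continuous_intros ch(1) c')
    show "p l q = 0" if "norm q \<ge> r + 1" for l and q :: "real \<times> real" using ch(5)[OF that] by (simp add: p_def)
    fix q :: "real \<times> real" and y assume y: "y \<in> {0..B}"
    have nz: "norm q \<le> norm (q, y)" by (rule norm_fst_le)
    have sum_eq: "(\<Sum>l\<le>max N M. p l q * of_real (cosfun B l y)) = of_real (ch q) * Complex (\<Sum>l\<le>N. a l q * cosfun B l y) (\<Sum>l\<le>M. b l q * cosfun B l y)"
      unfolding sa[symmetric] sb[symmetric] p_def
      by (simp add: complex_eq_iff sum_distrib_left mult_ac)
    have chP: "P (q, y) = of_real (ch q) * P (q, y)"
      using ch(4)[of q] supp[of "(q, y)"] nz by (cases "norm q < r") auto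
    show "norm (P (q, y) - (\<Sum>l\<le>max N M. p l q * of_real (cosfun B l y))) \<le> e * indicator (ball 0 (r + 1)) q"
    proof (cases "norm q < r + 1")
      case True
      define D where "D = P (q, y) - Complex (\<Sum>l\<le>N. a l q * cosfun B l y) (\<Sum>l\<le>M. b l q * cosfun B l y)"
      have "norm D \<le> \<bar>Re D\<bar> + \<bar>Im D\<bar>" by (rule cmod_le)
      also have "\<dots> \<le> e / 2 + e / 2"
        using a(2)[of q y] b(2)[of q y] True y by (intro add_mono) (auto simp: D_def)
      finally have "norm D \<le> e" by simp
      then have "ch q * norm D \<le> 1 * e" using ch by (intro mult_mono) auto
      moreover have "P (q, y) - (\<Sum>l\<le>max N M. p l q * of_real (cosfun B l y)) = of_real (ch q) * D"
        unfolding sum_eq D_def right_diff_distrib using chP by simp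
      ultimately show ?thesis using True ch(2)[of q] by (simp add: norm_mult)
    next
      case False
      then have "ch q = 0" using ch(5) by simp
      then have "P (q, y) = 0" using chP by simp
      then show ?thesis unfolding sum_eq using \<open>ch q = 0\<close> e by (simp add: indicator_def)
    qed
  qed
qed

text \<open>Orthogonality in \<open>y\<close> for each fixed first component. The lower bound
  \<open>B / 2\<close> for the square norm of a cosine covers the constant mode together with the
  others.\<close>

lemma sq_norm_cosine_sum:
  fixes p :: "nat \<Rightarrow> real \<times> real \<Rightarrow> complex"
  assumes B: "B > 0" and pm: "\<And>l. L2_fun (p l)"
  shows "(\<Sum>l\<le>N. sq_norm (p l)) \<le> ennreal (2 / B) * sq_norm (\<lambda>z. of_real (indicator {0<..<B} (snd z)) * (\<Sum>l\<le>N. p l (fst z) * of_real (cosfun B l (snd z))))"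
proof -
  have [measurable]: "p l \<in> borel_measurable borel" for l using pm by (simp add: L2_fun_def)
  let ?I = "\<lambda>i j. LBINT y. indicator {0<..<B} y * (cosfun B i y * cosfun B j y)"
  let ?T = "\<lambda>q y. of_real (indicator {0<..<B} y) * (\<Sum>l\<le>N. p l q * of_real (cosfun B l y)) :: complex"
  have pt: "ennreal (B / 2) * (\<Sum>l\<le>N. nsq (p l q)) \<le> (\<integral>\<^sup>+y. nsq (?T q y))" for q
  proof -
    have intc: "integrable lborel (\<lambda>y. indicator {0<..<B} y * (cosfun B i y * cosfun B j y))" for i j
    proof (rule Bochner_Integration.integrable_bound)
      show "integrable lborel (indicator {0<..<B} :: real \<Rightarrow> real)" using B by (intro integrable_real_indicator) auto
      show "AE y in lborel. norm (indicator {0<..<B} y * (cosfun B i y * cosfun B j y)) \<le> norm (indicator {0<..<B} y :: real)"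
        by (auto simp: indicator_def abs_mult intro!: mult_le_one cosfun_bound)
    qed measurable
    have e: "(norm (?T q y))^2 = (\<Sum>i\<le>N. \<Sum>j\<le>N. Re (p i q * cnj (p j q)) * (indicator {0<..<B} y * (cosfun B i y * cosfun B j y)))" for y
    proof -
      have "complex_of_real ((norm (?T q y))^2) = ?T q y * cnj (?T q y)" by (rule complex_norm_square)
      also have "\<dots> = (\<Sum>i\<le>N. \<Sum>j\<le>N. (p i q * cnj (p j q)) * of_real (indicator {0<..<B} y * (cosfun B i y * cosfun B j y)))"
        by (cases "y \<in> {0<..<B}") (simp_all add: sum_product mult_ac)
      finally have "Re (complex_of_real ((norm (?T q y))^2)) = Re (\<Sum>i\<le>N. \<Sum>j\<le>N. (p i q * cnj (p j q)) * of_real (indicator {0<..<B} y * (cosfun B i y * cosfun B j y)))"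
        by (rule arg_cong)
      moreover have "Re (z * complex_of_real r) = Re z * r" for z r by simp
      ultimately show ?thesis by (simp only: Re_complex_of_real Re_sum)
    qed
    have rn: "Re (z * cnj z) = (norm z)^2" for z unfolding cmod_power2 by (simp add: power2_eq_square)
    have off: "?I i j = 0" if "j \<noteq> i" for i j using cosfun_orthogonal[OF B, of i j] that by auto
    have int: "integrable lborel (\<lambda>y. (norm (?T q y))^2)"
      unfolding e by (intro Bochner_Integration.integrable_sum integrable_mult_right intc)
    have "(LBINT y. (norm (?T q y))^2) = (\<Sum>i\<le>N. \<Sum>j\<le>N. Re (p i q * cnj (p j q)) * ?I i j)"
      unfolding e
      by (subst Bochner_Integration.integral_sum, intro Bochner_Integration.integrable_sum integrable_mult_right intc)
         (intro sum.cong refl, subst Bochner_Integration.integral_sum, intro integrable_mult_right intc, simp)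
    also have "\<dots> = (\<Sum>i\<le>N. (norm (p i q))^2 * ?I i i)"
    proof (rule sum.cong[OF refl])
      fix i assume i: "i \<in> {..N}"
      have "(\<Sum>j\<le>N. Re (p i q * cnj (p j q)) * ?I i j) = (\<Sum>j\<le>N. if j = i then (norm (p i q))\<^sup>2 * ?I i i else 0)"
      proof (rule sum.cong[OF refl])
        fix j
        show "Re (p i q * cnj (p j q)) * ?I i j = (if j = i then (norm (p i q))\<^sup>2 * ?I i i else 0)"
          by (cases "j = i") (simp_all only: rn off if_True if_False mult_zero_right simp_thms)
      qed
      also have "\<dots> = (norm (p i q))^2 * ?I i i" using i by simp
      finally show "(\<Sum>j\<le>N. Re (p i q * cnj (p j q)) * ?I i j) = (norm (p i q))^2 * ?I i i" .
    qed
    also have "\<dots> \<ge> (\<Sum>i\<le>N. (norm (p i q))^2 * (B / 2))"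
      by (intro sum_mono mult_left_mono cosfun_norm[OF B]) auto
    finally have "B / 2 * (\<Sum>l\<le>N. (norm (p l q))^2) \<le> (LBINT y. (norm (?T q y))^2)"
      by (simp add: sum_distrib_left mult.commute)
    then have "ennreal (B / 2 * (\<Sum>l\<le>N. (norm (p l q))^2)) \<le> ennreal (LBINT y. (norm (?T q y))^2)" by (rule ennreal_leI)
    also have "\<dots> = (\<integral>\<^sup>+y. nsq (?T q y))"
      by (rule nn_integral_eq_integral[symmetric, OF int]) simp
    also have "ennreal (B / 2 * (\<Sum>l\<le>N. (norm (p l q))^2)) = ennreal (B / 2) * (\<Sum>l\<le>N. nsq (p l q))"
      using B by (subst ennreal_mult) (auto intro!: sum_nonneg simp: sum_ennreal)
    finally show ?thesis .
  qed
  have "ennreal (B / 2) * (\<Sum>l\<le>N. sq_norm (p l)) = (\<integral>\<^sup>+q. ennreal (B / 2) * (\<Sum>l\<le>N. nsq (p l q)))"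
    unfolding sq_norm_def by (subst nn_integral_cmult, measurable, subst nn_integral_sum) auto
  also have "\<dots> \<le> (\<integral>\<^sup>+q. \<integral>\<^sup>+y. nsq (?T q y))"
    by (intro nn_integral_mono pt)
  also have "\<dots> = sq_norm (\<lambda>z. ?T (fst z) (snd z))"
    unfolding sq_norm_def by (subst nn_integral_lborel_pair) auto
  finally have le: "ennreal (B / 2) * (\<Sum>l\<le>N. sq_norm (p l)) \<le> sq_norm (\<lambda>z. ?T (fst z) (snd z))" .
  have "(\<Sum>l\<le>N. sq_norm (p l)) = ennreal (2 / B) * (ennreal (B / 2) * (\<Sum>l\<le>N. sq_norm (p l)))"
  proof -
    have "ennreal (2 / B) * ennreal (B / 2) = 1" using B by (subst ennreal_mult[symmetric]) auto
    then show ?thesis by (simp add: mult.assoc[symmetric])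
  qed
  also have "\<dots> \<le> ennreal (2 / B) * sq_norm (\<lambda>z. ?T (fst z) (snd z))" by (intro mult_left_mono le) simp
  finally show ?thesis .
qed

section \<open>Convolution and its Fourier transform\<close>

definition conv :: "(real \<times> real \<Rightarrow> complex) \<Rightarrow> (real \<times> real \<Rightarrow> complex) \<Rightarrow> real \<times> real \<Rightarrow> complex" where
  "conv w u z1 = (LBINT z. w (z1 - z) * u z)"

lemma measurable_conv [measurable]:
  assumes [measurable]: "w \<in> borel_measurable borel" "u \<in> borel_measurable borel"
  shows "conv w u \<in> borel_measurable borel"
  unfolding conv_def[abs_def] by measurable

lemma norm_conv_le: "ennreal (norm (conv w u z1)) \<le> (\<integral>\<^sup>+z. ennreal (norm (w (z1 - z))) * ennreal (norm (u z)))"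
  unfolding conv_def by (rule order_trans[OF integral_norm_bound_ennreal_any]) (simp add: norm_mult ennreal_mult)

lemma nn_integral_conv_kernel:
  assumes [measurable]: "w \<in> borel_measurable borel" "u \<in> borel_measurable borel"
  shows "(\<integral>\<^sup>+z1. \<integral>\<^sup>+z. ennreal (norm (w (z1 - z))) * ennreal (norm (u z))) =
    (\<integral>\<^sup>+z. ennreal (norm (w z))) * (\<integral>\<^sup>+z. ennreal (norm (u z)))"
proof -
  have "(\<integral>\<^sup>+z1. \<integral>\<^sup>+z. ennreal (norm (w (z1 - z))) * ennreal (norm (u z))) =
    (\<integral>\<^sup>+z. \<integral>\<^sup>+z1. ennreal (norm (w (z1 - z))) * ennreal (norm (u z)))"
    by (rule nn_integral_lborel_swap) measurable
  also have "\<dots> = (\<integral>\<^sup>+z. (\<integral>\<^sup>+z1. ennreal (norm (w z1))) * ennreal (norm (u z)))"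
  proof (rule nn_integral_cong)
    fix z
    show "(\<integral>\<^sup>+z1. ennreal (norm (w (z1 - z))) * ennreal (norm (u z))) = (\<integral>\<^sup>+z1. ennreal (norm (w z1))) * ennreal (norm (u z))"
      by (subst nn_integral_multc) (auto simp: nn_integral_lborel_shift_diff[of "\<lambda>z. ennreal (norm (w z))"])
  qed
  also have "\<dots> = (\<integral>\<^sup>+z. ennreal (norm (w z))) * (\<integral>\<^sup>+z. ennreal (norm (u z)))"
    by (rule nn_integral_cmult) measurable
  finally show ?thesis .
qed

lemma integrable_conv:
  assumes w: "integrable lborel w" and u: "integrable lborel u"
  shows "integrable lborel (conv w u)"
proof (rule integrableI_bounded)
  have [measurable]: "w \<in> borel_measurable borel" "u \<in> borel_measurable borel" using w u by auto
  show "conv w u \<in> borel_measurable lborel" by simp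
  have "(\<integral>\<^sup>+z1. ennreal (norm (conv w u z1))) \<le> (\<integral>\<^sup>+z1. \<integral>\<^sup>+z. ennreal (norm (w (z1 - z))) * ennreal (norm (u z)))"
    by (intro nn_integral_mono norm_conv_le)
  also have "\<dots> < \<infinity>" unfolding nn_integral_conv_kernel[OF \<open>w \<in> _\<close> \<open>u \<in> _\<close>]
    using w u by (auto simp: integrable_iff_bounded ennreal_mult_less_top)
  finally show "(\<integral>\<^sup>+z1. ennreal (norm (conv w u z1))) < \<infinity>" .
qed

lemma L2_fun_bounded_integrable:
  assumes f: "integrable lborel f" and b: "\<And>x. norm (f x) \<le> C"
  shows "L2_fun f"
proof -
  have [measurable]: "f \<in> borel_measurable borel" using f by auto
  have C: "C \<ge> 0" using b[of undefined] norm_ge_zero order_trans by blast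
  have "sq_norm f \<le> (\<integral>\<^sup>+x. ennreal C * ennreal (norm (f x)))"
    unfolding sq_norm_def
  proof (rule nn_integral_mono)
    fix x
    have "(norm (f x))^2 \<le> C * norm (f x)" unfolding power2_eq_square by (intro mult_right_mono b) simp
    then show "nsq (f x) \<le> ennreal C * ennreal (norm (f x))"
      using C by (simp add: ennreal_mult[symmetric] ennreal_leI)
  qed
  also have "\<dots> = ennreal C * (\<integral>\<^sup>+x. ennreal (norm (f x)))" by (rule nn_integral_cmult) measurable
  also have "\<dots> < \<infinity>" using f by (auto simp: integrable_iff_bounded ennreal_mult_less_top)
  finally show ?thesis by (simp add: L2_fun_def)
qed

text \<open>Cauchy-Schwarz bounds the convolution and Tonelli makes it integrable; both together
  give square integrability.\<close>

lemma L2_fun_conv: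
  assumes w: "integrable lborel w" "L2_fun w" and u: "integrable lborel u" "L2_fun u"
  shows "L2_fun (conv w u)"
proof -
  have [measurable]: "w \<in> borel_measurable borel" "u \<in> borel_measurable borel" using w u by auto
  define M where "M = enn2real (esqrt (sq_norm w * sq_norm u))"
  have fin: "sq_norm w * sq_norm u < \<infinity>" using w u by (auto simp: L2_fun_def ennreal_mult_less_top)
  have "norm (conv w u z1) \<le> M" for z1
  proof -
    have rw: "sq_norm (\<lambda>z. w (z1 - z)) = sq_norm w"
      unfolding sq_norm_def by (rule nn_integral_lborel_reflect[of "\<lambda>z. nsq (w z)"]) measurable
    have "(ennreal (norm (conv w u z1)))^2 \<le> sq_norm w * sq_norm u"
      using integral_mult_sq_norm[of "\<lambda>z. w (z1 - z)" u] unfolding conv_def by (simp add: rw)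
    then have "(ennreal (norm (conv w u z1)))^2 \<le> (esqrt (sq_norm w * sq_norm u))^2" by (simp only: esqrt_power2)
    then have le: "ennreal (norm (conv w u z1)) \<le> esqrt (sq_norm w * sq_norm u)" by (simp only: power2_mono_ennreal_iff)
    have "esqrt (sq_norm w * sq_norm u) < \<top>" using fin by (auto simp: esqrt_def less_top)
    with le show ?thesis unfolding M_def by (metis enn2real_ennreal enn2real_mono norm_ge_zero)
  qed
  with integrable_conv[OF w(1) u(1)] show ?thesis by (rule L2_fun_bounded_integrable)
qed

lemma fourier_conv:
  assumes w: "integrable lborel w" and u: "integrable lborel u"
  shows "fourier (conv w u) p = fourier w p * fourier u p"
proof -
  have [measurable]: "w \<in> borel_measurable borel" "u \<in> borel_measurable borel" using w u by auto
  have int: "integrable (lborel \<Otimes>\<^sub>M lborel) (\<lambda>(z1, z). cis (- (z1 \<bullet> p)) * (w (z1 - z) * u z))"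
  proof (rule integrableI_bounded)
    show "(\<lambda>(z1, z). cis (- (z1 \<bullet> p)) * (w (z1 - z) * u z)) \<in> borel_measurable (lborel \<Otimes>\<^sub>M lborel)" by measurable
    have "(\<integral>\<^sup>+q. ennreal (norm (case q of (z1, z) \<Rightarrow> cis (- (z1 \<bullet> p)) * (w (z1 - z) * u z))) \<partial>(lborel \<Otimes>\<^sub>M lborel)) =
       (\<integral>\<^sup>+z1. \<integral>\<^sup>+z. ennreal (norm (w (z1 - z))) * ennreal (norm (u z)))"
      by (subst lborel.nn_integral_fst[symmetric]) (auto simp: norm_mult ennreal_mult)
    also have "\<dots> < \<infinity>" unfolding nn_integral_conv_kernel[OF \<open>w \<in> _\<close> \<open>u \<in> _\<close>]
      using w u by (auto simp: integrable_iff_bounded ennreal_mult_less_top)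
    finally show "(\<integral>\<^sup>+q. ennreal (norm (case q of (z1, z) \<Rightarrow> cis (- (z1 \<bullet> p)) * (w (z1 - z) * u z))) \<partial>(lborel \<Otimes>\<^sub>M lborel)) < \<infinity>" .
  qed
  have "fourier (conv w u) p = (LBINT z1. LBINT z. cis (- (z1 \<bullet> p)) * (w (z1 - z) * u z))"
    by (simp add: fourier_eq conv_def)
  also have "\<dots> = (LBINT z. LBINT z1. cis (- (z1 \<bullet> p)) * (w (z1 - z) * u z))"
    by (rule lborel_pair.Fubini_integral[OF int, symmetric])
  also have "\<dots> = (LBINT z. fourier w p * (cis (- (z \<bullet> p)) * u z))"
  proof (rule Bochner_Integration.integral_cong[OF refl])
    fix z
    have "(LBINT z1. cis (- (z1 \<bullet> p)) * (w (z1 - z) * u z)) = (LBINT z1. cis (- ((z1 + z) \<bullet> p)) * (w (z1 + z - z) * u z))"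
      by (rule lborel_integral_shift[symmetric]) measurable
    also have "\<dots> = (LBINT z1. (cis (- (z1 \<bullet> p)) * w z1) * (cis (- (z \<bullet> p)) * u z))"
    proof (rule Bochner_Integration.integral_cong[OF refl])
      fix z1
      have "cis (- ((z1 + z) \<bullet> p)) = cis (- (z1 \<bullet> p)) * cis (- (z \<bullet> p))" by (simp add: cis_mult inner_add_left)
      then show "cis (- ((z1 + z) \<bullet> p)) * (w (z1 + z - z) * u z) = (cis (- (z1 \<bullet> p)) * w z1) * (cis (- (z \<bullet> p)) * u z)"
        by (simp add: mult_ac)
    qed
    also have "\<dots> = fourier w p * (cis (- (z \<bullet> p)) * u z)" by (simp add: fourier_eq)
    finally show "(LBINT z1. cis (- (z1 \<bullet> p)) * (w (z1 - z) * u z)) = fourier w p * (cis (- (z \<bullet> p)) * u z)" .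
  qed
  also have "\<dots> = fourier w p * fourier u p" by (simp add: fourier_eq)
  finally show ?thesis .
qed

section \<open>Sine modes and the Schur test\<close>

definition sine_mode :: "real \<Rightarrow> ((real \<times> real) \<times> real \<Rightarrow> complex) \<Rightarrow> nat \<Rightarrow> real \<times> real \<Rightarrow> complex" where
  "sine_mode B V j p = (LBINT y. V (p, y) * of_real (eigfun B j y))"

lemma L2_fun_tensor:
  fixes F :: "real \<times> real \<Rightarrow> complex" and h :: "real \<Rightarrow> real"
  assumes F: "L2_fun F" and [measurable]: "h \<in> borel_measurable borel" and h: "\<And>y. \<bar>h y\<bar> \<le> C"
  shows "L2_fun (\<lambda>z. F (fst z) * of_real (indicator {0<..<B} (snd z) * h (snd z)))"
proof -
  have [measurable]: "F \<in> borel_measurable borel" using F by auto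
  have hL: "L2_fun (\<lambda>y. complex_of_real (indicator {0<..<B} y * h y))" by (rule interval_bounded_L2[OF _ h]) measurable
  have "sq_norm (\<lambda>z. F (fst z) * of_real (indicator {0<..<B} (snd z) * h (snd z))) =
    (\<integral>\<^sup>+p. \<integral>\<^sup>+y. nsq (F p) * nsq (complex_of_real (indicator {0<..<B} y * h y)))"
    unfolding sq_norm_def
    by (subst nn_integral_lborel_pair, measurable) (simp only: fst_conv snd_conv norm_mult power_mult_distrib ennreal_mult zero_le_power2)
  also have "\<dots> = (\<integral>\<^sup>+p. nsq (F p) * sq_norm (\<lambda>y. complex_of_real (indicator {0<..<B} y * h y)))"
    unfolding sq_norm_def by (intro nn_integral_cong nn_integral_cmult) measurable
  also have "\<dots> = sq_norm F * sq_norm (\<lambda>y. complex_of_real (indicator {0<..<B} y * h y))"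
    unfolding sq_norm_def by (intro nn_integral_multc) measurable
  also have "\<dots> < \<infinity>" using F hL by (auto simp: L2_fun_def ennreal_mult_less_top)
  finally show ?thesis by (simp add: L2_fun_def)
qed

text \<open>\<open>V\<close> is a function on the strip extended by 0, with the variables grouped as
  \<open>((x, t), y)\<close>: the pair that is Fourier transformed comes first, the sine variable
  last.\<close>

locale strip_function =
  fixes B :: real and V :: "(real \<times> real) \<times> real \<Rightarrow> complex"
  assumes B: "B > 0" and V: "L2_fun V" and supp: "\<And>p y. \<not> (0 < y \<and> y < B) \<Longrightarrow> V (p, y) = 0"
begin

lemma V_measurable [measurable]: "V \<in> borel_measurable borel"
  using V by auto

lemma V_indicator: "V z = V z * of_real (indicator {0<..<B} (snd z))"
  using supp[of "snd z" "fst z"] by (auto simp: indicator_def)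

lemma integrable_V_tensor:
  assumes F: "L2_fun F" and [measurable]: "h \<in> borel_measurable borel" and h: "\<And>y. \<bar>h y\<bar> \<le> C"
  shows "integrable lborel (\<lambda>z. V z * (F (fst z) * complex_of_real (h (snd z))))"
proof -
  have "V z * (F (fst z) * complex_of_real (h (snd z))) = V z * (F (fst z) * of_real (indicator {0<..<B} (snd z) * h (snd z)))" for z
    using V_indicator[of z] by (auto simp: indicator_def)
  then show ?thesis using L2_fun_mult_integrable[OF V L2_fun_tensor[OF F assms(2) h, of B]] by (simp only:)
qed

lemma integral_V_tensor:
  assumes F: "L2_fun F"
  shows "(LBINT z. V z * (F (fst z) * complex_of_real (eigfun B j (snd z)))) = (LBINT p. sine_mode B V j p * F p)"
proof -
  have int: "integrable (lborel \<Otimes>\<^sub>M lborel) (\<lambda>z. V z * (F (fst z) * complex_of_real (eigfun B j (snd z))))"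
    using integrable_V_tensor[OF F measurable_eigfun eigfun_bound[OF B]] by (simp add: lborel_prod)
  have "(LBINT z. V z * (F (fst z) * complex_of_real (eigfun B j (snd z)))) = (LBINT p. LBINT y. V (p, y) * (F p * complex_of_real (eigfun B j y)))"
    using lborel_pair.integral_fst'[OF int] by (simp add: lborel_prod)
  also have "\<dots> = (LBINT p. sine_mode B V j p * F p)"
  proof (rule Bochner_Integration.integral_cong[OF refl])
    fix p
    have "(LBINT y. V (p, y) * (F p * complex_of_real (eigfun B j y))) = (LBINT y. F p * (V (p, y) * complex_of_real (eigfun B j y)))"
      by (simp only: mult_ac)
    also have "\<dots> = F p * sine_mode B V j p" unfolding sine_mode_def by (rule integral_mult_right_zero)
    finally show "(LBINT y. V (p, y) * (F p * complex_of_real (eigfun B j y))) = sine_mode B V j p * F p" by (simp add: mult.commute)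
  qed
  finally show ?thesis .
qed

text \<open>The product of the transforms of \<open>w\<close> and \<open>u\<close> is the transform
  of their convolution, so the pairing with mode \<open>j\<close> moves to the Fourier side as
  \<open>g\<close> against \<open>conv w u\<close>, and its absolute value is bounded by the
  trilinear form.\<close>

lemma mode_pairing_bound:
  assumes rep: "fourier_rep (sine_mode B V j) g" and j: "j \<ge> 1"
    and w: "integrable lborel w" "L2_fun w" and u: "integrable lborel u" "L2_fun u"
  shows "(ennreal (norm (LBINT z. V z * ((fourier w (fst z) * fourier u (fst z)) * complex_of_real (eigfun B j (snd z))))))^2
    \<le> ennreal (trilinear_const * real j powr - (26/25)) * (\<integral>\<^sup>+z. ennreal (freq_weight a B j z) * nsq (g z))
       * (\<integral>\<^sup>+z. ennreal (mod_weight a B k z) * nsq (w z)) * sq_norm u"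
proof -
  have [measurable]: "w \<in> borel_measurable borel" "u \<in> borel_measurable borel" "g \<in> borel_measurable borel"
    using w u rep by (auto simp: fourier_rep_def)
  have F: "L2_fun (\<lambda>p. fourier w p * fourier u p)"
    by (rule L2_fun_bounded_mult[OF L2_fun_fourier[OF u], of "fourier w"]) (auto intro: norm_fourier_le)
  have "(LBINT z. V z * ((fourier w (fst z) * fourier u (fst z)) * complex_of_real (eigfun B j (snd z)))) = (LBINT p. sine_mode B V j p * (fourier w p * fourier u p))"
    by (rule integral_V_tensor[OF F])
  also have "\<dots> = (LBINT z1. g z1 * conv w u z1)"
    using rep integrable_conv[OF w(1) u(1)] L2_fun_conv[OF w u] unfolding fourier_rep_def fourier_dual_def
    by (simp add: fourier_conv[OF w(1) u(1)])
  finally have "ennreal (norm (LBINT z. V z * ((fourier w (fst z) * fourier u (fst z)) * complex_of_real (eigfun B j (snd z))))) \<le> (\<integral>\<^sup>+z1. ennreal (norm (g z1 * conv w u z1)))"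
    by (simp add: integral_norm_bound_ennreal_any)
  also have "\<dots> \<le> (\<integral>\<^sup>+z1. \<integral>\<^sup>+z. ennreal (norm (g z1)) * ennreal (norm (w (z1 - z))) * ennreal (norm (u z)))"
  proof (rule nn_integral_mono)
    fix z1
    have "ennreal (norm (g z1 * conv w u z1)) \<le> ennreal (norm (g z1)) * (\<integral>\<^sup>+z. ennreal (norm (w (z1 - z))) * ennreal (norm (u z)))"
      unfolding norm_mult by (subst ennreal_mult) (auto intro!: mult_left_mono norm_conv_le)
    also have "\<dots> = (\<integral>\<^sup>+z. ennreal (norm (g z1)) * (ennreal (norm (w (z1 - z))) * ennreal (norm (u z))))"
      by (rule nn_integral_cmult[symmetric]) measurable
    finally show "ennreal (norm (g z1 * conv w u z1)) \<le> (\<integral>\<^sup>+z. ennreal (norm (g z1)) * ennreal (norm (w (z1 - z))) * ennreal (norm (u z)))"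
      by (simp only: mult.assoc)
  qed
  also have "\<dots> = (\<integral>\<^sup>+z. \<integral>\<^sup>+z1. ennreal (norm (g z1)) * ennreal (norm (w (z1 - z))) * ennreal (norm (u z)))"
    by (rule nn_integral_lborel_swap) measurable
  finally have "(ennreal (norm (LBINT z. V z * ((fourier w (fst z) * fourier u (fst z)) * complex_of_real (eigfun B j (snd z))))))^2 \<le> (\<integral>\<^sup>+z. \<integral>\<^sup>+z1. ennreal (norm (g z1)) * ennreal (norm (w (z1 - z))) * ennreal (norm (u z)))^2"
    by (rule power_mono) simp
  also have "\<dots> \<le> ennreal (trilinear_const * real j powr - (26/25)) * (\<integral>\<^sup>+z. ennreal (freq_weight a B j z) * (ennreal (norm (g z)))^2)
       * (\<integral>\<^sup>+z. ennreal (mod_weight a B k z) * (ennreal (norm (w z)))^2) * (\<integral>\<^sup>+z. (ennreal (norm (u z)))^2)"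
    by (rule trilinear_estimate[OF _ _ _ j]) measurable
  finally show ?thesis by (simp add: sq_norm_def ennreal_power)
qed

end

text \<open>The difference of the mode numbers is taken in the natural numbers, hence the case
  distinction; the sign for \<open>l > k\<close> comes from the sine being odd.\<close>

lemma eigfun_cosfun_mult:
  assumes "B > 0"
  shows "eigfun B k y * cosfun B l y = (eigfun B (k + l) y + (if l \<le> k then eigfun B (k - l) y else - eigfun B (l - k) y)) / 2"
proof -
  have "sin (real k * pi * y / B) * cos (real l * pi * y / B) = (sin (real k * pi * y / B + real l * pi * y / B) + sin (real k * pi * y / B - real l * pi * y / B)) / 2"
    by (rule sin_times_cos)
  moreover have "real k * pi * y / B + real l * pi * y / B = real (k + l) * pi * y / B"
    by (simp add: add_divide_distrib distrib_right)
  moreover have "sin (real k * pi * y / B - real l * pi * y / B) = (if l \<le> k then sin (real (k - l) * pi * y / B) else - sin (real (l - k) * pi * y / B))"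
  proof (cases "l \<le> k")
    case True
    then have "real k * pi * y / B - real l * pi * y / B = real (k - l) * pi * y / B"
      by (simp add: of_nat_diff diff_divide_distrib left_diff_distrib)
    then show ?thesis using True by simp
  next
    case False
    then have "real k * pi * y / B - real l * pi * y / B = - (real (l - k) * pi * y / B)"
      by (simp add: of_nat_diff diff_divide_distrib left_diff_distrib)
    then show ?thesis using False by simp
  qed
  ultimately have *: "sin (real k * pi * y / B) * cos (real l * pi * y / B) = (sin (real (k + l) * pi * y / B) + (if l \<le> k then sin (real (k - l) * pi * y / B) else - sin (real (l - k) * pi * y / B))) / 2" by simp
  have "eigfun B k y * cosfun B l y = sqrt (2 / B) * (sin (real k * pi * y / B) * cos (real l * pi * y / B))"
    by (simp only: eigfun_eq[OF assms] cosfun_def mult.assoc)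
  also have "\<dots> = (eigfun B (k + l) y + (if l \<le> k then eigfun B (k - l) y else - eigfun B (l - k) y)) / 2"
    unfolding * eigfun_eq[OF assms] by (simp only: if_distrib[of "\<lambda>x. sqrt (2 / B) * x"] distrib_left times_divide_eq_right mult_minus_right)
  finally show ?thesis .
qed

text \<open>The square root of the matrix entry is given to each of the two factors before
  Cauchy-Schwarz, so that one sum sees the rows and the other the columns.\<close>

lemma schur_test:
  fixes A :: "nat \<Rightarrow> nat \<Rightarrow> real"
  assumes A: "\<And>k l. A k l \<ge> 0" and m: "\<And>k. m k \<ge> 0" and u: "\<And>l. u l \<ge> 0"
    and row: "\<And>k. k \<in> K \<Longrightarrow> (\<Sum>l\<in>L. A k l) \<le> Q" and col: "\<And>l. l \<in> L \<Longrightarrow> (\<Sum>k\<in>K. A k l) \<le> Q" and Q: "Q \<ge> 0"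
  shows "(\<Sum>k\<in>K. \<Sum>l\<in>L. A k l * m k * u l)^2 \<le> Q^2 * (\<Sum>k\<in>K. (m k)^2) * (\<Sum>l\<in>L. (u l)^2)"
proof -
  have "(\<Sum>k\<in>K. \<Sum>l\<in>L. A k l * m k * u l) = (\<Sum>x\<in>K \<times> L. (sqrt (A (fst x) (snd x)) * m (fst x)) * (sqrt (A (fst x) (snd x)) * u (snd x)))"
    unfolding sum.cartesian_product by (intro sum.cong refl) (use A in \<open>auto simp: algebra_simps\<close>)
  then have "(\<Sum>k\<in>K. \<Sum>l\<in>L. A k l * m k * u l)^2 \<le> (\<Sum>x\<in>K \<times> L. (sqrt (A (fst x) (snd x)) * m (fst x))^2) * (\<Sum>x\<in>K \<times> L. (sqrt (A (fst x) (snd x)) * u (snd x))^2)"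
    by (simp only: Cauchy_Schwarz_ineq_sum)
  also have "(\<Sum>x\<in>K \<times> L. (sqrt (A (fst x) (snd x)) * m (fst x))^2) = (\<Sum>k\<in>K. \<Sum>l\<in>L. A k l * (m k)^2)"
    unfolding sum.cartesian_product by (intro sum.cong refl) (use A in \<open>auto simp: power_mult_distrib\<close>)
  also have "(\<Sum>x\<in>K \<times> L. (sqrt (A (fst x) (snd x)) * u (snd x))^2) = (\<Sum>k\<in>K. \<Sum>l\<in>L. A k l * (u l)^2)"
    unfolding sum.cartesian_product by (intro sum.cong refl) (use A in \<open>auto simp: power_mult_distrib\<close>)
  also have "(\<Sum>k\<in>K. \<Sum>l\<in>L. A k l * (m k)^2) * (\<Sum>k\<in>K. \<Sum>l\<in>L. A k l * (u l)^2) \<le> (Q * (\<Sum>k\<in>K. (m k)^2)) * (Q * (\<Sum>l\<in>L. (u l)^2))"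
  proof (rule mult_mono)
    show "(\<Sum>k\<in>K. \<Sum>l\<in>L. A k l * (m k)^2) \<le> Q * (\<Sum>k\<in>K. (m k)^2)"
      unfolding sum_distrib_right[symmetric] sum_distrib_left by (intro sum_mono mult_right_mono row) auto
    show "(\<Sum>k\<in>K. \<Sum>l\<in>L. A k l * (u l)^2) \<le> Q * (\<Sum>l\<in>L. (u l)^2)"
      by (subst sum.swap, unfold sum_distrib_right[symmetric] sum_distrib_left) (intro sum_mono mult_right_mono col, auto)
    show "0 \<le> Q * (\<Sum>k\<in>K. (m k)^2)" using Q by (intro mult_nonneg_nonneg sum_nonneg) auto
    show "0 \<le> (\<Sum>k\<in>K. \<Sum>l\<in>L. A k l * (u l)^2)" using A by (intro mult_nonneg_nonneg sum_nonneg) auto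
  qed
  finally show ?thesis by (simp only: power2_eq_square mult_ac)
qed

text \<open>Each of \<open>k + l\<close>, \<open>k - l\<close> and \<open>l - k\<close> is injective
  in \<open>l\<close> on its own range, so each of the three partial sums consists of distinct terms
  of \<open>q\<close>.\<close>

lemma sum_shifted_le:
  fixes q :: "nat \<Rightarrow> real"
  assumes q: "\<And>j. q j \<ge> 0" and Q: "\<And>J. finite J \<Longrightarrow> (\<Sum>j\<in>J. q j) \<le> Q" and L: "finite L"
  shows "(\<Sum>l\<in>L. q (k + l) + q (if l \<le> k then k - l else l - k)) \<le> 3 * Q"
proof -
  have r: "(\<Sum>l\<in>M. q (f l)) \<le> Q" if "finite M" "inj_on f M" for M and f :: "nat \<Rightarrow> nat"
    using Q[of "f ` M"] that by (simp add: sum.reindex)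
  have 1: "(\<Sum>l\<in>L. q (k + l)) \<le> Q" by (rule r) (use L in \<open>auto simp: inj_on_def\<close>)
  have 2: "(\<Sum>l\<in>{l\<in>L. l \<le> k}. q (k - l)) \<le> Q" by (rule r) (use L in \<open>auto simp: inj_on_def\<close>)
  have 3: "(\<Sum>l\<in>{l\<in>L. \<not> l \<le> k}. q (l - k)) \<le> Q" by (rule r) (use L in \<open>auto simp: inj_on_def\<close>)
  have "(\<Sum>l\<in>L. q (if l \<le> k then k - l else l - k)) = (\<Sum>l\<in>{l\<in>L. l \<le> k}. q (k - l)) + (\<Sum>l\<in>{l\<in>L. \<not> l \<le> k}. q (l - k))"
    unfolding if_distrib[of q] using L by (subst sum.If_cases) (auto intro!: arg_cong2[where f = "(+)"] sum.cong)
  with 1 2 3 show ?thesis by (simp add: sum.distrib)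
qed

text \<open>\<open>9/4\<close> is the square of \<open>3/2\<close>: three partial sums in the Schur
  test, halved by the product formula for sine and cosine. The series converges because
  \<open>26/25 > 1\<close>, and its term at 0 vanishes since \<open>0 powr\<close> anything is
  0.\<close>

definition product_const :: real where
  "product_const = 9/4 * trilinear_const * (\<Sum>j. real j powr - (26/25))"

lemma product_const_nonneg: "product_const \<ge> 0"
proof -
  have "summable (\<lambda>j. real j powr - (26/25))" by (simp add: summable_real_powr_iff)
  then show ?thesis unfolding product_const_def by (intro mult_nonneg_nonneg suminf_nonneg) (auto simp: trilinear_const_def)
qed

text \<open>\<open>Z\<close> bounds the weighted energy of any finite set of modes of
  \<open>V\<close>, and \<open>m k\<close> the weighted norm of the dual mode \<open>w k\<close> on
  the Fourier side. \<open>K\<close> is finite so that the dual function \<open>W\<close> is a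
  bounded finite sum; the final bound sees \<open>K\<close> only through the sum of the squares of
  \<open>m\<close>.\<close>

locale strip_modes = strip_function +
  fixes a Z :: real and g :: "nat \<Rightarrow> real \<times> real \<Rightarrow> complex"
    and K :: "nat set" and w :: "nat \<Rightarrow> real \<times> real \<Rightarrow> complex" and m :: "nat \<Rightarrow> real"
  assumes rep: "\<And>j. j \<ge> 1 \<Longrightarrow> fourier_rep (sine_mode B V j) (g j)"
    and Z: "Z \<ge> 0" "\<And>J. finite J \<Longrightarrow> 0 \<notin> J \<Longrightarrow> (\<Sum>j\<in>J. \<integral>\<^sup>+z. ennreal (freq_weight a B j z) * nsq (g j z)) \<le> ennreal Z"
    and K: "finite K" and w: "\<And>k. integrable lborel (w k)" "\<And>k. L2_fun (w k)"
    and m: "\<And>k. m k \<ge> 0" "\<And>k. k \<in> K \<Longrightarrow> (\<integral>\<^sup>+z. ennreal (mod_weight a B k z) * nsq (w k z)) \<le> ennreal ((m k)^2)"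
begin

definition W :: "(real \<times> real) \<times> real \<Rightarrow> complex" where
  "W z = (\<Sum>k\<in>K. fourier (w k) (fst z) * of_real (eigfun B k (snd z)))"

lemma w_measurable [measurable]: "w k \<in> borel_measurable borel" using w by auto

lemma W_measurable [measurable]: "W \<in> borel_measurable borel"
  unfolding W_def[abs_def] by measurable

lemma W_bounded: "norm (W z) \<le> (\<Sum>k\<in>K. (LBINT p. norm (w k p)) * sqrt (2 / B))"
  unfolding W_def
  by (rule order_trans[OF norm_sum], intro sum_mono)
     (auto simp: norm_mult intro!: mult_mono norm_fourier_le eigfun_bound B)

lemma L2_VW: "L2_fun (\<lambda>z. V z * W z)"
  using L2_fun_bounded_mult[OF V W_measurable W_bounded] by (simp add: mult.commute)

lemma integrable_VW: "integrable lborel (\<lambda>z. V z * W z)"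
  unfolding W_def sum_distrib_left
  by (intro Bochner_Integration.integrable_sum integrable_V_tensor[OF L2_fun_fourier[OF w] measurable_eigfun eigfun_bound[OF B]])

text \<open>Each integral over three modes is at most \<open>q j * m k * v l\<close>, and
  \<open>k\<close> and \<open>l\<close> leave two values for \<open>j\<close>. Cauchy-Schwarz
  between the energies \<open>n j\<close> and the powers \<open>j powr - (26/25)\<close> makes
  \<open>q\<close> summable with sum at most \<open>Q\<close>, so rows and columns of
  \<open>A\<close> sum to at most \<open>3 / 2 * Q\<close>.\<close>

lemma cosine_pairing_bound:
  assumes u: "\<And>l. integrable lborel (u l)" "\<And>l. L2_fun (u l)" and v: "\<And>l. v l \<ge> 0" "\<And>l. sq_norm (u l) \<le> ennreal ((v l)^2)"
  shows "(norm (LBINT z. V z * W z * (\<Sum>l\<le>N. fourier (u l) (fst z) * of_real (cosfun B l (snd z)))))^2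
    \<le> product_const * Z * (\<Sum>k\<in>K. (m k)^2) * (\<Sum>l\<le>N. (v l)^2)"
proof -
  define T where "T j k l = (LBINT z. V z * ((fourier (w k) (fst z) * fourier (u l) (fst z)) * complex_of_real (eigfun B j (snd z))))" for j k l
  define n where "n j = enn2real (\<integral>\<^sup>+z. ennreal (freq_weight a B j z) * nsq (g j z))" for j
  define c where "c j = trilinear_const * real j powr - (26/25)" for j
  \<comment> \<open>For \<open>k = l\<close> the difference mode is 0; there the eigenfunction
    vanishes, and a representing function is given only for positive modes.\<close>
  define q where "q j = (if j = 0 then 0 else sqrt (c j * n j))" for j
  define S where "S = (\<Sum>j. real j powr - (26/25))"
  define Q where "Q = sqrt (trilinear_const * S * Z)"
  have tc: "trilinear_const \<ge> 0" by (simp add: trilinear_const_def)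
  have c0: "c j \<ge> 0" for j by (simp add: c_def tc)
  have n0: "n j \<ge> 0" for j by (simp add: n_def)
  have q0: "q j \<ge> 0" for j by (simp add: q_def c0 n0)
  have sS: "summable (\<lambda>j. real j powr - (26/25))" by (simp add: summable_real_powr_iff)
  have nfin: "(\<integral>\<^sup>+z. ennreal (freq_weight a B j z) * nsq (g j z)) = ennreal (n j)" if "j \<ge> 1" for j
  proof -
    have "(\<integral>\<^sup>+z. ennreal (freq_weight a B j z) * nsq (g j z)) \<le> ennreal Z" using Z(2)[of "{j}"] that by simp
    then have "(\<integral>\<^sup>+z. ennreal (freq_weight a B j z) * nsq (g j z)) < \<top>"
      by (rule le_less_trans) simp
    then show ?thesis unfolding n_def by simp
  qed
  have nZ: "(\<Sum>j\<in>J. n j) \<le> Z" if J: "finite J" "0 \<notin> J" for J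
  proof -
    have "ennreal (\<Sum>j\<in>J. n j) = (\<Sum>j\<in>J. ennreal (n j))" by (rule sum_ennreal[symmetric]) (simp add: n0)
    also have "\<dots> = (\<Sum>j\<in>J. \<integral>\<^sup>+z. ennreal (freq_weight a B j z) * nsq (g j z))"
    proof (intro sum.cong refl)
      fix j assume "j \<in> J" then have "j \<ge> 1" using J(2) by (cases j) auto
      from nfin[OF this] show "ennreal (n j) = (\<integral>\<^sup>+z. ennreal (freq_weight a B j z) * nsq (g j z))" by simp
    qed
    also have "\<dots> \<le> ennreal Z" by (rule Z(2)[OF J])
    finally show ?thesis using Z(1) by simp
  qed
  have Q0: "Q \<ge> 0" unfolding Q_def S_def using Z(1) tc sS by (intro real_sqrt_ge_zero mult_nonneg_nonneg suminf_nonneg) auto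
  have Q: "(\<Sum>j\<in>J. q j) \<le> Q" if "finite J" for J
  proof -
    let ?J = "J - {0}"
    have "(\<Sum>j\<in>J. q j) = (\<Sum>j\<in>?J. sqrt (c j) * sqrt (n j))"
      by (rule sum.mono_neutral_cong_right) (use that in \<open>auto simp: q_def real_sqrt_mult\<close>)
    also have "\<dots> \<le> Q"
    proof (rule power2_le_imp_le[OF _ Q0])
      have "(\<Sum>j\<in>?J. sqrt (c j) * sqrt (n j))^2 \<le> (\<Sum>j\<in>?J. (sqrt (c j))^2) * (\<Sum>j\<in>?J. (sqrt (n j))^2)"
        by (rule Cauchy_Schwarz_ineq_sum)
      also have "\<dots> = (\<Sum>j\<in>?J. c j) * (\<Sum>j\<in>?J. n j)" by (simp add: c0 n0)
      also have "\<dots> \<le> (trilinear_const * S) * Z"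
      proof (rule mult_mono)
        show "(\<Sum>j\<in>?J. c j) \<le> trilinear_const * S"
          unfolding c_def S_def sum_distrib_left[symmetric] using that by (intro mult_left_mono tc sum_le_suminf sS) auto
        show "(\<Sum>j\<in>?J. n j) \<le> Z" by (rule nZ) (use that in auto)
        show "0 \<le> trilinear_const * S" unfolding S_def using tc sS by (intro mult_nonneg_nonneg suminf_nonneg) auto
        show "0 \<le> (\<Sum>j\<in>?J. n j)" by (intro sum_nonneg n0)
      qed
      also have "\<dots> = Q^2" unfolding Q_def
        using Z(1) tc sS by (subst real_sqrt_pow2) (auto simp: S_def intro!: mult_nonneg_nonneg suminf_nonneg)
      finally show "(\<Sum>j\<in>?J. sqrt (c j) * sqrt (n j))^2 \<le> Q^2" .
    qed
    finally show ?thesis .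
  qed
  have Tb: "norm (T j k l) \<le> q j * m k * v l" if k: "k \<in> K" for j k l
  proof (cases "j = 0")
    case True
    have "eigfun B 0 y = 0" for y by (simp add: eigfun_def lam_def)
    then have "T 0 k l = 0" by (simp add: T_def)
    then show ?thesis using True by (simp add: q_def)
  next
    case False
    then have j: "j \<ge> 1" by simp
    have "nsq (T j k l) \<le> ennreal (c j) * ennreal (n j) * ennreal ((m k)^2) * ennreal ((v l)^2)"
    proof -
      have "(ennreal (norm (T j k l)))^2 \<le> ennreal (c j) * (\<integral>\<^sup>+z. ennreal (freq_weight a B j z) * nsq (g j z))
        * (\<integral>\<^sup>+z. ennreal (mod_weight a B k z) * nsq (w k z)) * sq_norm (u l)"
        unfolding T_def c_def by (rule mode_pairing_bound[OF rep[OF j] j w u])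
      also have "\<dots> \<le> ennreal (c j) * ennreal (n j) * ennreal ((m k)^2) * ennreal ((v l)^2)"
        unfolding nfin[OF j] by (intro mult_mono m(2)[OF k] v(2)) auto
      finally show ?thesis by (simp add: ennreal_power)
    qed
    also have "\<dots> = ennreal (c j * n j * (m k)^2 * (v l)^2)" by (simp add: ennreal_mult c0 n0)
    finally have "(norm (T j k l))^2 \<le> c j * n j * (m k)^2 * (v l)^2" using c0 n0 by (simp add: ennreal_le_iff)
    also have "\<dots> = (q j * m k * v l)^2" using False c0 n0 by (simp add: q_def power_mult_distrib)
    finally show ?thesis by (rule power2_le_imp_le) (auto intro!: mult_nonneg_nonneg q0 m v)
  qed
  define d where "d k l = (if l \<le> k then k - l else l - k)" for k l :: nat
  \<comment> \<open>The sign is kept apart from the mode number, since it disappears as soon as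
    norms are taken.\<close>
  define s where "s k l = (if l \<le> k then 1 else - 1 :: complex)" for k l :: nat
  have intT: "integrable lborel (\<lambda>z. V z * ((fourier (w k) (fst z) * fourier (u l) (fst z)) * complex_of_real (eigfun B j (snd z))))" for j k l
    by (rule integrable_V_tensor[OF _ measurable_eigfun eigfun_bound[OF B]])
       (rule L2_fun_bounded_mult[OF L2_fun_fourier[OF u], of "fourier (w k)"], auto intro: norm_fourier_le)
  have "V z * W z * (\<Sum>l\<le>N. fourier (u l) (fst z) * of_real (cosfun B l (snd z))) =
    (\<Sum>k\<in>K. \<Sum>l\<le>N. (V z * ((fourier (w k) (fst z) * fourier (u l) (fst z)) * complex_of_real (eigfun B (k + l) (snd z)))
       + s k l * (V z * ((fourier (w k) (fst z) * fourier (u l) (fst z)) * complex_of_real (eigfun B (d k l) (snd z))))) / 2)" for z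
  proof -
    have e: "complex_of_real (eigfun B k y) * complex_of_real (cosfun B l y) = (complex_of_real (eigfun B (k + l) y) + s k l * complex_of_real (eigfun B (d k l) y)) / 2" for k l y
      unfolding of_real_mult[symmetric] eigfun_cosfun_mult[OF B] by (simp add: s_def d_def)
    have "V z * W z * (\<Sum>l\<le>N. fourier (u l) (fst z) * of_real (cosfun B l (snd z))) =
      (\<Sum>k\<in>K. \<Sum>l\<le>N. V z * (fourier (w k) (fst z) * of_real (eigfun B k (snd z))) * (fourier (u l) (fst z) * of_real (cosfun B l (snd z))))"
      unfolding W_def by (simp add: sum_distrib_left sum_distrib_right sum.swap[of _ K])
    also have "\<dots> = (\<Sum>k\<in>K. \<Sum>l\<le>N. V z * (fourier (w k) (fst z) * fourier (u l) (fst z)) * (of_real (eigfun B k (snd z)) * of_real (cosfun B l (snd z))))"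
      by (simp only: mult_ac)
    finally show ?thesis unfolding e by (simp add: algebra_simps add_divide_distrib)
  qed
  then have "(LBINT z. V z * W z * (\<Sum>l\<le>N. fourier (u l) (fst z) * of_real (cosfun B l (snd z)))) =
    (LBINT z. (\<Sum>k\<in>K. \<Sum>l\<le>N. (V z * ((fourier (w k) (fst z) * fourier (u l) (fst z)) * complex_of_real (eigfun B (k + l) (snd z)))
       + s k l * (V z * ((fourier (w k) (fst z) * fourier (u l) (fst z)) * complex_of_real (eigfun B (d k l) (snd z))))) / 2))" by (simp only:)
  also have "\<dots> = (\<Sum>k\<in>K. \<Sum>l\<le>N. (T (k + l) k l + s k l * T (d k l) k l) / 2)"
  proof -
    have i: "integrable lborel (\<lambda>z. (V z * ((fourier (w k) (fst z) * fourier (u l) (fst z)) * complex_of_real (eigfun B (k + l) (snd z)))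
       + s k l * (V z * ((fourier (w k) (fst z) * fourier (u l) (fst z)) * complex_of_real (eigfun B (d k l) (snd z))))) / 2)" for k l
      by (intro integrable_divide Bochner_Integration.integrable_add integrable_mult_right intT)
    have e: "(LBINT z. (V z * ((fourier (w k) (fst z) * fourier (u l) (fst z)) * complex_of_real (eigfun B (k + l) (snd z)))
       + s k l * (V z * ((fourier (w k) (fst z) * fourier (u l) (fst z)) * complex_of_real (eigfun B (d k l) (snd z))))) / 2) = (T (k + l) k l + s k l * T (d k l) k l) / 2" for k l
      unfolding integral_divide_zero
      by (subst Bochner_Integration.integral_add) (auto simp: T_def intro!: integrable_mult_right intT)
    show ?thesis
      by (subst Bochner_Integration.integral_sum, intro Bochner_Integration.integrable_sum i)
         (intro sum.cong refl, subst Bochner_Integration.integral_sum, intro i, simp only: e)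
  qed
  finally have eq: "(LBINT z. V z * W z * (\<Sum>l\<le>N. fourier (u l) (fst z) * of_real (cosfun B l (snd z)))) = (\<Sum>k\<in>K. \<Sum>l\<le>N. (T (k + l) k l + s k l * T (d k l) k l) / 2)" .
  define A where "A k l = (q (k + l) + q (d k l)) / 2" for k l
  have "norm (LBINT z. V z * W z * (\<Sum>l\<le>N. fourier (u l) (fst z) * of_real (cosfun B l (snd z)))) \<le> (\<Sum>k\<in>K. \<Sum>l\<le>N. A k l * m k * v l)"
    unfolding eq
  proof (rule order_trans[OF norm_sum], intro sum_mono order_trans[OF norm_sum])
    fix k l assume k: "k \<in> K"
    have "norm ((T (k + l) k l + s k l * T (d k l) k l) / 2) \<le> (norm (T (k + l) k l) + norm (s k l * T (d k l) k l)) / 2"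
      by (simp add: norm_divide norm_triangle_ineq divide_right_mono)
    also have "norm (s k l * T (d k l) k l) = norm (T (d k l) k l)" by (simp add: s_def norm_mult)
    also have "(norm (T (k + l) k l) + norm (T (d k l) k l)) / 2 \<le> (q (k + l) * m k * v l + q (d k l) * m k * v l) / 2"
      by (intro divide_right_mono add_mono Tb k) auto
    also have "\<dots> = A k l * m k * v l" by (simp add: A_def algebra_simps)
    finally show "norm ((T (k + l) k l + s k l * T (d k l) k l) / 2) \<le> A k l * m k * v l" .
  qed
  then have "(norm (LBINT z. V z * W z * (\<Sum>l\<le>N. fourier (u l) (fst z) * of_real (cosfun B l (snd z)))))^2 \<le> (\<Sum>k\<in>K. \<Sum>l\<le>N. A k l * m k * v l)^2"
    by (rule power_mono) simp
  also have "\<dots> \<le> (3 / 2 * Q)^2 * (\<Sum>k\<in>K. (m k)^2) * (\<Sum>l\<le>N. (v l)^2)"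
  proof (rule schur_test)
    show "0 \<le> A k l" for k l by (simp add: A_def q0)
    show "(\<Sum>l\<le>N. A k l) \<le> 3 / 2 * Q" for k
      using sum_shifted_le[OF q0 Q finite_atMost, of k N] unfolding A_def d_def sum_divide_distrib[symmetric] by simp
    show "(\<Sum>k\<in>K. A k l) \<le> 3 / 2 * Q" for l
    proof -
      have "A k l = (q (l + k) + q (if k \<le> l then l - k else k - l)) / 2" for k
        by (auto simp: A_def d_def add.commute)
      then show ?thesis using sum_shifted_le[OF q0 Q K, of l] by (simp only: sum_divide_distrib[symmetric]) simp
    qed
  qed (use m v Q0 in auto)
  also have "(3 / 2 * Q)^2 = product_const * Z"
    using Z(1) tc sS unfolding Q_def power_mult_distrib
    by (subst real_sqrt_pow2) (auto simp: S_def product_const_def power2_eq_square intro!: mult_nonneg_nonneg suminf_nonneg)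
  finally show ?thesis .
qed

text \<open>The coefficients are replaced by the transforms of the approximate inverses
  \<open>U l n\<close>, to which the previous bound applies. These transforms are bounded uniformly
  in \<open>n\<close>, so the integral against the integrable function \<open>V * W\<close> passes
  to the limit; the norm bound of the inverses supplies the division by
  \<open>(2 * pi)^2\<close>.\<close>

lemma cosine_pairing_bound_Cc:
  assumes p: "\<And>l. continuous_on UNIV (p l)" "\<And>l q. norm q \<ge> r \<Longrightarrow> p l q = 0"
  shows "(ennreal (norm (LBINT z. V z * W z * (\<Sum>l\<le>N. p l (fst z) * of_real (cosfun B l (snd z))))))^2
    \<le> ennreal (product_const * Z * (\<Sum>k\<in>K. (m k)^2) / (2 * pi)^2) * (\<Sum>l\<le>N. sq_norm (p l))"
proof -
  have pm [measurable]: "p l \<in> borel_measurable borel" for l by (intro borel_measurable_continuous_onI p)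
  define P where "P l U \<longleftrightarrow> (\<forall>n::nat. integrable lborel (U n)) \<and> (\<forall>n. L2_fun (U n)) \<and>
    (\<forall>n. sq_norm (U n) \<le> ennreal (1 / (2 * pi)^2) * sq_norm (p l)) \<and> (\<exists>C. \<forall>n x. norm (fourier (U n) x) \<le> C) \<and>
    (\<forall>x. (\<lambda>n. fourier (U n) x) \<longlonglongrightarrow> p l x)" for l U
  have "\<forall>l. \<exists>U. P l U"
  proof
    fix l
    show "\<exists>U. P l U"
      by (rule fourier_approximate_inverse[OF p(1)[of l] p(2)[of _ l]]) (auto simp: P_def)
  qed
  from choice[OF this] obtain U where U: "\<forall>l. P l (U l)" ..
  have U1: "integrable lborel (U l n)" "L2_fun (U l n)" "sq_norm (U l n) \<le> ennreal (1 / (2 * pi)^2) * sq_norm (p l)" "(\<lambda>n. fourier (U l n) x) \<longlonglongrightarrow> p l x" for l n x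
    using U[rule_format, of l] unfolding P_def by blast+
  have "\<forall>l. \<exists>C. \<forall>n x. norm (fourier (U l n) x) \<le> C" using U unfolding P_def by blast
  from choice[OF this] obtain C where C: "\<forall>l n x. norm (fourier (U l n) x) \<le> C l" ..
  have [measurable]: "U l n \<in> borel_measurable borel" for l n using U1(2) by auto
  have pfin: "sq_norm (p l) < \<top>" for l
    using continuous_compact_support_L2[OF p(1)[of l] p(2)[of _ l]] by (simp add: L2_fun_def)
  define v where "v l = sqrt (1 / (2 * pi)^2 * enn2real (sq_norm (p l)))" for l
  have v: "v l \<ge> 0" "ennreal ((v l)^2) = ennreal (1 / (2 * pi)^2) * sq_norm (p l)" for l
  proof -
    show "v l \<ge> 0" by (simp add: v_def)
    have "(v l)^2 = 1 / (2 * pi)^2 * enn2real (sq_norm (p l))" unfolding v_def by (rule real_sqrt_pow2) simp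
    then have "ennreal ((v l)^2) = ennreal (1 / (2 * pi)^2) * ennreal (enn2real (sq_norm (p l)))"
      by (simp only: ennreal_mult[OF _ enn2real_nonneg] zero_le_divide_1_iff zero_le_power2)
    then show "ennreal ((v l)^2) = ennreal (1 / (2 * pi)^2) * sq_norm (p l)" using ennreal_enn2real[OF pfin] by simp
  qed
  let ?I = "\<lambda>f. LBINT z. V z * W z * (\<Sum>l\<le>N. f l (fst z) * of_real (cosfun B l (snd z)))"
  define D where "D = product_const * Z * (\<Sum>k\<in>K. (m k)^2)"
  have D0: "D \<ge> 0" unfolding D_def by (intro mult_nonneg_nonneg product_const_nonneg Z sum_nonneg) auto
  have b: "(norm (?I (\<lambda>l. fourier (U l n))))^2 \<le> D * (\<Sum>l\<le>N. (v l)^2)" for n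
    unfolding D_def by (rule cosine_pairing_bound[OF U1(1,2) v(1)]) (simp only: v U1)
  have "(\<lambda>n. ?I (\<lambda>l. fourier (U l n))) \<longlonglongrightarrow> ?I p"
  proof (rule integral_dominated_convergence[where w = "\<lambda>z. norm (V z * W z) * (\<Sum>l\<le>N. C l)"])
    show "integrable lborel (\<lambda>z. norm (V z * W z) * (\<Sum>l\<le>N. C l))"
      by (intro integrable_mult_left integrable_norm integrable_VW)
    show "AE z in lborel. (\<lambda>n. V z * W z * (\<Sum>l\<le>N. fourier (U l n) (fst z) * of_real (cosfun B l (snd z)))) \<longlonglongrightarrow> V z * W z * (\<Sum>l\<le>N. p l (fst z) * of_real (cosfun B l (snd z)))"
      by (intro always_eventually allI tendsto_mult tendsto_const tendsto_sum U1)
    show "AE z in lborel. norm (V z * W z * (\<Sum>l\<le>N. fourier (U l n) (fst z) * of_real (cosfun B l (snd z)))) \<le> norm (V z * W z) * (\<Sum>l\<le>N. C l)" for n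
    proof (intro always_eventually allI)
      fix z
      have "norm (\<Sum>l\<le>N. fourier (U l n) (fst z) * of_real (cosfun B l (snd z))) \<le> (\<Sum>l\<le>N. C l)"
      proof (rule order_trans[OF norm_sum], intro sum_mono)
        fix l
        have "norm (fourier (U l n) (fst z)) * \<bar>cosfun B l (snd z)\<bar> \<le> C l * 1"
          by (intro mult_mono cosfun_bound C[rule_format] order_trans[OF norm_ge_zero C[rule_format]]) auto
        then show "norm (fourier (U l n) (fst z) * of_real (cosfun B l (snd z))) \<le> C l" by (simp add: norm_mult)
      qed
      then show "norm (V z * W z * (\<Sum>l\<le>N. fourier (U l n) (fst z) * of_real (cosfun B l (snd z)))) \<le> norm (V z * W z) * (\<Sum>l\<le>N. C l)"
        unfolding norm_mult[of "V z * W z"] by (rule mult_left_mono) simp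
    qed
  qed measurable
  then have "(\<lambda>n. (norm (?I (\<lambda>l. fourier (U l n))))^2) \<longlonglongrightarrow> (norm (?I p))\<^sup>2"
    by (intro tendsto_power tendsto_norm)
  then have "(norm (?I p))^2 \<le> D * (\<Sum>l\<le>N. (v l)^2)"
    by (rule LIMSEQ_le_const2) (use b in blast)
  then have "nsq (?I p) \<le> ennreal D * (\<Sum>l\<le>N. ennreal ((v l)^2))"
    using D0 by (subst sum_ennreal) (auto simp: ennreal_mult[symmetric] sum_nonneg intro!: ennreal_leI)
  also have "\<dots> = ennreal D * ennreal (1 / (2 * pi)^2) * (\<Sum>l\<le>N. sq_norm (p l))"
    unfolding v(2) by (simp only: sum_distrib_left mult.assoc)
  also have "ennreal D * ennreal (1 / (2 * pi)^2) = ennreal (D / (2 * pi)^2)"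
    using D0 by (subst ennreal_mult[symmetric]) auto
  finally show ?thesis unfolding D_def by (simp only: ennreal_power norm_ge_zero)
qed

text \<open>By duality it suffices to pair with a continuous \<open>P\<close> of compact support. On
  the strip \<open>P\<close> is a uniform limit of cosine sums. Their pairings are bounded by the
  norms of the coefficients, which orthogonality converts into the norm of the sum at the price of
  \<open>2 / B\<close>.\<close>

theorem product_estimate:
  "sq_norm (\<lambda>z. V z * W z) \<le> ennreal (product_const * Z * (\<Sum>k\<in>K. (m k)^2) / (2 * pi)^2 * (2 / B))"
proof (rule sq_norm_le_dual_Cc[OF L2_VW])
  define D where "D = product_const * Z * (\<Sum>k\<in>K. (m k)^2) / (2 * pi)^2"
  have D0: "D \<ge> 0" unfolding D_def by (intro divide_nonneg_nonneg mult_nonneg_nonneg product_const_nonneg Z sum_nonneg) auto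
  show "ennreal (product_const * Z * (\<Sum>k\<in>K. (m k)^2) / (2 * pi)^2 * (2 / B)) < \<top>" by simp
  fix P :: "(real \<times> real) \<times> real \<Rightarrow> complex" and r
  assume P: "continuous_on UNIV P" and Psupp: "\<And>x. norm x \<ge> r \<Longrightarrow> P x = 0"
  have Pm [measurable]: "P \<in> borel_measurable borel" by (intro borel_measurable_continuous_onI P)
  have PL: "L2_fun P" by (rule continuous_compact_support_L2[OF P Psupp])
  \<comment> \<open>Cosine sums do not vanish outside the strip, so they and \<open>P\<close> are
    cut off by \<open>i\<close>. The errors are then confined to the bounded set \<open>E\<close>,
    and the approximants have a common square-integrable bound.\<close>
  define i where "i z = complex_of_real (indicator {0<..<B} (snd z))" for z :: "(real \<times> real) \<times> real"
  have [measurable]: "i \<in> borel_measurable borel" unfolding i_def[abs_def] by measurable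
  define E where "E = ball (0::real \<times> real) (r + 1) \<times> {0<..<B}"
  have Em [measurable]: "E \<in> sets borel" unfolding E_def by (intro borel_open open_Times) auto
  have "bounded E" unfolding E_def by (intro bounded_Times) auto
  from emeasure_bounded_finite[OF this] have Ef: "emeasure lborel E < \<infinity>" by simp
  have EL: "L2_fun (\<lambda>z. complex_of_real (indicator E z))" by (rule indicator_L1_L2(2)[OF Em Ef])
  have "\<forall>n. \<exists>R. R \<in> borel_measurable borel \<and> (\<forall>z. norm (R z - i z * P z) \<le> 1 / real (Suc n) * indicator E z) \<and>
     (ennreal (norm (LBINT z. (V z * W z) * R z)))\<^sup>2 \<le> ennreal (D * (2 / B)) * sq_norm R"
  proof
    fix n
    obtain N p where p: "\<And>l. continuous_on UNIV (p l)" "\<And>l q. norm q \<ge> r + 1 \<Longrightarrow> p l q = 0"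
      "\<And>q y. y \<in> {0..B} \<Longrightarrow> norm (P (q, y) - (\<Sum>l\<le>N. p l q * of_real (cosfun B l y))) \<le> 1 / real (Suc n) * indicator (ball 0 (r + 1)) q"
      by (rule cosine_approximation[OF B P Psupp, of r "1 / real (Suc n)"]) (auto intro: that)
    have pm [measurable]: "p l \<in> borel_measurable borel" for l by (intro borel_measurable_continuous_onI p)
    have pL: "L2_fun (p l)" for l by (rule continuous_compact_support_L2[OF p(1)[of l] p(2)[of _ l]])
    define R where "R z = i z * (\<Sum>l\<le>N. p l (fst z) * of_real (cosfun B l (snd z)))" for z
    have "V z * W z * R z = V z * W z * (\<Sum>l\<le>N. p l (fst z) * of_real (cosfun B l (snd z)))" for z
      using V_indicator[of z] by (auto simp: R_def i_def indicator_def)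
    then have "(ennreal (norm (LBINT z. (V z * W z) * R z)))^2 \<le> ennreal D * (\<Sum>l\<le>N. sq_norm (p l))"
      unfolding D_def using cosine_pairing_bound_Cc[where N = N and p = p, OF p(1,2)] by (simp only:)
    also have "\<dots> \<le> ennreal D * (ennreal (2 / B) * sq_norm R)"
      unfolding R_def[abs_def] i_def by (intro mult_left_mono sq_norm_cosine_sum[OF B pL]) auto
    also have "\<dots> = ennreal (D * (2 / B)) * sq_norm R" using D0 B ennreal_mult[of D "2 / B"] by (simp add: mult.assoc)
    finally have b: "(ennreal (norm (LBINT z. (V z * W z) * R z)))^2 \<le> ennreal (D * (2 / B)) * sq_norm R" .
    have c: "norm (R z - i z * P z) \<le> 1 / real (Suc n) * indicator E z" for z
    proof (cases "snd z \<in> {0<..<B}")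
      case True
      then have "norm (R z - i z * P z) = norm (P (fst z, snd z) - (\<Sum>l\<le>N. p l (fst z) * of_real (cosfun B l (snd z))))"
        by (simp add: R_def i_def norm_minus_commute)
      also have "\<dots> \<le> 1 / real (Suc n) * indicator (ball 0 (r + 1)) (fst z)" using True by (intro p(3)) auto
      also have "indicator (ball 0 (r + 1)) (fst z) = (indicator E z :: real)" using True by (cases z) (simp add: E_def indicator_def)
      finally show ?thesis .
    next
      case False
      then show ?thesis by (simp add: R_def i_def)
    qed
    have "R \<in> borel_measurable borel" unfolding R_def[abs_def] by measurable
    with b c show "\<exists>R. R \<in> borel_measurable borel \<and> (\<forall>z. norm (R z - i z * P z) \<le> 1 / real (Suc n) * indicator E z) \<and>
     (ennreal (norm (LBINT z. (V z * W z) * R z)))\<^sup>2 \<le> ennreal (D * (2 / B)) * sq_norm R" by blast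
  qed
  from choice[OF this] obtain R where R: "\<forall>n. R n \<in> borel_measurable borel \<and> (\<forall>z. norm (R n z - i z * P z) \<le> 1 / real (Suc n) * indicator E z) \<and>
     (ennreal (norm (LBINT z. (V z * W z) * R n z)))\<^sup>2 \<le> ennreal (D * (2 / B)) * sq_norm (R n)" ..
  then have Rm: "R n \<in> borel_measurable borel" and Rd: "norm (R n z - i z * P z) \<le> 1 / real (Suc n) * indicator E z"
    and Rb: "(ennreal (norm (LBINT z. (V z * W z) * R n z)))^2 \<le> ennreal (D * (2 / B)) * sq_norm (R n)" for n z by blast+
  define b where "b z = of_real (norm (P z)) + complex_of_real (indicator E z)" for z
  have ni: "norm (i z) \<le> 1" for z by (simp add: i_def indicator_def)
  have bL: "L2_fun b" unfolding b_def[abs_def] by (intro L2_fun_add EL L2_fun_bound(1)[OF PL]) auto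
  have Rle: "norm (R n z) \<le> norm (b z)" for n z
  proof -
    have "norm (R n z) \<le> norm (i z * P z) + norm (R n z - i z * P z)" by (metis norm_triangle_sub)
    also have "\<dots> \<le> norm (P z) + indicator E z"
    proof (rule add_mono)
      show "norm (i z * P z) \<le> norm (P z)" using ni[of z] by (simp add: norm_mult mult_left_le_one_le)
      have "1 / real (Suc n) * indicator E z \<le> 1 * indicator E z" by (intro mult_right_mono) auto
      then show "norm (R n z - i z * P z) \<le> indicator E z" using Rd[of n z] by simp
    qed
    also have "\<dots> = norm (b z)" unfolding b_def by (subst of_real_add[symmetric], subst norm_of_real) simp
    finally show ?thesis .
  qed
  have Rl: "(\<lambda>n. R n z) \<longlonglongrightarrow> i z * P z" for z
  proof (rule LIM_zero_cancel, rule Lim_null_comparison)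
    show "eventually (\<lambda>n. norm (R n z - i z * P z) \<le> 1 / real (Suc n)) sequentially"
    proof (intro always_eventually allI)
      fix n
      have "1 / real (Suc n) * indicator E z \<le> 1 / real (Suc n) * 1" by (intro mult_left_mono) (auto simp: indicator_def)
      then show "norm (R n z - i z * P z) \<le> 1 / real (Suc n)" using Rd[of n z] by simp
    qed
    show "(\<lambda>n. 1 / real (Suc n)) \<longlonglongrightarrow> 0" by (rule lim_1_over_n[THEN LIMSEQ_Suc])
  qed
  have VWi: "V z * W z * P z = V z * W z * (i z * P z)" for z using V_indicator[of z] by (auto simp: i_def indicator_def)
  have "(ennreal (norm (LBINT z. (V z * W z) * (i z * P z))))^2 \<le> ennreal (D * (2 / B)) * sq_norm (\<lambda>z. i z * P z)"
    by (rule dual_bound_limit[OF L2_VW _ bL Rm _ Rle _ Rb]) (auto intro: Rl)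
  also have "\<dots> \<le> ennreal (D * (2 / B)) * sq_norm P"
  proof (rule mult_left_mono)
    show "sq_norm (\<lambda>z. i z * P z) \<le> sq_norm P"
      by (rule L2_fun_bound(2)[OF PL]) (use ni in \<open>auto simp: norm_mult mult_left_le_one_le\<close>)
  qed simp
  finally show "(ennreal (norm (LBINT z. (V z * W z) * P z)))^2 \<le> ennreal (product_const * Z * (\<Sum>k\<in>K. (m k)^2) / (2 * pi)^2 * (2 / B)) * sq_norm P"
    unfolding VWi[symmetric] D_def .
qed

end

section \<open>Modes of functions in \<open>L\<^sup>2\<^sub>tH\<^sup>1\<^sub>x\<^sub>y\<close>\<close>

definition reorder :: "(real \<times> real) \<times> real \<Rightarrow> real \<times> real \<times> real" where
  "reorder z = (fst (fst z), snd z, snd (fst z))"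

lemma measurable_reorder [measurable]: "reorder \<in> borel \<rightarrow>\<^sub>M borel"
  unfolding reorder_def[abs_def] by (intro borel_measurable_continuous_onI continuous_intros)

text \<open>Time is moved outermost, because the \<open>L2H1\<close> norm is given through slices at
  fixed time while the Fourier variables pair \<open>x\<close> with \<open>t\<close>.\<close>

lemma nn_integral_slices:
  fixes F :: "(real \<times> real) \<times> real \<Rightarrow> ennreal"
  assumes [measurable]: "F \<in> borel_measurable borel"
  shows "(\<integral>\<^sup>+z. F z) = (\<integral>\<^sup>+t. \<integral>\<^sup>+q. F ((fst q, t), snd q))"
proof -
  have "(\<integral>\<^sup>+z. F z) = (\<integral>\<^sup>+p. \<integral>\<^sup>+y. F (p, y))"
    by (rule nn_integral_lborel_pair) measurable
  also have "\<dots> = (\<integral>\<^sup>+x. \<integral>\<^sup>+t. \<integral>\<^sup>+y. F ((x, t), y))"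
    by (subst nn_integral_lborel_pair) measurable
  also have "\<dots> = (\<integral>\<^sup>+t. \<integral>\<^sup>+x. \<integral>\<^sup>+y. F ((x, t), y))"
    by (rule nn_integral_lborel_swap) measurable
  also have "\<dots> = (\<integral>\<^sup>+t. \<integral>\<^sup>+q. F ((fst q, t), snd q))"
    by (rule nn_integral_cong, subst nn_integral_lborel_pair) auto
  finally show ?thesis .
qed

lemma nn_integral_reorder:
  fixes f :: "real \<times> real \<times> real \<Rightarrow> ennreal"
  assumes [measurable]: "f \<in> borel_measurable borel"
  shows "(\<integral>\<^sup>+z. f (reorder z)) = (\<integral>\<^sup>+p. f p)"
proof -
  have "(\<integral>\<^sup>+z. f (reorder z)) = (\<integral>\<^sup>+t. \<integral>\<^sup>+q. f (fst q, snd q, t))"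
    by (subst nn_integral_slices) (auto simp: reorder_def)
  also have "\<dots> = (\<integral>\<^sup>+t. \<integral>\<^sup>+x. \<integral>\<^sup>+y. f (x, y, t))"
    by (rule nn_integral_cong, subst nn_integral_lborel_pair) auto
  also have "\<dots> = (\<integral>\<^sup>+x. \<integral>\<^sup>+t. \<integral>\<^sup>+y. f (x, y, t))"
    by (rule nn_integral_lborel_swap) measurable
  also have "\<dots> = (\<integral>\<^sup>+x. \<integral>\<^sup>+y. \<integral>\<^sup>+t. f (x, y, t))"
    by (intro nn_integral_cong nn_integral_lborel_swap) measurable
  also have "\<dots> = (\<integral>\<^sup>+x. \<integral>\<^sup>+q. f (x, q))"
    by (rule nn_integral_cong, subst nn_integral_lborel_pair) auto
  also have "\<dots> = (\<integral>\<^sup>+p. f p)" by (rule nn_integral_lborel_pair[symmetric]) measurable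
  finally show ?thesis .
qed

lemma distr_reorder: "distr lborel borel reorder = (lborel :: (real \<times> real \<times> real) measure)"
proof (rule measure_eqI)
  fix A :: "(real \<times> real \<times> real) set" assume "A \<in> sets (distr lborel borel reorder)"
  then have [measurable]: "A \<in> sets borel" by simp
  have "emeasure (distr lborel borel reorder) A = (\<integral>\<^sup>+p. indicator A p \<partial>distr lborel borel reorder)" by simp
  also have "\<dots> = (\<integral>\<^sup>+z. indicator A (reorder z))" by (rule nn_integral_distr) measurable
  also have "\<dots> = (\<integral>\<^sup>+p. indicator A p)" by (rule nn_integral_reorder) measurable
  finally show "emeasure (distr lborel borel reorder) A = emeasure lborel A" by simp
qed simp

lemma integral_reorder:
  fixes f :: "real \<times> real \<times> real \<Rightarrow> complex"
  assumes [measurable]: "f \<in> borel_measurable borel"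
  shows "(LBINT p. f p) = (LBINT z. f (reorder z))"
proof -
  have "(LBINT p. f p) = (LINT p|distr lborel borel reorder. f p)" by (simp add: distr_reorder)
  also have "\<dots> = (LBINT z. f (reorder z))" by (rule integral_distr) measurable
  finally show ?thesis .
qed

definition lift :: "real \<Rightarrow> (real \<times> real \<times> real \<Rightarrow> complex) \<Rightarrow> (real \<times> real) \<times> real \<Rightarrow> complex" where
  "lift B v z = restr (tstrip B) v (reorder z)"

lemma lift_section: "lift B v ((x, t), y) = restr (strip B) (slice v t) (x, y)"
  by (simp add: lift_def reorder_def restr_def tstrip_def strip_def slice_def indicator_def)

lemma lift_supp: "\<not> (0 < y \<and> y < B) \<Longrightarrow> lift B v (p, y) = 0"
  by (simp add: lift_def reorder_def restr_def tstrip_def)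

lemma L2_lift:
  assumes "v \<in> L2_space (tstrip B)"
  shows "L2_fun (lift B v)"
proof -
  have r: "L2_fun (restr (tstrip B) v)" using assms by (simp add: L2_space_iff)
  note [measurable] = L2_fun_measurable[OF r]
  have "sq_norm (lift B v) = sq_norm (restr (tstrip B) v)"
    unfolding sq_norm_def lift_def by (rule nn_integral_reorder[of "\<lambda>p. nsq (restr (tstrip B) v p)"]) measurable
  moreover have "lift B v \<in> borel_measurable borel" unfolding lift_def[abs_def] by measurable
  ultimately show ?thesis using r by (simp add: L2_fun_def)
qed

lemma distr_of_eq_lift:
  assumes [measurable]: "restr (tstrip B) u \<in> borel_measurable borel" "\<psi> \<in> borel_measurable borel"
  shows "distr_of B u \<psi> = (LBINT z. lift B u z * \<psi> (reorder z))"
proof -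
  have "distr_of B u \<psi> = (LBINT p. restr (tstrip B) u p * \<psi> p)"
    by (simp add: distr_of_def set_lebesgue_integral_def restr_def)
  also have "\<dots> = (LBINT z. restr (tstrip B) u (reorder z) * \<psi> (reorder z))"
    by (rule integral_reorder) measurable
  finally show ?thesis by (simp add: lift_def)
qed

context strip_function
begin

lemma measurable_sine_mode [measurable]: "sine_mode B V j \<in> borel_measurable borel"
  unfolding sine_mode_def[abs_def] by measurable

lemma sine_mode_indicator: "sine_mode B V j p = (LBINT y. V (p, y) * of_real (indicator {0<..<B} y * eigfun B j y))"
  unfolding sine_mode_def
proof (intro Bochner_Integration.integral_cong refl)
  fix y show "V (p, y) * of_real (eigfun B j y) = V (p, y) * of_real (indicator {0<..<B} y * eigfun B j y)"
    using supp[of y p] by (auto simp: indicator_def)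
qed

lemma eigfun_L2: "L2_fun (\<lambda>y. complex_of_real (indicator {0<..<B} y * eigfun B j y))"
  by (rule interval_bounded_L2[OF measurable_eigfun eigfun_bound[OF B]])

lemma L2_sine_mode: "L2_fun (sine_mode B V j)"
proof -
  have "sq_norm (sine_mode B V j) \<le> sq_norm (\<lambda>y. complex_of_real (indicator {0<..<B} y * eigfun B j y)) * sq_norm V"
    unfolding sine_mode_indicator[abs_def] by (rule sq_norm_partial_integral) measurable
  also have "\<dots> < \<infinity>" using eigfun_L2[of j] V by (auto simp: L2_fun_def ennreal_mult_less_top)
  finally show ?thesis by (simp add: L2_fun_def)
qed

lemma bessel_modes:
  assumes J: "finite J" "0 \<notin> J"
  shows "(\<Sum>j\<in>J. sq_norm (sine_mode B V j)) \<le> sq_norm V"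
proof -
  have "(\<Sum>j\<in>J. sq_norm (sine_mode B V j)) = (\<integral>\<^sup>+p. (\<Sum>j\<in>J. nsq (sine_mode B V j p)))"
    unfolding sq_norm_def by (rule nn_integral_sum[symmetric]) measurable
  also have "\<dots> \<le> (\<integral>\<^sup>+p. sq_norm (\<lambda>y. V (p, y)))"
  proof (rule nn_integral_mono_AE)
    show "AE p in lborel. (\<Sum>j\<in>J. nsq (sine_mode B V j p)) \<le> sq_norm (\<lambda>y. V (p, y))"
      using AE_L2_section[OF V] by eventually_elim (unfold sine_mode_indicator, rule bessel_eigfun[OF B _ J])
  qed
  also have "\<dots> = sq_norm V" by (rule sq_norm_pair[symmetric]) measurable
  finally show ?thesis .
qed

text \<open>Bessel's inequality is applied to the increment of \<open>V\<close>, which again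
  vanishes outside the strip because the shift does not touch \<open>y\<close>.\<close>

lemma sine_mode_translation_bound:
  assumes J: "finite J" "0 \<notin> J"
  shows "(\<Sum>j\<in>J. sq_norm (\<lambda>p. sine_mode B V j (p + h) - sine_mode B V j p)) \<le> sq_norm (\<lambda>z. V (z + (h, 0)) - V z)"
proof -
  define D where "D z = V (z + (h, 0)) - V z" for z
  have VhL: "L2_fun (\<lambda>z. V (z + (h, 0)))" by (rule L2_fun_shift[OF V])
  interpret D: strip_function B D
  proof
    show "L2_fun D" unfolding D_def[abs_def] by (intro L2_fun_diff VhL V)
    show "\<not> (0 < y \<and> y < B) \<Longrightarrow> D (p, y) = 0" for p y using supp by (simp add: D_def)
  qed (rule B)
  have "sq_norm (\<lambda>p. sine_mode B V j (p + h) - sine_mode B V j p) = sq_norm (sine_mode B D j)" for j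
    unfolding sq_norm_def
  proof (rule nn_integral_cong_AE)
    show "AE p in lborel. nsq (sine_mode B V j (p + h) - sine_mode B V j p) = nsq (sine_mode B D j p)"
      using AE_L2_section[OF V] AE_L2_section[OF VhL]
    proof eventually_elim
      case (elim p)
      from elim(2) have e2: "L2_fun (\<lambda>y. V (p + h, y))" by simp
      have "sine_mode B D j p = sine_mode B V j (p + h) - sine_mode B V j p"
        unfolding sine_mode_indicator D.sine_mode_indicator
        by (subst Bochner_Integration.integral_diff[symmetric])
           (auto simp: D_def left_diff_distrib simp del: of_real_mult intro!: L2_fun_mult_integrable elim e2 eigfun_L2)
      then show ?case by simp
    qed
  qed
  then show ?thesis using D.bessel_modes[OF J] by (simp add: D_def[abs_def])
qed

end

section \<open>Frequency weights from difference quotients and time slices\<close>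

lemma cis_difference_quotient:
  "(\<lambda>n. (cis (1 / real (Suc n) * x) - 1) / of_real (1 / real (Suc n))) \<longlonglongrightarrow> \<i> * of_real x"
proof -
  define h where "h n = 1 / real (Suc n)" for n
  have h: "h n > 0" for n by (simp add: h_def)
  have h0: "filterlim (\<lambda>n. complex_of_real (h n)) (at 0) sequentially"
  proof -
    have "h \<longlonglongrightarrow> 0" unfolding h_def[abs_def] by (rule lim_1_over_n[THEN LIMSEQ_Suc])
    from tendsto_of_real[OF this, where 'a = complex] show ?thesis
      unfolding filterlim_at using h[THEN less_imp_neq, THEN not_sym] by simp
  qed
  have "((\<lambda>z. exp (\<i> * of_real x * z)) has_field_derivative (\<i> * of_real x)) (at 0)"
    by (auto intro!: derivative_eq_intros)
  then have "((\<lambda>z. (exp (\<i> * of_real x * z) - 1) / z) \<longlongrightarrow> \<i> * of_real x) (at 0)"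
    by (simp add: has_field_derivative_iff)
  from filterlim_compose[OF this h0] show ?thesis
    unfolding h_def[symmetric] by (simp add: cis_conv_exp mult_ac)
qed

text \<open>A horizontal translation by \<open>h\<close> acts on the Fourier side as the multiplier
  \<open>cis (h * \<xi>) - 1\<close>; divided by \<open>h\<close> it tends to
  \<open>\<i> * \<xi>\<close>, and Fatou's lemma passes the bound to the limit. The sum over
  \<open>J\<close> stays under one integral, since the hypothesis bounds only the total.\<close>

lemma fourier_rep_x_derivative_sum:
  assumes rep: "\<And>j. j \<in> J \<Longrightarrow> fourier_rep (f j) (g j)" and J: "finite J"
    and bd: "\<And>h. h > 0 \<Longrightarrow> (\<Sum>j\<in>J. sq_norm (\<lambda>p. f j (p + (h, 0)) - f j p)) \<le> ennreal (h^2) * N"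
  shows "(\<Sum>j\<in>J. \<integral>\<^sup>+\<zeta>. ennreal ((fst \<zeta>)^2) * nsq (g j \<zeta>)) \<le> ennreal ((2 * pi)^2) * N"
proof -
  \<comment> \<open>Extending by 0 outside \<open>J\<close> makes every \<open>G j\<close>
    measurable, whatever \<open>g j\<close> is there.\<close>
  define G where "G j = (if j \<in> J then g j else (\<lambda>_. 0))" for j
  have [measurable]: "G j \<in> borel_measurable borel" for j using rep[of j] by (auto simp: fourier_rep_def L2_fun_def G_def)
  define h where "h n = 1 / real (Suc n)" for n
  have h: "h n > 0" for n by (simp add: h_def)
  let ?D = "\<lambda>n j \<zeta>. (cis (h n * fst \<zeta>) - 1) / of_real (h n) * G j \<zeta>"
  have le: "(\<integral>\<^sup>+\<zeta>. (\<Sum>j\<in>J. nsq (?D n j \<zeta>))) \<le> ennreal ((2 * pi)^2) * N" for n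
  proof -
    have 1: "(\<integral>\<^sup>+\<zeta>. nsq (?D n j \<zeta>)) \<le> ennreal ((1 / h n)^2) * (ennreal ((2 * pi)^2) * sq_norm (\<lambda>p. f j (p + (h n, 0)) - f j p))" if j: "j \<in> J" for j
    proof -
      have "(\<integral>\<^sup>+\<zeta>. nsq (?D n j \<zeta>)) = sq_norm (\<lambda>\<zeta>. of_real (1 / h n) * ((cis ((h n, 0) \<bullet> \<zeta>) - 1) * G j \<zeta>))"
        unfolding sq_norm_def by (intro nn_integral_cong) (simp add: inner_prod_def)
      also have "\<dots> = nsq (complex_of_real (1 / h n)) * sq_norm (\<lambda>\<zeta>. (cis ((h n, 0) \<bullet> \<zeta>) - 1) * G j \<zeta>)"
        by (rule sq_norm_cmult) measurable
      also have "\<dots> \<le> ennreal ((1 / h n)^2) * (ennreal ((2 * pi)^2) * sq_norm (\<lambda>p. f j (p + (h n, 0)) - f j p))"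
        using fourier_rep_sq_norm[OF fourier_rep_translation[OF rep[OF j]], of "(h n, 0)"] j
        by (intro mult_mono) (auto simp: norm_divide power_divide G_def)
      finally show ?thesis .
    qed
    have "(\<integral>\<^sup>+\<zeta>. (\<Sum>j\<in>J. nsq (?D n j \<zeta>))) = (\<Sum>j\<in>J. \<integral>\<^sup>+\<zeta>. nsq (?D n j \<zeta>))"
      by (rule nn_integral_sum) measurable
    also have "\<dots> \<le> (\<Sum>j\<in>J. ennreal ((1 / h n)^2) * (ennreal ((2 * pi)^2) * sq_norm (\<lambda>p. f j (p + (h n, 0)) - f j p)))"
      by (intro sum_mono 1)
    also have "\<dots> = ennreal ((1 / h n)^2) * (ennreal ((2 * pi)^2) * (\<Sum>j\<in>J. sq_norm (\<lambda>p. f j (p + (h n, 0)) - f j p)))"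
      by (simp only: sum_distrib_left)
    also have "\<dots> \<le> ennreal ((1 / h n)^2) * (ennreal ((2 * pi)^2) * (ennreal ((h n)^2) * N))"
      by (intro mult_left_mono bd h) auto
    also have "\<dots> = (ennreal ((1 / h n)^2) * ennreal ((h n)^2)) * (ennreal ((2 * pi)^2) * N)" by (simp only: mult_ac)
    also have "ennreal ((1 / h n)^2) * ennreal ((h n)^2) = 1"
      using h[of n] by (subst ennreal_mult[symmetric]) (auto simp: power_divide)
    finally show ?thesis by simp
  qed
  have "(\<Sum>j\<in>J. \<integral>\<^sup>+\<zeta>. ennreal ((fst \<zeta>)^2) * nsq (g j \<zeta>)) = (\<Sum>j\<in>J. \<integral>\<^sup>+\<zeta>. ennreal ((fst \<zeta>)^2) * nsq (G j \<zeta>))"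
    by (intro sum.cong refl) (simp add: G_def)
  also have "\<dots> = (\<integral>\<^sup>+\<zeta>. (\<Sum>j\<in>J. ennreal ((fst \<zeta>)^2) * nsq (G j \<zeta>)))"
    by (rule nn_integral_sum[symmetric]) measurable
  also have "\<dots> = (\<integral>\<^sup>+\<zeta>. liminf (\<lambda>n. \<Sum>j\<in>J. nsq (?D n j \<zeta>)))"
  proof (rule nn_integral_cong)
    fix \<zeta> :: "real \<times> real"
    have "(\<lambda>n. nsq (?D n j \<zeta>)) \<longlonglongrightarrow> nsq (\<i> * of_real (fst \<zeta>) * G j \<zeta>)" for j
      unfolding h_def by (intro tendsto_ennrealI tendsto_power tendsto_norm tendsto_mult tendsto_const cis_difference_quotient)
    then have "(\<lambda>n. \<Sum>j\<in>J. nsq (?D n j \<zeta>)) \<longlonglongrightarrow> (\<Sum>j\<in>J. nsq (\<i> * of_real (fst \<zeta>) * G j \<zeta>))"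
      by (intro tendsto_sum)
    then show "(\<Sum>j\<in>J. ennreal ((fst \<zeta>)^2) * nsq (G j \<zeta>)) = liminf (\<lambda>n. \<Sum>j\<in>J. nsq (?D n j \<zeta>))"
      by (subst lim_imp_Liminf) (auto simp: norm_mult power_mult_distrib ennreal_mult)
  qed
  also have "\<dots> \<le> liminf (\<lambda>n. \<integral>\<^sup>+\<zeta>. (\<Sum>j\<in>J. nsq (?D n j \<zeta>)))"
    by (rule nn_integral_liminf) measurable
  also have "\<dots> \<le> ennreal ((2 * pi)^2) * N"
    by (intro Liminf_le always_eventually allI le) auto
  finally show ?thesis .
qed

text \<open>No measurability of \<open>g\<close>: it will be the \<open>H\<^sup>1\<close> norm of a time slice, whose integral is a lower integral.\<close>

lemma nn_integral_le_scaled_AE: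
  assumes [measurable]: "f \<in> borel_measurable M" and c: "c > 0" and le: "AE x in M. f x \<le> ennreal c * g x"
  shows "(\<integral>\<^sup>+x. f x \<partial>M) \<le> ennreal c * (\<integral>\<^sup>+x. g x \<partial>M)"
proof -
  have c1: "ennreal c * ennreal (1 / c) = 1" using c by (subst ennreal_mult[symmetric]) auto
  have "(\<integral>\<^sup>+x. f x \<partial>M) = ennreal c * (\<integral>\<^sup>+x. ennreal (1 / c) * f x \<partial>M)"
    by (subst nn_integral_cmult) (auto simp: mult.assoc[symmetric] c1)
  also have "\<dots> \<le> ennreal c * (\<integral>\<^sup>+x. g x \<partial>M)"
  proof (intro mult_left_mono nn_integral_mono_AE)
    show "AE x in M. ennreal (1 / c) * f x \<le> g x" using le
    proof eventually_elim
      case (elim x)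
      have "ennreal (1 / c) * f x \<le> ennreal (1 / c) * (ennreal c * g x)" by (intro mult_left_mono elim) simp
      also have "\<dots> = g x" using c1 by (simp add: mult.assoc[symmetric] mult.commute)
      finally show ?case .
    qed
  qed simp
  finally show ?thesis .
qed

lemma L2_sq_weak_deriv_le_H1_sq:
  assumes "f \<in> H1_space S" "d \<in> Basis"
  shows "L2_sq S (weak_deriv S d f) \<le> H1_sq S f"
  using assms member_le_sum[of d Basis "\<lambda>d. L2_sq S (weak_deriv S d f)"]
  by (auto simp: H1_sq_def intro: add_increasing)

text \<open>A horizontal shift commutes with taking slices, so the bound for \<open>H1\<close>
  functions applies at almost every time and is integrated.\<close>

lemma L2H1_difference_bound:
  assumes v: "v \<in> L2H1_space B" "v \<in> L2_space (tstrip B)" and h: "h > 0"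
  shows "sq_norm (\<lambda>z. lift B v (z + ((h, 0), 0)) - lift B v z) \<le> ennreal (4 * h^2) * (L2H1_norm B v)^2"
proof -
  note [measurable] = L2_fun_measurable[OF L2_lift[OF v(2)]]
  have "sq_norm (\<lambda>z. lift B v (z + ((h, 0), 0)) - lift B v z) =
     (\<integral>\<^sup>+t. \<integral>\<^sup>+q. nsq (lift B v (((fst q, t), snd q) + ((h, 0), 0)) - lift B v ((fst q, t), snd q)))"
    unfolding sq_norm_def by (subst nn_integral_slices) auto
  also have "\<dots> \<le> ennreal (4 * h^2) * (\<integral>\<^sup>+t. H1_sq (strip B) (slice v t))"
  proof (rule nn_integral_le_scaled_AE)
    have "AE t in lborel. slice v t \<in> H1_dir B" using v by (simp add: L2H1_space_def)
    then show "AE t in lborel. (\<integral>\<^sup>+q. nsq (lift B v (((fst q, t), snd q) + ((h, 0), 0)) - lift B v ((fst q, t), snd q)))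
       \<le> ennreal (4 * h^2) * H1_sq (strip B) (slice v t)"
    proof eventually_elim
      case (elim t)
      then have f: "slice v t \<in> H1_space (strip B)" "has_trace B 0 (slice v t) (\<lambda>_. 0)" by (auto simp: H1_dir_def)
      have "lift B v (((fst q, t), snd q) + ((h, 0), 0)) - lift B v ((fst q, t), snd q) = restr (strip B) (\<lambda>p. slice v t (p + (h, 0)) - slice v t p) q" for q
        using strip_shift[of q h B] by (cases q) (simp add: lift_section restr_def indicator_def)
      then have "(\<integral>\<^sup>+q. nsq (lift B v (((fst q, t), snd q) + ((h, 0), 0)) - lift B v ((fst q, t), snd q))) = sq_norm (restr (strip B) (\<lambda>p. slice v t (p + (h, 0)) - slice v t p))"
        by (simp add: sq_norm_def)
      also have "\<dots> \<le> ennreal (4 * h^2) * L2_sq (strip B) (weak_deriv (strip B) (1, 0) (slice v t))"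
        by (rule H1_difference_bound[OF f h])
      also have "\<dots> \<le> ennreal (4 * h^2) * H1_sq (strip B) (slice v t)"
        by (intro mult_left_mono L2_sq_weak_deriv_le_H1_sq f) (auto simp: Basis_prod_def)
      finally show ?case .
    qed
  qed (use h in \<open>auto intro!: mult_pos_pos\<close>)
  finally show ?thesis by (simp add: L2H1_norm_def esqrt_power2)
qed

text \<open>At almost every time the slice lies in \<open>H1_dir B\<close>, so its sine coefficients
  obey the estimate in \<open>x\<close> and \<open>y\<close>; time is a parameter that is integrated
  at the end.\<close>

lemma L2H1_sine_modes:
  assumes B: "B > 0" and v: "v \<in> L2H1_space B" "v \<in> L2_space (tstrip B)" and J: "finite J" "0 \<notin> J"
  shows "(\<Sum>j\<in>J. ennreal ((real j)^2) * sq_norm (sine_mode B (lift B v) j)) \<le> ennreal ((B / pi)^2) * (L2H1_norm B v)^2"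
proof -
  note LV = L2_lift[OF v(2)]
  interpret strip_function B "lift B v" by unfold_locales (auto intro: B LV lift_supp)
  let ?m = "\<lambda>j x t. nsq (sine_mode B (lift B v) j (x, t))"
  have "(\<Sum>j\<in>J. ennreal ((real j)^2) * sq_norm (sine_mode B (lift B v) j)) = (\<Sum>j\<in>J. ennreal ((real j)^2) * (\<integral>\<^sup>+t. \<integral>\<^sup>+x. ?m j x t))"
  proof (intro sum.cong refl arg_cong[where f = "\<lambda>x. _ * x"])
    fix j
    have "sq_norm (sine_mode B (lift B v) j) = (\<integral>\<^sup>+x. \<integral>\<^sup>+t. ?m j x t)"
      unfolding sq_norm_def by (rule nn_integral_lborel_pair) measurable
    also have "\<dots> = (\<integral>\<^sup>+t. \<integral>\<^sup>+x. ?m j x t)" by (rule nn_integral_lborel_swap) measurable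
    finally show "sq_norm (sine_mode B (lift B v) j) = (\<integral>\<^sup>+t. \<integral>\<^sup>+x. ?m j x t)" .
  qed
  also have "\<dots> = (\<integral>\<^sup>+t. (\<Sum>j\<in>J. ennreal ((real j)^2) * (\<integral>\<^sup>+x. ?m j x t)))"
    by (subst nn_integral_sum, measurable, intro sum.cong refl nn_integral_cmult[symmetric], measurable)
  also have "\<dots> \<le> ennreal ((B / pi)^2) * (\<integral>\<^sup>+t. H1_sq (strip B) (slice v t))"
  proof (rule nn_integral_le_scaled_AE)
    have "AE t in lborel. slice v t \<in> H1_dir B" using v by (simp add: L2H1_space_def)
    then show "AE t in lborel. (\<Sum>j\<in>J. ennreal ((real j)^2) * (\<integral>\<^sup>+x. ?m j x t)) \<le> ennreal ((B / pi)^2) * H1_sq (strip B) (slice v t)"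
    proof eventually_elim
      case (elim t)
      then have f: "slice v t \<in> H1_space (strip B)" by (auto simp: H1_dir_def)
      have "(\<Sum>j\<in>J. ennreal ((real j)^2) * (\<integral>\<^sup>+x. ?m j x t)) = (\<Sum>j\<in>J. ennreal ((real j)^2) * sq_norm (\<lambda>x. LBINT y. restr (strip B) (slice v t) (x, y) * of_real (eigfun B j y)))"
        by (simp add: sq_norm_def sine_mode_def lift_section)
      also have "\<dots> \<le> ennreal ((B / pi)^2) * L2_sq (strip B) (weak_deriv (strip B) (0, 1) (slice v t))"
        by (rule H1_dir_sine_coefficients[OF B elim J])
      also have "\<dots> \<le> ennreal ((B / pi)^2) * H1_sq (strip B) (slice v t)"
        by (intro mult_left_mono L2_sq_weak_deriv_le_H1_sq f) (auto simp: Basis_prod_def)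
      finally show ?case .
    qed
  qed (use B in \<open>auto\<close>)
  finally show ?thesis by (simp add: L2H1_norm_def esqrt_power2)
qed

section \<open>The bilinear estimate\<close>

lemma schwartz_measurable: "schwartz \<phi> \<Longrightarrow> \<phi> \<in> borel_measurable borel"
proof -
  assume "schwartz \<phi>"
  then have "\<forall>p. iter_partial [] \<phi> differentiable (at p)" unfolding schwartz_def smooth_fun_def by blast
  then have "continuous_on UNIV \<phi>"
    by (auto simp: iter_partial_def continuous_on_eq_continuous_at intro: differentiable_imp_continuous_within)
  then show ?thesis by (rule borel_measurable_continuous_onI)
qed

text \<open>Six powers of decay: two pay for \<open>h\<close>, and two for an integrable bracket in
  each of the two variables.\<close>

lemma schwartz_weighted_integrable:
  fixes \<phi> h :: "real \<times> real \<Rightarrow> complex"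
  assumes \<phi>: "schwartz \<phi>" and [measurable]: "h \<in> borel_measurable borel" and h: "\<And>p. norm (h p) \<le> (1 + norm p)^2"
  shows "integrable lborel (\<lambda>p. h p * \<phi> p)"
proof (rule integrableI_bounded)
  note [measurable] = schwartz_measurable[OF \<phi>]
  show "(\<lambda>p. h p * \<phi> p) \<in> borel_measurable lborel" by measurable
  have "bounded (range (\<lambda>p. (1 + norm p) ^ 6 * norm (iter_partial [] \<phi> p)))"
    using \<phi> unfolding schwartz_def by blast
  then obtain C0 where "\<forall>x\<in>range (\<lambda>p. (1 + norm p) ^ 6 * norm (iter_partial [] \<phi> p)). norm x \<le> C0"
    unfolding bounded_iff by blast
  then have "norm ((1 + norm p) ^ 6 * norm (iter_partial [] \<phi> p)) \<le> C0" for p by blast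
  then have C0: "(1 + norm p) ^ 6 * norm (\<phi> p) \<le> C0" for p by (simp add: iter_partial_def abs_mult)
  define C where "C = max C0 0"
  have C: "(1 + norm p) ^ 6 * norm (\<phi> p) \<le> C" "0 \<le> C" for p using C0[of p] by (auto simp: C_def)
  have b: "norm (h p * \<phi> p) \<le> C * (bracket (fst p) powr - 2 * bracket (snd p) powr - 2)" for p
  proof -
    have n: "bracket (fst p) \<le> 1 + norm p" "bracket (snd p) \<le> 1 + norm p"
      using norm_fst_le[of "fst p" "snd p"] norm_snd_le[of "snd p" "fst p"] by (auto simp: bracket_def)
    have "norm (h p * \<phi> p) \<le> (1 + norm p)^2 * norm (\<phi> p)" by (simp add: norm_mult mult_right_mono h)
    also have "\<dots> \<le> C / ((bracket (fst p))^2 * (bracket (snd p))^2)"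
    proof -
      have "(1 + norm p)^2 * norm (\<phi> p) * ((bracket (fst p))^2 * (bracket (snd p))^2) \<le> (1 + norm p)^2 * norm (\<phi> p) * ((1 + norm p)^2 * (1 + norm p)^2)"
        by (intro mult_left_mono mult_mono power_mono n) (auto simp: bracket_pos less_imp_le)
      also have "\<dots> = (1 + norm p) ^ 6 * norm (\<phi> p)" by (simp add: power_numeral_reduce power2_eq_square)
      also have "\<dots> \<le> C" by (rule C)
      finally show ?thesis by (subst pos_le_divide_eq) (auto intro!: mult_pos_pos zero_less_power bracket_pos)
    qed
    also have "\<dots> = C * (bracket (fst p) powr - 2 * bracket (snd p) powr - 2)"
      using bracket_pos[of "fst p"] bracket_pos[of "snd p"] by (simp add: powr_minus field_simps)
    finally show ?thesis .
  qed
  have "(\<integral>\<^sup>+p. ennreal (norm (h p * \<phi> p))) \<le> (\<integral>\<^sup>+p. ennreal C * (ennreal (bracket (fst p) powr - 2) * ennreal (bracket (snd p) powr - 2)))"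
    using C(2) by (intro nn_integral_mono) (simp add: ennreal_mult[symmetric] ennreal_leI b)
  also have "\<dots> = ennreal C * (\<integral>\<^sup>+x. \<integral>\<^sup>+y. ennreal (bracket x powr - 2) * ennreal (bracket y powr - 2))"
    by (subst nn_integral_cmult, measurable, subst nn_integral_lborel_pair) auto
  also have "\<dots> = ennreal C * ((\<integral>\<^sup>+x. ennreal (bracket x powr - 2)) * (\<integral>\<^sup>+y. ennreal (bracket y powr - 2)))"
    by (subst nn_integral_cmult, measurable, subst nn_integral_multc) auto
  also have "\<dots> \<le> ennreal C * (ennreal 2 * ennreal 2)"
    using nn_integral_bracket_powr[of 2] by (intro mult_left_mono mult_mono) auto
  also have "\<dots> < \<infinity>" by (simp add: ennreal_mult_less_top)
  finally show "(\<integral>\<^sup>+p. ennreal (norm (h p * \<phi> p))) < \<infinity>" .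
qed

lemma schwartz_integrable:
  fixes \<phi> :: "real \<times> real \<Rightarrow> complex"
  assumes "schwartz \<phi>"
  shows "integrable lborel \<phi>" "L2_fun \<phi>" "integrable lborel (\<lambda>\<zeta>. \<i> * of_real (fst \<zeta>) * \<phi> \<zeta>)"
    "integrable lborel (\<lambda>\<zeta>. of_real ((fst \<zeta>)^2) * \<phi> \<zeta>)"
proof -
  show 1: "integrable lborel \<phi>" using schwartz_weighted_integrable[OF assms, of "\<lambda>_. 1"] by simp
  have f: "\<bar>fst p\<bar> \<le> norm p" for p :: "real \<times> real" using norm_fst_le[of "fst p" "snd p"] by simp
  show "integrable lborel (\<lambda>\<zeta>. \<i> * of_real (fst \<zeta>) * \<phi> \<zeta>)"
  proof (rule schwartz_weighted_integrable[OF assms])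
    fix p :: "real \<times> real"
    have "norm p \<le> (1 + norm p)^2" by (simp add: power2_eq_square algebra_simps)
    then show "norm (\<i> * complex_of_real (fst p)) \<le> (1 + norm p)^2" using f[of p] by (simp add: norm_mult)
  qed measurable
  show "integrable lborel (\<lambda>\<zeta>. of_real ((fst \<zeta>)^2) * \<phi> \<zeta>)"
  proof (rule schwartz_weighted_integrable[OF assms])
    fix p :: "real \<times> real"
    have "\<bar>fst p\<bar> ^ 2 \<le> (1 + norm p)^2" using f[of p] by (intro power_mono) auto
    then show "norm (complex_of_real ((fst p)^2)) \<le> (1 + norm p)^2" by (simp add: norm_power)
  qed measurable
  have "bounded (range (\<lambda>p. (1 + norm p) ^ 0 * norm (iter_partial [] \<phi> p)))"
    using assms unfolding schwartz_def by blast
  then obtain C0 where "\<forall>x\<in>range (\<lambda>p. (1 + norm p) ^ 0 * norm (iter_partial [] \<phi> p)). norm x \<le> C0"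
    unfolding bounded_iff by blast
  then have "norm ((1 + norm p) ^ 0 * norm (iter_partial [] \<phi> p)) \<le> C0" for p by blast
  then have "norm (\<phi> p) \<le> C0" for p by (simp add: iter_partial_def)
  with 1 show "L2_fun \<phi>" by (rule L2_fun_bounded_integrable)
qed

lemma norm_cis_minus_1_le: "norm (cis x - 1) \<le> \<bar>x\<bar>"
  using iexp_approx1[of x 0] by (simp add: cis_conv_exp)

lemma norm_cis_taylor_le: "norm (cis x - 1 - \<i> * of_real x) \<le> x^2"
proof -
  have "norm (cis x - 1 - \<i> * of_real x) \<le> x^2 / 2"
    using iexp_approx1[of x 1] by (simp add: cis_conv_exp diff_diff_eq power2_eq_square)
  then show ?thesis using zero_le_power2[of x] by linarith
qed

text \<open>The Taylor remainder of the kernel is at most \<open>s^2 * (fst \<zeta>)^2\<close>, and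
  the second moment of \<open>\<phi>\<close> is finite. The derivative is wanted because the
  distributional derivative acts on a test function that is itself a Fourier transform.\<close>

lemma fourier_has_x_derivative:
  assumes \<phi>: "schwartz \<phi>"
  shows "((\<lambda>s. fourier \<phi> (p + s *\<^sub>R (1, 0))) has_vector_derivative - fourier (\<lambda>\<zeta>. \<i> * of_real (fst \<zeta>) * \<phi> \<zeta>) p) (at 0)"
proof -
  note int = schwartz_integrable[OF \<phi>]
  note [measurable] = schwartz_measurable[OF \<phi>]
  define M where "M = (LBINT \<zeta>. norm (complex_of_real ((fst \<zeta>)^2) * \<phi> \<zeta>))"
  let ?D = "- fourier (\<lambda>\<zeta>. \<i> * of_real (fst \<zeta>) * \<phi> \<zeta>) p"
  have b: "norm (fourier \<phi> (p + s *\<^sub>R (1, 0)) - fourier \<phi> p - s *\<^sub>R ?D) \<le> s^2 * M" for s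
  proof -
    have i0: "integrable lborel (\<lambda>\<zeta>. cis (- (\<zeta> \<bullet> q)) * \<phi> \<zeta>)" for q by (rule integrable_cis_mult[OF int(1)]) measurable
    have i1: "integrable lborel (\<lambda>\<zeta>. cis (- (\<zeta> \<bullet> p)) * (\<i> * of_real (fst \<zeta>) * \<phi> \<zeta>))" by (rule integrable_cis_mult[OF int(3)]) measurable
    let ?r = "\<lambda>\<zeta>. cis (- (\<zeta> \<bullet> (p + s *\<^sub>R (1, 0)))) * \<phi> \<zeta> - cis (- (\<zeta> \<bullet> p)) * \<phi> \<zeta> + of_real s * (cis (- (\<zeta> \<bullet> p)) * (\<i> * of_real (fst \<zeta>) * \<phi> \<zeta>))"
    have "fourier \<phi> (p + s *\<^sub>R (1, 0)) - fourier \<phi> p - s *\<^sub>R ?D = (LBINT \<zeta>. ?r \<zeta>)"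
      unfolding fourier_eq
      by (subst Bochner_Integration.integral_add, intro Bochner_Integration.integrable_diff i0, intro integrable_mult_right i1,
          subst Bochner_Integration.integral_diff, intro i0, intro i0) (simp add: scaleR_conv_of_real)
    also have "norm \<dots> \<le> (LBINT \<zeta>. s^2 * norm (complex_of_real ((fst \<zeta>)^2) * \<phi> \<zeta>))"
    proof (rule Bochner_Integration.integral_norm_bound_integral)
      show "integrable lborel ?r" by (intro Bochner_Integration.integrable_add Bochner_Integration.integrable_diff i0 integrable_mult_right i1)
      show "integrable lborel (\<lambda>\<zeta>. s^2 * norm (complex_of_real ((fst \<zeta>)^2) * \<phi> \<zeta>))"
        by (intro integrable_mult_right integrable_norm int)
      fix \<zeta> :: "real \<times> real"
      have c: "cis (- (\<zeta> \<bullet> (p + s *\<^sub>R (1, 0)))) = cis (- (\<zeta> \<bullet> p)) * cis (- (s * fst \<zeta>))"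
        by (cases \<zeta>) (simp add: cis_mult inner_add_right inner_prod_def algebra_simps)
      have "?r \<zeta> = cis (- (\<zeta> \<bullet> p)) * ((cis (- (s * fst \<zeta>)) - 1 - \<i> * of_real (- (s * fst \<zeta>))) * \<phi> \<zeta>)"
        unfolding c by (simp add: algebra_simps)
      then have "norm (?r \<zeta>) = norm (cis (- (s * fst \<zeta>)) - 1 - \<i> * of_real (- (s * fst \<zeta>))) * norm (\<phi> \<zeta>)"
        by (simp only: norm_mult norm_cis mult_1_left)
      also have "\<dots> \<le> (- (s * fst \<zeta>))^2 * norm (\<phi> \<zeta>)" by (intro mult_right_mono norm_cis_taylor_le) simp
      also have "\<dots> = s^2 * norm (complex_of_real ((fst \<zeta>)^2) * \<phi> \<zeta>)" by (simp add: norm_mult norm_power power_mult_distrib)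
      finally show "norm (?r \<zeta>) \<le> s^2 * norm (complex_of_real ((fst \<zeta>)^2) * \<phi> \<zeta>)" .
    qed
    finally show ?thesis by (simp add: M_def)
  qed
  show ?thesis
    unfolding has_vector_derivative_def
  proof (rule has_derivativeI_sandwich[of 1 _ _ _ _ "\<lambda>s. \<bar>s\<bar> * M"])
    show "bounded_linear (\<lambda>x. x *\<^sub>R ?D)" by (rule bounded_linear_scaleR_left)
    have "((\<lambda>s. \<bar>s\<bar> * M) \<longlongrightarrow> \<bar>0\<bar> * M) (at 0)" by (intro tendsto_intros)
    then show "((\<lambda>s. \<bar>s\<bar> * M) \<longlongrightarrow> 0) (at 0)" by simp
    show "norm (fourier \<phi> (p + s *\<^sub>R (1, 0)) - fourier \<phi> (p + 0 *\<^sub>R (1, 0)) - (s - 0) *\<^sub>R ?D) / norm (s - 0) \<le> \<bar>s\<bar> * M" if "s \<noteq> 0" for s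
    proof -
      have "s^2 * M = \<bar>s\<bar> * M * \<bar>s\<bar>" by (metis abs_mult_self_eq mult.commute mult.left_commute power2_eq_square)
      then have "norm (fourier \<phi> (p + s *\<^sub>R (1, 0)) - fourier \<phi> p - s *\<^sub>R ?D) \<le> \<bar>s\<bar> * M * \<bar>s\<bar>" using b[of s] by (simp only:)
      then have "norm (fourier \<phi> (p + s *\<^sub>R (1, 0)) - fourier \<phi> p - s *\<^sub>R ?D) / \<bar>s\<bar> \<le> \<bar>s\<bar> * M"
        using that by (subst pos_divide_le_eq) auto
      then show ?thesis by (simp only: diff_zero scaleR_zero_left add_0_right real_norm_def)
    qed
  qed simp_all
qed

context strip_function
begin

text \<open>The square of an \<open>L2\<close> function is integrable, so the transform of its sine
  coefficient is an ordinary integral over all three variables: defined at every frequency, and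
  bounded.\<close>

definition square_mode :: "nat \<Rightarrow> real \<times> real \<Rightarrow> complex" where
  "square_mode k \<zeta> = (LBINT z. ((V z)^2 * of_real (eigfun B k (snd z))) * cis (- (fst z \<bullet> \<zeta>)))"

lemma measurable_square_mode [measurable]: "square_mode k \<in> borel_measurable borel"
  unfolding square_mode_def[abs_def] by measurable

lemma integrable_square_eigfun: "integrable lborel (\<lambda>z. (V z)^2 * complex_of_real (eigfun B k (snd z)))"
proof (rule Bochner_Integration.integrable_bound)
  show "integrable lborel (\<lambda>z. of_real (sqrt (2 / B)) * (V z * V z))" by (intro integrable_mult_right L2_fun_mult_integrable V)
  show "AE z in lborel. norm ((V z)^2 * complex_of_real (eigfun B k (snd z))) \<le> norm (complex_of_real (sqrt (2 / B)) * (V z * V z))"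
  proof (intro always_eventually allI)
    fix z
    have "norm (V z) ^ 2 * \<bar>eigfun B k (snd z)\<bar> \<le> norm (V z) ^ 2 * sqrt (2 / B)" by (intro mult_left_mono eigfun_bound B) auto
    then show "norm ((V z)^2 * complex_of_real (eigfun B k (snd z))) \<le> norm (complex_of_real (sqrt (2 / B)) * (V z * V z))"
      using B by (simp add: norm_mult norm_power power2_eq_square mult_ac)
  qed
qed measurable

lemma norm_square_mode_le: "norm (square_mode k \<zeta>) \<le> (LBINT z. norm ((V z)^2 * complex_of_real (eigfun B k (snd z))))"
  unfolding square_mode_def
  by (rule order_trans[OF integral_norm_bound]) (simp add: norm_mult)

lemma square_mode_pairing:
  assumes u: "integrable lborel u"
  shows "(LBINT \<zeta>. square_mode k \<zeta> * u \<zeta>) = (LBINT z. (V z)^2 * (fourier u (fst z) * of_real (eigfun B k (snd z))))"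
proof -
  have [measurable]: "u \<in> borel_measurable borel" using u by auto
  let ?f = "\<lambda>z. (V z)^2 * complex_of_real (eigfun B k (snd z))"
  have int: "integrable (lborel \<Otimes>\<^sub>M lborel) (\<lambda>(z, \<zeta>). ?f z * cis (- (fst z \<bullet> \<zeta>)) * u \<zeta>)"
  proof (rule integrableI_bounded)
    show "(\<lambda>(z, \<zeta>). ?f z * cis (- (fst z \<bullet> \<zeta>)) * u \<zeta>) \<in> borel_measurable (lborel \<Otimes>\<^sub>M lborel)" by measurable
    have "(\<integral>\<^sup>+q. ennreal (norm (case q of (z, \<zeta>) \<Rightarrow> ?f z * cis (- (fst z \<bullet> \<zeta>)) * u \<zeta>)) \<partial>(lborel \<Otimes>\<^sub>M lborel)) =
      (\<integral>\<^sup>+z. \<integral>\<^sup>+\<zeta>. ennreal (norm (?f z)) * ennreal (norm (u \<zeta>)))"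
      by (subst lborel.nn_integral_fst[symmetric], measurable)
         (intro nn_integral_cong, simp add: norm_mult ennreal_mult)
    also have "\<dots> = (\<integral>\<^sup>+z. ennreal (norm (?f z))) * (\<integral>\<^sup>+\<zeta>. ennreal (norm (u \<zeta>)))"
      by (subst nn_integral_cmult, measurable, subst nn_integral_multc) auto
    also have "\<dots> < \<infinity>" using u integrable_square_eigfun[of k] by (simp add: integrable_iff_bounded ennreal_mult_less_top)
    finally show "(\<integral>\<^sup>+q. ennreal (norm (case q of (z, \<zeta>) \<Rightarrow> ?f z * cis (- (fst z \<bullet> \<zeta>)) * u \<zeta>)) \<partial>(lborel \<Otimes>\<^sub>M lborel)) < \<infinity>" .
  qed
  have "(LBINT \<zeta>. square_mode k \<zeta> * u \<zeta>) = (LBINT \<zeta>. LBINT z. ?f z * cis (- (fst z \<bullet> \<zeta>)) * u \<zeta>)"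
    by (simp add: square_mode_def)
  also have "\<dots> = (LBINT z. LBINT \<zeta>. ?f z * cis (- (fst z \<bullet> \<zeta>)) * u \<zeta>)"
    by (rule lborel_pair.Fubini_integral[OF int])
  also have "\<dots> = (LBINT z. (V z)^2 * (fourier u (fst z) * of_real (eigfun B k (snd z))))"
  proof (rule Bochner_Integration.integral_cong[OF refl])
    fix z
    have "(LBINT \<zeta>. ?f z * cis (- (fst z \<bullet> \<zeta>)) * u \<zeta>) = ?f z * fourier u (fst z)"
      unfolding fourier_eq by (subst integral_mult_right_zero[symmetric]) (simp add: inner_commute mult.assoc)
    then show "(LBINT \<zeta>. ?f z * cis (- (fst z \<bullet> \<zeta>)) * u \<zeta>) = (V z)^2 * (fourier u (fst z) * of_real (eigfun B k (snd z)))"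
      by (simp add: mult_ac)
  qed
  finally show ?thesis .
qed

end

text \<open>The minus sign of the distributional derivative cancels the one from differentiating the
  kernel of the transform, which leaves the multiplier \<open>\<i> * \<xi>\<close>.\<close>

lemma represents_dx_square:
  assumes B: "B > 0" and v: "v \<in> L2_space (tstrip B)"
  shows "represents (\<lambda>\<zeta>. \<i> * of_real (fst \<zeta>) * strip_function.square_mode B (lift B v) k \<zeta>)
    (fourier_distr (coef B (distr_dx (distr_of B (\<lambda>p. (v p)^2))) k))"
proof -
  interpret strip_function B "lift B v" by unfold_locales (auto intro: B L2_lift[OF v] lift_supp)
  have rm [measurable]: "restr (tstrip B) v \<in> borel_measurable borel" using v by (auto simp: L2_space_iff L2_fun_def)
  have r2: "restr (tstrip B) (\<lambda>p. (v p)^2) = (\<lambda>p. (restr (tstrip B) v p)^2)"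
    by (auto simp: restr_def indicator_def)
  have l2: "lift B (\<lambda>p. (v p)^2) z = (lift B v z)^2" for z unfolding lift_def r2 ..
  show ?thesis
    unfolding represents_def
  proof (intro conjI allI impI)
    show "(\<lambda>\<zeta>. \<i> * of_real (fst \<zeta>) * square_mode k \<zeta>) \<in> borel_measurable lborel" by measurable
    fix \<phi> :: "real \<times> real \<Rightarrow> complex" assume \<phi>: "schwartz \<phi>"
    note [measurable] = schwartz_measurable[OF \<phi>]
    note int = schwartz_integrable[OF \<phi>]
    let ?u = "\<lambda>\<zeta>. \<i> * of_real (fst \<zeta>) * \<phi> \<zeta>"
    show "integrable lborel (\<lambda>\<zeta>. \<i> * of_real (fst \<zeta>) * square_mode k \<zeta> * \<phi> \<zeta>)"
    proof (rule Bochner_Integration.integrable_bound)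
      let ?C = "LBINT z. norm ((lift B v z)^2 * complex_of_real (eigfun B k (snd z)))"
      show "integrable lborel (\<lambda>\<zeta>. complex_of_real ?C * ?u \<zeta>)" by (intro integrable_mult_right int)
      have C0: "0 \<le> ?C" by simp
      show "AE \<zeta> in lborel. norm (\<i> * of_real (fst \<zeta>) * square_mode k \<zeta> * \<phi> \<zeta>) \<le> norm (complex_of_real ?C * ?u \<zeta>)"
      proof (intro always_eventually allI)
        fix \<zeta>
        have "norm (\<i> * of_real (fst \<zeta>) * square_mode k \<zeta> * \<phi> \<zeta>) = norm (square_mode k \<zeta>) * norm (?u \<zeta>)" by (simp add: norm_mult)
        also have "\<dots> \<le> ?C * norm (?u \<zeta>)" by (intro mult_right_mono norm_square_mode_le) simp
        also have "\<dots> = norm (complex_of_real ?C * ?u \<zeta>)" unfolding norm_mult[of "complex_of_real ?C"] norm_of_real using C0 by (simp only: abs_of_nonneg)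
        finally show "norm (\<i> * of_real (fst \<zeta>) * square_mode k \<zeta> * \<phi> \<zeta>) \<le> norm (complex_of_real ?C * ?u \<zeta>)" .
      qed
    qed measurable
    let ?\<psi> = "\<lambda>(x, y, t). fourier \<phi> (x, t) * complex_of_real (eigfun B k y)"
    have d: "dir_deriv (1, 0, 0) ?\<psi> = (\<lambda>p. - fourier ?u (fst p, snd (snd p)) * complex_of_real (eigfun B k (fst (snd p))))"
    proof
      fix p :: "real \<times> real \<times> real"
      obtain x y t where p: "p = (x, y, t)" by (cases p) auto
      have "((\<lambda>s. fourier \<phi> ((x, t) + s *\<^sub>R (1, 0)) * complex_of_real (eigfun B k y)) has_vector_derivative - fourier ?u (x, t) * complex_of_real (eigfun B k y)) (at 0)"
        by (rule has_vector_derivative_mult_left[OF fourier_has_x_derivative[OF \<phi>]])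
      from vector_derivative_at[OF this] show "dir_deriv (1, 0, 0) ?\<psi> p = - fourier ?u (fst p, snd (snd p)) * complex_of_real (eigfun B k (fst (snd p)))"
        unfolding dir_deriv_def p by simp
    qed
    have "fourier_distr (coef B (distr_dx (distr_of B (\<lambda>p. (v p)^2))) k) \<phi> = - distr_of B (\<lambda>p. (v p)^2) (dir_deriv (1, 0, 0) ?\<psi>)"
      by (simp add: fourier_distr_def coef_def distr_dx_def)
    also have "\<dots> = - (LBINT z. lift B (\<lambda>p. (v p)^2) z * dir_deriv (1, 0, 0) ?\<psi> (reorder z))"
    proof (subst distr_of_eq_lift)
      show "restr (tstrip B) (\<lambda>p. (v p)^2) \<in> borel_measurable borel" unfolding r2 by measurable
      show "dir_deriv (1, 0, 0) ?\<psi> \<in> borel_measurable borel" unfolding d by measurable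
    qed simp
    also have "\<dots> = (LBINT z. (lift B v z)^2 * (fourier ?u (fst z) * of_real (eigfun B k (snd z))))"
      unfolding d l2 by (subst Bochner_Integration.integral_minus[symmetric]) (simp add: reorder_def)
    also have "\<dots> = (LBINT \<zeta>. square_mode k \<zeta> * ?u \<zeta>)" by (rule square_mode_pairing[OF int(3), symmetric])
    finally show "fourier_distr (coef B (distr_dx (distr_of B (\<lambda>p. (v p)^2))) k) \<phi> = (LBINT \<zeta>. \<i> * of_real (fst \<zeta>) * square_mode k \<zeta> * \<phi> \<zeta>)"
      by (simp only: mult_ac)
  qed
qed

section \<open>Comparison of the modulation weight with the weights of \<open>X\<close> and
  \<open>Y\<close>\<close>

lemma bracket_powr_resonant:
  assumes "\<bar>w\<bar> < 1"
  shows "bracket (t - w) powr (24/25) \<le> 2 * bracket t powr (24/25)"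
proof -
  have "bracket (t - w) \<le> 2 * bracket t" using assms by (simp add: bracket_def)
  then have "bracket (t - w) powr (24/25) \<le> (2 * bracket t) powr (24/25)"
    by (intro powr_mono2) (auto simp: bracket_pos less_imp_le)
  also have "\<dots> = 2 powr (24/25) * bracket t powr (24/25)" by (simp add: powr_mult)
  also have "\<dots> \<le> 2 powr 1 * bracket t powr (24/25)" by (intro mult_right_mono powr_mono) auto
  finally show ?thesis by simp
qed

lemma mod_weight_eq: "mod_weight a B k z = bracket (snd z - omega a B k (fst z)) powr (24/25)"
  by (simp add: mod_weight_def case_prod_beta')

lemma mod_weight_pos: "mod_weight a B k z > 0"
  using mod_weight_ge_1[of a B k z] by linarith

lemma X_term_eq:
  "X_term a B (13/25) (12/25) k g =
     (\<integral>\<^sup>+z. ennreal (mod_weight a B k z * (norm (g z))^2) * indicator {z. \<bar>omega a B k (fst z)\<bar> \<ge> 1} z) +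
     (\<integral>\<^sup>+z. ennreal (bracket (snd z) powr (26/25) * (norm (g z))^2) * indicator {z. \<bar>omega a B k (fst z)\<bar> < 1} z)"
  by (simp add: X_term_def case_prod_beta' mod_weight_eq)

text \<open>Where \<open>\<bar>omega a B k \<xi>\<bar> < 1\<close>, the bracket of
  \<open>\<tau> - omega a B k \<xi>\<close> is at most twice that of \<open>\<tau>\<close>, and the
  \<open>X\<close> weight has the larger exponent \<open>26/25\<close>. Hence one modulation weight
  is controlled in both regions, and the splitting can be forgotten.\<close>

lemma mod_weight_le_X_term:
  assumes [measurable]: "g \<in> borel_measurable borel"
  shows "(\<integral>\<^sup>+z. ennreal (mod_weight a B k z) * nsq (g z)) \<le> 2 * X_term a B (13/25) (12/25) k g"
proof -
  let ?f1 = "\<lambda>z. ennreal (mod_weight a B k z * (norm (g z))^2) * indicator {z. \<bar>omega a B k (fst z)\<bar> \<ge> 1} z"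
  let ?f2 = "\<lambda>z. ennreal (bracket (snd z) powr (26/25) * (norm (g z))^2) * indicator {z. \<bar>omega a B k (fst z)\<bar> < 1} z"
  have "(\<integral>\<^sup>+z. ennreal (mod_weight a B k z) * nsq (g z)) \<le> (\<integral>\<^sup>+z. 2 * (?f1 z + ?f2 z))"
  proof (rule nn_integral_mono)
    fix z
    have e: "ennreal (mod_weight a B k z) * nsq (g z) = ennreal (mod_weight a B k z * (norm (g z))^2)"
      using mod_weight_pos[of a B k z] by (simp add: ennreal_mult)
    show "ennreal (mod_weight a B k z) * nsq (g z) \<le> 2 * (?f1 z + ?f2 z)"
    proof (cases "\<bar>omega a B k (fst z)\<bar> \<ge> 1")
      case True
      have "ennreal (mod_weight a B k z * (norm (g z))^2) * 1 \<le> ennreal (mod_weight a B k z * (norm (g z))^2) * 2"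
        by (intro mult_left_mono) auto
      with True show ?thesis unfolding e by (simp add: mult.commute)
    next
      case False
      have "mod_weight a B k z \<le> 2 * bracket (snd z) powr (24/25)"
        unfolding mod_weight_eq using False by (intro bracket_powr_resonant) simp
      also have "\<dots> \<le> 2 * bracket (snd z) powr (26/25)" by (intro mult_left_mono powr_mono) (auto simp: bracket_ge_1)
      finally have "ennreal (mod_weight a B k z * (norm (g z))^2) \<le> ennreal (2 * (bracket (snd z) powr (26/25) * (norm (g z))^2))"
        by (intro ennreal_leI) (simp add: mult_right_mono mult.assoc[symmetric])
      also have "\<dots> = 2 * ennreal (bracket (snd z) powr (26/25) * (norm (g z))^2)" by (subst ennreal_mult) auto
      finally show ?thesis unfolding e using False by simp
    qed
  qed
  also have "\<dots> = 2 * X_term a B (13/25) (12/25) k g"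
    unfolding X_term_eq by (subst nn_integral_cmult, measurable, subst nn_integral_add) auto
  finally show ?thesis .
qed

text \<open>\<open>53 = 1 + 2 + 50\<close>. In the second region the exponent
  \<open>2 * (1 - \<alpha>)\<close> equals \<open>2 * b\<close>, so only the comparison of brackets
  costs a factor. In the third part Cauchy-Schwarz in \<open>\<tau>\<close> splits the exponent 2
  into \<open>24/25\<close> and \<open>26/25\<close>, and the integral of \<open>bracket\<close> to
  the power \<open>- (26/25)\<close> is at most \<open>2 / (1/25) = 50\<close>.\<close>

lemma Y_term_le:
  assumes [measurable]: "g \<in> borel_measurable borel"
  shows "Y_term a B (13/25) (12/25) k g \<le> 53 * (\<integral>\<^sup>+z. ennreal ((norm (g z))^2 / mod_weight a B k z))"
proof -
  let ?I = "\<integral>\<^sup>+z. ennreal ((norm (g z))^2 / mod_weight a B k z)"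
  let ?A = "{z :: real \<times> real. \<bar>omega a B k (fst z)\<bar> \<ge> 1}"
  let ?A' = "{z :: real \<times> real. \<bar>omega a B k (fst z)\<bar> < 1}"
  have 1: "(\<integral>\<^sup>+z. ennreal ((norm (g z))^2 / mod_weight a B k z) * indicator ?A z) \<le> 1 * ?I"
    unfolding mult_1 by (intro nn_integral_mono) (auto simp: indicator_def)
  have 2: "(\<integral>\<^sup>+z. ennreal ((norm (g z))^2 / bracket (snd z) powr (24/25)) * indicator ?A' z) \<le> 2 * ?I"
  proof -
    have "(\<integral>\<^sup>+z. ennreal ((norm (g z))^2 / bracket (snd z) powr (24/25)) * indicator ?A' z) \<le> (\<integral>\<^sup>+z. ennreal 2 * ennreal ((norm (g z))^2 / mod_weight a B k z))"
    proof (rule nn_integral_mono)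
      fix z
      show "ennreal ((norm (g z))^2 / bracket (snd z) powr (24/25)) * indicator ?A' z \<le> ennreal 2 * ennreal ((norm (g z))^2 / mod_weight a B k z)"
      proof (cases "\<bar>omega a B k (fst z)\<bar> < 1")
        case True
        have p: "bracket (snd z) powr (24/25) > 0" using bracket_pos[of "snd z"] by simp
        have "mod_weight a B k z \<le> 2 * bracket (snd z) powr (24/25)"
          unfolding mod_weight_eq using True by (rule bracket_powr_resonant)
        then have "(norm (g z))^2 * mod_weight a B k z \<le> (norm (g z))^2 * (2 * bracket (snd z) powr (24/25))" by (intro mult_left_mono) auto
        then have "(norm (g z))^2 / bracket (snd z) powr (24/25) \<le> 2 * ((norm (g z))^2 / mod_weight a B k z)"
          using p mod_weight_pos[of a B k z] by (simp add: divide_simps mult_ac)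
        then have "ennreal ((norm (g z))^2 / bracket (snd z) powr (24/25)) \<le> ennreal (2 * ((norm (g z))^2 / mod_weight a B k z))" by (rule ennreal_leI)
        also have "\<dots> = ennreal 2 * ennreal ((norm (g z))^2 / mod_weight a B k z)" using mod_weight_pos[of a B k z] by (subst ennreal_mult) auto
        finally show ?thesis using True by simp
      qed simp
    qed
    also have "\<dots> = 2 * ?I" by (subst nn_integral_cmult) auto
    finally show ?thesis .
  qed
  have 3: "(\<integral>\<^sup>+\<xi>\<in>{\<xi>. \<bar>omega a B k \<xi>\<bar> \<ge> 1}. (\<integral>\<^sup>+\<tau>. ennreal (norm (g (\<xi>, \<tau>)) / bracket (\<tau> - omega a B k \<xi>)))^2 \<partial>lborel) \<le> 50 * ?I"
  proof -
    have "(\<integral>\<^sup>+\<xi>\<in>{\<xi>. \<bar>omega a B k \<xi>\<bar> \<ge> 1}. (\<integral>\<^sup>+\<tau>. ennreal (norm (g (\<xi>, \<tau>)) / bracket (\<tau> - omega a B k \<xi>)))^2 \<partial>lborel)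
      \<le> (\<integral>\<^sup>+\<xi>. ennreal 50 * (\<integral>\<^sup>+\<tau>. ennreal ((norm (g (\<xi>, \<tau>)))^2 / mod_weight a B k (\<xi>, \<tau>))))"
    proof (rule nn_integral_mono)
      fix \<xi>
      let ?b = "\<lambda>\<tau>. bracket (\<tau> - omega a B k \<xi>)"
      have "(\<integral>\<^sup>+\<tau>. ennreal (norm (g (\<xi>, \<tau>)) / ?b \<tau>))^2 \<le>
        (\<integral>\<^sup>+\<tau>. ennreal ((norm (g (\<xi>, \<tau>)))^2 / mod_weight a B k (\<xi>, \<tau>))) * (\<integral>\<^sup>+\<tau>. ennreal (?b \<tau> powr - (26/25)))"
      proof (rule nn_integral_geometric_mean)
        fix \<tau>
        have "?b \<tau> powr (24/25) * ?b \<tau> powr (26/25) = (?b \<tau>)^2"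
          using bracket_pos[of "\<tau> - omega a B k \<xi>"] by (simp add: powr_add[symmetric])
        then have "(norm (g (\<xi>, \<tau>)) / ?b \<tau>)^2 = (norm (g (\<xi>, \<tau>)))^2 / mod_weight a B k (\<xi>, \<tau>) * ?b \<tau> powr - (26/25)"
          by (simp add: mod_weight_eq powr_minus_divide power_divide)
        then show "(ennreal (norm (g (\<xi>, \<tau>)) / ?b \<tau>))^2 \<le> ennreal ((norm (g (\<xi>, \<tau>)))^2 / mod_weight a B k (\<xi>, \<tau>)) * ennreal (?b \<tau> powr - (26/25))"
          using mod_weight_pos[of a B k "(\<xi>, \<tau>)"] bracket_pos[of "\<tau> - omega a B k \<xi>"]
          by (simp add: ennreal_power ennreal_mult[symmetric])
      qed measurable
      also have "(\<integral>\<^sup>+\<tau>. ennreal (?b \<tau> powr - (26/25))) \<le> ennreal 50"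
        using nn_integral_bracket_powr[of "26/25"] nn_integral_lborel_shift_diff[of "\<lambda>x. ennreal (bracket x powr - (26/25))" "omega a B k \<xi>"] by simp
      finally have "(\<integral>\<^sup>+\<tau>. ennreal (norm (g (\<xi>, \<tau>)) / ?b \<tau>))^2 \<le> (\<integral>\<^sup>+\<tau>. ennreal ((norm (g (\<xi>, \<tau>)))^2 / mod_weight a B k (\<xi>, \<tau>))) * ennreal 50"
        by (simp add: mult_left_mono)
      then show "(\<integral>\<^sup>+\<tau>. ennreal (norm (g (\<xi>, \<tau>)) / ?b \<tau>))^2 * indicator {\<xi>. \<bar>omega a B k \<xi>\<bar> \<ge> 1} \<xi> \<le> ennreal 50 * (\<integral>\<^sup>+\<tau>. ennreal ((norm (g (\<xi>, \<tau>)))^2 / mod_weight a B k (\<xi>, \<tau>)))"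
        by (auto simp: indicator_def mult.commute)
    qed
    also have "\<dots> = 50 * (\<integral>\<^sup>+\<xi>. \<integral>\<^sup>+\<tau>. ennreal ((norm (g (\<xi>, \<tau>)))^2 / mod_weight a B k (\<xi>, \<tau>)))"
      by (subst nn_integral_cmult) auto
    also have "(\<integral>\<^sup>+\<xi>. \<integral>\<^sup>+\<tau>. ennreal ((norm (g (\<xi>, \<tau>)))^2 / mod_weight a B k (\<xi>, \<tau>))) = ?I"
      by (rule nn_integral_lborel_pair[symmetric]) measurable
    finally show ?thesis .
  qed
  have eq: "Y_term a B (13/25) (12/25) k g =
    (\<integral>\<^sup>+z. ennreal ((norm (g z))^2 / mod_weight a B k z) * indicator ?A z) +
    (\<integral>\<^sup>+z. ennreal ((norm (g z))^2 / bracket (snd z) powr (24/25)) * indicator ?A' z) +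
    (\<integral>\<^sup>+\<xi>\<in>{\<xi>. \<bar>omega a B k \<xi>\<bar> \<ge> 1}. (\<integral>\<^sup>+\<tau>. ennreal (norm (g (\<xi>, \<tau>)) / bracket (\<tau> - omega a B k \<xi>)))^2 \<partial>lborel)"
    by (simp add: Y_term_def case_prod_beta' mod_weight_eq)
  have "Y_term a B (13/25) (12/25) k g \<le> 1 * ?I + 2 * ?I + 50 * ?I" unfolding eq by (intro add_mono 1 2 3)
  also have "\<dots> = 53 * ?I" by (simp only: distrib_right[symmetric]) simp
  finally show ?thesis .
qed

section \<open>Mode estimates for functions in \<open>Z\<close>\<close>

lemma sum_le_suminf_Suc:
  fixes f :: "nat \<Rightarrow> ennreal"
  assumes J: "finite J" "0 \<notin> J"
  shows "(\<Sum>j\<in>J. f j) \<le> (\<Sum>k. f (Suc k))"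
proof -
  have "J = Suc ` ((\<lambda>j. j - 1) ` J)"
  proof (intro equalityI subsetI)
    fix j assume "j \<in> J"
    moreover from this J have "j = Suc (j - 1)" by (cases j) auto
    ultimately show "j \<in> Suc ` ((\<lambda>j. j - 1) ` J)" by blast
  next
    fix j assume "j \<in> Suc ` ((\<lambda>j. j - 1) ` J)"
    then obtain i where "i \<in> J" "j = Suc (i - 1)" by blast
    with J show "j \<in> J" by (cases i) auto
  qed
  then have "(\<Sum>j\<in>J. f j) = (\<Sum>j\<in>Suc ` ((\<lambda>j. j - 1) ` J). f j)" by simp
  also have "\<dots> = (\<Sum>i\<in>(\<lambda>j. j - 1) ` J. f (Suc i))" by (rule sum.reindex[unfolded comp_def]) simp
  also have "\<dots> \<le> (\<Sum>k. f (Suc k))" using J by (intro sum_le_suminf) auto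
  finally show ?thesis .
qed

text \<open>\<open>coef_hat\<close> is known by its action on Schwartz functions only. Bumps are
  among them, and finiteness of the \<open>X\<close> norm puts the chosen function in
  \<open>L2\<close>, so the duality extends to all integrable \<open>L2\<close> tests.\<close>

lemma X_norm_modes:
  assumes B: "B > 0" and v: "v \<in> L2_space (tstrip B)" and X: "X_norm a B (13/25) (12/25) (distr_of B v) < \<infinity>"
  defines "g \<equiv> coef_hat B (distr_of B v)"
  shows "j \<ge> 1 \<Longrightarrow> fourier_rep (sine_mode B (lift B v) j) (g j)"
    and "finite J \<Longrightarrow> 0 \<notin> J \<Longrightarrow> (\<Sum>j\<in>J. \<integral>\<^sup>+z. ennreal (mod_weight a B j z) * nsq (g j z))
      \<le> 2 * (X_norm a B (13/25) (12/25) (distr_of B v))^2"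
proof -
  interpret strip_function B "lift B v" by unfold_locales (auto intro: B L2_lift[OF v] lift_supp)
  have h: "has_coef_hats B (distr_of B v)" using X by (auto simp: X_norm_def split: if_splits)
  have X2: "(X_norm a B (13/25) (12/25) (distr_of B v))^2 = (\<Sum>k. X_term a B (13/25) (12/25) (Suc k) (g (Suc k)))"
    using h by (simp add: X_norm_def esqrt_power2 g_def)
  have rep: "represents (g j) (fourier_distr (coef B (distr_of B v) j))" if "j \<ge> 1" for j
    using h[unfolded has_coef_hats_def, rule_format, OF that] unfolding g_def coef_hat_def by (rule someI_ex)
  have gm: "g j \<in> borel_measurable borel" if "j \<ge> 1" for j using rep[OF that] by (simp add: represents_def)
  show 2: "(\<Sum>j\<in>J. \<integral>\<^sup>+z. ennreal (mod_weight a B j z) * nsq (g j z))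
      \<le> 2 * (X_norm a B (13/25) (12/25) (distr_of B v))^2" if J: "finite J" "0 \<notin> J" for J
  proof -
    have "(\<Sum>j\<in>J. \<integral>\<^sup>+z. ennreal (mod_weight a B j z) * nsq (g j z)) \<le> (\<Sum>j\<in>J. 2 * X_term a B (13/25) (12/25) j (g j))"
    proof (intro sum_mono mod_weight_le_X_term gm)
      fix j assume "j \<in> J" then show "j \<ge> 1" using J by (cases j) auto
    qed
    also have "\<dots> = 2 * (\<Sum>j\<in>J. X_term a B (13/25) (12/25) j (g j))" by (simp add: sum_distrib_left)
    also have "\<dots> \<le> 2 * (\<Sum>k. X_term a B (13/25) (12/25) (Suc k) (g (Suc k)))"
      by (intro mult_left_mono sum_le_suminf_Suc J) auto
    finally show ?thesis unfolding X2 .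
  qed
  show "fourier_rep (sine_mode B (lift B v) j) (g j)" if j: "j \<ge> 1"
  proof -
    have "sq_norm (g j) \<le> (\<integral>\<^sup>+z. ennreal (mod_weight a B j z) * nsq (g j z))"
      unfolding sq_norm_def
    proof (rule nn_integral_mono)
      fix z
      have "1 * nsq (g j z) \<le> ennreal (mod_weight a B j z) * nsq (g j z)"
        by (intro mult_right_mono) (auto simp: mod_weight_ge_1)
      then show "nsq (g j z) \<le> ennreal (mod_weight a B j z) * nsq (g j z)" by simp
    qed
    also have "\<dots> \<le> 2 * (X_norm a B (13/25) (12/25) (distr_of B v))^2" using 2[of "{j}"] j by simp
    also have "\<dots> < \<infinity>" using X by (simp add: ennreal_mult_less_top power2_eq_square)
    finally have gL: "L2_fun (g j)" using gm[OF j] by (simp add: L2_fun_def)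
    have rm [measurable]: "restr (tstrip B) v \<in> borel_measurable borel" using v by (auto simp: L2_space_iff L2_fun_def)
    have dual: "fourier_dual (sine_mode B (lift B v) j) (g j) \<phi>" if \<phi>: "schwartz \<phi>" for \<phi>
    proof -
      note [measurable] = schwartz_measurable[OF \<phi>]
      let ?\<psi> = "\<lambda>(x, y, t). fourier \<phi> (x, t) * complex_of_real (eigfun B j y)"
      have \<psi>: "?\<psi> = (\<lambda>p. fourier \<phi> (fst p, snd (snd p)) * complex_of_real (eigfun B j (fst (snd p))))" by auto
      have "(LBINT p. g j p * \<phi> p) = distr_of B v ?\<psi>"
        using rep[OF j] \<phi> by (simp add: represents_def fourier_distr_def coef_def)
      also have "\<dots> = (LBINT z. lift B v z * ?\<psi> (reorder z))"
        by (rule distr_of_eq_lift[OF rm]) (unfold \<psi>, measurable)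
      also have "\<dots> = (LBINT z. lift B v z * (fourier \<phi> (fst z) * complex_of_real (eigfun B j (snd z))))"
        by (simp add: reorder_def)
      also have "\<dots> = (LBINT p. sine_mode B (lift B v) j p * fourier \<phi> p)"
        by (rule integral_V_tensor[OF L2_fun_fourier[OF schwartz_integrable(1,2)[OF \<phi>]]])
      finally show ?thesis by (simp add: fourier_dual_def)
    qed
    show ?thesis
      unfolding fourier_rep_def using L2_sine_mode gL fourier_dual_extend[OF L2_sine_mode gL dual[OF bump_schwartz]] by blast
  qed
qed

text \<open>The three summands of the weight are bounded separately: 2 comes from comparing the
  modulation weight with \<open>X\<close>, 4 from the difference bound in \<open>x\<close>, and
  \<open>(B / pi)^2\<close> from the sine coefficients. The last two carry the Plancherel factor
  \<open>(2 * pi)^2\<close>.\<close>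

lemma freq_weight_modes:
  assumes B: "B > 0" and v: "v \<in> L2_space (tstrip B)" "v \<in> L2H1_space B" and X: "X_norm a B (13/25) (12/25) (distr_of B v) < \<infinity>"
    and J: "finite J" "0 \<notin> J"
  shows "(\<Sum>j\<in>J. \<integral>\<^sup>+z. ennreal (freq_weight a B j z) * nsq (coef_hat B (distr_of B v) j z))
    \<le> ennreal (2 + (2 * pi)^2 * 4 + (2 * pi)^2 * (B / pi)^2) * (Z_norm a B (13/25) (12/25) v)^2"
proof -
  interpret strip_function B "lift B v" by unfold_locales (auto intro: B L2_lift[OF v(1)] lift_supp)
  define g where "g = coef_hat B (distr_of B v)"
  define N where "N = Z_norm a B (13/25) (12/25) v"
  have XN: "(X_norm a B (13/25) (12/25) (distr_of B v))^2 \<le> N^2" and LN: "(L2H1_norm B v)^2 \<le> N^2"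
    unfolding N_def Z_norm_def by (auto intro!: power_mono)
  have J1: "j \<ge> 1" if "j \<in> J" for j using that J by (cases j) auto
  have rep: "fourier_rep (sine_mode B (lift B v) j) (g j)" if "j \<in> J" for j
    unfolding g_def by (rule X_norm_modes(1)[OF B v(1) X J1[OF that]])
  have gm: "g j \<in> borel_measurable borel" if "j \<in> J" for j using rep[OF that] by (auto simp: fourier_rep_def L2_fun_def)
  have "(\<Sum>j\<in>J. \<integral>\<^sup>+z. ennreal (freq_weight a B j z) * nsq (g j z)) =
    (\<Sum>j\<in>J. (\<integral>\<^sup>+z. ennreal (mod_weight a B j z) * nsq (g j z)) +
      (\<integral>\<^sup>+z. ennreal ((fst z)^2) * nsq (g j z)) + ennreal ((real j)^2) * sq_norm (g j))"
  proof (intro sum.cong refl)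
    fix j assume "j \<in> J"
    note [measurable] = gm[OF this]
    have "ennreal (freq_weight a B j z) = ennreal (mod_weight a B j z) + ennreal ((fst z)^2) + ennreal ((real j)^2)" for z
      using mod_weight_pos[of a B j z] by (simp add: freq_weight_def mod_weight_def case_prod_beta' ennreal_plus[symmetric] del: ennreal_plus)
    then show "(\<integral>\<^sup>+z. ennreal (freq_weight a B j z) * nsq (g j z)) =
      (\<integral>\<^sup>+z. ennreal (mod_weight a B j z) * nsq (g j z)) +
      (\<integral>\<^sup>+z. ennreal ((fst z)^2) * nsq (g j z)) + ennreal ((real j)^2) * sq_norm (g j)"
      unfolding sq_norm_def by (simp add: distrib_right nn_integral_add nn_integral_cmult)
  qed
  also have "\<dots> = (\<Sum>j\<in>J. \<integral>\<^sup>+z. ennreal (mod_weight a B j z) * nsq (g j z)) +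
      (\<Sum>j\<in>J. \<integral>\<^sup>+z. ennreal ((fst z)^2) * nsq (g j z)) + (\<Sum>j\<in>J. ennreal ((real j)^2) * sq_norm (g j))"
    by (simp add: sum.distrib)
  also have "\<dots> \<le> 2 * N^2 + ennreal ((2 * pi)^2) * (ennreal 4 * N^2) + ennreal ((2 * pi)^2) * (ennreal ((B / pi)^2) * N^2)"
  proof (intro add_mono)
    have "(\<Sum>j\<in>J. \<integral>\<^sup>+z. ennreal (mod_weight a B j z) * nsq (g j z)) \<le> 2 * (X_norm a B (13/25) (12/25) (distr_of B v))^2"
      unfolding g_def by (rule X_norm_modes(2)[OF B v(1) X J])
    also have "\<dots> \<le> 2 * N^2" by (intro mult_left_mono XN) auto
    finally show "(\<Sum>j\<in>J. \<integral>\<^sup>+z. ennreal (mod_weight a B j z) * nsq (g j z)) \<le> 2 * N^2" .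
    show "(\<Sum>j\<in>J. \<integral>\<^sup>+z. ennreal ((fst z)^2) * nsq (g j z)) \<le> ennreal ((2 * pi)^2) * (ennreal 4 * N^2)"
    proof (rule fourier_rep_x_derivative_sum[OF rep J(1)])
      fix h :: real assume h: "h > 0"
      have "(\<Sum>j\<in>J. sq_norm (\<lambda>p. sine_mode B (lift B v) j (p + (h, 0)) - sine_mode B (lift B v) j p)) \<le> sq_norm (\<lambda>z. lift B v (z + ((h, 0), 0)) - lift B v z)"
        by (rule sine_mode_translation_bound[OF J])
      also have "\<dots> \<le> ennreal (4 * h^2) * (L2H1_norm B v)^2" by (rule L2H1_difference_bound[OF v(2,1) h])
      also have "\<dots> \<le> ennreal (4 * h^2) * N^2" by (intro mult_left_mono LN) auto
      also have "\<dots> = ennreal (h^2) * (ennreal 4 * N^2)" by (subst ennreal_mult) (auto simp: mult_ac)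
      finally show "(\<Sum>j\<in>J. sq_norm (\<lambda>p. sine_mode B (lift B v) j (p + (h, 0)) - sine_mode B (lift B v) j p)) \<le> ennreal (h^2) * (ennreal 4 * N^2)" .
    qed
    have "(\<Sum>j\<in>J. ennreal ((real j)^2) * sq_norm (g j)) \<le> (\<Sum>j\<in>J. ennreal ((real j)^2) * (ennreal ((2 * pi)^2) * sq_norm (sine_mode B (lift B v) j)))"
      by (intro sum_mono mult_left_mono fourier_rep_sq_norm rep) auto
    also have "\<dots> = ennreal ((2 * pi)^2) * (\<Sum>j\<in>J. ennreal ((real j)^2) * sq_norm (sine_mode B (lift B v) j))"
      unfolding sum_distrib_left by (simp only: mult_ac)
    also have "\<dots> \<le> ennreal ((2 * pi)^2) * (ennreal ((B / pi)^2) * (L2H1_norm B v)^2)"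
      by (intro mult_left_mono L2H1_sine_modes[OF B v(2,1) J]) auto
    also have "\<dots> \<le> ennreal ((2 * pi)^2) * (ennreal ((B / pi)^2) * N^2)" by (intro mult_left_mono LN) auto
    finally show "(\<Sum>j\<in>J. ennreal ((real j)^2) * sq_norm (g j)) \<le> ennreal ((2 * pi)^2) * (ennreal ((B / pi)^2) * N^2)" .
  qed
  also have "\<dots> = (ennreal 2 + ennreal ((2 * pi)^2) * ennreal 4 + ennreal ((2 * pi)^2) * ennreal ((B / pi)^2)) * N^2"
    by (simp only: distrib_right mult.assoc ennreal_numeral)
  also have "ennreal 2 + ennreal ((2 * pi)^2) * ennreal 4 + ennreal ((2 * pi)^2) * ennreal ((B / pi)^2) = ennreal (2 + (2 * pi)^2 * 4 + (2 * pi)^2 * (B / pi)^2)"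
    by (subst ennreal_plus, simp, simp, subst ennreal_plus, simp, simp, subst (1 2) ennreal_mult) auto
  finally show ?thesis unfolding g_def N_def .
qed

section \<open>Duality for the differentiated square\<close>

definition product_bound :: "real \<Rightarrow> real" where
  "product_bound B = product_const / (2 * pi)^2 * (2 / B)"

lemma product_bound_nonneg: "B > 0 \<Longrightarrow> product_bound B \<ge> 0"
  unfolding product_bound_def by (intro mult_nonneg_nonneg divide_nonneg_nonneg product_const_nonneg) auto

context strip_function
begin

text \<open>The dual function is built from the quantity itself: \<open>w k\<close> is chosen so
  that its pairing with \<open>f k\<close> and its squared weighted norm are both
  \<open>s k\<close>. The product estimate then gives a bound proportional to the total
  \<open>S\<close>, so \<open>S^2\<close> is at most a constant times \<open>S\<close>. The cutoff
  to a ball makes \<open>w k\<close> bounded with bounded support and \<open>S\<close> finite, which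
  permits the cancellation.\<close>

lemma square_estimate_ball:
  fixes a L Z R :: real
  assumes rep: "\<And>j. j \<ge> 1 \<Longrightarrow> fourier_rep (sine_mode B V j) (g j)"
    and Z: "Z \<ge> 0" "\<And>J. finite J \<Longrightarrow> 0 \<notin> J \<Longrightarrow> (\<Sum>j\<in>J. \<integral>\<^sup>+z. ennreal (freq_weight a B j z) * nsq (g j z)) \<le> ennreal Z"
    and L: "\<And>h. h > 0 \<Longrightarrow> sq_norm (\<lambda>z. V (z + ((h, 0), 0)) - V z) \<le> ennreal (4 * h^2 * L)" "L \<ge> 0"
    and K: "finite K"
  shows "(\<Sum>k\<in>K. \<integral>\<^sup>+\<zeta>. ennreal ((norm (\<i> * of_real (fst \<zeta>) * square_mode k \<zeta>))^2 / mod_weight a B k \<zeta> * indicator (ball 0 R) \<zeta>))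
    \<le> ennreal (16 * L * product_bound B * Z)"
proof -
  define f where "f k \<zeta> = \<i> * of_real (fst \<zeta>) * square_mode k \<zeta>" for k \<zeta>
  define w where "w k \<zeta> = cnj (f k \<zeta>) * of_real (indicator (ball 0 R) \<zeta> / mod_weight a B k \<zeta>)" for k \<zeta>
  define r where "r k \<zeta> = (norm (f k \<zeta>))^2 / mod_weight a B k \<zeta> * indicator (ball 0 R) \<zeta>" for k \<zeta>
  have [measurable]: "ball (0 :: real \<times> real) R \<in> sets borel" by (intro borel_open open_ball)
  have fm [measurable]: "f k \<in> borel_measurable borel" for k unfolding f_def[abs_def] by measurable
  have wm [measurable]: "w k \<in> borel_measurable borel" for k unfolding w_def[abs_def] by measurable
  have rm [measurable]: "r k \<in> borel_measurable borel" for k unfolding r_def[abs_def] by measurable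
  have wb: "norm (w k \<zeta>) \<le> (R * (LBINT z. norm ((V z)^2 * complex_of_real (eigfun B k (snd z))))) * indicator (ball 0 R) \<zeta>" for k \<zeta>
  proof (cases "\<zeta> \<in> ball 0 R")
    case True
    then have "norm \<zeta> < R" by simp
    then have fR: "\<bar>fst \<zeta>\<bar> \<le> R" using norm_fst_le[of "fst \<zeta>" "snd \<zeta>"] by simp
    have "norm (w k \<zeta>) = norm (f k \<zeta>) / mod_weight a B k \<zeta>"
      using True mod_weight_pos[of a B k \<zeta>] by (simp add: w_def norm_mult norm_divide)
    also have "\<dots> \<le> norm (f k \<zeta>) / 1" by (intro divide_left_mono mod_weight_ge_1) (auto intro!: mult_pos_pos mod_weight_pos)
    also have "\<dots> = \<bar>fst \<zeta>\<bar> * norm (square_mode k \<zeta>)" by (simp add: f_def norm_mult)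
    also have "\<dots> \<le> R * (LBINT z. norm ((V z)^2 * complex_of_real (eigfun B k (snd z))))"
      using fR by (intro mult_mono norm_square_mode_le) auto
    finally show ?thesis using True by simp
  qed (simp add: w_def)
  have w12: "integrable lborel (w k)" "L2_fun (w k)" for k
    by (rule bounded_support_L1_L2(1)[OF wm wb], rule bounded_support_L1_L2(2)[OF wm wb])
  have fw: "f k \<zeta> * w k \<zeta> = of_real (r k \<zeta>)" for k \<zeta>
    unfolding w_def r_def by (simp add: complex_norm_square[symmetric] mult.assoc[symmetric] del: of_real_power)
  have r0: "r k \<zeta> \<ge> 0" for k \<zeta> using mod_weight_pos[of a B k \<zeta>] by (simp add: r_def)
  have mw: "mod_weight a B k \<zeta> * (norm (w k \<zeta>))^2 = r k \<zeta>" for k \<zeta>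
    using mod_weight_pos[of a B k \<zeta>] by (simp add: w_def r_def norm_mult norm_divide power_mult_distrib power_divide indicator_def power2_eq_square)
  have fwb: "norm (f k \<zeta> * w k \<zeta>) \<le> (\<bar>R\<bar> * (LBINT z. norm ((V z)^2 * complex_of_real (eigfun B k (snd z))))) * norm (w k \<zeta>)" for k \<zeta>
  proof (cases "\<zeta> \<in> ball 0 R")
    case True
    then have fR: "\<bar>fst \<zeta>\<bar> \<le> \<bar>R\<bar>" using norm_fst_le[of "fst \<zeta>" "snd \<zeta>"] by simp
    have "norm (f k \<zeta>) \<le> \<bar>R\<bar> * (LBINT z. norm ((V z)^2 * complex_of_real (eigfun B k (snd z))))"
    proof -
      from fR have "\<bar>fst \<zeta>\<bar> * norm (square_mode k \<zeta>) \<le> \<bar>R\<bar> * (LBINT z. norm ((V z)^2 * complex_of_real (eigfun B k (snd z))))"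
        by (intro mult_mono norm_square_mode_le) auto
      moreover have "norm (f k \<zeta>) = \<bar>fst \<zeta>\<bar> * norm (square_mode k \<zeta>)" by (simp add: f_def norm_mult)
      ultimately show ?thesis by (simp only:)
    qed
    then show ?thesis unfolding norm_mult[of "f k \<zeta>"] by (intro mult_right_mono) auto
  qed (simp add: w_def)
  have fwi: "integrable lborel (\<lambda>\<zeta>. f k \<zeta> * w k \<zeta>)" for k
  proof (rule Bochner_Integration.integrable_bound)
    let ?C = "\<bar>R\<bar> * (LBINT z. norm ((V z)^2 * complex_of_real (eigfun B k (snd z))))"
    show "integrable lborel (\<lambda>\<zeta>. ?C * norm (w k \<zeta>))" by (intro integrable_mult_right integrable_norm w12)
    show "AE \<zeta> in lborel. norm (f k \<zeta> * w k \<zeta>) \<le> norm (?C * norm (w k \<zeta>))"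
      by (intro always_eventually allI order_trans[OF fwb]) (simp only: real_norm_def abs_ge_self)
  qed measurable
  have ri: "integrable lborel (r k)" for k
    using fwi[of k] unfolding fw complex_of_real_integrable_eq .
  define s where "s k = (LBINT \<zeta>. r k \<zeta>)" for k
  have s0: "s k \<ge> 0" for k unfolding s_def by (intro integral_nonneg_AE) (simp add: r0)
  have rs: "(\<integral>\<^sup>+\<zeta>. ennreal (r k \<zeta>)) = ennreal (s k)" for k
    unfolding s_def by (rule nn_integral_eq_integral[OF ri]) (simp add: r0)
  define m where "m k = sqrt (s k)" for k
  define S where "S = (\<Sum>k\<in>K. s k)"
  have m2: "(m k)^2 = s k" for k by (simp add: m_def s0)
  have S0: "S \<ge> 0" unfolding S_def by (intro sum_nonneg s0)
  have mwi: "(\<integral>\<^sup>+z. ennreal (mod_weight a B k z) * nsq (w k z)) \<le> ennreal ((m k)^2)" for k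
  proof -
    have "ennreal (mod_weight a B k z) * nsq (w k z) = ennreal (r k z)" for z
      using mod_weight_pos[of a B k z] by (simp add: ennreal_mult[symmetric] mw)
    then show ?thesis by (simp add: rs m2)
  qed
  interpret M: strip_modes B V a Z g K w m
    by unfold_locales (use rep Z K w12 mwi in \<open>auto simp: m_def s0\<close>)
  have PZ: "product_const * Z * (\<Sum>k\<in>K. (m k)^2) / (2 * pi)^2 * (2 / B) = product_bound B * Z * S"
    unfolding m2 S_def[symmetric] product_bound_def by (simp add: field_simps)
  define b where "b = product_bound B * Z * S"
  have b0: "b \<ge> 0" unfolding b_def by (intro mult_nonneg_nonneg product_bound_nonneg B Z S0)
  have VW: "sq_norm (\<lambda>z. V z * M.W z) \<le> ennreal b" using M.product_estimate unfolding PZ b_def .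
  \<comment> \<open>The multiplier of a difference quotient in \<open>x\<close>: it tends to
    \<open>\<i> * \<xi>\<close> and is bounded by \<open>\<bar>\<xi>\<bar>\<close>, so the
    derivative is reached by dominated convergence.\<close>
  define q where "q h \<zeta> = (cis (h * fst \<zeta>) - 1) / complex_of_real h" for h and \<zeta> :: "real \<times> real"
  have [measurable]: "q h \<in> borel_measurable borel" for h unfolding q_def[abs_def] by measurable
  have bound: "(norm (\<Sum>k\<in>K. LBINT \<zeta>. q h \<zeta> * (square_mode k \<zeta> * w k \<zeta>)))^2 \<le> 16 * L * b" if h: "h > 0" for h
  proof -
    let ?H = "((h, 0), 0) :: (real \<times> real) \<times> real"
    define w' where "w' k \<zeta> = cis ((h, 0) \<bullet> \<zeta>) * w k \<zeta>" for k \<zeta>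
    have [measurable]: "w' k \<in> borel_measurable borel" for k unfolding w'_def[abs_def] by measurable
    have nw': "norm (w' k \<zeta>) = norm (w k \<zeta>)" for k \<zeta> by (simp add: w'_def norm_mult)
    have w'1: "integrable lborel (w' k)" for k unfolding w'_def[abs_def] by (rule integrable_cis_mult[OF w12(1)]) measurable
    have w'2: "L2_fun (w' k)" for k by (rule L2_fun_bound(1)[OF w12(2)]) (auto simp: nw')
    \<comment> \<open>A translation of \<open>V\<close> in the product with \<open>W\<close> can be
      moved to \<open>W\<close>, whose modes then acquire a unimodular factor. The weighted norms do
      not notice it, so the product estimate covers the translated product with the same
      \<open>b\<close>.\<close>
    interpret M': strip_modes B V a Z g K w' m
      by unfold_locales (use rep Z K w'1 w'2 mwi in \<open>auto simp: m_def s0 nw'\<close>)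
    have VW': "sq_norm (\<lambda>z. V z * M'.W z) \<le> ennreal b" using M'.product_estimate unfolding PZ b_def .
    have W': "M'.W (z + ?H) = M.W z" for z
      unfolding M'.W_def M.W_def w'_def by (simp add: fourier_cis_mult)
    have VhW: "sq_norm (\<lambda>z. V (z + ?H) * M.W z) = sq_norm (\<lambda>z. V z * M'.W z)"
      using sq_norm_shift[of "\<lambda>z. V z * M'.W z" ?H] by (simp add: W')
    have VhL: "L2_fun (\<lambda>z. V (z + ?H))" by (rule L2_fun_shift[OF V])
    have i2: "integrable lborel (\<lambda>z. (V z)^2 * M.W z)" "integrable lborel (\<lambda>z. (V z)^2 * M'.W z)"
      using L2_fun_mult_integrable[OF V M.L2_VW] L2_fun_mult_integrable[OF V M'.L2_VW] by (simp_all add: power2_eq_square mult.assoc)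
    have sm: "(\<Sum>k\<in>K. LBINT \<zeta>. square_mode k \<zeta> * u k \<zeta>) = (LBINT z. (V z)^2 * (\<Sum>k\<in>K. fourier (u k) (fst z) * of_real (eigfun B k (snd z))))"
      if u: "\<And>k. integrable lborel (u k)" for u
    proof -
      have [measurable]: "u k \<in> borel_measurable borel" for k using u[of k] by auto
      have i: "integrable lborel (\<lambda>z. (V z)^2 * (fourier (u k) (fst z) * complex_of_real (eigfun B k (snd z))))" for k
      proof (rule Bochner_Integration.integrable_bound)
        let ?C = "LBINT p. norm (u k p)"
        show "integrable lborel (\<lambda>z. of_real ?C * ((V z)^2 * complex_of_real (eigfun B k (snd z))))"
          by (intro integrable_mult_right integrable_square_eigfun)
        show "AE z in lborel. norm ((V z)^2 * (fourier (u k) (fst z) * complex_of_real (eigfun B k (snd z)))) \<le> norm (of_real ?C * ((V z)^2 * complex_of_real (eigfun B k (snd z))))"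
        proof (intro always_eventually allI)
          fix z
          have "norm ((V z)^2 * (fourier (u k) (fst z) * complex_of_real (eigfun B k (snd z)))) = norm (fourier (u k) (fst z)) * norm ((V z)^2 * complex_of_real (eigfun B k (snd z)))"
            by (simp only: norm_mult mult_ac)
          also have "\<dots> \<le> \<bar>?C\<bar> * norm ((V z)^2 * complex_of_real (eigfun B k (snd z)))"
            by (intro mult_right_mono order_trans[OF norm_fourier_le abs_ge_self]) simp
          also have "\<dots> = norm (of_real ?C * ((V z)^2 * complex_of_real (eigfun B k (snd z))))" by (simp only: norm_mult[of "complex_of_real ?C"] norm_of_real)
          finally show "norm ((V z)^2 * (fourier (u k) (fst z) * complex_of_real (eigfun B k (snd z)))) \<le> norm (of_real ?C * ((V z)^2 * complex_of_real (eigfun B k (snd z))))" .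
        qed
      qed measurable
      show ?thesis
        unfolding square_mode_pairing[OF u] sum_distrib_left
        by (rule Bochner_Integration.integral_sum[symmetric]) (rule i)
    qed
    have qe: "q h \<zeta> * (square_mode k \<zeta> * w k \<zeta>) = (square_mode k \<zeta> * w' k \<zeta> - square_mode k \<zeta> * w k \<zeta>) / of_real h" for k \<zeta>
      by (cases \<zeta>) (simp add: q_def w'_def inner_prod_def algebra_simps diff_divide_distrib)
    have smi: "integrable lborel (\<lambda>\<zeta>. square_mode k \<zeta> * u \<zeta>)" if u: "integrable lborel u" for k u
    proof (rule Bochner_Integration.integrable_bound)
      have [measurable]: "u \<in> borel_measurable borel" using u by auto
      let ?C = "LBINT z. norm ((V z)^2 * complex_of_real (eigfun B k (snd z)))"
      show "(\<lambda>\<zeta>. square_mode k \<zeta> * u \<zeta>) \<in> borel_measurable lborel" by measurable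
      show "integrable lborel (\<lambda>\<zeta>. ?C * norm (u \<zeta>))" by (intro integrable_mult_right integrable_norm u)
      show "AE \<zeta> in lborel. norm (square_mode k \<zeta> * u \<zeta>) \<le> norm (?C * norm (u \<zeta>))"
      proof (intro always_eventually allI)
        fix \<zeta>
        have "norm (square_mode k \<zeta> * u \<zeta>) \<le> ?C * norm (u \<zeta>)"
          unfolding norm_mult[of "square_mode k \<zeta>"] by (intro mult_right_mono norm_square_mode_le) simp
        then show "norm (square_mode k \<zeta> * u \<zeta>) \<le> norm (?C * norm (u \<zeta>))"
          unfolding real_norm_def by (rule order_trans[OF _ abs_ge_self])
      qed
    qed
    have "(\<Sum>k\<in>K. LBINT \<zeta>. q h \<zeta> * (square_mode k \<zeta> * w k \<zeta>)) = ((\<Sum>k\<in>K. LBINT \<zeta>. square_mode k \<zeta> * w' k \<zeta>) - (\<Sum>k\<in>K. LBINT \<zeta>. square_mode k \<zeta> * w k \<zeta>)) / of_real h"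
      unfolding qe integral_divide_zero sum_subtractf[symmetric] sum_divide_distrib
      by (intro sum.cong refl arg_cong2[where f = "(/)"] Bochner_Integration.integral_diff smi w12 w'1)
    also have "\<dots> = ((LBINT z. (V z)^2 * M'.W z) - (LBINT z. (V z)^2 * M.W z)) / of_real h"
      unfolding sm[OF w12(1)] sm[OF w'1] M.W_def M'.W_def ..
    also have "(LBINT z. (V z)^2 * M'.W z) = (LBINT z. (V (z + ?H))^2 * M.W z)"
      using lborel_integral_shift[of "\<lambda>z. (V z)^2 * M'.W z" ?H] by (simp add: W')
    \<comment> \<open>Factoring the difference of squares puts the increment, of size
      \<open>h\<close> in \<open>L2\<close>, on one side and two products covered by the product
      estimate on the other. The 16 below is 4 from the increment times 4 from adding the two
      products.\<close>
    also have "(LBINT z. (V (z + ?H))^2 * M.W z) - (LBINT z. (V z)^2 * M.W z) = (LBINT z. (V (z + ?H) - V z) * (V (z + ?H) * M.W z + V z * M.W z))"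
    proof -
      have ih: "integrable lborel (\<lambda>z. (V (z + ?H))^2 * M.W z)"
        using lborel_integrable_shift[OF i2(2), of ?H] by (simp add: W')
      have "(V (z + ?H) - V z) * (V (z + ?H) * M.W z + V z * M.W z) = (V (z + ?H))^2 * M.W z - (V z)^2 * M.W z" for z
        by (simp add: power2_eq_square algebra_simps)
      then show ?thesis using Bochner_Integration.integral_diff[OF ih i2(1)] by (simp only:)
    qed
    finally have e: "(\<Sum>k\<in>K. LBINT \<zeta>. q h \<zeta> * (square_mode k \<zeta> * w k \<zeta>)) = (LBINT z. (V (z + ?H) - V z) * (V (z + ?H) * M.W z + V z * M.W z)) / of_real h" .
    have "nsq (LBINT z. (V (z + ?H) - V z) * (V (z + ?H) * M.W z + V z * M.W z)) \<le> sq_norm (\<lambda>z. V (z + ?H) - V z) * sq_norm (\<lambda>z. V (z + ?H) * M.W z + V z * M.W z)"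
      using integral_mult_sq_norm[of "\<lambda>z. V (z + ?H) - V z" "\<lambda>z. V (z + ?H) * M.W z + V z * M.W z"] by (simp add: ennreal_power)
    also have "\<dots> \<le> ennreal (4 * h^2 * L) * (2 * ennreal b + 2 * ennreal b)"
    proof (intro mult_mono L h)
      have "sq_norm (\<lambda>z. V (z + ?H) * M.W z + V z * M.W z) \<le> 2 * sq_norm (\<lambda>z. V (z + ?H) * M.W z) + 2 * sq_norm (\<lambda>z. V z * M.W z)"
        by (rule sq_norm_add_le) measurable
      also have "\<dots> \<le> 2 * ennreal b + 2 * ennreal b" unfolding VhW by (intro add_mono mult_left_mono VW VW') auto
      finally show "sq_norm (\<lambda>z. V (z + ?H) * M.W z + V z * M.W z) \<le> 2 * ennreal b + 2 * ennreal b" .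
    qed auto
    also have "\<dots> = ennreal (h^2 * (16 * L * b))"
    proof -
      have "2 * ennreal b + 2 * ennreal b = ennreal (4 * b)"
        using b0 by (simp flip: distrib_right add: ennreal_mult)
      then show ?thesis using L(2) b0 by (simp add: ennreal_mult[symmetric] mult_ac)
    qed
    finally have n: "(norm (LBINT z. (V (z + ?H) - V z) * (V (z + ?H) * M.W z + V z * M.W z)))^2 \<le> h^2 * (16 * L * b)"
      using L(2) b0 by (simp add: ennreal_le_iff)
    show ?thesis unfolding e norm_divide power_divide norm_of_real power2_abs
      using n h by (subst pos_divide_le_eq) (auto simp: mult_ac)
  qed
  have lim: "(\<lambda>n. \<Sum>k\<in>K. LBINT \<zeta>. q (1 / real (Suc n)) \<zeta> * (square_mode k \<zeta> * w k \<zeta>)) \<longlonglongrightarrow> (\<Sum>k\<in>K. LBINT \<zeta>. f k \<zeta> * w k \<zeta>)"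
  proof (rule tendsto_sum)
    fix k
    show "(\<lambda>n. LBINT \<zeta>. q (1 / real (Suc n)) \<zeta> * (square_mode k \<zeta> * w k \<zeta>)) \<longlonglongrightarrow> (LBINT \<zeta>. f k \<zeta> * w k \<zeta>)"
    proof (rule integral_dominated_convergence[where w = "\<lambda>\<zeta>. norm (f k \<zeta> * w k \<zeta>)"])
      show "integrable lborel (\<lambda>\<zeta>. norm (f k \<zeta> * w k \<zeta>))" by (intro integrable_norm fwi)
      show "AE \<zeta> in lborel. (\<lambda>n. q (1 / real (Suc n)) \<zeta> * (square_mode k \<zeta> * w k \<zeta>)) \<longlonglongrightarrow> f k \<zeta> * w k \<zeta>"
        unfolding f_def mult.assoc[of _ "square_mode k _"] q_def
        by (intro always_eventually allI tendsto_mult tendsto_const cis_difference_quotient)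
      show "AE \<zeta> in lborel. norm (q (1 / real (Suc n)) \<zeta> * (square_mode k \<zeta> * w k \<zeta>)) \<le> norm (f k \<zeta> * w k \<zeta>)" for n
      proof (intro always_eventually allI)
        fix \<zeta> :: "real \<times> real"
        define h where "h = 1 / real (Suc n)"
        have h: "h > 0" by (simp add: h_def)
        have "norm (q h \<zeta>) \<le> \<bar>h * fst \<zeta>\<bar> / h"
          unfolding q_def norm_divide norm_of_real using h by (simp add: divide_right_mono norm_cis_minus_1_le)
        also have "\<dots> = \<bar>fst \<zeta>\<bar>" using h by (simp add: abs_mult)
        finally have "norm (q h \<zeta>) * (norm (square_mode k \<zeta>) * norm (w k \<zeta>)) \<le> \<bar>fst \<zeta>\<bar> * (norm (square_mode k \<zeta>) * norm (w k \<zeta>))"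
          by (intro mult_right_mono) auto
        then show "norm (q (1 / real (Suc n)) \<zeta> * (square_mode k \<zeta> * w k \<zeta>)) \<le> norm (f k \<zeta> * w k \<zeta>)"
          unfolding h_def[symmetric] f_def by (simp add: norm_mult mult_ac)
      qed
    qed measurable
  qed
  have fS: "(\<Sum>k\<in>K. LBINT \<zeta>. f k \<zeta> * w k \<zeta>) = of_real S"
    unfolding fw S_def s_def integral_complex_of_real of_real_sum ..
  have "(\<lambda>n. (norm (\<Sum>k\<in>K. LBINT \<zeta>. q (1 / real (Suc n)) \<zeta> * (square_mode k \<zeta> * w k \<zeta>)))^2) \<longlonglongrightarrow> S\<^sup>2"
    using tendsto_power[OF tendsto_norm[OF lim], of 2] S0 by (simp add: fS)
  then have "S^2 \<le> 16 * L * b"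
    by (rule LIMSEQ_le_const2) (use bound in auto)
  then have "S * S \<le> (16 * L * product_bound B * Z) * S" by (simp add: b_def power2_eq_square mult_ac)
  moreover have "0 \<le> 16 * L * product_bound B * Z" using L(2) Z(1) product_bound_nonneg[OF B] by simp
  ultimately have "S \<le> 16 * L * product_bound B * Z"
    using S0 by (cases "S = 0") (auto simp: mult_le_cancel_right)
  then have "ennreal S \<le> ennreal (16 * L * product_bound B * Z)" by (rule ennreal_leI)
  moreover have "(\<Sum>k\<in>K. \<integral>\<^sup>+\<zeta>. ennreal (r k \<zeta>)) = ennreal S"
    unfolding rs S_def by (rule sum_ennreal) (rule s0)
  ultimately show ?thesis unfolding r_def f_def by simp
qed

text \<open>The bound does not depend on the radius of the ball, so Fatou's lemma removes the
  cutoff.\<close>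

lemma square_estimate:
  fixes a L Z :: real
  assumes rep: "\<And>j. j \<ge> 1 \<Longrightarrow> fourier_rep (sine_mode B V j) (g j)"
    and Z: "Z \<ge> 0" "\<And>J. finite J \<Longrightarrow> 0 \<notin> J \<Longrightarrow> (\<Sum>j\<in>J. \<integral>\<^sup>+z. ennreal (freq_weight a B j z) * nsq (g j z)) \<le> ennreal Z"
    and L: "\<And>h. h > 0 \<Longrightarrow> sq_norm (\<lambda>z. V (z + ((h, 0), 0)) - V z) \<le> ennreal (4 * h^2 * L)" "L \<ge> 0"
    and K: "finite K"
  shows "(\<Sum>k\<in>K. \<integral>\<^sup>+\<zeta>. ennreal ((norm (\<i> * of_real (fst \<zeta>) * square_mode k \<zeta>))^2 / mod_weight a B k \<zeta>))
    \<le> ennreal (16 * L * product_bound B * Z)"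
proof -
  define r where "r k \<zeta> = (norm (\<i> * of_real (fst \<zeta>) * square_mode k \<zeta>))^2 / mod_weight a B k \<zeta>" for k \<zeta>
  have [measurable]: "r k \<in> borel_measurable borel" for k unfolding r_def[abs_def] by measurable
  have [measurable]: "ball (0 :: real \<times> real) s \<in> sets borel" for s by (intro borel_open open_ball)
  have "(\<Sum>k\<in>K. \<integral>\<^sup>+\<zeta>. ennreal (r k \<zeta>)) = (\<integral>\<^sup>+\<zeta>. (\<Sum>k\<in>K. ennreal (r k \<zeta>)))"
    by (rule nn_integral_sum[symmetric]) measurable
  also have "\<dots> = (\<integral>\<^sup>+\<zeta>. liminf (\<lambda>n. \<Sum>k\<in>K. ennreal (r k \<zeta> * indicator (ball 0 (real n)) \<zeta>)))"
  proof (rule nn_integral_cong)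
    fix \<zeta> :: "real \<times> real"
    obtain N where N: "norm \<zeta> < real N" using reals_Archimedean2 by blast
    have "eventually (\<lambda>n. (\<Sum>k\<in>K. ennreal (r k \<zeta> * indicator (ball 0 (real n)) \<zeta>)) = (\<Sum>k\<in>K. ennreal (r k \<zeta>))) sequentially"
      using eventually_ge_at_top[of N]
    proof eventually_elim
      case (elim n)
      then have "norm \<zeta> < real n" using N by linarith
      then show ?case by simp
    qed
    then have "(\<lambda>n. \<Sum>k\<in>K. ennreal (r k \<zeta> * indicator (ball 0 (real n)) \<zeta>)) \<longlonglongrightarrow> (\<Sum>k\<in>K. ennreal (r k \<zeta>))"
      by (rule tendsto_eventually)
    then show "(\<Sum>k\<in>K. ennreal (r k \<zeta>)) = liminf (\<lambda>n. \<Sum>k\<in>K. ennreal (r k \<zeta> * indicator (ball 0 (real n)) \<zeta>))"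
      by (intro lim_imp_Liminf[symmetric]) auto
  qed
  also have "\<dots> \<le> liminf (\<lambda>n. \<integral>\<^sup>+\<zeta>. (\<Sum>k\<in>K. ennreal (r k \<zeta> * indicator (ball 0 (real n)) \<zeta>)))"
    by (rule nn_integral_liminf) measurable
  also have "\<dots> \<le> ennreal (16 * L * product_bound B * Z)"
  proof (intro Liminf_le always_eventually allI)
    fix n
    have "(\<integral>\<^sup>+\<zeta>. (\<Sum>k\<in>K. ennreal (r k \<zeta> * indicator (ball 0 (real n)) \<zeta>))) = (\<Sum>k\<in>K. \<integral>\<^sup>+\<zeta>. ennreal (r k \<zeta> * indicator (ball 0 (real n)) \<zeta>))"
      by (rule nn_integral_sum) measurable
    also have "\<dots> \<le> ennreal (16 * L * product_bound B * Z)"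
      unfolding r_def by (rule square_estimate_ball[OF rep Z L K])
    finally show "(\<integral>\<^sup>+\<zeta>. (\<Sum>k\<in>K. ennreal (r k \<zeta> * indicator (ball 0 (real n)) \<zeta>))) \<le> ennreal (16 * L * product_bound B * Z)" .
  qed auto
  finally show ?thesis unfolding r_def .
qed

end

lemma esqrt_le_of_square: "x \<le> y^2 \<Longrightarrow> esqrt x \<le> y"
  by (subst power2_mono_ennreal_iff[symmetric]) (simp add: esqrt_power2)

theorem lemma5:
  fixes a B :: real
  assumes "B > 0"
  shows "\<exists>b \<alpha> :: real. 3/8 < b \<and> b < 1/2 \<and> 1/2 < \<alpha> \<and> \<alpha> < 2/3 \<and>
    (\<exists>C :: real. C \<ge> 0 \<and>
      (\<forall>v \<in> Z_set a B \<alpha> b.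
         Y_norm a B \<alpha> b (distr_dx (distr_of B (\<lambda>p. (v p)\<^sup>2))) \<le> ennreal C * (Z_norm a B \<alpha> b v)\<^sup>2))"
proof -
  note B = assms
  define D where "D = 2 + (2 * pi)^2 * 4 + (2 * pi)^2 * (B / pi)^2"
  \<comment> \<open>The summand 1 keeps \<open>C\<close> positive, so that the right side is
    infinite when the \<open>Z\<close> norm is.\<close>
  define C where "C = sqrt (53 * (16 * product_bound B * D)) + 1"
  have D0: "D \<ge> 0" unfolding D_def by (intro add_nonneg_nonneg mult_nonneg_nonneg) auto
  have P0: "0 \<le> 53 * (16 * product_bound B * D)" using D0 product_bound_nonneg[OF B] by simp
  have C0: "C > 0" unfolding C_def using real_sqrt_ge_zero[OF P0] by linarith
  have C2: "53 * (16 * product_bound B * D) \<le> C^2"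
  proof -
    have "(sqrt (53 * (16 * product_bound B * D)))^2 \<le> C^2" unfolding C_def by (rule power_mono) (use P0 in auto)
    then show ?thesis using P0 by simp
  qed
  have "Y_norm a B (13/25) (12/25) (distr_dx (distr_of B (\<lambda>p. (v p)^2))) \<le> ennreal C * (Z_norm a B (13/25) (12/25) v)^2"
    if v: "v \<in> Z_set a B (13/25) (12/25)" for v
  proof (cases "Z_norm a B (13/25) (12/25) v < \<infinity>")
    case False
    then have "Z_norm a B (13/25) (12/25) v = \<infinity>" by (simp add: less_top[symmetric])
    then show ?thesis using C0 by (simp add: ennreal_mult_top power2_eq_square)
  next
    case True
    have vL: "v \<in> L2_space (tstrip B)" and vH: "v \<in> L2H1_space B" using v by (auto simp: Z_set_def X_set_def)
    have X: "X_norm a B (13/25) (12/25) (distr_of B v) < \<infinity>" using True by (auto simp: Z_norm_def)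
    interpret strip_function B "lift B v" by unfold_locales (auto intro: B L2_lift[OF vL] lift_supp)
    define N where "N = enn2real (Z_norm a B (13/25) (12/25) v)"
    have N: "Z_norm a B (13/25) (12/25) v = ennreal N" "N \<ge> 0" unfolding N_def using True by auto
    define T where "T = distr_dx (distr_of B (\<lambda>p. (v p)^2))"
    define f where "f k = (\<lambda>\<zeta>. \<i> * of_real (fst \<zeta>) * square_mode k \<zeta>)" for k
    have rep: "represents (f k) (fourier_distr (coef B T k))" for k
      unfolding f_def T_def by (rule represents_dx_square[OF B vL])
    have rep': "represents (coef_hat B T k) (fourier_distr (coef B T k))" for k
      unfolding coef_hat_def by (rule someI[of "\<lambda>g. represents g (fourier_distr (coef B T k))", OF rep])
    have hc: "has_coef_hats B T" unfolding has_coef_hats_def using rep by blast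
    have hm: "coef_hat B T k \<in> borel_measurable borel" for k using rep'[of k] by (simp add: represents_def)
    define I where "I k = (\<integral>\<^sup>+\<zeta>. ennreal ((norm (f k \<zeta>))^2 / mod_weight a B k \<zeta>))" for k
    \<comment> \<open>\<open>coef_hat\<close> is some representing function, known to equal
      \<open>f k\<close> only almost everywhere. \<open>Y_term\<close> is therefore bounded first,
      by an integral over the plane that is insensitive to null sets.\<close>
    have Yk: "Y_term a B (13/25) (12/25) k (coef_hat B T k) \<le> 53 * I k" for k
    proof -
      have "(\<integral>\<^sup>+\<zeta>. ennreal ((norm (coef_hat B T k \<zeta>))^2 / mod_weight a B k \<zeta>)) = I k"
        unfolding I_def
      proof (rule nn_integral_cong_AE)
        show "AE \<zeta> in lborel. ennreal ((norm (coef_hat B T k \<zeta>))^2 / mod_weight a B k \<zeta>) = ennreal ((norm (f k \<zeta>))^2 / mod_weight a B k \<zeta>)"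
          using represents_unique[OF rep'[of k] rep[of k]] by eventually_elim simp
      qed
      then show ?thesis using Y_term_le[OF hm[of k], of a B k] by (simp only:)
    qed
    have Ik: "(\<Sum>k\<in>K. I k) \<le> ennreal (16 * N^2 * product_bound B * (D * N^2))" if "finite K" for K
      unfolding I_def f_def
    proof (rule square_estimate[where g = "coef_hat B (distr_of B v)"])
      show "fourier_rep (sine_mode B (lift B v) j) (coef_hat B (distr_of B v) j)" if "j \<ge> 1" for j
        by (rule X_norm_modes(1)[OF B vL X that])
      show "0 \<le> D * N^2" using D0 by simp
      show "(\<Sum>j\<in>J. \<integral>\<^sup>+z. ennreal (freq_weight a B j z) * nsq (coef_hat B (distr_of B v) j z)) \<le> ennreal (D * N^2)"
        if "finite J" "0 \<notin> J" for J
        using freq_weight_modes[OF B vL vH X that] N D0 unfolding D_def[symmetric] by (simp add: ennreal_mult ennreal_power)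
      show "sq_norm (\<lambda>z. lift B v (z + ((h, 0), 0)) - lift B v z) \<le> ennreal (4 * h^2 * N^2)" if "h > 0" for h
      proof -
        have "L2H1_norm B v \<le> ennreal N" unfolding N(1)[symmetric] Z_norm_def by simp
        then have "(L2H1_norm B v)^2 \<le> ennreal (N^2)" using power_mono[of "L2H1_norm B v" "ennreal N" 2] N(2) by (simp add: ennreal_power)
        then have "ennreal (4 * h^2) * (L2H1_norm B v)^2 \<le> ennreal (4 * h^2) * ennreal (N^2)" by (rule mult_left_mono) simp
        with L2H1_difference_bound[OF vH vL that] show ?thesis by (simp add: ennreal_mult)
      qed
    qed (use that in auto)
    have "(\<Sum>k. Y_term a B (13/25) (12/25) (Suc k) (coef_hat B T (Suc k))) \<le> (\<Sum>k. 53 * I (Suc k))"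
      by (intro suminf_le Yk) auto
    also have "\<dots> \<le> ennreal (53 * (16 * N^2 * product_bound B * (D * N^2)))"
    proof (rule suminf_le_const)
      show "summable (\<lambda>k. 53 * I (Suc k))" by (rule summableI)
      fix n
      have "(\<Sum>k<n. 53 * I (Suc k)) = 53 * (\<Sum>k\<in>Suc ` {..<n}. I k)"
        by (simp add: sum_distrib_left sum.reindex)
      also have "\<dots> \<le> 53 * ennreal (16 * N^2 * product_bound B * (D * N^2))" by (intro mult_left_mono Ik) auto
      finally show "(\<Sum>k<n. 53 * I (Suc k)) \<le> ennreal (53 * (16 * N^2 * product_bound B * (D * N^2)))"
        using D0 product_bound_nonneg[OF B] ennreal_mult[of 53 "16 * N^2 * product_bound B * (D * N^2)"]
        by (simp only: ennreal_numeral) simp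
    qed
    also have "\<dots> \<le> ennreal ((C * N^2)^2)"
    proof (rule ennreal_leI)
      have "53 * (16 * N^2 * product_bound B * (D * N^2)) = (53 * (16 * product_bound B * D)) * (N^2)^2"
        by (simp add: power2_eq_square mult_ac)
      also have "\<dots> \<le> C^2 * (N^2)^2" by (intro mult_right_mono C2) auto
      finally show "53 * (16 * N^2 * product_bound B * (D * N^2)) \<le> (C * N^2)^2" by (simp add: power_mult_distrib)
    qed
    also have "\<dots> = (ennreal C * (ennreal N)^2)^2"
      using C0 N(2) by (simp add: ennreal_power ennreal_mult[symmetric])
    finally have "esqrt (\<Sum>k. Y_term a B (13/25) (12/25) (Suc k) (coef_hat B T (Suc k))) \<le> ennreal C * (ennreal N)^2"
      by (rule esqrt_le_of_square)
    then show ?thesis unfolding N(1) T_def[symmetric] Y_norm_def using hc by simp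
  qed
  then show ?thesis using C0 by (intro exI[of _ "12/25"] exI[of _ "13/25"]) (auto intro!: exI[of _ C])
qed

end
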